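(* Let $M$ be a connected compact Riemannian manifold of dimension $n$ and $\mathcal F$ a singular Riemannian foliation on $M$ whose leaves are closed and with no trivial leaf, that is, $d^*:=\min_{x\in M}\dim L_x\ge1$. For any $1\le p<\infty$ with $p<n$ there exists $p_0>p^*:=\frac{np}{n-p}$ such that for any $1\le q<p_0$ the canonical embedding $W^{1,p}(M)^{\mathcal F}\hookrightarrow L^q(M)$ is (well defined and) completely continuous, that is, compact. Moreover, for any $1\le p<\infty$ with $p\ge n-d^*$, the embedding $W^{1,p}(M)^{\mathcal F}\hookrightarrow L^q(M)$ is compact for every $q\ge1$ (finite).
   Context: A singular Riemannian foliation on a complete Riemannian manifold $(M,\mathbf g)$ is a partition $\mathcal F=\{L_x\}_{x\in M}$ of $M$ into immersed submanifolds without self-intersections (leaves; $L_x$ is the leaf through $x$) such that (a) every vector tangent to a leaf extends to a local smooth vector field tangent to the leaves, and (b) every geodesic starting orthogonal to a leaf stays orthogonal to all leaves it meets. $W^{1,p}(M)^{\mathcal F}$ is the closure in the Sobolev space $W^{1,p}(M)$ of the smooth functions on $M$ that are constant on each leaf of $\mathcal F$. *)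

theory Defs
  imports "HOL-Analysis.Analysis"
begin

section \<open>Smooth maps\<close>

text \<open>\<open>C_on k S f\<close> is meant for open \<open>S\<close>; \<open>smooth_on S f\<close> is the usual notion for an arbitrary
  subset \<open>S\<close>: \<open>f\<close> extends, near each point of \<open>S\<close>, to a smooth function on an open set.\<close>

primrec C_on :: "nat \<Rightarrow> 'a::real_normed_vector set \<Rightarrow> ('a \<Rightarrow> 'b::real_normed_vector) \<Rightarrow> bool" where
  "C_on 0 S f \<longleftrightarrow> continuous_on S f"
| "C_on (Suc k) S f \<longleftrightarrow> (\<forall>x\<in>S. f differentiable (at x)) \<and>
     (\<forall>v. C_on k S (\<lambda>x. frechet_derivative f (at x) v))"

definition smooth_on :: "'a::real_normed_vector set \<Rightarrow> ('a \<Rightarrow> 'b::real_normed_vector) \<Rightarrow> bool" where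
  "smooth_on S f \<longleftrightarrow>
     (\<forall>x\<in>S. \<exists>W f'. open W \<and> x \<in> W \<and> (\<forall>k. C_on k W f') \<and> (\<forall>y\<in>W \<inter> S. f' y = f y))"


section \<open>Manifolds\<close>

text \<open>The manifold is the whole (Hausdorff, second countable) type \<open>'m\<close>, its dimension is
  \<open>CARD('n)\<close>, and its smooth structure is given by an atlas, not necessarily maximal.
  A chart is a pair of a domain and a map; the values of the map off the domain are irrelevant.\<close>

type_synonym ('m, 'n) chart = "'m set \<times> ('m \<Rightarrow> real ^ 'n)"

definition chart_inv :: "('m, 'n::finite) chart \<Rightarrow> real ^ 'n \<Rightarrow> 'm" where
  "chart_inv c = inv_into (fst c) (snd c)"

definition is_chart :: "('m::topological_space, 'n::finite) chart \<Rightarrow> bool" where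
  "is_chart c \<longleftrightarrow> open (fst c) \<and> open (snd c ` fst c) \<and>
     homeomorphism (fst c) (snd c ` fst c) (snd c) (chart_inv c)"

definition transition :: "('m, 'n::finite) chart \<Rightarrow> ('m, 'n) chart \<Rightarrow> real ^ 'n \<Rightarrow> real ^ 'n" where
  "transition c c' = snd c' \<circ> chart_inv c"

definition smooth_atlas ::
  "('m::{t2_space, second_countable_topology}, 'n::finite) chart set \<Rightarrow> bool" where
  "smooth_atlas A \<longleftrightarrow> (\<forall>c\<in>A. is_chart c) \<and> (\<Union>c\<in>A. fst c) = UNIV \<and>
     (\<forall>c\<in>A. \<forall>c'\<in>A. smooth_on (snd c ` (fst c \<inter> fst c')) (transition c c'))"

definition smooth_function :: "('m, 'n::finite) chart set \<Rightarrow> ('m \<Rightarrow> real) \<Rightarrow> bool" where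
  "smooth_function A u \<longleftrightarrow> (\<forall>c\<in>A. smooth_on (snd c ` fst c) (u \<circ> chart_inv c))"

text \<open>A tangent vector at \<open>x\<close> is represented by its coordinates in each chart around \<open>x\<close>;
  \<open>coord_change c c' x\<close> turns its \<open>c\<close>-coordinates into its \<open>c'\<close>-coordinates.\<close>

definition coord_change ::
  "('m, 'n::finite) chart \<Rightarrow> ('m, 'n) chart \<Rightarrow> 'm \<Rightarrow> real ^ 'n \<Rightarrow> real ^ 'n" where
  "coord_change c c' x = frechet_derivative (transition c c') (at (snd c x))"


section \<open>Riemannian metrics\<close>

text \<open>\<open>g c x v w\<close> is the inner product of the tangent vectors at \<open>x\<close> whose coordinates in the
  chart \<open>c\<close> are \<open>v\<close> and \<open>w\<close>.\<close>

type_synonym ('m, 'n) metric =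
  "('m, 'n) chart \<Rightarrow> 'm \<Rightarrow> real ^ 'n \<Rightarrow> real ^ 'n \<Rightarrow> real"

definition riemannian_metric :: "('m, 'n::finite) chart set \<Rightarrow> ('m, 'n) metric \<Rightarrow> bool" where
  "riemannian_metric A g \<longleftrightarrow>
     (\<forall>c\<in>A. (\<forall>v w. smooth_on (snd c ` fst c) (\<lambda>y. g c (chart_inv c y) v w)) \<and>
       (\<forall>x\<in>fst c. bilinear (g c x) \<and> (\<forall>v w. g c x v w = g c x w v) \<and>
          (\<forall>v. v \<noteq> 0 \<longrightarrow> g c x v v > 0))) \<and>
     (\<forall>c\<in>A. \<forall>c'\<in>A. \<forall>x\<in>fst c \<inter> fst c'. \<forall>v w.
        g c x v w = g c' x (coord_change c c' x v) (coord_change c c' x w))"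

text \<open>Christoffel symbols of the first kind:
  \<open>christoffel g c x u v w\<close> is \<open>g (\<nabla>\<^sub>U V) W\<close> at \<open>x\<close>, where \<open>U\<close>, \<open>V\<close>, \<open>W\<close> are the fields with
  constant coordinates \<open>u\<close>, \<open>v\<close>, \<open>w\<close> and \<open>\<nabla>\<close> is the Levi-Civita connection.\<close>

definition metric_deriv :: "('m, 'n::finite) metric \<Rightarrow> ('m, 'n) chart \<Rightarrow> 'm \<Rightarrow>
    real ^ 'n \<Rightarrow> real ^ 'n \<Rightarrow> real ^ 'n \<Rightarrow> real" where
  "metric_deriv g c x u v w =
     frechet_derivative (\<lambda>y. g c (chart_inv c y) v w) (at (snd c x)) u"

definition christoffel :: "('m, 'n::finite) metric \<Rightarrow> ('m, 'n) chart \<Rightarrow> 'm \<Rightarrow>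
    real ^ 'n \<Rightarrow> real ^ 'n \<Rightarrow> real ^ 'n \<Rightarrow> real" where
  "christoffel g c x u v w =
     (metric_deriv g c x u v w + metric_deriv g c x v u w - metric_deriv g c x w u v) / 2"

definition velocity :: "('m, 'n::finite) chart \<Rightarrow> (real \<Rightarrow> 'm) \<Rightarrow> real \<Rightarrow> real ^ 'n" where
  "velocity c \<gamma> t = vector_derivative (snd c \<circ> \<gamma>) (at t)"

definition acceleration :: "('m, 'n::finite) chart \<Rightarrow> (real \<Rightarrow> 'm) \<Rightarrow> real \<Rightarrow> real ^ 'n" where
  "acceleration c \<gamma> t = vector_derivative (velocity c \<gamma>) (at t)"

text \<open>The geodesic equation \<open>\<nabla>\<^bsub>\<gamma>'\<^esub> \<gamma>' = 0\<close>, paired by the metric with an arbitrary vector \<open>w\<close>.\<close>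

definition geodesic :: "('m::topological_space, 'n::finite) chart set \<Rightarrow> ('m, 'n) metric \<Rightarrow>
    real set \<Rightarrow> (real \<Rightarrow> 'm) \<Rightarrow> bool" where
  "geodesic A g I \<gamma> \<longleftrightarrow> open I \<and> is_interval I \<and> continuous_on I \<gamma> \<and>
     (\<forall>c\<in>A. smooth_on {t\<in>I. \<gamma> t \<in> fst c} (snd c \<circ> \<gamma>) \<and>
       (\<forall>t\<in>I. \<gamma> t \<in> fst c \<longrightarrow> (\<forall>w.
          g c (\<gamma> t) (acceleration c \<gamma> t) w
          + christoffel g c (\<gamma> t) (velocity c \<gamma> t) (velocity c \<gamma> t) w = 0)))"

text \<open>The Riemannian measure is the Borel measure with density \<open>sqrt (det (g\<^sub>i\<^sub>j))\<close> in every chart.\<close>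

definition gram :: "('m, 'n::finite) metric \<Rightarrow> ('m, 'n) chart \<Rightarrow> 'm \<Rightarrow> real ^ 'n ^ 'n" where
  "gram g c x = (\<chi> i j. g c x (axis i 1) (axis j 1))"

definition riemannian_volume ::
  "('m::topological_space, 'n::finite) chart set \<Rightarrow> ('m, 'n) metric \<Rightarrow> 'm measure" where
  "riemannian_volume A g = (THE \<mu>. sets \<mu> = sets borel \<and>
     (\<forall>c\<in>A. \<forall>B\<in>sets borel. B \<subseteq> fst c \<longrightarrow>
        emeasure \<mu> B =
          (\<integral>\<^sup>+ y. ennreal (sqrt (det (gram g c (chart_inv c y)))) * indicator (snd c ` B) y \<partial>lborel)))"


section \<open>Singular Riemannian foliations\<close>

text \<open>A manifold structure on a subset of \<open>'m\<close> is a pair \<open>(V, P)\<close>: the model space \<open>V\<close> is a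
  \<open>k\<close>-dimensional linear subspace of \<open>real ^ 'n\<close>, standing for \<open>\<real>\<^sup>k\<close> (so that \<open>k\<close> may depend on
  the subset), and \<open>P\<close> is a set of parametrizations \<open>(D, \<sigma>)\<close>, the inverses of charts, each
  defined on a relatively open subset \<open>D\<close> of \<open>V\<close>.\<close>

type_synonym ('m, 'n) submanifold_structure =
  "(real ^ 'n) set \<times> ((real ^ 'n) set \<times> (real ^ 'n \<Rightarrow> 'm)) set"

definition leaf_dim :: "('m, 'n::finite) submanifold_structure \<Rightarrow> nat" where
  "leaf_dim S = dim (fst S)"

text \<open>Immersed submanifold without self-intersections. The submanifold topology (the one generated
  by the sets \<open>\<sigma> ` D'\<close> with \<open>D'\<close> open in \<open>D\<close>) may be finer than the subspace topology. It is
  automatically Hausdorff; the countable subcover makes it second countable.\<close>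

definition immersed_submanifold :: "('m::topological_space, 'n::finite) chart set \<Rightarrow>
    ('m, 'n) submanifold_structure \<Rightarrow> 'm set \<Rightarrow> bool" where
  "immersed_submanifold A S L \<longleftrightarrow> (case S of (V, P) \<Rightarrow>
     subspace V \<and>
     (\<forall>(D, \<sigma>)\<in>P. openin (top_of_set V) D \<and> inj_on \<sigma> D \<and> continuous_on D \<sigma> \<and>
        (\<forall>c\<in>A. smooth_on {u\<in>D. \<sigma> u \<in> fst c} (snd c \<circ> \<sigma>) \<and>
           (\<forall>u\<in>D. \<sigma> u \<in> fst c \<longrightarrow>
              (\<exists>f'. (snd c \<circ> \<sigma> has_derivative f') (at u within D) \<and> inj_on f' V)))) \<and>
     (\<forall>(D, \<sigma>)\<in>P. \<forall>(D', \<sigma>')\<in>P.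
        openin (top_of_set V) {u\<in>D. \<sigma> u \<in> \<sigma>' ` D'} \<and>
        smooth_on {u\<in>D. \<sigma> u \<in> \<sigma>' ` D'} (inv_into D' \<sigma>' \<circ> \<sigma>)) \<and>
     (\<Union>(D, \<sigma>)\<in>P. \<sigma> ` D) = L \<and>
     (\<exists>Q. countable Q \<and> Q \<subseteq> P \<and> (\<Union>(D, \<sigma>)\<in>Q. \<sigma> ` D) = L))"

definition leaf_tangent :: "('m, 'n::finite) submanifold_structure \<Rightarrow> ('m, 'n) chart \<Rightarrow> 'm \<Rightarrow>
    (real ^ 'n) set" where
  "leaf_tangent S c x = {f' v | f' v D \<sigma> u. (D, \<sigma>) \<in> snd S \<and> u \<in> D \<and> \<sigma> u = x \<and> v \<in> fst S \<and>
     (snd c \<circ> \<sigma> has_derivative f') (at u within D)}"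

definition leaf_through :: "'m set set \<Rightarrow> 'm \<Rightarrow> 'm set" where
  "leaf_through F x = (THE L. L \<in> F \<and> x \<in> L)"

definition vectors_extend :: "('m::topological_space, 'n::finite) chart set \<Rightarrow> 'm set set \<Rightarrow>
    ('m set \<Rightarrow> ('m, 'n) submanifold_structure) \<Rightarrow> bool" where
  "vectors_extend A F S \<longleftrightarrow>
     (\<forall>c\<in>A. \<forall>x\<in>fst c. \<forall>v\<in>leaf_tangent (S (leaf_through F x)) c x.
        \<exists>W X. open W \<and> x \<in> W \<and> W \<subseteq> fst c \<and> smooth_on (snd c ` W) (X \<circ> chart_inv c) \<and> X x = v \<and>
          (\<forall>y\<in>W. X y \<in> leaf_tangent (S (leaf_through F y)) c y))"

definition orthogonal_to_leaf :: "('m, 'n::finite) chart set \<Rightarrow> ('m, 'n) metric \<Rightarrow> 'm set set \<Rightarrow>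
    ('m set \<Rightarrow> ('m, 'n) submanifold_structure) \<Rightarrow> (real \<Rightarrow> 'm) \<Rightarrow> real \<Rightarrow> bool" where
  "orthogonal_to_leaf A g F S \<gamma> t \<longleftrightarrow>
     (\<forall>c\<in>A. \<gamma> t \<in> fst c \<longrightarrow>
        (\<forall>w\<in>leaf_tangent (S (leaf_through F (\<gamma> t))) c (\<gamma> t). g c (\<gamma> t) (velocity c \<gamma> t) w = 0))"

text \<open>\<open>F\<close> is the set of leaves and \<open>S L\<close> the manifold structure of the leaf \<open>L\<close>. Completeness of the
  ambient manifold is not part of the definition; it holds automatically on a compact manifold.\<close>

definition singular_riemannian_foliation ::
  "('m::topological_space, 'n::finite) chart set \<Rightarrow> ('m, 'n) metric \<Rightarrow> 'm set set \<Rightarrow>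
    ('m set \<Rightarrow> ('m, 'n) submanifold_structure) \<Rightarrow> bool" where
  "singular_riemannian_foliation A g F S \<longleftrightarrow>
     partition_on UNIV F \<and>
     (\<forall>L\<in>F. immersed_submanifold A (S L) L) \<and>
     vectors_extend A F S \<and>
     (\<forall>I \<gamma>. geodesic A g I \<gamma> \<longrightarrow> (\<exists>t\<in>I. orthogonal_to_leaf A g F S \<gamma> t) \<longrightarrow>
        (\<forall>t\<in>I. orthogonal_to_leaf A g F S \<gamma> t))"

definition min_leaf_dim :: "'m set set \<Rightarrow> ('m set \<Rightarrow> ('m, 'n::finite) submanifold_structure) \<Rightarrow> nat"
  where "min_leaf_dim F S = Min (range (\<lambda>x. leaf_dim (S (leaf_through F x))))"


section \<open>Lebesgue and Sobolev spaces\<close>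

text \<open>Elements are functions rather than classes of functions modulo null sets, so the norms below
  are seminorms whose null functions are those vanishing almost everywhere.\<close>

definition Lp_space :: "'a measure \<Rightarrow> real \<Rightarrow> ('a \<Rightarrow> real) set" where
  "Lp_space M p = {u \<in> borel_measurable M. integrable M (\<lambda>x. \<bar>u x\<bar> powr p)}"

definition Lp_norm :: "'a measure \<Rightarrow> real \<Rightarrow> ('a \<Rightarrow> real) \<Rightarrow> real" where
  "Lp_norm M p u = (\<integral>x. \<bar>u x\<bar> powr p \<partial>M) powr (1 / p)"

text \<open>\<open>X c x\<close> is the vector of coordinates, in the chart \<open>c\<close>, of the field at \<open>x\<close>.\<close>

definition measurable_vector_field :: "('m::topological_space, 'n::finite) chart set \<Rightarrow>
    (('m, 'n) chart \<Rightarrow> 'm \<Rightarrow> real ^ 'n) \<Rightarrow> bool" where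
  "measurable_vector_field A X \<longleftrightarrow>
     (\<forall>c\<in>A. X c \<in> borel_measurable (restrict_space borel (fst c))) \<and>
     (\<forall>c\<in>A. \<forall>c'\<in>A. \<forall>x\<in>fst c \<inter> fst c'. X c' x = coord_change c c' x (X c x))"

text \<open>By the transformation rules the pointwise norm does not depend on the chart chosen.\<close>

definition field_norm :: "('m, 'n::finite) chart set \<Rightarrow> ('m, 'n) metric \<Rightarrow>
    (('m, 'n) chart \<Rightarrow> 'm \<Rightarrow> real ^ 'n) \<Rightarrow> 'm \<Rightarrow> real" where
  "field_norm A g X x = (let c = (SOME c. c \<in> A \<and> x \<in> fst c) in sqrt (g c x (X c x) (X c x)))"

text \<open>\<open>X\<close> is the weak gradient of \<open>u\<close>: in each chart the weak derivative of \<open>u\<close> in a coordinate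
  direction \<open>w\<close> is \<open>g X w\<close>.\<close>

definition weak_gradient :: "('m::topological_space, 'n::finite) chart set \<Rightarrow> ('m, 'n) metric \<Rightarrow>
    ('m \<Rightarrow> real) \<Rightarrow> (('m, 'n) chart \<Rightarrow> 'm \<Rightarrow> real ^ 'n) \<Rightarrow> bool" where
  "weak_gradient A g u X \<longleftrightarrow> measurable_vector_field A X \<and>
     (\<forall>c\<in>A. \<forall>w.
        (\<forall>K. compact K \<and> K \<subseteq> snd c ` fst c \<longrightarrow>
           set_integrable lborel K (\<lambda>y. u (chart_inv c y)) \<and>
           set_integrable lborel K (\<lambda>y. g c (chart_inv c y) (X c (chart_inv c y)) w)) \<and>
        (\<forall>\<eta> K. smooth_on UNIV \<eta> \<and> compact K \<and> K \<subseteq> snd c ` fst c \<and> (\<forall>y. y \<notin> K \<longrightarrow> \<eta> y = 0) \<longrightarrow>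
           (LINT y:K|lborel. u (chart_inv c y) * frechet_derivative \<eta> (at y) w) =
           - (LINT y:K|lborel. g c (chart_inv c y) (X c (chart_inv c y)) w * \<eta> y)))"

definition sobolev_space :: "('m::topological_space, 'n::finite) chart set \<Rightarrow> ('m, 'n) metric \<Rightarrow>
    real \<Rightarrow> ('m \<Rightarrow> real) set" where
  "sobolev_space A g p = {u \<in> Lp_space (riemannian_volume A g) p.
     \<exists>X. weak_gradient A g u X \<and> field_norm A g X \<in> Lp_space (riemannian_volume A g) p}"

text \<open>The weak gradient is unique up to null sets, so the choice below does not matter.\<close>

definition sobolev_norm :: "('m::topological_space, 'n::finite) chart set \<Rightarrow> ('m, 'n) metric \<Rightarrow>
    real \<Rightarrow> ('m \<Rightarrow> real) \<Rightarrow> real" where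
  "sobolev_norm A g p u =
     ((\<integral>x. \<bar>u x\<bar> powr p \<partial>riemannian_volume A g) +
      (\<integral>x. field_norm A g (SOME X. weak_gradient A g u X) x powr p \<partial>riemannian_volume A g))
     powr (1 / p)"

definition smooth_basic_functions :: "('m, 'n::finite) chart set \<Rightarrow> 'm set set \<Rightarrow>
    ('m \<Rightarrow> real) set" where
  "smooth_basic_functions A F =
     {v. smooth_function A v \<and> (\<forall>L\<in>F. \<forall>x\<in>L. \<forall>y\<in>L. v x = v y)}"

definition basic_sobolev_space :: "('m::topological_space, 'n::finite) chart set \<Rightarrow>
    ('m, 'n) metric \<Rightarrow> 'm set set \<Rightarrow> real \<Rightarrow> ('m \<Rightarrow> real) set" where
  "basic_sobolev_space A g F p = {u \<in> sobolev_space A g p.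
     \<forall>\<epsilon>>0. \<exists>v \<in> smooth_basic_functions A F \<inter> sobolev_space A g p.
       sobolev_norm A g p (\<lambda>x. u x - v x) < \<epsilon>}"

text \<open>Compact embedding of one (semi)normed function space into another: the inclusion is well
  defined, bounded, and maps bounded sequences to sequences having convergent subsequences.\<close>

definition compactly_embedded :: "('a \<Rightarrow> real) set \<Rightarrow> (('a \<Rightarrow> real) \<Rightarrow> real) \<Rightarrow>
    ('a \<Rightarrow> real) set \<Rightarrow> (('a \<Rightarrow> real) \<Rightarrow> real) \<Rightarrow> bool" where
  "compactly_embedded X NX Y NY \<longleftrightarrow>
     X \<subseteq> Y \<and> (\<exists>C. \<forall>u\<in>X. NY u \<le> C * NX u) \<and>
     (\<forall>s :: nat \<Rightarrow> 'a \<Rightarrow> real. (\<forall>k. s k \<in> X) \<and> (\<exists>B. \<forall>k. NX (s k) \<le> B) \<longrightarrow>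
        (\<exists>r u. strict_mono r \<and> u \<in> Y \<and> (\<lambda>k. NY (\<lambda>x. s (r k) x - u x)) \<longlonglongrightarrow> 0))"

end

theory Submission
  imports Defs "HOL-Probability.Probability" "HOL-Combinatorics.Permutations" "HOL-Library.Diagonal_Subsequence"
begin

text \<open>Near a point, extending \<open>d\<close> independent tangent vectors of the leaf and solving a linear system writes \<open>d\<close> of the
  partial derivatives of a basic function (those with index in \<open>J\<close>) as combinations of the remaining \<open>n - d\<close>, with
  coefficients independent of the function. Read as transport equations with the \<open>J\<close> coordinates as times, these relations
  bound integrals of \<open>\<bar>f\<bar>\<^sup>p\<close>, \<open>\<bar>\<nabla>f\<bar>\<^sup>p\<close> and \<open>\<bar>f\<bar>\<^sup>q\<close> by those of the function obtained by freezing the \<open>J\<close> coordinates, and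
  conversely. The frozen function depends on \<open>n - d\<close> variables only and obeys the Sobolev inequality of that dimension, whose
  critical exponent exceeds \<open>p\<^sup>*\<close> as \<open>d \<ge> 1\<close> (and is infinite if \<open>p \<ge> n - d\<close>). So the smooth basic functions of norm at
  most 1 are bounded in some \<open>L\<^sup>q\<^sup>'\<close> with \<open>q' > q\<close>; they are precompact in \<open>L\<^sup>1\<close>, hence by interpolation in \<open>L\<^sup>q\<close>, and
  the passage to the closure is Fatou's lemma.\<close>

section \<open>Calculus of smooth functions\<close>

text \<open>Leaf dimensions may jump, and the extended fields need not span an integrable
  distribution, so a chart that straightens the leaves is not at hand. Freezing the \<open>J\<close>
  coordinates does not follow the leaves either: it replaces \<open>f\<close> by a different
  function, whose integrals are comparable with those of \<open>f\<close> because the transport has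
  bounded speed. The price is a loss of domain, paid by passing to smaller plaques. Powers of
  \<open>\<bar>f\<bar>\<close> may fail to be C^1 at zeros, hence the energies are powers of
  \<open>1 + f^2\<close>. The gradient satisfies the transport equation only up to a multiple of
  itself, which a Gronwall bound tolerates. The condition \<open>k * (q / p - 1) < q\<close> with
  \<open>k = n - d\<close> says that \<open>q\<close> lies strictly below the critical exponent
  \<open>k * p / (k - p)\<close> of dimension \<open>k\<close>; for \<open>k \<le> p \<le> q\<close>
  it always holds. Strictness permits a proof of the Sobolev inequality by averaging over segments,
  without the critical case. Compactness in L^1 does not involve the foliation; its input is the
  Poincare inequality on small cells.\<close>

lemma C_on_cong:
  assumes "open S" "\<And>x. x \<in> S \<Longrightarrow> f x = g x"
  shows "C_on k S f \<longleftrightarrow> C_on k S g"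
  using assms(2)
proof (induction k arbitrary: f g)
  case 0
  then show ?case using continuous_on_cong[OF refl, of S f g] by simp
next
  case (Suc k)
  have *: "C_on (Suc k) S g" if "C_on (Suc k) S f" and eq: "\<And>x. x \<in> S \<Longrightarrow> f x = g x" for f g :: "'a \<Rightarrow> 'b"
  proof -
    have fr: "frechet_derivative f (at x) = frechet_derivative g (at x)" if "x \<in> S" for x
      using frechet_derivative_transform_within_open[of f x S g] \<open>C_on (Suc k) S f\<close> that eq assms(1) by auto
    have "g differentiable (at x)" if "x \<in> S" for x
    proof -
      have "(f has_derivative frechet_derivative f (at x)) (at x)"
        using \<open>C_on (Suc k) S f\<close> that by (simp add: frechet_derivative_works)
      then have "(g has_derivative frechet_derivative f (at x)) (at x)"
        by (rule has_derivative_transform_within_open[OF _ assms(1) that]) (simp add: eq)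
      then show ?thesis by (auto simp: differentiable_def)
    qed
    moreover have "C_on k S (\<lambda>x. frechet_derivative g (at x) v)" for v
      using Suc.IH[of "\<lambda>x. frechet_derivative f (at x) v" "\<lambda>x. frechet_derivative g (at x) v"] fr that by simp
    ultimately show ?thesis by simp
  qed
  show ?case
    by (rule iffI; erule *) (simp_all add: Suc.prems)
qed

lemma C_on_subset: "C_on k S f \<Longrightarrow> T \<subseteq> S \<Longrightarrow> C_on k T f"
  by (induction k arbitrary: f) (auto intro: continuous_on_subset)

lemma C_on_SucI:
  assumes "open S" "\<And>x. x \<in> S \<Longrightarrow> (f has_derivative f' x) (at x)" "\<And>v. C_on k S (\<lambda>x. f' x v)"
  shows "C_on (Suc k) S f"
proof -
  have "frechet_derivative f (at x) = f' x" if "x \<in> S" for x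
    using assms(2)[OF that] by (metis frechet_derivative_at)
  then have "C_on k S (\<lambda>x. frechet_derivative f (at x) v)" for v
    using C_on_cong[OF assms(1), of "\<lambda>x. frechet_derivative f (at x) v" "\<lambda>x. f' x v"] assms(3) by auto
  then show ?thesis using assms(2) by (auto simp: differentiable_def)
qed

lemma C_on_has_derivative:
  "C_on (Suc k) S f \<Longrightarrow> x \<in> S \<Longrightarrow> (f has_derivative frechet_derivative f (at x)) (at x)"
  by (simp add: frechet_derivative_works)

lemma C_on_Suc_imp: "C_on (Suc k) S f \<Longrightarrow> C_on k S f"
proof (induction k arbitrary: f)
  case 0
  then show ?case by (auto intro!: continuous_at_imp_continuous_on differentiable_imp_continuous_within)
next
  case (Suc k)
  then show ?case by (metis C_on.simps(2))
qed

lemma C_on_mono: "C_on k S f \<Longrightarrow> l \<le> k \<Longrightarrow> C_on l S f"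
  by (induction k) (auto simp: le_Suc_eq simp del: C_on.simps dest: C_on_Suc_imp)

lemma C_on_imp_continuous_on: "C_on k S f \<Longrightarrow> continuous_on S f"
  using C_on_mono[of k S f 0] by simp

lemma C_on_local:
  assumes "\<And>x. x \<in> S \<Longrightarrow> \<exists>W. open W \<and> x \<in> W \<and> C_on k W f"
  shows "C_on k S f"
  using assms
proof (induction k arbitrary: f)
  case 0
  then have "continuous (at x) f" if "x \<in> S" for x
    using that by (metis C_on.simps(1) continuous_on_eq_continuous_at)
  then show ?case by (simp add: continuous_at_imp_continuous_on)
next
  case (Suc k)
  have "f differentiable (at x)" if "x \<in> S" for x
    using Suc.prems[OF that] by auto
  moreover have "C_on k S (\<lambda>x. frechet_derivative f (at x) v)" for v
    by (rule Suc.IH) (metis Suc.prems C_on.simps(2))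
  ultimately show ?case by simp
qed

text \<open>On an open set a local extension coincides with the function near each point, hence
  shares its derivatives. This lets every later argument work with \<open>C_on\<close> instead of
  extensions.\<close>

lemma smooth_on_open:
  assumes "open S"
  shows "smooth_on S f \<longleftrightarrow> (\<forall>k. C_on k S f)"
proof
  assume sm: "smooth_on S f"
  show "\<forall>k. C_on k S f"
  proof
    fix k
    show "C_on k S f"
    proof (rule C_on_local)
      fix x assume "x \<in> S"
      then obtain W f' where W: "open W" "x \<in> W" "\<forall>k. C_on k W f'" "\<forall>y\<in>W \<inter> S. f' y = f y"
        using sm unfolding smooth_on_def by blast
      then have "C_on k (W \<inter> S) f"
        using C_on_cong[of "W \<inter> S" f' f k] C_on_subset[of k W f' "W \<inter> S"] assms by auto
      then show "\<exists>W. open W \<and> x \<in> W \<and> C_on k W f"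
        using W \<open>x \<in> S\<close> assms by blast
    qed
  qed
next
  assume "\<forall>k. C_on k S f"
  then show "smooth_on S f" unfolding smooth_on_def using assms by blast
qed

lemma C_on_const: "open S \<Longrightarrow> C_on k S (\<lambda>x. c)"
proof (induction k arbitrary: c)
  case (Suc k)
  then show ?case by (intro C_on_SucI[where f'="\<lambda>x v. 0"]) auto
qed auto

lemma C_on_bounded_linear_compose:
  assumes "bounded_linear L" "open S"
  shows "C_on k S f \<Longrightarrow> C_on k S (\<lambda>x. L (f x))"
proof (induction k arbitrary: f)
  case 0
  then show ?case using assms(1) by (auto intro: bounded_linear.continuous_on)
next
  case (Suc k)
  show ?case
  proof (rule C_on_SucI[OF assms(2), where f'="\<lambda>x v. L (frechet_derivative f (at x) v)"])
    show "((\<lambda>x. L (f x)) has_derivative (\<lambda>v. L (frechet_derivative f (at x) v))) (at x)" if "x \<in> S" for x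
      by (rule bounded_linear.has_derivative[OF assms(1) C_on_has_derivative[OF Suc.prems that]])
  qed (use Suc in auto)
qed

lemma C_on_bounded_linear:
  assumes "bounded_linear L" "open S"
  shows "C_on k S L"
proof (cases k)
  case 0
  then show ?thesis using assms by (auto intro: linear_continuous_on)
next
  case (Suc l)
  show ?thesis unfolding Suc
    by (rule C_on_SucI[OF assms(2), where f'="\<lambda>x v. L v"])
       (auto simp: C_on_const assms bounded_linear_imp_has_derivative)
qed

lemma C_on_add:
  assumes "open S"
  shows "C_on k S f \<Longrightarrow> C_on k S g \<Longrightarrow> C_on k S (\<lambda>x. f x + g x)"
proof (induction k arbitrary: f g)
  case 0
  then show ?case by (auto intro: continuous_on_add)
next
  case (Suc k)
  show ?case
    by (rule C_on_SucI[OF assms, where f'="\<lambda>x v. frechet_derivative f (at x) v + frechet_derivative g (at x) v"])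
       (use Suc in \<open>auto intro!: has_derivative_add C_on_has_derivative\<close>)
qed

lemma C_on_mult:
  fixes f g :: "'a::real_normed_vector \<Rightarrow> real"
  assumes "open S"
  shows "C_on k S f \<Longrightarrow> C_on k S g \<Longrightarrow> C_on k S (\<lambda>x. f x * g x)"
proof (induction k arbitrary: f g)
  case 0
  then show ?case by (auto intro: continuous_on_mult)
next
  case (Suc k)
  have "C_on k S f" "C_on k S g" using Suc.prems C_on_Suc_imp by blast+
  then show ?case
    by (intro C_on_SucI[OF assms, where f'="\<lambda>x v. f x * frechet_derivative g (at x) v + frechet_derivative f (at x) v * g x"])
       (use Suc in \<open>auto intro!: has_derivative_mult C_on_has_derivative C_on_add[OF assms]\<close>)
qed

lemma C_on_uminus:
  assumes "open S" "C_on k S f" shows "C_on k S (\<lambda>x. - f x)"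
  using C_on_bounded_linear_compose[of uminus, OF _ assms] by (simp add: bounded_linear_minus)

lemma C_on_diff:
  assumes "open S" "C_on k S f" "C_on k S g" shows "C_on k S (\<lambda>x. f x - g x)"
  using C_on_add[OF assms(1,2) C_on_uminus[OF assms(1,3)]] by simp

lemma C_on_sum:
  assumes "open S" "\<And>i. i \<in> I \<Longrightarrow> C_on k S (f i)"
  shows "C_on k S (\<lambda>x. \<Sum>i\<in>I. f i x)"
  using assms(2)
  by (induction I rule: infinite_finite_induct) (auto simp: C_on_const C_on_add assms(1))

lemma C_on_prod:
  fixes f :: "'i \<Rightarrow> 'a::real_normed_vector \<Rightarrow> real"
  assumes "open S" "\<And>i. i \<in> I \<Longrightarrow> C_on k S (f i)"
  shows "C_on k S (\<lambda>x. \<Prod>i\<in>I. f i x)"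
  using assms(2)
  by (induction I rule: infinite_finite_induct) (auto simp: C_on_const C_on_mult assms(1))

lemma C_on_inverse:
  fixes f :: "'a::real_normed_vector \<Rightarrow> real"
  assumes "open S" "\<And>x. x \<in> S \<Longrightarrow> f x \<noteq> 0"
  shows "C_on k S f \<Longrightarrow> C_on k S (\<lambda>x. inverse (f x))"
proof (induction k)
  case 0
  then show ?case using assms by (auto intro: continuous_on_inverse)
next
  case (Suc k)
  have "C_on k S (\<lambda>x. inverse (f x))" using Suc C_on_Suc_imp by blast
  moreover have "((\<lambda>x. inverse (f x)) has_derivative
      (\<lambda>v. - (inverse (f x) * frechet_derivative f (at x) v * inverse (f x)))) (at x)" if "x \<in> S" for x
    by (rule Deriv.has_derivative_inverse[OF assms(2)[OF that] C_on_has_derivative[OF Suc.prems that]])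
  moreover have "C_on k S (\<lambda>x. frechet_derivative f (at x) v)" for v using Suc.prems by simp
  ultimately show ?case
    by (intro C_on_SucI[OF assms(1), where f'="\<lambda>x v. - (inverse (f x) * frechet_derivative f (at x) v * inverse (f x))"]
        C_on_uminus C_on_mult assms(1))
qed

text \<open>For an outer function of one real variable the chain rule is a product with the scalar
  function \<open>?h (f x)\<close>, which has the same form, so the induction over \<open>k\<close>
  closes up with \<open>C_on_mult\<close>.\<close>

lemma C_on_compose_real:
  fixes f :: "'a::real_normed_vector \<Rightarrow> real" and h :: "real \<Rightarrow> real"
  assumes "open S" "open T" "\<And>x. x \<in> S \<Longrightarrow> f x \<in> T"
  shows "C_on k T h \<Longrightarrow> C_on k S f \<Longrightarrow> C_on k S (\<lambda>x. h (f x))"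
proof (induction k arbitrary: h)
  case 0
  then show ?case using assms(3) by (auto intro!: continuous_on_compose2[of T h])
next
  case (Suc k)
  let ?h = "\<lambda>t. frechet_derivative h (at t) 1"
  have lin: "frechet_derivative h (at t) v = v * ?h t" if "t \<in> T" for t v
  proof -
    have "linear (frechet_derivative h (at t))"
      using C_on_has_derivative[OF Suc.prems(1) that] has_derivative_linear by blast
    then show ?thesis using linear_cmul[of _ v 1] by fastforce
  qed
  have "C_on k S (\<lambda>x. ?h (f x))"
    using Suc.IH[of ?h] Suc.prems C_on_Suc_imp[of k S f] by auto
  moreover have "((\<lambda>x. h (f x)) has_derivative (\<lambda>v. frechet_derivative f (at x) v * ?h (f x))) (at x)" if "x \<in> S" for x
  proof -
    have "((\<lambda>x. h (f x)) has_derivative (\<lambda>v. frechet_derivative h (at (f x)) (frechet_derivative f (at x) v))) (at x)"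
      by (rule has_derivative_compose[OF C_on_has_derivative[OF Suc.prems(2) that]])
         (rule C_on_has_derivative[OF Suc.prems(1) assms(3)[OF that]])
    moreover have "(\<lambda>v. frechet_derivative h (at (f x)) (frechet_derivative f (at x) v)) =
        (\<lambda>v. frechet_derivative f (at x) v * ?h (f x))"
      by (rule ext) (rule lin[OF assms(3)[OF that]])
    ultimately show ?thesis by (rule subst[rotated])
  qed
  ultimately show ?case
    by (intro C_on_SucI[OF assms(1), where f'="\<lambda>x v. frechet_derivative f (at x) v * ?h (f x)"])
       (use Suc.prems in \<open>auto intro!: C_on_mult assms\<close>)
qed

text \<open>For \<open>n = 0\<close> the classical flat function, continued by 0. The factors
  \<open>inverse t ^ n\<close> are there because the whole family, unlike its member
  \<open>n = 0\<close>, is closed under differentiation up to linear combinations; smoothness is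
  then one induction for all \<open>n\<close> at once.\<close>

definition flatexp :: "nat \<Rightarrow> real \<Rightarrow> real" where
  "flatexp n t = (if t \<le> 0 then 0 else exp (- inverse t) * inverse t ^ n)"

lemma flatexp_tendsto_0: "(flatexp n \<longlongrightarrow> 0) (at 0)"
proof -
  have "((\<lambda>s::real. s ^ n / exp s) \<longlongrightarrow> 0) at_top" by (rule tendsto_power_div_exp_0)
  then have "((\<lambda>t::real. inverse t ^ n / exp (inverse t)) \<longlongrightarrow> 0) (at_right 0)"
    by (rule filterlim_compose) (rule filterlim_inverse_at_top_right)
  moreover have "\<forall>\<^sub>F t in at_right 0. inverse t ^ n / exp (inverse t) = flatexp n (t::real)"
    by (auto simp: flatexp_def eventually_at_right_field exp_minus field_simps intro!: exI[of _ 1])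
  ultimately have "(flatexp n \<longlongrightarrow> 0) (at_right 0)"
    by (rule Lim_transform_eventually)
  moreover have "(flatexp n \<longlongrightarrow> 0) (at_left 0)"
    by (rule Lim_transform_eventually[OF tendsto_const])
       (auto simp: flatexp_def eventually_at_left_field intro!: exI[of _ "-1"])
  ultimately show ?thesis by (simp add: filterlim_at_split)
qed

lemma flatexp_has_derivative:
  "(flatexp n has_derivative (\<lambda>v. v * (flatexp (n+2) x - real n * flatexp (n+1) x))) (at x)"
proof -
  consider "x < 0" | "x = 0" | "x > 0" by linarith
  then show ?thesis
  proof cases
    case 1
    have "((\<lambda>_. 0) has_derivative (\<lambda>v. v * (flatexp (n+2) x - real n * flatexp (n+1) x))) (at x)"
      using 1 by (simp add: flatexp_def)
    then show ?thesis
      by (rule has_derivative_transform_within_open[of _ _ _ _ "{..<0}"]) (use 1 in \<open>auto simp: flatexp_def\<close>)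
  next
    case 2
    \<comment> \<open>The difference quotient at 0 is again a member of the family,
      \<open>flatexp (Suc n)\<close>, so its limit is already known.\<close>
    have "((\<lambda>h. (flatexp n (0 + h) - flatexp n 0) / h) \<longlongrightarrow> 0) (at 0)"
      by (rule Lim_transform_eventually[OF flatexp_tendsto_0[of "Suc n"]])
         (auto simp: eventually_at flatexp_def divide_inverse intro!: exI[of _ 1])
    then have "(flatexp n has_real_derivative 0) (at 0)" by (simp add: DERIV_def)
    moreover have z: "times 0 = (\<lambda>v::real. 0::real)" by auto
    ultimately show ?thesis using 2 unfolding has_field_derivative_def z by (simp add: flatexp_def)
  next
    case 3
    have "((\<lambda>t. exp (- inverse t) * inverse t ^ n) has_real_derivative (flatexp (n+2) x - real n * flatexp (n+1) x)) (at x)"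
    proof (cases n)
      case 0
      then show ?thesis using 3
        by (auto intro!: derivative_eq_intros simp: flatexp_def power2_eq_square field_simps)
    next
      case (Suc m)
      then show ?thesis using 3
        by (auto intro!: derivative_eq_intros simp: flatexp_def power2_eq_square field_simps, cases m, auto)
    qed
    then have "((\<lambda>t. exp (- inverse t) * inverse t ^ n) has_derivative (\<lambda>v. v * (flatexp (n+2) x - real n * flatexp (n+1) x))) (at x)"
      by (simp add: has_field_derivative_def mult_commute_abs)
    then show ?thesis
      by (rule has_derivative_transform_within_open[of _ _ _ _ "{0<..}"]) (use 3 in \<open>auto simp: flatexp_def\<close>)
  qed
qed

lemma C_on_flat: "C_on k UNIV (flatexp n)"
proof (induction k arbitrary: n)
  case 0
  show ?case
    using flatexp_has_derivative[of n] by (auto intro!: continuous_at_imp_continuous_on has_derivative_continuous)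
next
  case (Suc k)
  show ?case
    by (rule C_on_SucI[OF _ flatexp_has_derivative])
       (auto intro!: C_on_mult C_on_diff C_on_const Suc)
qed

section \<open>Integration by parts and the fundamental lemma\<close>

text \<open>A bridge: differentiation under the integral sign is carried out for gauge integrals
  over boxes, while translation invariance and dominated convergence concern the Lebesgue integral
  over the whole space.\<close>

lemma integral_zero_outside_compact:
  fixes f :: "'a::euclidean_space \<Rightarrow> real"
  assumes "continuous_on UNIV f" "compact K" "\<And>x. x \<notin> K \<Longrightarrow> f x = 0"
  shows "integrable lborel f"
    and "K \<subseteq> cbox a b \<Longrightarrow> integral (cbox a b) f = integral\<^sup>L lborel f"
proof -
  have eq: "(\<lambda>x. indicator K x *\<^sub>R f x) = f" using assms(3) by (auto simp: fun_eq_iff indicator_def)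
  show "integrable lborel f"
    using borel_integrable_compact[OF assms(2) continuous_on_subset[OF assms(1)]] eq by simp
  assume K: "K \<subseteq> cbox a b"
  have "set_integrable lborel (cbox a b) f" unfolding set_integrable_def
    by (rule borel_integrable_compact) (auto intro: continuous_on_subset[OF assms(1)])
  then have "integral (cbox a b) f = (LINT x:cbox a b|lborel. f x)"
    by (rule set_borel_integral_eq_integral(2)[symmetric])
  also have "\<dots> = integral\<^sup>L lborel f" unfolding set_lebesgue_integral_def
    using assms(3) K by (intro Bochner_Integration.integral_cong) (auto simp: indicator_def)
  finally show "integral (cbox a b) f = integral\<^sup>L lborel f" .
qed

text \<open>By translation invariance the integral of \<open>\<Theta> (x + t v)\<close> does not depend on \<open>t\<close>.\<close>

lemma integral_derivative_compact_support:
  fixes \<Theta> :: "'a::euclidean_space \<Rightarrow> real"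
  assumes C: "C_on 1 UNIV \<Theta>" and K: "compact K" and off: "\<And>x. x \<notin> K \<Longrightarrow> \<Theta> x = 0"
  shows "integral\<^sup>L lborel (\<lambda>x. frechet_derivative \<Theta> (at x) v) = 0"
proof -
  have der: "(\<Theta> has_derivative frechet_derivative \<Theta> (at x)) (at x)" for x
    using C by (simp add: frechet_derivative_works)
  have cont: "continuous_on UNIV (\<lambda>x. frechet_derivative \<Theta> (at x) v)" using C by simp
  have contT: "continuous_on UNIV \<Theta>" using C_on_imp_continuous_on[OF C] .
  have off': "frechet_derivative \<Theta> (at x) v = 0" if "x \<notin> K" for x
  proof -
    have "((\<lambda>x. 0) has_derivative frechet_derivative \<Theta> (at x)) (at x)"
      by (rule has_derivative_transform_within_open[OF der, of "- K"])
         (use that off K in \<open>auto simp: compact_imp_closed open_Compl\<close>)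
    then show ?thesis using has_derivative_unique[OF _ has_derivative_const, of 0 _ x] by fastforce
  qed
  \<comment> \<open>\<open>K'\<close> collects the supports of all translates with
    \<open>\<bar>t\<bar> \<le> 1\<close>, so that one box serves for every \<open>t\<close> near
    0.\<close>
  define K' where "K' = (\<lambda>(t, x). x - t *\<^sub>R v) ` ({-1..1} \<times> K)"
  have "compact K'" unfolding K'_def using K
    by (intro compact_continuous_image) (auto intro!: continuous_intros compact_Times simp: case_prod_unfold)
  then obtain a where a: "K' \<subseteq> cbox (- a) a" using bounded_subset_cbox_symmetric compact_imp_bounded by blast
  let ?Q = "cbox (-a) a" and ?F = "\<lambda>t. integral (cbox (-a) a) (\<lambda>z. \<Theta> (z + t *\<^sub>R v))"
  have F: "?F t = integral\<^sup>L lborel \<Theta>" if "t \<in> {-1<..<1}" for t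
  proof -
    have "?F t = integral\<^sup>L lborel (\<lambda>z. \<Theta> (z + t *\<^sub>R v))"
    proof (rule integral_zero_outside_compact(2)[OF _ \<open>compact K'\<close> _ a])
      show "continuous_on UNIV (\<lambda>z. \<Theta> (z + t *\<^sub>R v))"
        by (rule continuous_on_compose2[OF contT]) (auto intro!: continuous_intros)
      show "\<Theta> (z + t *\<^sub>R v) = 0" if z: "z \<notin> K'" for z
      proof (rule off, rule notI)
        assume "z + t *\<^sub>R v \<in> K"
        then have "(\<lambda>(t, x). x - t *\<^sub>R v) (t, z + t *\<^sub>R v) \<in> K'"
          unfolding K'_def using \<open>t \<in> {-1<..<1}\<close> by (intro imageI) auto
        then show False using z by simp
      qed
    qed
    also have "\<dots> = integral\<^sup>L (distr lborel borel ((+) (t *\<^sub>R v))) \<Theta>"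
      using contT by (subst integral_distr) (auto simp: add.commute intro: borel_measurable_continuous_onI)
    finally show ?thesis by (simp add: lborel_distr_plus)
  qed
  have "(?F has_vector_derivative integral ?Q (\<lambda>z. frechet_derivative \<Theta> (at (z + 0 *\<^sub>R v)) v)) (at 0 within {-1<..<1})"
  proof (rule leibniz_rule_vector_derivative)
    fix t z
    have "((\<lambda>t. \<Theta> (z + t *\<^sub>R v)) has_derivative (\<lambda>h. frechet_derivative \<Theta> (at (z + t *\<^sub>R v)) (h *\<^sub>R v))) (at t within {-1<..<1})"
      by (rule has_derivative_compose[OF _ der]) (auto intro!: derivative_eq_intros)
    moreover have "frechet_derivative \<Theta> (at (z + t *\<^sub>R v)) (h *\<^sub>R v) = h *\<^sub>R frechet_derivative \<Theta> (at (z + t *\<^sub>R v)) v" for h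
      using has_derivative_linear[OF der] linear_cmul by blast
    ultimately show "((\<lambda>t. \<Theta> (z + t *\<^sub>R v)) has_vector_derivative frechet_derivative \<Theta> (at (z + t *\<^sub>R v)) v) (at t within {-1<..<1})"
      by (simp add: has_vector_derivative_def)
  next
    fix t show "(\<lambda>z. \<Theta> (z + t *\<^sub>R v)) integrable_on ?Q"
      by (rule integrable_continuous, rule continuous_on_compose2[OF contT]) (auto intro!: continuous_intros)
  next
    show "continuous_on ({-1<..<1} \<times> ?Q) (\<lambda>(t, z). frechet_derivative \<Theta> (at (z + t *\<^sub>R v)) v)"
      unfolding case_prod_unfold by (rule continuous_on_compose2[OF cont]) (auto intro!: continuous_intros)
  qed auto
  then have "(?F has_vector_derivative integral ?Q (\<lambda>z. frechet_derivative \<Theta> (at z) v)) (at 0)"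
    by (simp add: at_within_open[of _ "{-1<..<1::real}"])
  moreover have "(?F has_vector_derivative 0) (at 0)"
    by (rule has_vector_derivative_transform_within_open[of "\<lambda>_. integral\<^sup>L lborel \<Theta>" _ _ "{-1<..<1}"])
       (use F in auto)
  ultimately have "integral ?Q (\<lambda>z. frechet_derivative \<Theta> (at z) v) = 0"
    using vector_derivative_unique_at by blast
  moreover have "K \<subseteq> ?Q"
  proof
    fix x assume "x \<in> K"
    then have "(\<lambda>(t, x). x - t *\<^sub>R v) (0, x) \<in> K'" unfolding K'_def by (intro imageI) auto
    then show "x \<in> ?Q" using a by auto
  qed
  ultimately show ?thesis
    using integral_zero_outside_compact(2)[OF cont K, of "-a" a] off' by simp
qed

text \<open>Regularity is local, and the two open sets \<open>\<Omega>\<close> and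
  \<open>- K\<close> cover the space.\<close>

lemma C_on_zero_extension:
  fixes f :: "'a::euclidean_space \<Rightarrow> 'b::real_normed_vector"
  assumes "open \<Omega>" "C_on k \<Omega> f" "compact K" "K \<subseteq> \<Omega>" "\<And>x. x \<notin> K \<Longrightarrow> f x = 0"
  shows "C_on k UNIV f"
proof (rule C_on_local)
  fix x
  have "C_on k (- K) f"
    using C_on_cong[of "-K" f "\<lambda>_. 0" k] assms C_on_const[of "-K" k 0] by (auto simp: compact_imp_closed open_Compl)
  then show "\<exists>W. open W \<and> x \<in> W \<and> C_on k W f"
    using assms compact_imp_closed[of K] by (cases "x \<in> K") (auto intro: exI[of _ \<Omega>] exI[of _ "-K"])
qed

text \<open>The product of \<open>f\<close> and \<open>\<eta>\<close> vanishes off \<open>K\<close>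
  and is therefore C^1 on the whole space, whatever \<open>f\<close> does outside
  \<open>\<Omega>\<close>; the integral of its derivative is zero.\<close>

lemma integration_by_parts:
  fixes f \<eta> :: "'a::euclidean_space \<Rightarrow> real"
  assumes "open \<Omega>" "C_on 1 \<Omega> f" "C_on 1 \<Omega> \<eta>" "compact K" "K \<subseteq> \<Omega>" "\<And>x. x \<notin> K \<Longrightarrow> \<eta> x = 0"
  shows "(LINT x:K|lborel. f x * frechet_derivative \<eta> (at x) v) =
    - (LINT x:K|lborel. frechet_derivative f (at x) v * \<eta> x)"
proof -
  define \<Theta> where "\<Theta> = (\<lambda>x. f x * \<eta> x)"
  have off: "\<Theta> x = 0" if "x \<notin> K" for x using assms(6) that by (simp add: \<Theta>_def)
  have "C_on 1 \<Omega> \<Theta>" unfolding \<Theta>_def by (intro C_on_mult assms)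
  then have C: "C_on 1 UNIV \<Theta>" using C_on_zero_extension assms off by blast
  have D: "frechet_derivative \<Theta> (at x) v = f x * frechet_derivative \<eta> (at x) v + frechet_derivative f (at x) v * \<eta> x"
    if "x \<in> \<Omega>" for x
  proof -
    have d: "(\<Theta> has_derivative (\<lambda>v. f x * frechet_derivative \<eta> (at x) v + frechet_derivative f (at x) v * \<eta> x)) (at x)"
      unfolding \<Theta>_def using assms(2,3) that by (intro has_derivative_mult) (auto simp: frechet_derivative_works)
    show ?thesis using fun_cong[OF frechet_derivative_at[OF d], of v] by simp
  qed
  have c: "continuous_on K (\<lambda>x. f x * frechet_derivative \<eta> (at x) v)" "continuous_on K (\<lambda>x. frechet_derivative f (at x) v * \<eta> x)"
    using assms(2,3) C_on_imp_continuous_on[OF assms(2)] C_on_imp_continuous_on[OF assms(3)]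
    by (auto intro!: continuous_on_mult intro: continuous_on_subset[OF _ assms(5)])
  have i: "set_integrable lborel K (\<lambda>x. f x * frechet_derivative \<eta> (at x) v)" "set_integrable lborel K (\<lambda>x. frechet_derivative f (at x) v * \<eta> x)"
    unfolding set_integrable_def by (rule borel_integrable_compact[OF assms(4)], rule c)+
  have off': "frechet_derivative \<Theta> (at x) v = 0" if "x \<notin> K" for x
  proof -
    have "((\<lambda>x. 0) has_derivative frechet_derivative \<Theta> (at x)) (at x)"
      by (rule has_derivative_transform_within_open[of \<Theta> _ _ _ "- K"])
         (use that off assms(4) C in \<open>auto simp: compact_imp_closed open_Compl frechet_derivative_works\<close>)
    then show ?thesis using has_derivative_unique[OF _ has_derivative_const, of 0 _ x] by fastforce
  qed
  have "(LINT x:K|lborel. f x * frechet_derivative \<eta> (at x) v) + (LINT x:K|lborel. frechet_derivative f (at x) v * \<eta> x)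
     = (LINT x:K|lborel. f x * frechet_derivative \<eta> (at x) v + frechet_derivative f (at x) v * \<eta> x)"
    by (rule set_integral_add(2)[OF i, symmetric])
  also have "\<dots> = integral\<^sup>L lborel (\<lambda>x. frechet_derivative \<Theta> (at x) v)"
    unfolding set_lebesgue_integral_def
    by (rule Bochner_Integration.integral_cong) (use D off' assms(5) in \<open>auto simp: indicator_def\<close>)
  also have "\<dots> = 0" by (rule integral_derivative_compact_support[OF C assms(4) off])
  finally show ?thesis by simp
qed

text \<open>The increment of \<open>f\<close> in direction \<open>v\<close> is the integral of
  \<open>F v\<close>. Differentiating this identity in direction \<open>u\<close> under the integral
  sign, and then with respect to the endpoint, exchanges the two derivatives.\<close>

lemma symmetric_second_derivative:
  fixes f :: "'a::euclidean_space \<Rightarrow> real"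
  assumes "open \<Omega>" and C: "C_on 2 \<Omega> f" and x: "x \<in> \<Omega>"
  shows "frechet_derivative (\<lambda>y. frechet_derivative f (at y) u) (at x) v =
    frechet_derivative (\<lambda>y. frechet_derivative f (at y) v) (at x) u"
proof -
  define F where "F w = (\<lambda>y. frechet_derivative f (at y) w)" for w
  have C1: "C_on 1 \<Omega> (F w)" for w using C by (simp add: F_def numeral_2_eq_2)
  have der: "(f has_derivative (\<lambda>w. F w y)) (at y)" if "y \<in> \<Omega>" for y
    using C that by (simp add: F_def numeral_2_eq_2 frechet_derivative_works)
  have derF: "(F w has_derivative frechet_derivative (F w) (at y)) (at y)" if "y \<in> \<Omega>" for y w
    using C1[of w] that by (simp add: frechet_derivative_works)
  have contF: "continuous_on \<Omega> (F w)" for w using C1 C_on_imp_continuous_on by blast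
  have contDF: "continuous_on \<Omega> (\<lambda>y. frechet_derivative (F w) (at y) w')" for w w'
    using C1[of w] by simp
  have lin: "F (h *\<^sub>R w) y = h *\<^sub>R F w y" if "y \<in> \<Omega>" for h w y
    using has_derivative_linear[OF der[OF that]] linear_cmul by fastforce
  have linF: "frechet_derivative (F w) (at y) (h *\<^sub>R w') = h *\<^sub>R frechet_derivative (F w) (at y) w'" if "y \<in> \<Omega>" for h w w' y
    using has_derivative_linear[OF derF[OF that]] linear_cmul by fastforce
  obtain e0 where e0: "e0 > 0" "ball x e0 \<subseteq> \<Omega>" using assms open_contains_ball by blast
  \<comment> \<open>Small enough for all points \<open>x + s *\<^sub>R u + t *\<^sub>R v\<close>
    with \<open>\<bar>s\<bar>, \<bar>t\<bar> \<le> e\<close> to stay inside the ball of radius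
    \<open>e0\<close>; the summand 1 covers \<open>u = v = 0\<close>.\<close>
  define e where "e = e0 / (2 * (norm u + norm v + 1))"
  have e: "e > 0" using e0 by (simp add: e_def add_nonneg_pos)
  have in\<Omega>: "x + s *\<^sub>R u + t *\<^sub>R v \<in> \<Omega>" if "\<bar>s\<bar> \<le> e" "\<bar>t\<bar> \<le> e" for s t
  proof -
    have "norm (s *\<^sub>R u + t *\<^sub>R v) \<le> \<bar>s\<bar> * norm u + \<bar>t\<bar> * norm v" using norm_triangle_ineq[of "s *\<^sub>R u" "t *\<^sub>R v"] by simp
    also have "\<dots> \<le> e * norm u + e * norm v" using that by (intro add_mono mult_right_mono) auto
    also have "\<dots> \<le> e * (norm u + norm v + 1)" using e by (simp add: algebra_simps)
    also have "\<dots> = e0 / 2"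
    proof -
      have "norm u + norm v + 1 > 0" by (simp add: add_nonneg_pos)
      then have "e * (norm u + norm v + 1) = e0 * ((norm u + norm v + 1) / (2 * (norm u + norm v + 1)))" by (simp only: e_def times_divide_eq_left times_divide_eq_right)
      also have "(norm u + norm v + 1) / (2 * (norm u + norm v + 1)) = 1 / 2"
        using \<open>norm u + norm v + 1 > 0\<close> by (subst nonzero_divide_mult_cancel_right) auto
      finally show ?thesis by simp
    qed
    finally have "norm (s *\<^sub>R u + t *\<^sub>R v) < e0" using e0 by simp
    moreover have "dist x (x + w) = norm w" for w :: 'a by (simp add: dist_norm)
    ultimately have "x + (s *\<^sub>R u + t *\<^sub>R v) \<in> ball x e0" by (simp only: mem_ball)
    then show ?thesis using e0 by (auto simp: add.assoc)
  qed
  have ftc: "integral {0..t} (\<lambda>\<tau>. F v (x + s *\<^sub>R u + \<tau> *\<^sub>R v)) = f (x + s *\<^sub>R u + t *\<^sub>R v) - f (x + s *\<^sub>R u)"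
    if "\<bar>s\<bar> \<le> e" "0 \<le> t" "t \<le> e" for s t
  proof -
    have "((\<lambda>\<tau>. F v (x + s *\<^sub>R u + \<tau> *\<^sub>R v)) has_integral
       (f (x + s *\<^sub>R u + t *\<^sub>R v) - f (x + s *\<^sub>R u + 0 *\<^sub>R v))) {0..t}"
    proof (rule fundamental_theorem_of_calculus[OF that(2)])
      fix \<tau> assume "\<tau> \<in> {0..t}"
      then have i: "x + s *\<^sub>R u + \<tau> *\<^sub>R v \<in> \<Omega>" using that by (intro in\<Omega>) auto
      have "((\<lambda>\<tau>. f (x + s *\<^sub>R u + \<tau> *\<^sub>R v)) has_derivative (\<lambda>h. F (h *\<^sub>R v) (x + s *\<^sub>R u + \<tau> *\<^sub>R v))) (at \<tau> within {0..t})"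
        by (rule has_derivative_compose[where g="f" and f="\<lambda>\<tau>. x + s *\<^sub>R u + \<tau> *\<^sub>R v" and f'="\<lambda>h. h *\<^sub>R v" and g'="\<lambda>w. F w (x + s *\<^sub>R u + \<tau> *\<^sub>R v)"])
          (use der[OF i] in \<open>auto intro!: derivative_eq_intros\<close>)
      then show "((\<lambda>\<tau>. f (x + s *\<^sub>R u + \<tau> *\<^sub>R v)) has_vector_derivative F v (x + s *\<^sub>R u + \<tau> *\<^sub>R v)) (at \<tau> within {0..t})"
        using lin[OF i] by (simp add: has_vector_derivative_def)
    qed
    then show ?thesis by (simp add: integral_unique)
  qed
  have A: "F u (x + t *\<^sub>R v) - F u x = integral {0..t} (\<lambda>\<tau>. frechet_derivative (F v) (at (x + \<tau> *\<^sub>R v)) u)"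
    if t: "0 \<le> t" "t \<le> e" for t
  proof -
    let ?G = "\<lambda>s. integral (cbox 0 t) (\<lambda>\<tau>. F v (x + s *\<^sub>R u + \<tau> *\<^sub>R v))"
    have "(?G has_vector_derivative integral (cbox 0 t) (\<lambda>\<tau>. frechet_derivative (F v) (at (x + 0 *\<^sub>R u + \<tau> *\<^sub>R v)) u)) (at 0 within {-e<..<e})"
    proof (rule leibniz_rule_vector_derivative)
      fix s \<tau> assume s: "s \<in> {-e<..<e}" "\<tau> \<in> cbox 0 t"
      then have i: "x + s *\<^sub>R u + \<tau> *\<^sub>R v \<in> \<Omega>" using t by (intro in\<Omega>) auto
      have "((\<lambda>s. F v (x + s *\<^sub>R u + \<tau> *\<^sub>R v)) has_derivative (\<lambda>h. frechet_derivative (F v) (at (x + s *\<^sub>R u + \<tau> *\<^sub>R v)) (h *\<^sub>R u))) (at s within {-e<..<e})"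
        by (rule has_derivative_compose[where g="F v" and f="\<lambda>s. x + s *\<^sub>R u + \<tau> *\<^sub>R v" and f'="\<lambda>h. h *\<^sub>R u" and g'="frechet_derivative (F v) (at (x + s *\<^sub>R u + \<tau> *\<^sub>R v))"])
          (use derF[OF i] in \<open>auto intro!: derivative_eq_intros\<close>)
      then show "((\<lambda>s. F v (x + s *\<^sub>R u + \<tau> *\<^sub>R v)) has_vector_derivative frechet_derivative (F v) (at (x + s *\<^sub>R u + \<tau> *\<^sub>R v)) u) (at s within {-e<..<e})"
        using linF[OF i] by (simp add: has_vector_derivative_def)
    next
      fix s assume s: "s \<in> {-e<..<e}"
      show "(\<lambda>\<tau>. F v (x + s *\<^sub>R u + \<tau> *\<^sub>R v)) integrable_on cbox 0 t"
        by (rule integrable_continuous, rule continuous_on_compose2[OF contF])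
           (use s t in \<open>auto intro!: continuous_intros in\<Omega>\<close>)
    next
      show "continuous_on ({-e<..<e} \<times> cbox 0 t) (\<lambda>(s, \<tau>). frechet_derivative (F v) (at (x + s *\<^sub>R u + \<tau> *\<^sub>R v)) u)"
        unfolding case_prod_unfold
        by (rule continuous_on_compose2[OF contDF]) (use t in \<open>auto intro!: continuous_intros in\<Omega>\<close>)
    qed (use e in auto)
    then have 1: "(?G has_vector_derivative integral {0..t} (\<lambda>\<tau>. frechet_derivative (F v) (at (x + \<tau> *\<^sub>R v)) u)) (at 0)"
      using e by (simp add: at_within_open[of _ "{-e<..<e}"])
    have fd: "((\<lambda>s. f (x + s *\<^sub>R u + \<tau> *\<^sub>R v)) has_vector_derivative F u (x + \<tau> *\<^sub>R v)) (at 0)" if "\<bar>\<tau>\<bar> \<le> e" for \<tau>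
    proof -
      have i: "x + 0 *\<^sub>R u + \<tau> *\<^sub>R v \<in> \<Omega>" using that e by (intro in\<Omega>) auto
      have "((\<lambda>s. f (x + s *\<^sub>R u + \<tau> *\<^sub>R v)) has_derivative (\<lambda>h. F (h *\<^sub>R u) (x + 0 *\<^sub>R u + \<tau> *\<^sub>R v))) (at 0)"
        by (rule has_derivative_compose[where g="f" and f="\<lambda>s. x + s *\<^sub>R u + \<tau> *\<^sub>R v" and f'="\<lambda>h. h *\<^sub>R u" and g'="\<lambda>w. F w (x + 0 *\<^sub>R u + \<tau> *\<^sub>R v)"])
          (use der[OF i] in \<open>auto intro!: derivative_eq_intros\<close>)
      then show ?thesis using lin[OF i] by (simp add: has_vector_derivative_def)
    qed
    have "((\<lambda>s. f (x + s *\<^sub>R u + t *\<^sub>R v) - f (x + s *\<^sub>R u)) has_vector_derivative (F u (x + t *\<^sub>R v) - F u x)) (at 0)"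
      using has_vector_derivative_diff[OF fd[of t] fd[of 0]] t e by simp
    then have "(?G has_vector_derivative (F u (x + t *\<^sub>R v) - F u x)) (at 0)"
      by (rule has_vector_derivative_transform_within_open[of _ _ _ "{-e<..<e}"]) (use e t ftc in auto)
    then show ?thesis using 1 vector_derivative_unique_at by blast
  qed
  \<comment> \<open>Only \<open>t \<ge> 0\<close> occurs in the identity \<open>A\<close>, so the
    second differentiation is one-sided; uniqueness of derivatives on an interval still identifies
    both sides.\<close>
  have "((\<lambda>t. integral {0..t} (\<lambda>\<tau>. frechet_derivative (F v) (at (x + \<tau> *\<^sub>R v)) u)) has_vector_derivative
     frechet_derivative (F v) (at (x + 0 *\<^sub>R v)) u) (at 0 within {0..e})"
  proof (rule integral_has_vector_derivative)
    show "continuous_on {0..e} (\<lambda>\<tau>. frechet_derivative (F v) (at (x + \<tau> *\<^sub>R v)) u)"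
      by (rule continuous_on_compose2[OF contDF]) (use in\<Omega>[of 0] e in \<open>auto intro!: continuous_intros\<close>)
  qed (use e in auto)
  then have B: "((\<lambda>t. F u (x + t *\<^sub>R v) - F u x) has_vector_derivative frechet_derivative (F v) (at x) u) (at 0 within {0..e})"
    using has_vector_derivative_transform[of 0 "{0..e}" "\<lambda>t. F u (x + t *\<^sub>R v) - F u x"] A e by simp
  have "((\<lambda>t. F u (x + t *\<^sub>R v)) has_derivative (\<lambda>h. frechet_derivative (F u) (at (x + 0 *\<^sub>R v)) (h *\<^sub>R v))) (at 0 within {0..e})"
    by (rule has_derivative_compose[where g="F u" and f="\<lambda>t. x + t *\<^sub>R v" and f'="\<lambda>h. h *\<^sub>R v" and g'="frechet_derivative (F u) (at (x + 0 *\<^sub>R v))"])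
          (use derF[of x u] x in \<open>auto intro!: derivative_eq_intros\<close>)
  then have "((\<lambda>t. F u (x + t *\<^sub>R v)) has_vector_derivative frechet_derivative (F u) (at x) v) (at 0 within {0..e})"
    using linF[OF x] by (simp add: has_vector_derivative_def)
  then have "((\<lambda>t. F u (x + t *\<^sub>R v) - F u x) has_vector_derivative frechet_derivative (F u) (at x) v - 0) (at 0 within {0..e})"
    by (intro has_vector_derivative_diff) auto
  then have "frechet_derivative (F u) (at x) v - 0 = frechet_derivative (F v) (at x) u"
    using B e by (metis vector_derivative_unique_within_closed_interval atLeastAtMost_iff cbox_interval less_eq_real_def)
  then show ?thesis by (simp add: F_def)
qed

text \<open>The positive and negative parts of \<open>D\<close> are densities of two measures. They
  agree on boxes, which are stable under intersection and generate the Borel sets, so the measures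
  are equal, and with them the densities almost everywhere.\<close>

lemma AE_zero_if_box_integrals_zero:
  fixes D :: "'a::euclidean_space \<Rightarrow> real"
  assumes D: "integrable lborel D" and 0: "\<And>a b. (LINT y:box a b|lborel. D y) = 0"
  shows "AE y in lborel. D y = 0"
proof -
  have [measurable]: "D \<in> borel_measurable borel" using D borel_measurable_integrable by force
  let ?M = "density lborel (\<lambda>x. ennreal (D x))" and ?N = "density lborel (\<lambda>x. ennreal (- D x))"
  have fin: "(\<integral>\<^sup>+x. ennreal (D x) \<partial>lborel) \<noteq> \<infinity>" "(\<integral>\<^sup>+x. ennreal (- D x) \<partial>lborel) \<noteq> \<infinity>"
    using D by (auto simp: real_integrable_def)
  have eqI: "P = Q" if "0 = enn2real P - enn2real Q" "P \<noteq> \<infinity>" "Q \<noteq> \<infinity>" for P Q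
    using that by (cases P; cases Q) auto
  have "?M = ?N"
  proof (rule measure_eqI_generator_eq)
    let ?E = "range (\<lambda>(a, b). box a b::'a set)"
    show "Int_stable ?E" by (auto simp: Int_stable_def box_Int_box)
    show "?E \<subseteq> Pow UNIV" "sets ?M = sigma_sets UNIV ?E" "sets ?N = sigma_sets UNIV ?E"
      by (simp_all add: borel_eq_box)
    let ?A = "\<lambda>n::nat. box (- (real n *\<^sub>R One)) (real n *\<^sub>R One) :: 'a set"
    show "range ?A \<subseteq> ?E" "(\<Union>i. ?A i) = UNIV"
      unfolding UN_box_eq_UNIV by auto
    show "emeasure ?M (?A i) \<noteq> \<infinity>" for i
    proof -
      have "emeasure ?M (?A i) \<le> (\<integral>\<^sup>+x. ennreal (D x) \<partial>lborel)"
        by (subst emeasure_density) (auto intro!: nn_integral_mono simp: indicator_def)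
      then show ?thesis using fin(1) by (auto simp: top_unique)
    qed
    fix X assume "X \<in> ?E"
    then obtain a b where X: "X = box a b" by auto
    let ?D = "\<lambda>y. indicator (box a b) y *\<^sub>R D y"
    have i: "integrable lborel ?D" using D by (rule integrable_mult_indicator[rotated]) auto
    have e: "emeasure ?M X = (\<integral>\<^sup>+y. ennreal (?D y) \<partial>lborel)" "emeasure ?N X = (\<integral>\<^sup>+y. ennreal (- ?D y) \<partial>lborel)"
      by (auto simp: X emeasure_density indicator_def intro!: nn_integral_cong)
    have "0 = enn2real (\<integral>\<^sup>+y. ennreal (?D y) \<partial>lborel) - enn2real (\<integral>\<^sup>+y. ennreal (- ?D y) \<partial>lborel)"
      using real_lebesgue_integral_def[OF i] 0[of a b] by (simp add: set_lebesgue_integral_def)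
    moreover have "(\<integral>\<^sup>+y. ennreal (?D y) \<partial>lborel) \<noteq> \<infinity>" "(\<integral>\<^sup>+y. ennreal (- ?D y) \<partial>lborel) \<noteq> \<infinity>"
      using i by (auto simp: real_integrable_def)
    ultimately show "emeasure ?M X = emeasure ?N X"
      unfolding e by (rule eqI)
  qed
  then have "AE x in lborel. ennreal (D x) = ennreal (- D x)"
    using finite_density_unique[of "\<lambda>x. ennreal (D x)" lborel "\<lambda>x. ennreal (- D x)"] fin by auto
  then show ?thesis
  proof eventually_elim
    case (elim x)
    then show ?case
      by (cases "D x \<ge> 0") (auto simp: ennreal_neg ennreal_eq_zero_iff)
  qed
qed

text \<open>Smooth functions between 0 and the indicator of the open box, converging to it as
  \<open>k\<close> tends to infinity: for positive \<open>t\<close> the values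
  \<open>flatexp 0 (real k * t)\<close> tend to 1, for other \<open>t\<close> they are 0.\<close>

definition box_bump :: "real ^ 'n \<Rightarrow> real ^ 'n \<Rightarrow> nat \<Rightarrow> real ^ 'n::finite \<Rightarrow> real" where
  "box_bump a b k y = (\<Prod>i\<in>UNIV. flatexp 0 (real k * (y $ i - a $ i)) * flatexp 0 (real k * (b $ i - y $ i)))"

lemma smooth_box_bump: "smooth_on UNIV (box_bump a b k)"
proof -
  have "C_on m UNIV (box_bump a b k)" for m
    unfolding box_bump_def
    by (intro C_on_prod C_on_mult C_on_compose_real[OF _ _ _ C_on_flat] C_on_const C_on_diff
        C_on_bounded_linear bounded_linear_vec_nth) auto
  then show ?thesis by (simp add: smooth_on_open)
qed

lemma flatexp_0_bounds: "0 \<le> flatexp 0 t" "flatexp 0 t \<le> 1"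
  by (auto simp: flatexp_def)

lemma box_bump_bounds: "0 \<le> box_bump a b k y" "box_bump a b k y \<le> 1"
  unfolding box_bump_def by (auto intro!: prod_nonneg prod_le_1 mult_le_one flatexp_0_bounds mult_nonneg_nonneg)

lemma box_bump_outside: "y \<notin> box a b \<Longrightarrow> box_bump a b k y = 0"
  unfolding box_bump_def mem_box_cart
  by (auto simp: flatexp_def not_less mult_le_0_iff zero_less_mult_iff)

lemma box_bump_tendsto:
  fixes y :: "real ^ 'n::finite"
  shows "(\<lambda>k. box_bump a b k y) \<longlonglongrightarrow> indicator (box a b) y"
proof (cases "y \<in> box a b")
  case True
  have 1: "(\<lambda>k. flatexp 0 (real k * t)) \<longlonglongrightarrow> 1" if "t > 0" for t
  proof -
    have "(\<lambda>k. exp (- inverse (real k * t))) \<longlonglongrightarrow> exp (- 0)"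
      using that by (intro tendsto_intros tendsto_inverse_0_at_top filterlim_at_top_mult_tendsto_pos[where c=t]
          filterlim_tendsto_pos_mult_at_top[where c=t] filterlim_real_sequentially) (auto simp: mult.commute intro: filterlim_at_top_mult_at_top)
    moreover have "\<forall>\<^sub>F k in sequentially. exp (- inverse (real k * t)) = flatexp 0 (real k * t)"
      using eventually_gt_at_top[of 0] by eventually_elim (use that in \<open>auto simp: flatexp_def mult_le_0_iff\<close>)
    ultimately show ?thesis using Lim_transform_eventually by fastforce
  qed
  have "(\<lambda>k. box_bump a b k y) \<longlonglongrightarrow> (\<Prod>i\<in>(UNIV :: 'n set). 1 * 1)"
    unfolding box_bump_def using True by (intro tendsto_prod tendsto_mult 1) (auto simp: mem_box_cart)
  then show ?thesis using True by simp
qed (simp add: box_bump_outside)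

text \<open>By dominated convergence the bumps may be replaced by indicators, so \<open>h\<close>
  integrates to zero over every open box whose closed box lies in \<open>\<Omega>\<close>. An open
  set is a countable union of closed boxes, which turns this into a statement almost
  everywhere.\<close>

lemma fundamental_lemma_of_calculus_of_variations:
  fixes h :: "real ^ 'n::finite \<Rightarrow> real"
  assumes "open \<Omega>" and int: "\<And>K. compact K \<Longrightarrow> K \<subseteq> \<Omega> \<Longrightarrow> set_integrable lborel K h"
    and test: "\<And>\<eta> K. smooth_on UNIV \<eta> \<Longrightarrow> compact K \<Longrightarrow> K \<subseteq> \<Omega> \<Longrightarrow> (\<And>y. y \<notin> K \<Longrightarrow> \<eta> y = 0) \<Longrightarrow>
      (LINT y:K|lborel. h y * \<eta> y) = 0"
  shows "AE y in lborel. y \<in> \<Omega> \<longrightarrow> h y = 0"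
proof -
  have box0: "(LINT y:box a b|lborel. h y) = 0" if ab: "cbox a b \<subseteq> \<Omega>" for a b
  proof -
    have i: "integrable lborel (\<lambda>y. indicator (cbox a b) y *\<^sub>R h y)"
      using int[OF compact_cbox ab] by (simp add: set_integrable_def)
    have "(\<lambda>k. LINT y|lborel. indicator (cbox a b) y *\<^sub>R h y * box_bump a b k y)
       \<longlonglongrightarrow> (LINT y|lborel. indicator (cbox a b) y *\<^sub>R h y * indicator (box a b) y)"
    proof (rule integral_dominated_convergence[where w="\<lambda>y. \<bar>indicator (cbox a b) y *\<^sub>R h y\<bar>"])
      show "AE y in lborel. (\<lambda>k. indicator (cbox a b) y *\<^sub>R h y * box_bump a b k y) \<longlonglongrightarrow> indicator (cbox a b) y *\<^sub>R h y * indicator (box a b) y"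
        by (intro AE_I2 tendsto_mult tendsto_const box_bump_tendsto)
      show "AE y in lborel. norm (indicator (cbox a b) y *\<^sub>R h y * box_bump a b k y) \<le> \<bar>indicator (cbox a b) y *\<^sub>R h y\<bar>" for k
        using box_bump_bounds[of a b k] by (intro AE_I2) (auto simp: abs_mult mult_left_le)
      have "box_bump a b k \<in> borel_measurable borel" for k
        using smooth_box_bump[of a b k] C_on_imp_continuous_on borel_measurable_continuous_onI smooth_on_open by blast
      then show "(\<lambda>y. indicator (cbox a b) y *\<^sub>R h y * box_bump a b k y) \<in> borel_measurable lborel" for k
        by (intro borel_measurable_times borel_measurable_integrable[OF i]) auto
      show "(\<lambda>y. indicator (cbox a b) y *\<^sub>R h y * indicator (box a b) y) \<in> borel_measurable lborel"
        by (intro borel_measurable_times borel_measurable_integrable[OF i]) auto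
      show "integrable lborel (\<lambda>y. \<bar>indicator (cbox a b) y *\<^sub>R h y\<bar>)" using integrable_abs[OF i] .
    qed
    moreover have "(LINT y|lborel. indicator (cbox a b) y *\<^sub>R h y * box_bump a b k y) = 0" for k
      using test[OF smooth_box_bump[of a b k] compact_cbox ab] box_bump_outside[of _ a b k] box_subset_cbox[of a b]
      by (auto simp: set_lebesgue_integral_def mult.assoc)
    moreover have "(\<lambda>y. indicator (cbox a b) y *\<^sub>R h y * indicator (box a b) y) = (\<lambda>y. indicator (box a b) y *\<^sub>R h y)"
      using box_subset_cbox[of a b] by (auto simp: fun_eq_iff indicator_def)
    ultimately show ?thesis using LIMSEQ_unique[OF _ tendsto_const] by (simp add: set_lebesgue_integral_def)
  qed
  have AE_cbox: "AE y in lborel. y \<in> cbox a b \<longrightarrow> h y = 0" if ab: "cbox a b \<subseteq> \<Omega>" for a b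
  proof -
    have "AE y in lborel. indicator (box a b) y *\<^sub>R h y = 0"
    proof (rule AE_zero_if_box_integrals_zero)
      show "integrable lborel (\<lambda>y. indicator (box a b) y *\<^sub>R h y)"
        using set_integrable_subset[OF int[OF compact_cbox ab] _ box_subset_cbox] by (simp add: set_integrable_def)
      fix c d
      \<comment> \<open>Open and closed boxes with the same corners are needed together: the
        integral is over an open box, while \<open>box0\<close> asks for the closed one to lie in
        \<open>\<Omega>\<close>.\<close>
      obtain a' b' where a'b': "box a' b' = box a b \<inter> box c d" "cbox a' b' = cbox a b \<inter> cbox c d"
        by (rule that[OF box_Int_box[symmetric] Int_interval[symmetric]])
      have "(LINT y:box c d|lborel. indicator (box a b) y *\<^sub>R h y) = (LINT y:box a' b'|lborel. h y)"
        unfolding set_lebesgue_integral_def a'b' by (intro Bochner_Integration.integral_cong) (auto simp: indicator_def)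
      also have "\<dots> = 0" using a'b' ab by (intro box0) auto
      finally show "(LINT y:box c d|lborel. indicator (box a b) y *\<^sub>R h y) = 0" .
    qed
    moreover have "AE y in lborel. y \<notin> cbox a b - box a b"
    proof (rule AE_not_in)
      have "emeasure lborel (cbox a b - box a b) = 0"
        using box_subset_cbox[of a b]
        by (subst emeasure_Diff) (auto simp: emeasure_lborel_cbox_eq emeasure_lborel_box_eq)
      then show "cbox a b - box a b \<in> null_sets lborel" by auto
    qed
    ultimately show ?thesis by eventually_elim (auto simp: indicator_def split: if_splits)
  qed
  obtain \<D> where D: "countable \<D>" "\<D> \<subseteq> Pow \<Omega>" "\<And>X. X \<in> \<D> \<Longrightarrow> \<exists>a b. X = cbox a b" "\<Union>\<D> = \<Omega>"
    using open_countable_Union_open_cbox[OF assms(1)] by metis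
  have "AE y in lborel. \<forall>X\<in>\<D>. y \<in> X \<longrightarrow> h y = 0"
  proof (subst AE_ball_countable[OF D(1)], rule ballI)
    fix X assume "X \<in> \<D>"
    then show "AE y in lborel. y \<in> X \<longrightarrow> h y = 0" using D(2,3) AE_cbox by blast
  qed
  then show ?thesis by eventually_elim (use D(4) in auto)
qed

section \<open>Sobolev and Poincare inequalities\<close>

lemma powr_tangent_line:
  fixes c y q :: real
  assumes "q \<ge> 1" "c > 0" "y \<ge> 0"
  shows "c powr q + q * c powr (q - 1) * (y - c) \<le> y powr q"
proof (cases "y = 0")
  case True
  have "c powr (q - 1) * c = c powr q" using assms by (simp add: powr_mult_base mult.commute)
  then have "c powr q + q * c powr (q - 1) * (y - c) = (1 - q) * c powr q"
    using True by (simp add: algebra_simps)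
  also have "\<dots> \<le> 0" using assms by (simp add: mult_le_0_iff)
  finally show ?thesis using True by simp
next
  case False
  have "((\<lambda>x. x powr q) has_real_derivative q * c powr (q - 1)) (at c within {0<..})"
    using assms by (auto intro!: derivative_eq_intros)
  then have "y powr q - c powr q \<ge> q * c powr (q - 1) * (y - c)"
    using assms False by (intro convex_on_imp_above_tangent[OF powr_convex[OF assms(1)]]) (auto simp: interior_open)
  then show ?thesis by simp
qed

text \<open>The tangent of \<open>t powr q\<close> at the mean lies below the graph, and integrating
  it leaves only the constant term. The extended integral on the right turns integrability of the
  power into a case distinction.\<close>

lemma (in prob_space) jensen_powr:
  fixes f :: "'a \<Rightarrow> real"
  assumes f: "integrable M f" and nonneg: "AE x in M. 0 \<le> f x" and q: "q \<ge> 1"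
  shows "ennreal ((\<integral>x. f x \<partial>M) powr q) \<le> (\<integral>\<^sup>+x. ennreal (f x powr q) \<partial>M)"
proof (cases "(\<integral>\<^sup>+x. ennreal (f x powr q) \<partial>M) = \<infinity>")
  case False
  have [measurable]: "f \<in> borel_measurable M" using f by simp
  have i: "integrable M (\<lambda>x. f x powr q)"
    using False by (intro integrableI_nonneg) (auto simp: less_top)
  define c where "c = (\<integral>x. f x \<partial>M)"
  have c0: "c \<ge> 0" unfolding c_def using nonneg by (rule integral_nonneg_AE)
  have "c powr q \<le> (\<integral>x. f x powr q \<partial>M)"
  proof (cases "c = 0")
    case False
    have "c powr q = (\<integral>x. c powr q + q * c powr (q - 1) * (f x - c) \<partial>M)"
      using f by (simp add: prob_space c_def)
    also have "\<dots> \<le> (\<integral>x. f x powr q \<partial>M)"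
    proof (rule integral_mono_AE)
      show "AE x in M. c powr q + q * c powr (q - 1) * (f x - c) \<le> f x powr q"
        using nonneg by eventually_elim (use powr_tangent_line q c0 False in auto)
    qed (use f i in auto)
    finally show ?thesis .
  qed (auto intro!: integral_nonneg_AE)
  then show ?thesis unfolding c_def by (subst nn_integral_eq_integral[OF i]) auto
qed simp

section \<open>Averages over the unit interval\<close>

abbreviation unit_uniform :: "real measure" where
  "unit_uniform \<equiv> uniform_measure lborel {0..1}"

lemma prob_space_unit_uniform: "prob_space unit_uniform"
  by (rule prob_space_uniform_measure) auto

lemma nn_integral_unit_uniform:
  "f \<in> borel_measurable borel \<Longrightarrow> (\<integral>\<^sup>+t. f t \<partial>unit_uniform) = (\<integral>\<^sup>+t. f t * indicator {0..1} t \<partial>lborel)"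
  by (subst nn_integral_uniform_measure) (auto simp: ennreal_divide_self divide_ennreal_def)

lemma AE_uniform_measure_in:
  assumes "A \<in> sets M" shows "AE x in uniform_measure M A. x \<in> A"
  by (rule AE_uniform_measureI[OF assms]) auto

text \<open>The value 0 is excluded because negative powers of \<open>t\<close> occur below.\<close>

lemma AE_unit_uniform: "AE t in unit_uniform. 0 < t \<and> t \<le> 1"
proof (rule AE_uniform_measureI)
  have "AE t in lborel. t \<noteq> (0::real)" by (rule AE_lborel_singleton)
  then show "AE t in lborel. t \<in> {0..1} \<longrightarrow> 0 < t \<and> t \<le> (1::real)" by eventually_elim auto
qed auto

lemma nn_integral_powr_unit_uniform:
  assumes "\<gamma> > -1"
  shows "(\<integral>\<^sup>+t. ennreal (t powr \<gamma>) \<partial>unit_uniform) = ennreal (1 / (\<gamma> + 1))"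
proof -
  have "(\<integral>\<^sup>+t. ennreal (t powr \<gamma>) * indicator {0..1} t \<partial>lborel) = ennreal (1 / (\<gamma> + 1))"
    using has_integral_powr_from_0[OF assms, of 1] by (intro nn_integral_has_integral_lebesgue') auto
  then show ?thesis by (subst nn_integral_unit_uniform) auto
qed

text \<open>Jensen's inequality for the probability density
  \<open>(1 - \<beta>) * t powr (-\<beta>)\<close>, applied to \<open>t powr \<beta> * f t\<close>.
  Compared with the plain inequality it gains the weight \<open>t powr (\<beta> * (q - 1))\<close>,
  which tames the singularity at \<open>t = 0\<close> in the Sobolev inequality.\<close>

lemma weighted_jensen_powr:
  fixes f :: "real \<Rightarrow> real"
  assumes f[measurable]: "f \<in> borel_measurable borel" and fB: "\<And>t. 0 \<le> f t" "\<And>t. f t \<le> B"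
    and q: "q \<ge> 1" and \<beta>: "0 < \<beta>" "\<beta> < 1"
  shows "ennreal ((\<integral>t. f t \<partial>unit_uniform) powr q)
    \<le> ennreal ((1 - \<beta>) powr (1 - q)) * (\<integral>\<^sup>+t. ennreal (t powr (\<beta> * (q - 1)) * f t powr q) \<partial>unit_uniform)"
proof -
  interpret W: prob_space unit_uniform by (rule prob_space_unit_uniform)
  have W_sets[measurable_cong]: "sets unit_uniform = sets borel" by simp
  define P where "P = density unit_uniform (\<lambda>t. ennreal ((1 - \<beta>) * t powr (-\<beta>)))"
  have P_sets[measurable_cong]: "sets P = sets borel" by (simp add: P_def)
  have nnP: "(\<integral>\<^sup>+t. h t \<partial>P) = (\<integral>\<^sup>+t. ennreal ((1 - \<beta>) * t powr (-\<beta>)) * h t \<partial>unit_uniform)"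
    if [measurable]: "h \<in> borel_measurable borel" for h
    unfolding P_def by (rule nn_integral_density) auto
  have "emeasure P (space P) = (\<integral>\<^sup>+t. 1 \<partial>P)" by simp
  also have "\<dots> = (\<integral>\<^sup>+t. ennreal (1 - \<beta>) * ennreal (t powr (-\<beta>)) \<partial>unit_uniform)"
    by (subst nnP) (use \<beta> in \<open>auto simp: ennreal_mult\<close>)
  also have "\<dots> = ennreal (1 - \<beta>) * ennreal (1 / (- \<beta> + 1))"
    using \<beta> by (subst nn_integral_cmult) (auto simp: nn_integral_powr_unit_uniform)
  also have "\<dots> = 1" using \<beta> by (simp add: ennreal_mult[symmetric])
  finally interpret P: prob_space P by (rule prob_spaceI)
  \<comment> \<open>Clamping \<open>t\<close> to the unit interval changes nothing almost everywhere
    but keeps \<open>?g\<close> bounded by \<open>B\<close> on the whole line.\<close>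
  let ?g = "\<lambda>t. max 0 (min 1 t) powr \<beta> * f t"
  have [measurable]: "?g \<in> borel_measurable borel" by measurable
  have gB: "0 \<le> ?g t" "?g t \<le> B" for t
  proof -
    have "max 0 (min 1 t) powr \<beta> \<le> 1" using \<beta> by (intro powr_le1) auto
    then show "?g t \<le> B" using fB[of t] by (meson mult_left_le_one_le order_trans powr_ge_zero)
  qed (use fB in auto)
  have gint: "integrable P ?g"
    by (rule P.integrable_const_bound[where B=B]) (use gB in \<open>auto simp: measurable_cong_sets[OF P_sets refl]\<close>)
  have "ennreal (\<integral>t. ?g t \<partial>P) = (\<integral>\<^sup>+t. ennreal (?g t) \<partial>P)"
    by (rule nn_integral_eq_integral[symmetric, OF gint]) (use gB in auto)
  also have "\<dots> = (\<integral>\<^sup>+t. ennreal (1 - \<beta>) * ennreal (f t) \<partial>unit_uniform)"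
    unfolding nnP[of "\<lambda>t. ennreal (?g t)", simplified]
  proof (rule nn_integral_cong_AE)
    show "AE t in unit_uniform. ennreal ((1 - \<beta>) * t powr (-\<beta>)) * ennreal (?g t) = ennreal (1 - \<beta>) * ennreal (f t)"
      using AE_unit_uniform
    proof eventually_elim
      case (elim t)
      then have "t powr (-\<beta>) * t powr \<beta> = 1" by (simp add: powr_minus field_simps)
      then have "(1 - \<beta>) * t powr (-\<beta>) * ?g t = (1 - \<beta>) * f t" using elim by (simp add: algebra_simps)
      then show ?case using \<beta> fB gB by (simp add: ennreal_mult[symmetric] del: ennreal_mult')
    qed
  qed
  also have "\<dots> = ennreal (1 - \<beta>) * (\<integral>\<^sup>+t. ennreal (f t) \<partial>unit_uniform)" by (rule nn_integral_cmult) auto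
  also have "(\<integral>\<^sup>+t. ennreal (f t) \<partial>unit_uniform) = ennreal (\<integral>t. f t \<partial>unit_uniform)"
    by (rule nn_integral_eq_integral[OF W.integrable_const_bound[where B=B]]) (use fB in auto)
  finally have "ennreal (\<integral>t. ?g t \<partial>P) = ennreal ((1 - \<beta>) * (\<integral>t. f t \<partial>unit_uniform))"
    using \<beta> fB by (simp add: ennreal_mult)
  moreover have nn: "0 \<le> (\<integral>t. ?g t \<partial>P)" "0 \<le> (\<integral>t. f t \<partial>unit_uniform)"
    using gB fB by (auto intro!: integral_nonneg_AE)
  ultimately have eq: "(\<integral>t. ?g t \<partial>P) = (1 - \<beta>) * (\<integral>t. f t \<partial>unit_uniform)"
    using \<beta> by (simp add: ennreal_inj)
  have "ennreal ((\<integral>t. f t \<partial>unit_uniform) powr q) = ennreal ((1 - \<beta>) powr (-q)) * ennreal ((\<integral>t. ?g t \<partial>P) powr q)"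
    unfolding eq using \<beta> nn by (subst powr_mult) (auto simp: ennreal_mult[symmetric] powr_minus field_simps)
  also have "ennreal ((\<integral>t. ?g t \<partial>P) powr q) \<le> (\<integral>\<^sup>+t. ennreal (?g t powr q) \<partial>P)"
    by (rule P.jensen_powr[OF gint _ q]) (use gB in auto)
  also have "(\<integral>\<^sup>+t. ennreal (?g t powr q) \<partial>P) = (\<integral>\<^sup>+t. ennreal (1 - \<beta>) * ennreal (t powr (\<beta> * (q - 1)) * f t powr q) \<partial>unit_uniform)"
    unfolding nnP[of "\<lambda>t. ennreal (?g t powr q)", simplified]
  proof (rule nn_integral_cong_AE)
    show "AE t in unit_uniform. ennreal ((1 - \<beta>) * t powr (-\<beta>)) * ennreal (?g t powr q) = ennreal (1 - \<beta>) * ennreal (t powr (\<beta> * (q - 1)) * f t powr q)"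
      using AE_unit_uniform
    proof eventually_elim
      case (elim t)
      then have "t powr (-\<beta>) * (t powr \<beta> * f t) powr q = t powr (-\<beta>) * (t powr (\<beta> * q) * f t powr q)"
        using fB by (simp add: powr_mult powr_powr)
      also have "\<dots> = t powr (\<beta> * (q - 1)) * f t powr q"
        using elim by (simp add: powr_add[symmetric] algebra_simps)
      finally have "(1 - \<beta>) * t powr (-\<beta>) * ?g t powr q = (1 - \<beta>) * (t powr (\<beta> * (q - 1)) * f t powr q)"
        using elim by (simp add: mult.assoc)
      then show ?case using \<beta> by (simp add: ennreal_mult[symmetric] del: ennreal_mult')
    qed
  qed
  also have "\<dots> = ennreal (1 - \<beta>) * (\<integral>\<^sup>+t. ennreal (t powr (\<beta> * (q - 1)) * f t powr q) \<partial>unit_uniform)"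
    by (rule nn_integral_cmult) auto
  also have "ennreal ((1 - \<beta>) powr (-q)) * (ennreal (1 - \<beta>) * (\<integral>\<^sup>+t. ennreal (t powr (\<beta> * (q - 1)) * f t powr q) \<partial>unit_uniform))
    = ennreal ((1 - \<beta>) powr (1 - q)) * (\<integral>\<^sup>+t. ennreal (t powr (\<beta> * (q - 1)) * f t powr q) \<partial>unit_uniform)"
    using \<beta> by (simp add: mult.assoc[symmetric] ennreal_mult[symmetric] powr_mult_base mult.commute)
  finally show ?thesis by (simp add: mult_left_mono)
qed

section \<open>Averages over convex domains\<close>

lemma lborel_affine_vec:
  fixes c :: "'n::finite \<Rightarrow> real" and \<tau> :: "real ^ 'n"
  assumes "\<And>j. c j \<noteq> 0"
  shows "lborel = density (distr lborel borel (\<lambda>z. \<chi> j. \<tau> $ j + c j * z $ j)) (\<lambda>_. ennreal (\<Prod>j\<in>UNIV. \<bar>c j\<bar>))"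
proof -
  let ?c = "\<lambda>b. (\<chi> i. c i) \<bullet> b"
  have b: "b \<in> Basis \<longleftrightarrow> (\<exists>i. b = axis i 1)" for b :: "real ^ 'n" by (auto simp: Basis_vec_def)
  have c: "?c b \<noteq> 0" if "b \<in> Basis" for b
    using that assms by (auto simp: b inner_axis)
  have "\<tau> + (\<Sum>b\<in>Basis. (?c b * (z \<bullet> b)) *\<^sub>R b) = (\<chi> j. \<tau> $ j + c j * z $ j)" for z
  proof (rule euclidean_eqI)
    fix b :: "real ^ 'n" assume "b \<in> Basis"
    then have "(\<tau> + (\<Sum>b\<in>Basis. (?c b * (z \<bullet> b)) *\<^sub>R b)) \<bullet> b = \<tau> \<bullet> b + ?c b * (z \<bullet> b)"
      by (simp only: inner_add_left inner_sum_left_Basis)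
    also obtain i where "b = axis i 1" using \<open>b \<in> Basis\<close> by (auto simp: b)
    then have "\<tau> \<bullet> b + ?c b * (z \<bullet> b) = (\<chi> j. \<tau> $ j + c j * z $ j) \<bullet> b" by (simp add: inner_axis)
    finally show "(\<tau> + (\<Sum>b\<in>Basis. (?c b * (z \<bullet> b)) *\<^sub>R b)) \<bullet> b = (\<chi> j. \<tau> $ j + c j * z $ j) \<bullet> b" .
  qed
  moreover have "(\<Prod>b\<in>Basis. \<bar>?c b\<bar>) = (\<Prod>j\<in>UNIV. \<bar>c j\<bar>)"
  proof -
    have B: "(Basis :: (real ^ 'n) set) = (\<lambda>i. axis i 1) ` UNIV" by (auto simp: b)
    have inj: "inj (\<lambda>i::'n. axis i 1 :: real ^ 'n)" by (auto simp: inj_def axis_eq_axis)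
    show ?thesis unfolding B prod.reindex[OF inj] by (simp add: inner_axis)
  qed
  ultimately show ?thesis using lborel_affine_euclidean[where c="?c" and t=\<tau>, OF c] by simp
qed

text \<open>The affine map has the product of the \<open>c j\<close> as Jacobian and maps
  \<open>D\<close> into itself, so after the substitution the left side integrates \<open>f\<close>
  over the image of \<open>D\<close> only.\<close>

lemma nn_integral_uniform_affine_le:
  fixes D :: "(real ^ 'n::finite) set"
  assumes D: "D \<in> sets borel" and c: "\<And>j. c j > 0"
    and TD: "\<And>z. z \<in> D \<Longrightarrow> (\<chi> j. \<tau> $ j + c j * z $ j) \<in> D" and f[measurable]: "f \<in> borel_measurable borel"
  shows "ennreal (\<Prod>j\<in>UNIV. c j) * (\<integral>\<^sup>+z. f (\<chi> j. \<tau> $ j + c j * z $ j) \<partial>uniform_measure lborel D)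
    \<le> (\<integral>\<^sup>+z. f z \<partial>uniform_measure lborel D)"
proof -
  note D[measurable]
  let ?T = "\<lambda>z. \<chi> j. \<tau> $ j + c j * z $ j"
  have "continuous_on UNIV ?T" by (intro continuous_intros)
  then have [measurable]: "?T \<in> borel_measurable borel" by (rule borel_measurable_continuous_onI)
  have "(\<integral>\<^sup>+z. f z * indicator D z \<partial>lborel) =
    (\<integral>\<^sup>+z. f z * indicator D z \<partial>density (distr lborel borel ?T) (\<lambda>_. ennreal (\<Prod>j\<in>UNIV. \<bar>c j\<bar>)))"
    by (rule arg_cong[where f="\<lambda>M. integral\<^sup>N M (\<lambda>z. f z * indicator D z)"], rule lborel_affine_vec)
       (use c less_imp_neq in fastforce)
  also have "\<dots> = (\<integral>\<^sup>+z. ennreal (\<Prod>j\<in>UNIV. \<bar>c j\<bar>) * (f (?T z) * indicator D (?T z)) \<partial>lborel)"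
    by (subst nn_integral_density) (auto simp: nn_integral_distr)
  also have "\<dots> = ennreal (\<Prod>j\<in>UNIV. c j) * (\<integral>\<^sup>+z. f (?T z) * indicator D (?T z) \<partial>lborel)"
    using c by (subst nn_integral_cmult) (auto simp: less_imp_le)
  finally have eq: "(\<integral>\<^sup>+z. f z * indicator D z \<partial>lborel) = ennreal (\<Prod>j\<in>UNIV. c j) * (\<integral>\<^sup>+z. f (?T z) * indicator D (?T z) \<partial>lborel)" .
  have "ennreal (\<Prod>j\<in>UNIV. c j) * (\<integral>\<^sup>+z. f (?T z) * indicator D z \<partial>lborel) \<le> (\<integral>\<^sup>+z. f z * indicator D z \<partial>lborel)"
    unfolding eq by (intro mult_left_mono nn_integral_mono) (auto simp: indicator_def TD)
  then show ?thesis
    by (subst (1 2) nn_integral_uniform_measure)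
       (auto simp: divide_ennreal_def mult.assoc[symmetric] intro!: mult_right_mono)
qed

text \<open>Only the \<open>K\<close> coordinates are interpolated, the others are those of
  \<open>\<zeta>\<close>. As a map of \<open>\<zeta>\<close> it has Jacobian
  \<open>t ^ card K\<close> instead of \<open>t ^ CARD('n)\<close>, yet a function of the
  \<open>K\<close> coordinates cannot tell it from the point
  \<open>(1 - t) *\<^sub>R z + t *\<^sub>R \<zeta>\<close> of the segment. This is how the dimension
  drops to \<open>card K\<close>.\<close>

definition mix :: "'n set \<Rightarrow> real \<Rightarrow> real ^ 'n \<Rightarrow> real ^ 'n \<Rightarrow> real ^ 'n::finite" where
  "mix K t z \<zeta> = (\<chi> j. if j \<in> K then (1 - t) * z $ j + t * \<zeta> $ j else \<zeta> $ j)"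

locale mixing_domain =
  fixes D :: "(real ^ 'n::finite) set" and K :: "'n set"
  assumes D_borel [measurable]: "D \<in> sets borel"
    and D_convex: "convex D"
    and D_pos: "emeasure lborel D \<noteq> 0" and D_fin: "emeasure lborel D \<noteq> \<infinity>"
    and D_mix: "\<lbrakk>z \<in> D; \<zeta> \<in> D; 0 \<le> t; t \<le> 1\<rbrakk> \<Longrightarrow> mix K t z \<zeta> \<in> D"
begin

abbreviation U :: "(real ^ 'n) measure" where
  "U \<equiv> uniform_measure lborel D"

lemma prob_space_U: "prob_space U"
  by (rule prob_space_uniform_measure[OF D_pos D_fin])

lemma AE_U: "AE z in U. z \<in> D"
  by (rule AE_uniform_measure_in) simp

text \<open>The homothety with centre \<open>\<zeta>\<close> and ratio \<open>c\<close> maps the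
  convex set \<open>D\<close> into itself, and \<open>c \<ge> 1 / 2\<close> bounds the inverse of
  its Jacobian.\<close>

lemma nn_integral_scaled_le:
  assumes f: "f \<in> borel_measurable borel" and \<zeta>: "\<zeta> \<in> D" and c: "1 / 2 \<le> c" "c \<le> 1"
  shows "(\<integral>\<^sup>+z. f (c *\<^sub>R z + (1 - c) *\<^sub>R \<zeta>) \<partial>U) \<le> ennreal (2 ^ CARD('n)) * (\<integral>\<^sup>+z. f z \<partial>U)"
proof -
  have vec: "(\<chi> j. ((1 - c) *\<^sub>R \<zeta>) $ j + c * z $ j) = c *\<^sub>R z + (1 - c) *\<^sub>R \<zeta>" for z :: "real ^ 'n"
    by (simp add: vec_eq_iff)
  have "ennreal (\<Prod>j\<in>(UNIV::'n set). c) * (\<integral>\<^sup>+z. f (\<chi> j. ((1 - c) *\<^sub>R \<zeta>) $ j + c * z $ j) \<partial>U) \<le> (\<integral>\<^sup>+z. f z \<partial>U)"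
    by (rule nn_integral_uniform_affine_le)
       (unfold vec, use f c \<zeta> in \<open>auto intro!: convexD[OF D_convex]\<close>)
  then have *: "ennreal (c ^ CARD('n)) * (\<integral>\<^sup>+z. f (c *\<^sub>R z + (1 - c) *\<^sub>R \<zeta>) \<partial>U) \<le> (\<integral>\<^sup>+z. f z \<partial>U)"
    unfolding vec by simp
  have "1 \<le> (2 * c) ^ CARD('n)" using c by (intro one_le_power) auto
  then have "1 \<le> ennreal (2 ^ CARD('n)) * ennreal (c ^ CARD('n))"
    using c by (simp add: ennreal_mult[symmetric] power_mult_distrib del: ennreal_power)
  then have "1 * (\<integral>\<^sup>+z. f (c *\<^sub>R z + (1 - c) *\<^sub>R \<zeta>) \<partial>U) \<le> (ennreal (2 ^ CARD('n)) * ennreal (c ^ CARD('n))) * (\<integral>\<^sup>+z. f (c *\<^sub>R z + (1 - c) *\<^sub>R \<zeta>) \<partial>U)"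
    by (rule mult_right_mono) simp
  also have "\<dots> \<le> ennreal (2 ^ CARD('n)) * (\<integral>\<^sup>+z. f z \<partial>U)"
    using * by (simp only: mult.assoc mult_left_mono zero_le)
  finally show ?thesis by simp
qed

lemma nn_integral_mix_le:
  assumes f: "f \<in> borel_measurable borel" and z: "z \<in> D" and t: "0 < t" "t \<le> 1"
  shows "ennreal (t ^ card K) * (\<integral>\<^sup>+\<zeta>. f (mix K t z \<zeta>) \<partial>U) \<le> (\<integral>\<^sup>+\<zeta>. f \<zeta> \<partial>U)"
proof -
  let ?\<tau> = "\<chi> j. if j \<in> K then (1 - t) * z $ j else 0" and ?c = "\<lambda>j. if j \<in> K then t else 1"
  have vec: "(\<chi> j. ?\<tau> $ j + ?c j * \<zeta> $ j) = mix K t z \<zeta>" for \<zeta> :: "real ^ 'n"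
    by (simp add: vec_eq_iff mix_def)
  have "ennreal (\<Prod>j\<in>UNIV. ?c j) * (\<integral>\<^sup>+\<zeta>. f (\<chi> j. ?\<tau> $ j + ?c j * \<zeta> $ j) \<partial>U) \<le> (\<integral>\<^sup>+\<zeta>. f \<zeta> \<partial>U)"
    by (rule nn_integral_uniform_affine_le) (unfold vec, use f t z in \<open>auto intro: D_mix\<close>)
  moreover have "(\<Prod>j\<in>UNIV. ?c j) = t ^ card K" by (simp add: prod.If_cases)
  ultimately show ?thesis by (simp only: vec)
qed

text \<open>One of \<open>t\<close> and \<open>1 - t\<close> is at least 1/2. In the variable with
  the larger coefficient the segment point is a homothety about the other endpoint; integrating
  first over that variable gives a constant that does not blow up as \<open>t\<close> tends to 0 or
  1.\<close>

lemma nn_integral_average_le: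
  assumes f[measurable]: "f \<in> borel_measurable borel" and t: "0 \<le> t" "t \<le> 1"
  shows "(\<integral>\<^sup>+z. (\<integral>\<^sup>+\<zeta>. f ((1 - t) *\<^sub>R z + t *\<^sub>R \<zeta>) \<partial>U) \<partial>U) \<le> ennreal (2 ^ CARD('n)) * (\<integral>\<^sup>+z. f z \<partial>U)"
    (is "_ \<le> ?R")
proof -
  interpret U: prob_space U by (rule prob_space_U)
  interpret UU: pair_sigma_finite U U by unfold_locales
  have [measurable_cong]: "sets U = sets borel" by simp
  have const: "(\<integral>\<^sup>+z. ?R \<partial>U) = ?R" using U.emeasure_space_1 by simp
  show ?thesis
  proof (cases "t \<le> 1 / 2")
    case True
    have "(\<integral>\<^sup>+z. (\<integral>\<^sup>+\<zeta>. f ((1 - t) *\<^sub>R z + t *\<^sub>R \<zeta>) \<partial>U) \<partial>U) = (\<integral>\<^sup>+\<zeta>. (\<integral>\<^sup>+z. f ((1 - t) *\<^sub>R z + t *\<^sub>R \<zeta>) \<partial>U) \<partial>U)"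
      by (rule UU.Fubini') measurable
    also have "\<dots> \<le> (\<integral>\<^sup>+\<zeta>. ?R \<partial>U)"
    proof (rule nn_integral_mono_AE)
      show "AE \<zeta> in U. (\<integral>\<^sup>+z. f ((1 - t) *\<^sub>R z + t *\<^sub>R \<zeta>) \<partial>U) \<le> ?R"
        using AE_U by eventually_elim (use nn_integral_scaled_le[OF f, of _ "1 - t"] True t in auto)
    qed
    finally show ?thesis using const by simp
  next
    case False
    have "(\<integral>\<^sup>+z. (\<integral>\<^sup>+\<zeta>. f ((1 - t) *\<^sub>R z + t *\<^sub>R \<zeta>) \<partial>U) \<partial>U) \<le> (\<integral>\<^sup>+\<zeta>. ?R \<partial>U)"
    proof (rule nn_integral_mono_AE)
      show "AE z in U. (\<integral>\<^sup>+\<zeta>. f ((1 - t) *\<^sub>R z + t *\<^sub>R \<zeta>) \<partial>U) \<le> ?R"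
        using AE_U by eventually_elim (use nn_integral_scaled_le[OF f, of _ t] False t in \<open>auto simp: add.commute\<close>)
    qed
    then show ?thesis using const by simp
  qed
qed

text \<open>\<open>u z - u \<zeta>\<close> is bounded by the integral of the gradient over the segment; averaging over \<open>\<zeta>\<close> leaves an
  operator which, for each \<open>t\<close>, maps \<open>L\<^sup>1\<close> to \<open>L\<^sup>1\<close> with bounded norm and, for functions of the \<open>K\<close> coordinates,
  to \<open>L\<^sup>\<infinity>\<close> with norm at most \<open>t\<close> to the power \<open>- card K\<close>.\<close>

theorem sobolev_poincare:
  assumes p: "1 \<le> p" "p \<le> q" and pq: "real (card K) * (q / p - 1) < q" and R: "R \<ge> 0"
  shows "\<exists>C\<ge>0. \<forall>H G B. integrable U H \<longrightarrow> H \<in> borel_measurable borel \<longrightarrow> G \<in> borel_measurable borel \<longrightarrow>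
    (\<forall>z. 0 \<le> G z \<and> G z \<le> B) \<longrightarrow>
    (\<forall>z\<in>D. \<forall>z'\<in>D. (\<forall>k\<in>K. z $ k = z' $ k) \<longrightarrow> G z = G z') \<longrightarrow>
    (\<forall>z\<in>D. \<forall>\<zeta>\<in>D. ennreal \<bar>H z - H \<zeta>\<bar> \<le> ennreal R * (\<integral>\<^sup>+t. ennreal (G ((1 - t) *\<^sub>R z + t *\<^sub>R \<zeta>)) \<partial>unit_uniform)) \<longrightarrow>
    (\<integral>\<^sup>+z. ennreal (\<bar>H z - (\<integral>\<zeta>. H \<zeta> \<partial>U)\<bar> powr q) \<partial>U) \<le> ennreal (C * (\<integral>z. G z powr p \<partial>U) powr (q / p))"
proof -
  interpret U: prob_space U by (rule prob_space_U)
  interpret W: prob_space unit_uniform by (rule prob_space_unit_uniform)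
  interpret UW: pair_sigma_finite U unit_uniform by unfold_locales
  interpret WU: pair_sigma_finite unit_uniform U by unfold_locales
  have [measurable_cong]: "sets U = sets borel" "sets unit_uniform = sets borel" by simp_all
  define m where "m = real (card K)"
  define s where "s = q / p - 1"
  have s: "s \<ge> 0" using p by (simp add: s_def)
  have q1: "q \<ge> 1" using p by simp
  \<comment> \<open>With \<open>\<beta> = 1\<close> the exponent \<open>\<gamma>\<close> would be
    \<open>q - 1 - m * s\<close>, which exceeds -1 by \<open>pq\<close>. The weighted Jensen
    inequality needs \<open>\<beta> < 1\<close>, so \<open>\<beta> = 1 - \<delta>\<close> uses up at
    most half of that room; the minimum with 1/2 keeps \<open>\<beta>\<close> positive.\<close>
  define \<delta> where "\<delta> = min (1/2) ((q - m * s) / (2 * q))"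
  define \<beta> where "\<beta> = 1 - \<delta>"
  have "0 < (q - m * s) / (2 * q)" using pq q1 by (intro divide_pos_pos) (auto simp: m_def s_def)
  then have \<delta>: "0 < \<delta>" "\<delta> \<le> 1/2" unfolding \<delta>_def by (simp_all only: min_less_iff_conj min.cobounded1) simp
  have \<beta>: "0 < \<beta>" "\<beta> < 1" using \<delta> by (auto simp: \<beta>_def)
  define \<gamma> where "\<gamma> = \<beta> * (q - 1) - m * s"
  have "\<gamma> > -1"
  proof -
    have "\<delta> \<le> (q - m * s) / (2 * q)" by (simp add: \<delta>_def)
    then have "\<delta> * (2 * q) \<le> q - m * s" using q1 by (simp add: pos_le_divide_eq)
    moreover have "\<delta> * (q - 1) < \<delta> * (2 * q)" using \<delta> q1 by simp
    ultimately show ?thesis by (simp add: \<gamma>_def \<beta>_def algebra_simps)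
  qed
  \<comment> \<open>The factors stem, in this order, from the segment bound, the weighted Jensen
    inequality, the average over segments, and the integral of
    \<open>t powr \<gamma>\<close>.\<close>
  define C where "C = R powr q * (1 - \<beta>) powr (1 - q) * (2 ^ CARD('n)) * (1 / (\<gamma> + 1))"
  have "C \<ge> 0" using \<open>\<gamma> > -1\<close> by (simp add: C_def)
  moreover have "(\<integral>\<^sup>+z. ennreal (\<bar>H z - (\<integral>\<zeta>. H \<zeta> \<partial>U)\<bar> powr q) \<partial>U) \<le> ennreal (C * (\<integral>z. G z powr p \<partial>U) powr (q / p))"
    if Hi: "integrable U H" and H[measurable]: "H \<in> borel_measurable borel" and G[measurable]: "G \<in> borel_measurable borel"
      and GB: "\<forall>z. 0 \<le> G z \<and> G z \<le> B"
      and inv: "\<forall>z\<in>D. \<forall>z'\<in>D. (\<forall>k\<in>K. z $ k = z' $ k) \<longrightarrow> G z = G z'"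
      and seg: "\<forall>z\<in>D. \<forall>\<zeta>\<in>D. ennreal \<bar>H z - H \<zeta>\<bar> \<le> ennreal R * (\<integral>\<^sup>+t. ennreal (G ((1 - t) *\<^sub>R z + t *\<^sub>R \<zeta>)) \<partial>unit_uniform)"
    for H G B
  proof -
    define I where "I = (\<integral>z. G z powr p \<partial>U)"
    have I0: "I \<ge> 0" by (simp add: I_def)
    have I: "(\<integral>\<^sup>+z. ennreal (G z powr p) \<partial>U) = ennreal I"
      unfolding I_def using GB p
      by (intro nn_integral_eq_integral U.integrable_const_bound[where B="B powr p"]) (auto intro!: AE_I2 powr_mono2)
    define a where "a z t = (\<integral>\<zeta>. G ((1 - t) *\<^sub>R z + t *\<^sub>R \<zeta>) \<partial>U)" for z t
    define A where "A z t = (\<integral>\<^sup>+\<zeta>. ennreal (G ((1 - t) *\<^sub>R z + t *\<^sub>R \<zeta>) powr p) \<partial>U)" for z t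
    have Gi: "integrable U (\<lambda>\<zeta>. G ((1 - t) *\<^sub>R z + t *\<^sub>R \<zeta>))" for z t
      using GB by (intro U.integrable_const_bound[where B=B]) auto
    have aB: "0 \<le> a z t" "a z t \<le> B" for z t
      unfolding a_def using GB Gi by (auto intro!: integral_nonneg_AE U.integral_le_const)
    have a_meas[measurable]: "a z \<in> borel_measurable borel" for z
      unfolding a_def[abs_def] by measurable
    have A_meas[measurable]: "(\<lambda>(z, t). A z t) \<in> borel_measurable (borel \<Otimes>\<^sub>M borel)"
      unfolding A_def[abs_def] by measurable
    have ennA: "ennreal (a z t) = (\<integral>\<^sup>+\<zeta>. ennreal (G ((1 - t) *\<^sub>R z + t *\<^sub>R \<zeta>)) \<partial>U)" for z t
      unfolding a_def using GB by (intro nn_integral_eq_integral[symmetric] Gi) auto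
    have AI: "(\<integral>\<^sup>+z. A z t \<partial>U) \<le> ennreal (2 ^ CARD('n)) * ennreal I" if "0 < t" "t \<le> 1" for t
      unfolding A_def I[symmetric]
      by (rule nn_integral_average_le[where f="\<lambda>z. ennreal (G z powr p)"]) (use that in auto)
    have aA: "ennreal (a z t powr p) \<le> A z t" for z t
      unfolding a_def A_def using GB p by (intro U.jensen_powr Gi) auto
    \<comment> \<open>The bound in L^\<infinity>: replacing the segment point by
      \<open>mix K t z \<zeta>\<close> costs the Jacobian \<open>t ^ card K\<close>, hence the
      factor \<open>t powr (- m)\<close>.\<close>
    define S where "S t = t powr (- m) * I" for t
    have AS: "A z t \<le> ennreal (S t)" if z: "z \<in> D" and t: "0 < t" "t \<le> 1" for z t
    proof -
      have "A z t = (\<integral>\<^sup>+\<zeta>. ennreal (G (mix K t z \<zeta>) powr p) \<partial>U)"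
        unfolding A_def
      proof (rule nn_integral_cong_AE)
        show "AE \<zeta> in U. ennreal (G ((1 - t) *\<^sub>R z + t *\<^sub>R \<zeta>) powr p) = ennreal (G (mix K t z \<zeta>) powr p)"
          using AE_U
        proof eventually_elim
          case (elim \<zeta>)
          have "G ((1 - t) *\<^sub>R z + t *\<^sub>R \<zeta>) = G (mix K t z \<zeta>)"
          proof (rule inv[rule_format])
            show "(1 - t) *\<^sub>R z + t *\<^sub>R \<zeta> \<in> D" using convexD[OF D_convex z elim, of "1 - t" t] t by simp
            show "mix K t z \<zeta> \<in> D" using D_mix z elim t by simp
          qed (simp add: mix_def)
          then show ?case by simp
        qed
      qed
      then have *: "ennreal (t ^ card K) * A z t \<le> ennreal I"
        using nn_integral_mix_le[of "\<lambda>z. ennreal (G z powr p)", OF _ z t] by (simp add: I)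
      have "A z t = ennreal (t powr (- m)) * (ennreal (t ^ card K) * A z t)"
        using t by (simp add: mult.assoc[symmetric] ennreal_mult[symmetric] m_def powr_minus powr_realpow del: ennreal_power)
      also have "\<dots> \<le> ennreal (t powr (- m)) * ennreal I" using * by (rule mult_left_mono) simp
      finally show ?thesis using I0 by (simp add: S_def ennreal_mult)
    qed
    \<comment> \<open>Interpolation: of the power \<open>q = p * (s + 1)\<close> the part
      \<open>p * s\<close> is estimated by the supremum, and one power \<open>p\<close> is kept for
      the integral over \<open>z\<close>.\<close>
    have aq: "ennreal (a z t powr q) \<le> ennreal (S t powr s) * A z t" if z: "z \<in> D" and t: "0 < t" "t \<le> 1" for z t
    proof -
      have le: "a z t powr p \<le> S t" using order_trans[OF aA AS[OF that]] I0 by (simp add: S_def ennreal_le_iff)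
      have "a z t powr q = (a z t powr p) powr (s + 1)" using p by (simp add: powr_powr s_def)
      also have "\<dots> = (a z t powr p) powr s * (a z t powr p)" by (simp add: powr_add)
      also have "\<dots> \<le> S t powr s * (a z t powr p)" using le s by (intro mult_right_mono powr_mono2) auto
      finally have "ennreal (a z t powr q) \<le> ennreal (S t powr s) * ennreal (a z t powr p)"
        by (simp add: ennreal_mult[symmetric] ennreal_leI)
      also have "\<dots> \<le> ennreal (S t powr s) * A z t" by (intro mult_left_mono aA) simp
      finally show ?thesis .
    qed
    \<comment> \<open>Averaging the segment bound over \<open>\<zeta>\<close> and exchanging the
      integrals turns it into a time integral of \<open>a z\<close>.\<close>
    have Hz: "\<bar>H z - (\<integral>\<zeta>. H \<zeta> \<partial>U)\<bar> \<le> R * (\<integral>t. a z t \<partial>unit_uniform)" if z: "z \<in> D" for z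
    proof -
      have "\<bar>H z - (\<integral>\<zeta>. H \<zeta> \<partial>U)\<bar> = \<bar>\<integral>\<zeta>. H z - H \<zeta> \<partial>U\<bar>" using Hi U.prob_space by simp
      also have "\<dots> \<le> (\<integral>\<zeta>. \<bar>H z - H \<zeta>\<bar> \<partial>U)" by (rule integral_abs_bound)
      finally have "ennreal \<bar>H z - (\<integral>\<zeta>. H \<zeta> \<partial>U)\<bar> \<le> ennreal (\<integral>\<zeta>. \<bar>H z - H \<zeta>\<bar> \<partial>U)" by (rule ennreal_leI)
      also have "\<dots> = (\<integral>\<^sup>+\<zeta>. ennreal \<bar>H z - H \<zeta>\<bar> \<partial>U)"
        by (rule nn_integral_eq_integral[symmetric]) (use Hi in auto)
      also have "\<dots> \<le> (\<integral>\<^sup>+\<zeta>. ennreal R * (\<integral>\<^sup>+t. ennreal (G ((1 - t) *\<^sub>R z + t *\<^sub>R \<zeta>)) \<partial>unit_uniform) \<partial>U)"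
        by (rule nn_integral_mono_AE, use AE_U in eventually_elim) (use seg z in auto)
      also have "\<dots> = ennreal R * (\<integral>\<^sup>+\<zeta>. (\<integral>\<^sup>+t. ennreal (G ((1 - t) *\<^sub>R z + t *\<^sub>R \<zeta>)) \<partial>unit_uniform) \<partial>U)"
        by (rule nn_integral_cmult) measurable
      also have "(\<integral>\<^sup>+\<zeta>. (\<integral>\<^sup>+t. ennreal (G ((1 - t) *\<^sub>R z + t *\<^sub>R \<zeta>)) \<partial>unit_uniform) \<partial>U)
         = (\<integral>\<^sup>+t. (\<integral>\<^sup>+\<zeta>. ennreal (G ((1 - t) *\<^sub>R z + t *\<^sub>R \<zeta>)) \<partial>U) \<partial>unit_uniform)"
        by (rule UW.Fubini'[symmetric]) measurable
      also have "\<dots> = (\<integral>\<^sup>+t. ennreal (a z t) \<partial>unit_uniform)" by (simp add: ennA)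
      also have "\<dots> = ennreal (\<integral>t. a z t \<partial>unit_uniform)"
        by (rule nn_integral_eq_integral[OF W.integrable_const_bound[where B=B]]) (use aB in auto)
      finally show ?thesis using R aB by (simp add: ennreal_mult[symmetric] ennreal_le_iff mult_nonneg_nonneg integral_nonneg_AE)
    qed
    have step: "ennreal (\<bar>H z - (\<integral>\<zeta>. H \<zeta> \<partial>U)\<bar> powr q) \<le> ennreal (R powr q * (1 - \<beta>) powr (1 - q)) *
        (\<integral>\<^sup>+t. ennreal (t powr (\<beta> * (q - 1)) * S t powr s) * A z t \<partial>unit_uniform)" if z: "z \<in> D" for z
    proof -
      have "\<bar>H z - (\<integral>\<zeta>. H \<zeta> \<partial>U)\<bar> powr q \<le> R powr q * (\<integral>t. a z t \<partial>unit_uniform) powr q"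
        using powr_mono2[OF _ _ Hz[OF z], of q] q1 R aB by (simp add: powr_mult integral_nonneg_AE)
      then have "ennreal (\<bar>H z - (\<integral>\<zeta>. H \<zeta> \<partial>U)\<bar> powr q) \<le> ennreal (R powr q) * ennreal ((\<integral>t. a z t \<partial>unit_uniform) powr q)"
        by (simp add: ennreal_mult[symmetric] ennreal_leI)
      also have "\<dots> \<le> ennreal (R powr q) * (ennreal ((1 - \<beta>) powr (1 - q)) * (\<integral>\<^sup>+t. ennreal (t powr (\<beta> * (q - 1)) * a z t powr q) \<partial>unit_uniform))"
        by (intro mult_left_mono weighted_jensen_powr[OF _ _ _ q1 \<beta>, of _ B] a_meas aB) simp
      also have "\<dots> = ennreal (R powr q * (1 - \<beta>) powr (1 - q)) * (\<integral>\<^sup>+t. ennreal (t powr (\<beta> * (q - 1)) * a z t powr q) \<partial>unit_uniform)"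
        by (simp add: ennreal_mult mult.assoc)
      also have "\<dots> \<le> ennreal (R powr q * (1 - \<beta>) powr (1 - q)) * (\<integral>\<^sup>+t. ennreal (t powr (\<beta> * (q - 1)) * S t powr s) * A z t \<partial>unit_uniform)"
      proof (rule mult_left_mono[OF nn_integral_mono_AE])
        show "AE t in unit_uniform. ennreal (t powr (\<beta> * (q - 1)) * a z t powr q) \<le> ennreal (t powr (\<beta> * (q - 1)) * S t powr s) * A z t"
          using AE_unit_uniform
        proof eventually_elim
          case (elim t)
          have "ennreal (t powr (\<beta> * (q - 1))) * ennreal (a z t powr q) \<le> ennreal (t powr (\<beta> * (q - 1))) * (ennreal (S t powr s) * A z t)"
            using aq[OF z] elim by (intro mult_left_mono) auto
          then show ?case by (simp add: ennreal_mult mult.assoc)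
        qed
      qed simp
      finally show ?thesis .
    qed
    let ?c = "R powr q * (1 - \<beta>) powr (1 - q)"
    have "(\<integral>\<^sup>+z. ennreal (\<bar>H z - (\<integral>\<zeta>. H \<zeta> \<partial>U)\<bar> powr q) \<partial>U)
      \<le> (\<integral>\<^sup>+z. ennreal ?c * (\<integral>\<^sup>+t. ennreal (t powr (\<beta> * (q - 1)) * S t powr s) * A z t \<partial>unit_uniform) \<partial>U)"
      by (rule nn_integral_mono_AE, use AE_U in eventually_elim) (use step in auto)
    also have "\<dots> = ennreal ?c * (\<integral>\<^sup>+z. (\<integral>\<^sup>+t. ennreal (t powr (\<beta> * (q - 1)) * S t powr s) * A z t \<partial>unit_uniform) \<partial>U)"
      unfolding S_def by (rule nn_integral_cmult) measurable
    also have "(\<integral>\<^sup>+z. (\<integral>\<^sup>+t. ennreal (t powr (\<beta> * (q - 1)) * S t powr s) * A z t \<partial>unit_uniform) \<partial>U)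
        = (\<integral>\<^sup>+t. (\<integral>\<^sup>+z. ennreal (t powr (\<beta> * (q - 1)) * S t powr s) * A z t \<partial>U) \<partial>unit_uniform)"
      unfolding S_def by (rule UW.Fubini'[symmetric]) measurable
    \<comment> \<open>For fixed \<open>t\<close> the integral of \<open>A z t\<close> over
      \<open>z\<close> costs a constant only; all powers of \<open>t\<close> combine to
      \<open>t powr \<gamma>\<close>, which is integrable at 0.\<close>
    also have "\<dots> \<le> (\<integral>\<^sup>+t. ennreal (2 ^ CARD('n) * I powr (q / p)) * ennreal (t powr \<gamma>) \<partial>unit_uniform)"
    proof (rule nn_integral_mono_AE)
      show "AE t in unit_uniform. (\<integral>\<^sup>+z. ennreal (t powr (\<beta> * (q - 1)) * S t powr s) * A z t \<partial>U)
          \<le> ennreal (2 ^ CARD('n) * I powr (q / p)) * ennreal (t powr \<gamma>)"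
        using AE_unit_uniform
      proof eventually_elim
        case (elim t)
        have [measurable]: "(\<lambda>z. A z t) \<in> borel_measurable borel" unfolding A_def by measurable
        have "(\<integral>\<^sup>+z. ennreal (t powr (\<beta> * (q - 1)) * S t powr s) * A z t \<partial>U)
           = ennreal (t powr (\<beta> * (q - 1)) * S t powr s) * (\<integral>\<^sup>+z. A z t \<partial>U)"
          by (rule nn_integral_cmult) measurable
        also have "\<dots> \<le> ennreal (t powr (\<beta> * (q - 1)) * S t powr s) * (ennreal (2 ^ CARD('n)) * ennreal I)"
          using AI elim by (intro mult_left_mono) auto
        also have "\<dots> = ennreal (t powr (\<beta> * (q - 1)) * S t powr s * (2 ^ CARD('n) * I))"
          using I0 by (simp add: ennreal_mult[symmetric] del: ennreal_power)
        also have "t powr (\<beta> * (q - 1)) * S t powr s * (2 ^ CARD('n) * I) = (2 ^ CARD('n) * I powr (q / p)) * t powr \<gamma>"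
        proof -
          have 1: "S t powr s = t powr (- m * s) * I powr s" using elim I0 by (simp add: S_def powr_mult powr_powr)
          have 2: "I powr s * I = I powr (q / p)" using I0 s by (cases "I = 0") (auto simp: s_def powr_diff)
          have 3: "t powr (\<beta> * (q - 1)) * t powr (- m * s) = t powr \<gamma>" by (simp add: powr_add[symmetric] \<gamma>_def)
          have "t powr (\<beta> * (q - 1)) * S t powr s * (2 ^ CARD('n) * I) = (t powr (\<beta> * (q - 1)) * t powr (- m * s)) * (I powr s * I) * 2 ^ CARD('n)"
            unfolding 1 by (simp only: mult_ac)
          then show ?thesis unfolding 2 3 by (simp only: mult_ac)
        qed
        finally show ?case by (simp add: ennreal_mult[symmetric])
      qed
    qed
    also have "\<dots> = ennreal (2 ^ CARD('n) * I powr (q / p)) * ennreal (1 / (\<gamma> + 1))"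
      by (subst nn_integral_cmult) (auto simp: nn_integral_powr_unit_uniform \<open>\<gamma> > -1\<close>)
    finally have "(\<integral>\<^sup>+z. ennreal (\<bar>H z - (\<integral>\<zeta>. H \<zeta> \<partial>U)\<bar> powr q) \<partial>U) \<le>
        ennreal ?c * (ennreal (2 ^ CARD('n) * I powr (q / p)) * ennreal (1 / (\<gamma> + 1)))"
      by (simp add: mult_left_mono)
    also have "\<dots> = ennreal (C * I powr (q / p))"
      using \<open>\<gamma> > -1\<close> by (simp add: ennreal_mult[symmetric] C_def mult_ac del: ennreal_power)
    finally show ?thesis by (simp add: I_def)
  qed
  ultimately show ?thesis by blast
qed

end

section \<open>Gradients and the Poincare inequality in L^1\<close>

definition grad :: "(real ^ 'n \<Rightarrow> real) \<Rightarrow> real ^ 'n \<Rightarrow> real ^ 'n::finite" where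
  "grad f z = (\<chi> i. frechet_derivative f (at z) (axis i 1))"

lemma frechet_derivative_eq_grad:
  fixes f :: "real ^ 'n::finite \<Rightarrow> real"
  assumes "f differentiable (at z)"
  shows "frechet_derivative f (at z) v = grad f z \<bullet> v"
proof -
  have lin: "linear (frechet_derivative f (at z))"
    using assms by (simp add: linear_frechet_derivative)
  have "frechet_derivative f (at z) v = frechet_derivative f (at z) (\<Sum>i\<in>UNIV. v $ i *\<^sub>R axis i 1)"
    by (simp add: basis_expansion scalar_mult_eq_scaleR[symmetric])
  also have "\<dots> = (\<Sum>i\<in>UNIV. v $ i * frechet_derivative f (at z) (axis i 1))"
    using lin by (simp add: linear_sum linear_cmul)
  finally show ?thesis by (simp add: grad_def inner_vec_def mult.commute)
qed

lemma has_derivative_grad: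
  fixes f :: "real ^ 'n::finite \<Rightarrow> real"
  assumes "C_on (Suc k) \<Omega> f" "z \<in> \<Omega>"
  shows "(f has_derivative (\<lambda>v. grad f z \<bullet> v)) (at z)"
proof -
  have "f differentiable (at z)" using assms by simp
  then have eq: "frechet_derivative f (at z) = (\<lambda>v. grad f z \<bullet> v)"
    by (intro ext frechet_derivative_eq_grad)
  show ?thesis using C_on_has_derivative[OF assms] unfolding eq .
qed

lemma C_on_grad:
  fixes f :: "real ^ 'n::finite \<Rightarrow> real"
  assumes "C_on (Suc k) \<Omega> f" shows "C_on k \<Omega> (\<lambda>z. grad f z $ i)"
  using assms by (simp add: grad_def)

lemma continuous_on_grad:
  fixes f :: "real ^ 'n::finite \<Rightarrow> real"
  assumes "C_on (Suc k) \<Omega> f" shows "continuous_on \<Omega> (grad f)"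
  using C_on_imp_continuous_on[OF C_on_grad[OF assms]]
  by (subst continuous_on_componentwise) (auto simp: Basis_vec_def inner_axis)

text \<open>\<open>G\<close> is any Borel function that agrees with the norm of the gradient on
  \<open>D\<close>. This admits cut-offs, as the gradient of \<open>f\<close> is under control on
  \<open>\<Omega>\<close> only.\<close>

lemma segment_gradient_bound:
  fixes f :: "real ^ 'n::finite \<Rightarrow> real"
  assumes C: "C_on 1 \<Omega> f" and D: "convex D" "D \<subseteq> \<Omega>" "z \<in> D" "\<zeta> \<in> D"
    and G[measurable]: "G \<in> borel_measurable borel" and GD: "\<And>y. y \<in> D \<Longrightarrow> G y = norm (grad f y)"
    and R: "norm (z - \<zeta>) \<le> R"
  shows "ennreal \<bar>f z - f \<zeta>\<bar> \<le> ennreal R * (\<integral>\<^sup>+t. ennreal (G ((1 - t) *\<^sub>R z + t *\<^sub>R \<zeta>)) \<partial>unit_uniform)"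
proof -
  let ?\<phi> = "\<lambda>t. (1 - t) *\<^sub>R z + t *\<^sub>R \<zeta>"
  have inD: "?\<phi> t \<in> D" if "t \<in> {0..1}" for t using that D by (auto intro: convexD)
  have "((\<lambda>t. grad f (?\<phi> t) \<bullet> (\<zeta> - z)) has_integral (f (?\<phi> 1) - f (?\<phi> 0))) {0..1}"
  proof (rule fundamental_theorem_of_calculus)
    fix t :: real assume "t \<in> {0..1}"
    then have "?\<phi> t \<in> \<Omega>" using inD D by auto
    have "((\<lambda>t. f (?\<phi> t)) has_derivative (\<lambda>h. grad f (?\<phi> t) \<bullet> (h *\<^sub>R (\<zeta> - z)))) (at t within {0..1})"
      by (rule has_derivative_compose[where g=f and f="?\<phi>" and f'="\<lambda>h. h *\<^sub>R (\<zeta> - z)" and g'="\<lambda>v. grad f (?\<phi> t) \<bullet> v"])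
         (use has_derivative_grad[of 0 \<Omega> f, OF _ \<open>?\<phi> t \<in> \<Omega>\<close>] C in \<open>auto intro!: derivative_eq_intros simp: algebra_simps\<close>)
    then show "((\<lambda>t. f (?\<phi> t)) has_vector_derivative grad f (?\<phi> t) \<bullet> (\<zeta> - z)) (at t within {0..1})"
      by (simp add: has_vector_derivative_def)
  qed simp
  then have I: "((\<lambda>t. grad f (?\<phi> t) \<bullet> (\<zeta> - z)) has_integral (f \<zeta> - f z)) {0..1}" by simp
  have contg: "continuous_on {0..1} (\<lambda>t. grad f (?\<phi> t))"
    by (rule continuous_on_compose2[OF continuous_on_grad[of 0 \<Omega> f]]) (use C inD D in \<open>auto intro!: continuous_intros\<close>)
  have "continuous_on {0..1} (\<lambda>t. R * norm (grad f (?\<phi> t)))" by (intro continuous_intros contg)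
  then have J: "((\<lambda>t. R * norm (grad f (?\<phi> t))) has_integral integral {0..1} (\<lambda>t. R * norm (grad f (?\<phi> t)))) {0..1}"
    using integrable_continuous_interval by blast
  have R0: "R \<ge> 0" using R norm_ge_zero order_trans by blast
  have "norm (f \<zeta> - f z) \<le> integral {0..1} (\<lambda>t. R * norm (grad f (?\<phi> t)))"
  proof -
    have "norm (integral {0..1} (\<lambda>t. grad f (?\<phi> t) \<bullet> (\<zeta> - z))) \<le> integral {0..1} (\<lambda>t. R * norm (grad f (?\<phi> t)))"
    proof (rule integral_norm_bound_integral)
      fix t :: real assume "t \<in> {0..1}"
      have "norm (grad f (?\<phi> t) \<bullet> (\<zeta> - z)) \<le> norm (grad f (?\<phi> t)) * norm (\<zeta> - z)" using Cauchy_Schwarz_ineq2 by simp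
      also have "\<dots> \<le> norm (grad f (?\<phi> t)) * R" using R by (intro mult_left_mono) (auto simp: norm_minus_commute)
      finally show "norm (grad f (?\<phi> t) \<bullet> (\<zeta> - z)) \<le> R * norm (grad f (?\<phi> t))" by (simp add: mult.commute)
    qed (use I J in auto)
    then show ?thesis using I by (simp add: integral_unique)
  qed
  then have "ennreal \<bar>f z - f \<zeta>\<bar> \<le> ennreal (integral {0..1} (\<lambda>t. R * norm (grad f (?\<phi> t))))"
    by (intro ennreal_leI) (simp add: abs_minus_commute)
  also have "\<dots> = (\<integral>\<^sup>+t. ennreal (R * norm (grad f (?\<phi> t))) * indicator {0..1} t \<partial>lborel)"
    using J R0 by (intro nn_integral_has_integral_lebesgue'[symmetric]) auto
  also have "\<dots> = (\<integral>\<^sup>+t. ennreal R * ennreal (G (?\<phi> t)) * indicator {0..1} t \<partial>lborel)"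
    by (intro nn_integral_cong) (use GD inD R0 in \<open>auto simp: indicator_def ennreal_mult\<close>)
  also have "\<dots> = (\<integral>\<^sup>+t. ennreal R * ennreal (G (?\<phi> t)) \<partial>unit_uniform)"
    by (rule nn_integral_unit_uniform[symmetric]) measurable
  also have "\<dots> = ennreal R * (\<integral>\<^sup>+t. ennreal (G (?\<phi> t)) \<partial>unit_uniform)"
    by (rule nn_integral_cmult) measurable
  finally show ?thesis .
qed

text \<open>The double average of \<open>\<bar>f z - f \<zeta>\<bar>\<close> is bounded through
  segments and \<open>nn_integral_average_le\<close>. The constant is proportional to the bound
  \<open>R\<close> on the diameter, which is what small cells exploit; the mean enters as a plain
  integral because it is linear in \<open>f\<close> and can be made to converge along a
  sequence.\<close>

lemma poincare_convex:
  fixes f :: "real ^ 'n::finite \<Rightarrow> real"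
  assumes C: "C_on 1 \<Omega> f" and D[measurable]: "D \<in> sets borel" and D': "convex D" "D \<subseteq> Q"
    and Q: "compact Q" "Q \<subseteq> \<Omega>" and R: "\<And>z \<zeta>. z \<in> D \<Longrightarrow> \<zeta> \<in> D \<Longrightarrow> norm (z - \<zeta>) \<le> R"
  shows "(\<integral>\<^sup>+z\<in>D. ennreal \<bar>f z\<bar> \<partial>lborel) \<le>
    ennreal (R * 2 ^ CARD('n)) * (\<integral>\<^sup>+z\<in>D. ennreal (norm (grad f z)) \<partial>lborel) + ennreal \<bar>LINT z:D|lborel. f z\<bar>"
proof (cases "emeasure lborel D = 0")
  case True
  then have "D \<in> null_sets lborel" by auto
  then have "(\<integral>\<^sup>+z\<in>D. ennreal \<bar>f z\<bar> \<partial>lborel) = 0" by (rule nn_integral_null_set)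
  then show ?thesis by simp
next
  case False
  have DO: "D \<subseteq> \<Omega>" using D' Q by blast
  have fin: "emeasure lborel D \<noteq> \<infinity>"
    using emeasure_mono[OF D'(2), of lborel] emeasure_compact_finite[OF Q(1)] Q(1) by (auto simp: top_unique compact_imp_closed)
  \<comment> \<open>With \<open>K\<close> empty, \<open>mix\<close> returns \<open>\<zeta>\<close>,
    so the closure condition of the locale is trivial.\<close>
  interpret mixing_domain D "{}"
    by unfold_locales (use D D' False fin in \<open>auto simp: mix_def\<close>)
  interpret U: prob_space U by (rule prob_space_U)
  interpret UW: pair_sigma_finite U unit_uniform
    using prob_space_unit_uniform by (intro pair_sigma_finite.intro U.sigma_finite_measure_axioms) (simp add: prob_space_imp_sigma_finite)
  interpret WU: pair_sigma_finite unit_uniform U ..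
  have [measurable_cong]: "sets U = sets borel" "sets unit_uniform = sets borel" by simp_all
  define G where "G z = indicator D z *\<^sub>R norm (grad f z)" for z
  define H where "H z = indicator D z *\<^sub>R f z" for z
  have [measurable]: "G \<in> borel_measurable borel" unfolding G_def
    by (intro borel_measurable_continuous_on_indicator D continuous_on_norm continuous_on_subset[OF continuous_on_grad[of 0 \<Omega> f] DO]) (use C in simp)
  have [measurable]: "H \<in> borel_measurable borel" unfolding H_def
    by (intro borel_measurable_continuous_on_indicator D continuous_on_subset[OF C_on_imp_continuous_on[OF C] DO])
  obtain B where B: "\<And>z. z \<in> Q \<Longrightarrow> \<bar>f z\<bar> \<le> B"
    using compact_imp_bounded[OF compact_continuous_image[OF continuous_on_subset[OF C_on_imp_continuous_on[OF C] Q(2)] Q(1)]]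
    unfolding bounded_iff by auto
  have Hi: "integrable U H"
    by (rule U.integrable_const_bound[where B=B], use AE_U in eventually_elim) (use B D' in \<open>auto simp: H_def\<close>)
  obtain z0 where "z0 \<in> D" using False by (metis ex_in_conv emeasure_empty)
  then have R0: "R \<ge> 0" using R[of z0 z0] by simp
  have seg: "ennreal \<bar>H z - H \<zeta>\<bar> \<le> ennreal R * (\<integral>\<^sup>+t. ennreal (G ((1 - t) *\<^sub>R z + t *\<^sub>R \<zeta>)) \<partial>unit_uniform)" if "z \<in> D" "\<zeta> \<in> D" for z \<zeta>
    using segment_gradient_bound[OF C D'(1) DO that, of G R] that R by (simp add: H_def) (simp add: G_def)
  have "(\<integral>\<^sup>+z. (\<integral>\<^sup>+\<zeta>. ennreal \<bar>H z - H \<zeta>\<bar> \<partial>U) \<partial>U)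
     \<le> (\<integral>\<^sup>+z. (\<integral>\<^sup>+\<zeta>. ennreal R * (\<integral>\<^sup>+t. ennreal (G ((1 - t) *\<^sub>R z + t *\<^sub>R \<zeta>)) \<partial>unit_uniform) \<partial>U) \<partial>U)"
  proof (rule nn_integral_mono_AE, use AE_U in eventually_elim)
    fix z assume "z \<in> D"
    then show "(\<integral>\<^sup>+\<zeta>. ennreal \<bar>H z - H \<zeta>\<bar> \<partial>U) \<le> (\<integral>\<^sup>+\<zeta>. ennreal R * (\<integral>\<^sup>+t. ennreal (G ((1 - t) *\<^sub>R z + t *\<^sub>R \<zeta>)) \<partial>unit_uniform) \<partial>U)"
      by (intro nn_integral_mono_AE, use AE_U in eventually_elim) (use seg in auto)
  qed
  also have "\<dots> = ennreal R * (\<integral>\<^sup>+z. (\<integral>\<^sup>+\<zeta>. (\<integral>\<^sup>+t. ennreal (G ((1 - t) *\<^sub>R z + t *\<^sub>R \<zeta>)) \<partial>unit_uniform) \<partial>U) \<partial>U)"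
    by (subst nn_integral_cmult, measurable)+
  also have "(\<integral>\<^sup>+z. (\<integral>\<^sup>+\<zeta>. (\<integral>\<^sup>+t. ennreal (G ((1 - t) *\<^sub>R z + t *\<^sub>R \<zeta>)) \<partial>unit_uniform) \<partial>U) \<partial>U) =
     (\<integral>\<^sup>+z. (\<integral>\<^sup>+t. (\<integral>\<^sup>+\<zeta>. ennreal (G ((1 - t) *\<^sub>R z + t *\<^sub>R \<zeta>)) \<partial>U) \<partial>unit_uniform) \<partial>U)"
    by (rule nn_integral_cong, rule UW.Fubini'[symmetric]) measurable
  also have "\<dots> = (\<integral>\<^sup>+t. (\<integral>\<^sup>+z. (\<integral>\<^sup>+\<zeta>. ennreal (G ((1 - t) *\<^sub>R z + t *\<^sub>R \<zeta>)) \<partial>U) \<partial>U) \<partial>unit_uniform)"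
    by (rule UW.Fubini'[symmetric]) measurable
  also have "\<dots> \<le> (\<integral>\<^sup>+t. ennreal (2 ^ CARD('n)) * (\<integral>\<^sup>+z. ennreal (G z) \<partial>U) \<partial>unit_uniform)"
    by (rule nn_integral_mono_AE, use AE_unit_uniform in eventually_elim)
       (rule nn_integral_average_le[where f="\<lambda>z. ennreal (G z)"], auto)
  also have "\<dots> = ennreal (2 ^ CARD('n)) * (\<integral>\<^sup>+z. ennreal (G z) \<partial>U)"
    using prob_space.emeasure_space_1[OF prob_space_unit_uniform] by simp
  finally have PP: "(\<integral>\<^sup>+z. (\<integral>\<^sup>+\<zeta>. ennreal \<bar>H z - H \<zeta>\<bar> \<partial>U) \<partial>U) \<le> ennreal R * (ennreal (2 ^ CARD('n)) * (\<integral>\<^sup>+z. ennreal (G z) \<partial>U))"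
    by (simp add: mult_left_mono)
  let ?m = "\<integral>z. H z \<partial>U"
  have "(\<integral>\<^sup>+z. ennreal \<bar>H z\<bar> \<partial>U) \<le> (\<integral>\<^sup>+z. (\<integral>\<^sup>+\<zeta>. ennreal \<bar>H z - H \<zeta>\<bar> \<partial>U) + ennreal \<bar>?m\<bar> \<partial>U)"
  proof (rule nn_integral_mono)
    fix z
    have "\<bar>H z\<bar> \<le> \<bar>\<integral>\<zeta>. H z - H \<zeta> \<partial>U\<bar> + \<bar>?m\<bar>" using Hi U.prob_space by simp
    also have "\<dots> \<le> (\<integral>\<zeta>. \<bar>H z - H \<zeta>\<bar> \<partial>U) + \<bar>?m\<bar>" by (intro add_right_mono integral_abs_bound)
    finally have "ennreal \<bar>H z\<bar> \<le> ennreal (\<integral>\<zeta>. \<bar>H z - H \<zeta>\<bar> \<partial>U) + ennreal \<bar>?m\<bar>"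
      by (simp add: ennreal_plus[symmetric] ennreal_leI integral_nonneg_AE del: ennreal_plus)
    also have "ennreal (\<integral>\<zeta>. \<bar>H z - H \<zeta>\<bar> \<partial>U) = (\<integral>\<^sup>+\<zeta>. ennreal \<bar>H z - H \<zeta>\<bar> \<partial>U)"
      by (rule nn_integral_eq_integral[symmetric]) (use Hi in auto)
    finally show "ennreal \<bar>H z\<bar> \<le> (\<integral>\<^sup>+\<zeta>. ennreal \<bar>H z - H \<zeta>\<bar> \<partial>U) + ennreal \<bar>?m\<bar>" .
  qed
  also have "\<dots> = (\<integral>\<^sup>+z. (\<integral>\<^sup>+\<zeta>. ennreal \<bar>H z - H \<zeta>\<bar> \<partial>U) \<partial>U) + ennreal \<bar>?m\<bar>"
    using U.emeasure_space_1 by (subst nn_integral_add) auto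
  also have "\<dots> \<le> ennreal R * (ennreal (2 ^ CARD('n)) * (\<integral>\<^sup>+z. ennreal (G z) \<partial>U)) + ennreal \<bar>?m\<bar>"
    by (rule add_right_mono[OF PP])
  finally have main: "(\<integral>\<^sup>+z. ennreal \<bar>H z\<bar> \<partial>U) \<le> ennreal (R * 2 ^ CARD('n)) * (\<integral>\<^sup>+z. ennreal (G z) \<partial>U) + ennreal \<bar>?m\<bar>"
    using R0 by (simp add: ennreal_mult mult.assoc)
  \<comment> \<open>Passing from the normalised measure to Lebesgue measure multiplies by the volume
    \<open>V\<close>; the mean then becomes the integral of \<open>f\<close>.\<close>
  define V where "V = emeasure lborel D"
  have V: "V \<noteq> 0" "V \<noteq> \<infinity>" "V < top" using False fin by (auto simp: V_def less_top)
  have VV: "X / V * V = X" for X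
  proof -
    obtain v where v: "V = ennreal v" "v > 0" using V by (cases V) (auto simp: zero_less_iff_neq_zero)
    then show ?thesis
      by (simp add: divide_ennreal_def inverse_ennreal mult.assoc ennreal_mult[symmetric])
  qed
  have nnU: "(\<integral>\<^sup>+z. h z \<partial>U) * V = (\<integral>\<^sup>+z. h z * indicator D z \<partial>lborel)" if "h \<in> borel_measurable borel" for h
    using that VV by (subst nn_integral_uniform_measure) (auto simp: V_def)
  have m: "ennreal \<bar>?m\<bar> * V = ennreal \<bar>LINT z:D|lborel. f z\<bar>"
  proof -
    have emD: "emeasure lborel D = ennreal (measure lborel D)" using fin by (simp add: emeasure_eq_ennreal_measure)
    then have mpos: "measure lborel D > 0" using False by (simp add: zero_less_measure_iff)
    have U_eq: "U = density lborel (\<lambda>z. ennreal (indicator D z / measure lborel D))"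
      unfolding uniform_measure_def
    proof (rule density_cong)
      have "indicator D z / ennreal (measure lborel D) = ennreal (indicator D z / measure lborel D)" for z
        using mpos divide_ennreal[of 1 "measure lborel D"] by (auto simp: indicator_def)
      then show "AE z in lborel. indicator D z / emeasure lborel D = ennreal (indicator D z / measure lborel D)"
        unfolding emD by simp
    qed auto
    have "?m = (LINT z|lborel. (indicator D z / measure lborel D) *\<^sub>R H z)"
      unfolding U_eq by (rule integral_density) auto
    also have "\<dots> = (LINT z|lborel. (indicator D z *\<^sub>R f z) * (1 / measure lborel D))"
      by (intro Bochner_Integration.integral_cong) (auto simp: H_def indicator_def)
    also have "\<dots> = (LINT z:D|lborel. f z) * (1 / measure lborel D)" by (simp add: set_lebesgue_integral_def)
    finally have "\<bar>?m\<bar> * measure lborel D = \<bar>LINT z:D|lborel. f z\<bar>"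
      using False fin by (simp add: abs_mult measure_def enn2real_eq_0_iff)
    moreover have "V = ennreal (measure lborel D)" using fin by (simp add: V_def emeasure_eq_ennreal_measure)
    ultimately show ?thesis by (simp add: ennreal_mult[symmetric])
  qed
  have "(\<integral>\<^sup>+z. ennreal \<bar>H z\<bar> \<partial>U) * V \<le> (ennreal (R * 2 ^ CARD('n)) * (\<integral>\<^sup>+z. ennreal (G z) \<partial>U) + ennreal \<bar>?m\<bar>) * V"
    by (rule mult_right_mono[OF main]) simp
  also have "\<dots> = ennreal (R * 2 ^ CARD('n)) * ((\<integral>\<^sup>+z. ennreal (G z) \<partial>U) * V) + ennreal \<bar>LINT z:D|lborel. f z\<bar>"
    by (simp add: distrib_right m mult.assoc)
  finally have fin': "(\<integral>\<^sup>+z. ennreal \<bar>H z\<bar> * indicator D z \<partial>lborel) \<le>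
     ennreal (R * 2 ^ CARD('n)) * (\<integral>\<^sup>+z. ennreal (G z) * indicator D z \<partial>lborel) + ennreal \<bar>LINT z:D|lborel. f z\<bar>"
    by (simp add: nnU)
  moreover have "(\<integral>\<^sup>+z. ennreal \<bar>H z\<bar> * indicator D z \<partial>lborel) = (\<integral>\<^sup>+z\<in>D. ennreal \<bar>f z\<bar> \<partial>lborel)"
    by (intro nn_integral_cong) (simp add: H_def indicator_def)
  moreover have "(\<integral>\<^sup>+z. ennreal (G z) * indicator D z \<partial>lborel) = (\<integral>\<^sup>+z\<in>D. ennreal (norm (grad f z)) \<partial>lborel)"
    by (intro nn_integral_cong) (simp add: G_def indicator_def)
  ultimately show ?thesis by simp
qed

section \<open>Subdivision of a convex body into small cells\<close>

definition grid_cell :: "(real ^ 'n) set \<Rightarrow> nat \<Rightarrow> ('n \<Rightarrow> int) \<Rightarrow> (real ^ 'n::finite) set" where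
  "grid_cell Q N i = {z \<in> Q. \<forall>j. of_int (i j) \<le> real N * z $ j \<and> real N * z $ j < of_int (i j) + 1}"

definition grid_index :: "(real ^ 'n) set \<Rightarrow> nat \<Rightarrow> ('n::finite \<Rightarrow> int) set" where
  "grid_index Q N = (\<lambda>z j. \<lfloor>real N * z $ j\<rfloor>) ` Q"

lemma mem_grid_cell: "z \<in> grid_cell Q N i \<longleftrightarrow> z \<in> Q \<and> i = (\<lambda>j. \<lfloor>real N * z $ j\<rfloor>)"
  by (auto simp: grid_cell_def fun_eq_iff floor_eq_iff eq_commute[of "i _"])

lemma finite_grid_index:
  fixes Q :: "(real ^ 'n::finite) set"
  assumes "bounded Q" shows "finite (grid_index Q N)"
proof -
  obtain b where b: "\<And>z. z \<in> Q \<Longrightarrow> norm z \<le> b" using assms bounded_iff by blast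
  have "grid_index Q N \<subseteq> Pi UNIV (\<lambda>_. {\<lfloor>- (real N * b)\<rfloor>..\<lfloor>real N * b\<rfloor>})"
  proof
    fix i assume "i \<in> grid_index Q N"
    then obtain z where z: "z \<in> Q" "i = (\<lambda>j. \<lfloor>real N * z $ j\<rfloor>)" by (auto simp: grid_index_def)
    have bd: "- (real N * b) \<le> real N * z $ j \<and> real N * z $ j \<le> real N * b" for j
    proof -
      have "\<bar>z $ j\<bar> \<le> b" using b[OF z(1)] component_le_norm_cart order_trans by blast
      then have "real N * \<bar>z $ j\<bar> \<le> real N * b" by (intro mult_left_mono) auto
      then have "\<bar>real N * z $ j\<bar> \<le> real N * b" by (simp add: abs_mult)
      then show ?thesis by linarith
    qed
    then show "i \<in> Pi UNIV (\<lambda>_. {\<lfloor>- (real N * b)\<rfloor>..\<lfloor>real N * b\<rfloor>})"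
      unfolding z(2) by (auto intro!: floor_mono bd[THEN conjunct1] bd[THEN conjunct2])
  qed
  moreover have "finite (Pi (UNIV::'n set) (\<lambda>_. {\<lfloor>- (real N * b)\<rfloor>..\<lfloor>real N * b\<rfloor>}))"
    using finite_PiE[of UNIV "\<lambda>_::'n. {\<lfloor>- (real N * b)\<rfloor>..\<lfloor>real N * b\<rfloor>}"] by (simp add: PiE_UNIV_domain)
  ultimately show ?thesis by (rule finite_subset)
qed

lemma convex_grid_cell: "convex Q \<Longrightarrow> convex (grid_cell Q N i)"
proof -
  assume Q: "convex Q"
  have "grid_cell Q N i = Q \<inter> (\<Inter>j. {z. z $ j \<in> {t. of_int (i j) \<le> real N * t \<and> real N * t < of_int (i j) + 1}})"
    by (auto simp: grid_cell_def)
  moreover have "convex {z::real^'a. z $ j \<in> {t. of_int (i j) \<le> real N * t \<and> real N * t < of_int (i j) + 1}}" for j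
  proof -
    have "convex {t. of_int (i j) \<le> real N * t \<and> real N * t < of_int (i j) + 1}"
    proof (rule convexI)
      fix x y u v :: real
      assume h: "x \<in> {t. of_int (i j) \<le> real N * t \<and> real N * t < of_int (i j) + 1}"
         "y \<in> {t. of_int (i j) \<le> real N * t \<and> real N * t < of_int (i j) + 1}" "0 \<le> u" "0 \<le> v" "u + v = 1"
      have e: "real N * (u *\<^sub>R x + v *\<^sub>R y) = u *\<^sub>R (real N * x) + v *\<^sub>R (real N * y)" by (simp add: algebra_simps)
      have "u *\<^sub>R (real N * x) + v *\<^sub>R (real N * y) \<in> {of_int (i j)..<of_int (i j) + 1}"
        by (rule convexD) (use h in auto)
      then show "u *\<^sub>R x + v *\<^sub>R y \<in> {t. of_int (i j) \<le> real N * t \<and> real N * t < of_int (i j) + 1}"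
        unfolding mem_Collect_eq e by simp
    qed
    from convex_linear_vimage[OF bounded_linear.linear[OF bounded_linear_vec_nth[of j]] this]
    show ?thesis by (simp add: vimage_def)
  qed
  ultimately show ?thesis using Q by (auto intro!: convex_Int convex_INT)
qed

lemma borel_grid_cell [measurable]: "Q \<in> sets borel \<Longrightarrow> grid_cell Q N i \<in> sets borel"
proof -
  assume [measurable]: "Q \<in> sets borel"
  have "grid_cell Q N i = Q \<inter> (\<Inter>j\<in>UNIV. {z. of_int (i j) \<le> real N * z $ j \<and> real N * z $ j < of_int (i j) + 1})"
    by (auto simp: grid_cell_def)
  also have "\<dots> \<in> sets borel"
    by (intro sets.Int sets.finite_INT) auto
  finally show ?thesis .
qed

lemma diameter_grid_cell:
  fixes z \<zeta> :: "real ^ 'n::finite"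
  assumes "z \<in> grid_cell Q N i" "\<zeta> \<in> grid_cell Q N i" "N > 0"
  shows "norm (z - \<zeta>) \<le> real CARD('n) / real N"
proof -
  have "norm (z - \<zeta>) \<le> (\<Sum>j\<in>UNIV. \<bar>(z - \<zeta>) $ j\<bar>)" by (rule norm_le_l1_cart)
  also have "\<dots> \<le> (\<Sum>j\<in>(UNIV::'n set). 1 / real N)"
  proof (rule sum_mono)
    fix j
    have "\<bar>real N * z $ j - real N * \<zeta> $ j\<bar> \<le> 1"
    proof -
      have "of_int (i j) \<le> real N * z $ j" "real N * z $ j < of_int (i j) + 1"
        "of_int (i j) \<le> real N * \<zeta> $ j" "real N * \<zeta> $ j < of_int (i j) + 1"
        using assms by (auto simp: grid_cell_def)
      then show ?thesis by linarith
    qed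
    then have "real N * \<bar>(z - \<zeta>) $ j\<bar> \<le> 1" by (simp add: right_diff_distrib[symmetric] abs_mult)
    then show "\<bar>(z - \<zeta>) $ j\<bar> \<le> 1 / real N" using assms(3) by (simp add: field_simps)
  qed
  finally show ?thesis by simp
qed

text \<open>The quantitative core of Rellich's theorem: up to \<open>1 / N\<close> times the
  gradient, the L^1 norm is controlled by finitely many linear functionals, the integrals over the
  cells. Half-open cells partition \<open>Q\<close> exactly and inherit its convexity.\<close>

theorem grid_poincare:
  fixes f :: "real ^ 'n::finite \<Rightarrow> real"
  assumes C: "C_on 1 \<Omega> f" and Q: "compact Q" "convex Q" "Q \<subseteq> \<Omega>" and N: "N > 0"
  shows "(\<integral>\<^sup>+z\<in>Q. ennreal \<bar>f z\<bar> \<partial>lborel) \<le>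
    ennreal (real CARD('n) / real N * 2 ^ CARD('n)) * (\<integral>\<^sup>+z\<in>Q. ennreal (norm (grad f z)) \<partial>lborel)
    + (\<Sum>i\<in>grid_index Q N. ennreal \<bar>LINT z:grid_cell Q N i|lborel. f z\<bar>)"
proof -
  have Qb[measurable]: "Q \<in> sets borel" using Q(1) by (simp add: compact_imp_closed)
  have fin: "finite (grid_index Q N)" using Q(1) by (simp add: finite_grid_index compact_imp_bounded)
  have split: "(\<integral>\<^sup>+z\<in>Q. h z \<partial>lborel) = (\<Sum>i\<in>grid_index Q N. \<integral>\<^sup>+z\<in>grid_cell Q N i. h z \<partial>lborel)"
    if [measurable]: "(\<lambda>z. h z * indicator Q z) \<in> borel_measurable borel" for h :: "real ^ 'n \<Rightarrow> ennreal"
  proof -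
    have m: "(\<lambda>z. h z * indicator (grid_cell Q N i) z) \<in> borel_measurable borel" for i
    proof -
      have "(\<lambda>z. h z * indicator Q z * indicator (grid_cell Q N i) z) \<in> borel_measurable borel" by measurable
      also have "(\<lambda>z. h z * indicator Q z * indicator (grid_cell Q N i) z) = (\<lambda>z. h z * indicator (grid_cell Q N i) z)"
        by (auto simp: fun_eq_iff indicator_def grid_cell_def)
      finally show ?thesis .
    qed
    have "h z * indicator Q z = (\<Sum>i\<in>grid_index Q N. h z * indicator (grid_cell Q N i) z)" for z
    proof (cases "z \<in> Q")
      case True
      let ?i = "\<lambda>j. \<lfloor>real N * z $ j\<rfloor>"
      have "(\<Sum>i\<in>grid_index Q N. h z * indicator (grid_cell Q N i) z) = (\<Sum>i\<in>grid_index Q N. if i = ?i then h z else 0)"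
        using True by (intro sum.cong) (auto simp: indicator_def mem_grid_cell)
      then show ?thesis using True fin by (simp add: grid_index_def)
    qed (auto simp: indicator_def mem_grid_cell)
    then show ?thesis using m by (simp add: nn_integral_sum)
  qed
  have m1: "(\<lambda>z. ennreal \<bar>f z\<bar> * indicator Q z) \<in> borel_measurable borel"
  proof -
    have "(\<lambda>z. indicator Q z *\<^sub>R \<bar>f z\<bar>) \<in> borel_measurable borel"
      by (intro borel_measurable_continuous_on_indicator Qb continuous_intros continuous_on_subset[OF C_on_imp_continuous_on[OF C] Q(3)])
    then have "(\<lambda>z. ennreal (indicator Q z *\<^sub>R \<bar>f z\<bar>)) \<in> borel_measurable borel" by measurable
    also have "(\<lambda>z. ennreal (indicator Q z *\<^sub>R \<bar>f z\<bar>)) = (\<lambda>z. ennreal \<bar>f z\<bar> * indicator Q z)" by (auto simp: indicator_def)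
    finally show ?thesis .
  qed
  have m2: "(\<lambda>z. ennreal (norm (grad f z)) * indicator Q z) \<in> borel_measurable borel"
  proof -
    have "(\<lambda>z. indicator Q z *\<^sub>R norm (grad f z)) \<in> borel_measurable borel"
      by (intro borel_measurable_continuous_on_indicator Qb continuous_intros continuous_on_subset[OF continuous_on_grad[of 0] Q(3)])
         (use C in simp)
    then have "(\<lambda>z. ennreal (indicator Q z *\<^sub>R norm (grad f z))) \<in> borel_measurable borel" by measurable
    also have "(\<lambda>z. ennreal (indicator Q z *\<^sub>R norm (grad f z))) = (\<lambda>z. ennreal (norm (grad f z)) * indicator Q z)" by (auto simp: indicator_def)
    finally show ?thesis .
  qed
  have "(\<integral>\<^sup>+z\<in>Q. ennreal \<bar>f z\<bar> \<partial>lborel) = (\<Sum>i\<in>grid_index Q N. \<integral>\<^sup>+z\<in>grid_cell Q N i. ennreal \<bar>f z\<bar> \<partial>lborel)"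
    by (rule split[OF m1])
  also have "\<dots> \<le> (\<Sum>i\<in>grid_index Q N. ennreal (real CARD('n) / real N * 2 ^ CARD('n)) *
      (\<integral>\<^sup>+z\<in>grid_cell Q N i. ennreal (norm (grad f z)) \<partial>lborel) + ennreal \<bar>LINT z:grid_cell Q N i|lborel. f z\<bar>)"
    by (intro sum_mono poincare_convex[OF C _ _ _ Q(1,3)] convex_grid_cell Q(2) borel_grid_cell Qb)
       (auto simp: grid_cell_def intro: diameter_grid_cell[OF _ _ N, unfolded grid_cell_def])
  also have "\<dots> = ennreal (real CARD('n) / real N * 2 ^ CARD('n)) * (\<integral>\<^sup>+z\<in>Q. ennreal (norm (grad f z)) \<partial>lborel)
    + (\<Sum>i\<in>grid_index Q N. ennreal \<bar>LINT z:grid_cell Q N i|lborel. f z\<bar>)"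
    unfolding split[OF m2] by (simp add: sum.distrib sum_distrib_left)
  finally show ?thesis .
qed

section \<open>Transport along the leaves\<close>

lemma C_on_affine_compose:
  fixes f :: "'a::real_normed_vector \<Rightarrow> 'b::real_normed_vector"
  assumes L: "bounded_linear L" and S: "open S" "\<And>x. x \<in> S \<Longrightarrow> c + L x \<in> T" and T: "open T"
  shows "C_on k T f \<Longrightarrow> C_on k S (\<lambda>x. f (c + L x))"
proof (induction k arbitrary: f)
  case 0
  have "continuous_on S (\<lambda>x. c + L x)"
    using L by (intro continuous_on_add continuous_on_const linear_continuous_on)
  then show ?case using 0 S(2) by (auto intro!: continuous_on_compose2[of T f])
next
  case (Suc k)
  show ?case
  proof (rule C_on_SucI[OF S(1), where f'="\<lambda>x v. frechet_derivative f (at (c + L x)) (L v)"])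
    fix x assume "x \<in> S"
    have "((\<lambda>x. c + L x) has_derivative L) (at x)"
      using has_derivative_add[OF has_derivative_const bounded_linear_imp_has_derivative[OF L], of c] by simp
    from has_derivative_compose[OF this C_on_has_derivative[OF Suc.prems S(2)[OF \<open>x \<in> S\<close>]]]
    show "((\<lambda>x. f (c + L x)) has_derivative (\<lambda>v. frechet_derivative f (at (c + L x)) (L v))) (at x)" .
  next
    fix v
    show "C_on k S (\<lambda>x. frechet_derivative f (at (c + L x)) (L v))"
      by (rule Suc.IH[of "\<lambda>y. frechet_derivative f (at y) (L v)"]) (use Suc.prems in simp)
  qed
qed

lemma flatexp_nonneg: "flatexp n t \<ge> 0"
  by (simp add: flatexp_def)

lemma flatexp_0_mono: "s \<le> t \<Longrightarrow> flatexp 0 s \<le> flatexp 0 t"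
  by (auto simp: flatexp_def)

lemma flatexp_0_pos: "t > 0 \<Longrightarrow> flatexp 0 t > 0"
  by (auto simp: flatexp_def)

lemma DERIV_flat_0: "(flatexp 0 has_real_derivative flatexp 2 t) (at t)"
  using flatexp_has_derivative[of 0 t] by (simp add: has_field_derivative_def mult_commute_abs numeral_2_eq_2)

lemma DERIV_along_line:
  fixes f :: "real ^ 'n::finite \<Rightarrow> real"
  assumes "f differentiable (at z)"
  shows "((\<lambda>h. f (z + h *\<^sub>R v)) has_real_derivative grad f z \<bullet> v) (at 0)"
proof -
  have "(f has_derivative (\<lambda>w. grad f z \<bullet> w)) (at (z + 0 *\<^sub>R v))"
    using assms frechet_derivative_eq_grad[OF assms] by (metis frechet_derivative_works pth_1 scaleR_zero_left add.right_neutral ext)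
  then have "((\<lambda>h. f (z + h *\<^sub>R v)) has_derivative (\<lambda>h. grad f z \<bullet> (h *\<^sub>R v))) (at 0)"
    by (intro has_derivative_compose[where g=f and f="\<lambda>h. z + h *\<^sub>R v" and f'="\<lambda>h. h *\<^sub>R v" and g'="\<lambda>w. grad f z \<bullet> w"])
       (auto intro!: derivative_eq_intros)
  then show ?thesis by (simp add: has_field_derivative_def mult_commute_abs)
qed

text \<open>The local situation at a point \<open>a\<close>: a cube of half-width \<open>h\<close>,
  and coefficients \<open>B k j\<close> meant to express the derivative in a direction
  \<open>j \<in> J\<close> by those in directions \<open>k \<in> - J\<close>. One derivative of
  \<open>B\<close> enters in the divergence of the transport field and in the equation for the
  gradient.\<close>

locale leaf_chart =
  fixes \<Omega> :: "(real ^ 'n::finite) set" and a :: "real ^ 'n" and h :: real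
    and J :: "'n set" and B :: "'n \<Rightarrow> 'n \<Rightarrow> real ^ 'n \<Rightarrow> real"
  assumes open_\<Omega>: "open \<Omega>" and h_pos: "h > 0"
    and Q_sub: "cbox (a - (\<chi> i. h)) (a + (\<chi> i. h)) \<subseteq> \<Omega>"
    and B_C1: "C_on 1 \<Omega> (B k j)"
begin

definition Q :: "(real ^ 'n) set" where "Q = cbox (a - (\<chi> i. h)) (a + (\<chi> i. h))"

lemma mem_Q: "z \<in> Q \<longleftrightarrow> (\<forall>i. \<bar>z $ i - a $ i\<bar> \<le> h)"
  unfolding Q_def mem_box_cart by (auto simp: abs_le_iff algebra_simps)

lemma Q_props: "compact Q" "convex Q" "Q \<subseteq> \<Omega>"
  using Q_sub by (auto simp: Q_def)

definition dist2 :: "'n set \<Rightarrow> real ^ 'n \<Rightarrow> real" where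
  "dist2 I z = (\<Sum>i\<in>I. (z $ i - a $ i)\<^sup>2)"

lemma component_le_dist2: "i \<in> I \<Longrightarrow> (z $ i - a $ i)\<^sup>2 \<le> dist2 I z"
  unfolding dist2_def by (rule member_le_sum) auto

lemma C_on_dist2: "open S \<Longrightarrow> C_on k S (dist2 I)"
  unfolding dist2_def[abs_def] power2_eq_square
  by (intro C_on_sum C_on_mult C_on_diff C_on_const C_on_bounded_linear bounded_linear_vec_nth)

text \<open>A homotopy from the freezing of the \<open>J\<close> coordinates at their values in
  \<open>a\<close>, at \<open>s = 0\<close>, to the identity, at \<open>s = 1\<close>.\<close>

definition slide :: "real \<Rightarrow> real ^ 'n \<Rightarrow> real ^ 'n" where
  "slide s z = (\<chi> i. if i \<in> J then a $ i + s * (z $ i - a $ i) else z $ i)"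

lemma slide_in_Q: "z \<in> Q \<Longrightarrow> 0 \<le> s \<Longrightarrow> s \<le> 1 \<Longrightarrow> slide s z \<in> Q"
  unfolding mem_Q slide_def by (auto simp: abs_mult) (meson abs_ge_zero mult_left_le_one_le order_trans)

lemma slide_1 [simp]: "slide 1 z = z"
  by (simp add: slide_def vec_eq_iff)

text \<open>A ball of radius \<open>r\<close> in the \<open>J\<close> directions times a ball of
  radius \<open>\<rho>\<close> in the others. Round factors make cut-offs smooth functions of
  \<open>dist2\<close>; separate radii allow \<open>r\<close> to be so small against
  \<open>\<rho>\<close> that transport over the extent in the \<open>J\<close> directions does not
  cross the plaque.\<close>

definition plaque :: "real \<Rightarrow> real \<Rightarrow> (real ^ 'n) set" where
  "plaque r \<rho> = {z. dist2 J z \<le> r\<^sup>2 \<and> dist2 (- J) z \<le> \<rho>\<^sup>2}"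

lemma plaque_component: "z \<in> plaque r \<rho> \<Longrightarrow> 0 \<le> r \<Longrightarrow> 0 \<le> \<rho> \<Longrightarrow> \<bar>z $ i - a $ i\<bar> \<le> (if i \<in> J then r else \<rho>)"
  using component_le_dist2[of i J z] component_le_dist2[of i "-J" z]
  by (auto simp: plaque_def intro!: abs_le_square_iff[THEN iffD2] power2_le_imp_le[of "\<bar>z $ i - a $ i\<bar>"])

lemma plaque_sub_Q: "0 \<le> r \<Longrightarrow> r \<le> h \<Longrightarrow> 0 \<le> \<rho> \<Longrightarrow> \<rho> \<le> h \<Longrightarrow> plaque r \<rho> \<subseteq> Q"
proof
  fix z assume "0 \<le> r" "r \<le> h" "0 \<le> \<rho>" "\<rho> \<le> h" "z \<in> plaque r \<rho>"
  then have "\<bar>z $ i - a $ i\<bar> \<le> h" for i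
    using plaque_component[of z r \<rho> i] by (auto split: if_splits)
  then show "z \<in> Q" by (simp add: mem_Q)
qed

lemma closed_plaque: "closed (plaque r \<rho>)"
proof -
  have "continuous_on UNIV (dist2 I)" for I
    using C_on_imp_continuous_on[OF C_on_dist2[OF open_UNIV, of 0]] .
  then show ?thesis unfolding plaque_def by (intro closed_Collect_conj closed_Collect_le continuous_on_const)
qed

lemma compact_plaque: "0 \<le> r \<Longrightarrow> r \<le> h \<Longrightarrow> 0 \<le> \<rho> \<Longrightarrow> \<rho> \<le> h \<Longrightarrow> compact (plaque r \<rho>)"
  using compact_Int_closed[OF Q_props(1) closed_plaque[of r \<rho>]] plaque_sub_Q[of r \<rho>] by (simp add: Int_absorb1)

lemma bounded_on_Q:
  assumes "\<And>i j. continuous_on \<Omega> (f i j)"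
  obtains \<beta> where "\<beta> \<ge> 1" "\<And>i j z. z \<in> Q \<Longrightarrow> \<bar>f (i::'n) (j::'n) z\<bar> \<le> (\<beta>::real)"
proof -
  have "\<exists>b. \<forall>z\<in>Q. \<bar>f i j z\<bar> \<le> b" for i j
    using compact_imp_bounded[OF compact_continuous_image[OF continuous_on_subset[OF assms Q_props(3)] Q_props(1)]]
    unfolding bounded_iff by (auto simp: real_norm_def)
  then obtain b where b: "\<And>i j z. z \<in> Q \<Longrightarrow> \<bar>f i j z\<bar> \<le> b i j" by metis
  let ?\<beta> = "Max (insert 1 ((\<lambda>(i, j). b i j) ` UNIV))"
  have "b i j \<le> ?\<beta>" for i j by (rule Max_ge) (auto intro: rev_image_eqI[of "(i, j)"])
  then show ?thesis using that[of ?\<beta>] b by (meson Max_ge finite_imageI finite finite_insert insertI1 order_trans)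
qed

text \<open>The energy \<open>\<integral> w (slide s z) \<phi> s z\<close> satisfies a Gronwall inequality in \<open>s\<close>, because \<open>w \<circ> slide s\<close> solves a transport
  equation in the directions \<open>- J\<close> with velocity at most \<open>O r\<close>, while the support of the cut-off \<open>\<phi> s\<close> shrinks with speed at
  least that. The parameters \<open>c0, c1\<close> allow to run time forwards or backwards.\<close>

lemma transport_energy:
  assumes c: "(c0, c1) = (0, 1) \<or> (c0, c1) = (1, -1)"
    and \<beta>: "\<beta> \<ge> 1" "\<And>k j z. z \<in> Q \<Longrightarrow> \<bar>B k j z\<bar> \<le> \<beta>" "\<And>k j z. z \<in> Q \<Longrightarrow> \<bar>grad (B k j) z $ k\<bar> \<le> \<beta>"
    and \<rho>: "0 < \<rho>" "\<rho> < h" and r: "r = \<rho> / (4 * (real CARD('n))\<^sup>2 * \<beta>)"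
    and w: "C_on 1 \<Omega> w" "\<And>z. z \<in> \<Omega> \<Longrightarrow> w z \<ge> 0" and Lw0: "L \<ge> 0"
    and Lw: "\<And>z j. z \<in> Q \<Longrightarrow> j \<in> J \<Longrightarrow> \<bar>grad w z $ j - (\<Sum>k\<in>- J. B k j z * grad w z $ k)\<bar> \<le> L * w z"
  shows "(LINT z:plaque (r / 2) (\<rho> / 2)|lborel. w (slide (c0 + c1) z)) \<le>
    exp (real CARD('n) * h * (L + real CARD('n) * \<beta>)) / (flatexp 0 (3 * r\<^sup>2 / 4) * flatexp 0 (\<rho>\<^sup>2 / 4)) *
    (LINT z:plaque r \<rho>|lborel. w (slide c0 z))"
proof -
  let ?n = "real CARD('n)"
  have n1: "?n \<ge> 1" by (simp add: Suc_leI)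
  \<comment> \<open>The time \<open>\<sigma>\<close> runs from 0 to 1 in either case, while
    \<open>s \<sigma>\<close> runs upwards or downwards.\<close>
  define s where "s \<sigma> = c0 + c1 * \<sigma>" for \<sigma> :: real
  have s01: "0 \<le> s \<sigma>" "s \<sigma> \<le> 1" if "\<sigma> \<in> {0..1}" for \<sigma> using c that by (auto simp: s_def)
  have c1: "\<bar>c1\<bar> = 1" using c by auto
  have r0: "0 < r" using \<rho> \<beta> n1 unfolding r by (intro divide_pos_pos mult_pos_pos) auto
  have r\<rho>: "r \<le> \<rho>"
  proof -
    define X where "X = 4 * ?n\<^sup>2 * \<beta>"
    have "X \<ge> 1" unfolding X_def using n1 \<beta>(1) mult_mono[of 1 "4 * ?n\<^sup>2" 1 \<beta>] one_le_power[OF n1, of 2] by simp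
    then have "\<rho> / X \<le> \<rho> / 1" using \<rho> by (intro divide_left_mono) auto
    then show ?thesis by (simp add: r X_def)
  qed
  have rh: "r \<le> h" using r\<rho> \<rho> by simp
  \<comment> \<open>Speed at which the squared radius of the cut-off shrinks. At
    \<open>\<sigma> = 1\<close> half of \<open>\<rho>\<^sup>2\<close> is used up, so the cut-off is
    still positive on the plaque with half the radii.\<close>
  define \<kappa> where "\<kappa> = \<rho>\<^sup>2 / 2"
  define \<phi> where "\<phi> \<sigma> z = flatexp 0 (r\<^sup>2 - dist2 J z) * flatexp 0 (\<rho>\<^sup>2 - dist2 (-J) z - \<kappa> * \<sigma>)" for \<sigma> z
  \<comment> \<open>\<open>flatexp 2\<close> is the derivative of \<open>flatexp 0\<close>, so
    \<open>\<psi>\<close> is the derivative of the cut-off with respect to the squared radius in the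
    directions \<open>- J\<close>.\<close>
  define \<psi> where "\<psi> \<sigma> z = flatexp 0 (r\<^sup>2 - dist2 J z) * flatexp 2 (\<rho>\<^sup>2 - dist2 (-J) z - \<kappa> * \<sigma>)" for \<sigma> z
  have \<phi>0: "\<phi> \<sigma> z \<ge> 0" "\<psi> \<sigma> z \<ge> 0" for \<sigma> z by (simp_all add: \<phi>_def \<psi>_def flatexp_nonneg)
  have supp: "z \<in> plaque r \<rho>" if "\<phi> \<sigma> z \<noteq> 0 \<or> \<psi> \<sigma> z \<noteq> 0" "\<sigma> \<ge> 0" for \<sigma> z
  proof -
    have "r\<^sup>2 - dist2 J z > 0" "\<rho>\<^sup>2 - dist2 (-J) z - \<kappa> * \<sigma> > 0"
      using that(1) by (auto simp: \<phi>_def \<psi>_def flatexp_def split: if_splits)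
    moreover have "\<kappa> * \<sigma> \<ge> 0" using that by (simp add: \<kappa>_def)
    ultimately show ?thesis by (simp add: plaque_def)
  qed
  have plQ: "plaque r \<rho> \<subseteq> Q" using plaque_sub_Q r0 rh \<rho> by simp
  define dz where "dz z = (\<chi> i. if i \<in> J then z $ i - a $ i else 0)" for z
  have slide_s: "slide (s \<sigma>) z = slide c0 z + (\<sigma> * c1) *\<^sub>R dz z" for \<sigma> z
    by (auto simp: slide_def s_def dz_def vec_eq_iff algebra_simps)
  have slide\<Omega>: "slide (s \<sigma>) z \<in> \<Omega>" "slide (s \<sigma>) z \<in> Q" if "\<sigma> \<in> {0..1}" "z \<in> Q" for \<sigma> z
    using slide_in_Q[OF that(2)] s01[OF that(1)] Q_props(3) by auto
  define W where "W \<sigma> z = w (slide (s \<sigma>) z)" for \<sigma> z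
  define dW where "dW \<sigma> z = c1 * (grad w (slide (s \<sigma>) z) \<bullet> dz z)" for \<sigma> z
  \<comment> \<open>The transport field: up to the error controlled by \<open>Lw\<close>, the
    derivative of \<open>W\<close> in \<open>\<sigma>\<close> is its derivative along the field with
    components \<open>b k\<close>, \<open>k \<in> - J\<close>. Each term carries a factor
    \<open>z $ j - a $ j\<close>, so on the plaque the speed is of order \<open>r\<close>;
    \<open>db k\<close> is the derivative of \<open>b k\<close> in direction
    \<open>k\<close>.\<close>
  define b where "b k \<sigma> z = c1 * (\<Sum>j\<in>J. (z $ j - a $ j) * B k j (slide (s \<sigma>) z))" for k \<sigma> z
  define db where "db k \<sigma> z = c1 * (\<Sum>j\<in>J. (z $ j - a $ j) * grad (B k j) (slide (s \<sigma>) z) $ k)" for k \<sigma> z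
  have W0: "W \<sigma> z \<ge> 0" if "\<sigma> \<in> {0..1}" "z \<in> Q" for \<sigma> z using w(2) slide\<Omega>[OF that] by (simp add: W_def)
  have cont_if: "continuous_on X (\<lambda>x. if P then f x else g x)"
    if "continuous_on X f" "continuous_on X g" for X :: "'x::topological_space set" and f g :: "'x \<Rightarrow> real" and P
    using that by (cases P) simp_all
  have cont_slide: "continuous_on X (\<lambda>x. slide (s (f x)) (g x))"
    if "continuous_on X f" "continuous_on X g" for X :: "'x::topological_space set" and f g
    unfolding slide_def s_def using that
    by (intro continuous_on_vec_lambda cont_if) (auto intro!: continuous_intros)
  have cont_dist2: "continuous_on UNIV (dist2 I)" for I
    using C_on_imp_continuous_on[OF C_on_dist2[OF open_UNIV, of 0]] .
  have cont_flat: "continuous_on UNIV (flatexp m)" for m using C_on_flat[of 0 m] by simp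
  have cont_\<phi>: "continuous_on X (\<lambda>x. \<phi> (f x) (g x))" "continuous_on X (\<lambda>x. \<psi> (f x) (g x))"
    if "continuous_on X f" "continuous_on X g" for X :: "'x::topological_space set" and f g
    unfolding \<phi>_def \<psi>_def using that
    by (auto intro!: continuous_intros continuous_on_compose2[OF cont_flat] continuous_on_compose2[OF cont_dist2])
  have cont_w: "continuous_on \<Omega> w" using C_on_imp_continuous_on[OF w(1)] .
  have cont_gw: "continuous_on \<Omega> (grad w)" using continuous_on_grad[of 0 \<Omega> w] w(1) by simp
  let ?X = "{0..1} \<times> Q"
  have contX: "continuous_on ?X (\<lambda>x. W (fst x) (snd x))" "continuous_on ?X (\<lambda>x. dW (fst x) (snd x))"
  proof -
    have 1: "continuous_on ?X (\<lambda>x. slide (s (fst x)) (snd x))" by (intro cont_slide continuous_intros)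
    have 2: "(\<lambda>x. slide (s (fst x)) (snd x)) ` ?X \<subseteq> \<Omega>" using slide\<Omega> by auto
    show "continuous_on ?X (\<lambda>x. W (fst x) (snd x))" unfolding W_def
      by (rule continuous_on_compose2[OF cont_w 1 2])
    have "continuous_on ?X (\<lambda>x. dz (snd x))" unfolding dz_def
      by (intro continuous_on_vec_lambda cont_if) (auto intro!: continuous_intros)
    then show "continuous_on ?X (\<lambda>x. dW (fst x) (snd x))" unfolding dW_def
      by (intro continuous_intros continuous_on_compose2[OF cont_gw 1 2])
  qed
  define E where "E \<sigma> = integral Q (\<lambda>z. W \<sigma> z * \<phi> \<sigma> z)" for \<sigma>
  define E' where "E' \<sigma> = integral Q (\<lambda>z. dW \<sigma> z * \<phi> \<sigma> z - W \<sigma> z * (\<kappa> * \<psi> \<sigma> z))" for \<sigma>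
  have contXf: "continuous_on ?X (\<lambda>x. dW (fst x) (snd x) * \<phi> (fst x) (snd x) - W (fst x) (snd x) * (\<kappa> * \<psi> (fst x) (snd x)))"
    by (intro continuous_intros contX cont_\<phi>)
  have contXe: "continuous_on ?X (\<lambda>x. W (fst x) (snd x) * \<phi> (fst x) (snd x))"
    by (intro continuous_intros contX cont_\<phi>)
  have contz: "continuous_on Q (F \<sigma>)" if "continuous_on ?X (\<lambda>x. F (fst x) (snd x))" "\<sigma> \<in> {0..1}" for F :: "real \<Rightarrow> real ^ 'n \<Rightarrow> real" and \<sigma>
  proof -
    have c: "continuous_on Q (\<lambda>z. (\<sigma>, z))" by (intro continuous_intros)
    have "(\<lambda>z. (\<sigma>, z)) ` Q \<subseteq> ?X" using that(2) by auto
    from continuous_on_compose2[OF that(1) c this] show ?thesis by simp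
  qed
  have intQ: "f integrable_on Q" if "continuous_on Q f" for f :: "real ^ 'n \<Rightarrow> real"
    using that unfolding Q_def by (rule integrable_continuous)
  \<comment> \<open>The domain of integration is the fixed cube and all motion sits in the cut-off,
    so differentiation under the integral sign produces no boundary terms.\<close>
  have derE: "(E has_vector_derivative E' \<sigma>) (at \<sigma> within {0..1})" if \<sigma>: "\<sigma> \<in> {0..1}" for \<sigma>
    unfolding E_def E'_def Q_def
  proof (rule leibniz_rule_vector_derivative)
    fix \<tau> z assume "\<tau> \<in> {0..1::real}" and z: "z \<in> cbox (a - (\<chi> i. h)) (a + (\<chi> i. h))"
    then have in\<Omega>: "slide (s \<tau>) z \<in> \<Omega>" using slide\<Omega> by (simp add: Q_def)
    have "((\<lambda>\<tau>. w (slide (s \<tau>) z)) has_derivative (\<lambda>k. grad w (slide (s \<tau>) z) \<bullet> ((k * c1) *\<^sub>R dz z))) (at \<tau> within {0..1})"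
      by (rule has_derivative_compose[where g=w and f="\<lambda>\<tau>. slide (s \<tau>) z" and f'="\<lambda>k. (k * c1) *\<^sub>R dz z" and g'="\<lambda>v. grad w (slide (s \<tau>) z) \<bullet> v"])
         (use has_derivative_grad[of 0 \<Omega> w, OF _ in\<Omega>] w(1) in \<open>auto simp: slide_s intro!: derivative_eq_intros\<close>)
    then have 1: "((\<lambda>\<tau>. W \<tau> z) has_real_derivative dW \<tau> z) (at \<tau> within {0..1})"
      by (simp add: W_def dW_def has_field_derivative_def mult_commute_abs mult.assoc)
    have "((\<lambda>\<tau>. flatexp 0 (\<rho>\<^sup>2 - dist2 (-J) z - \<kappa> * \<tau>)) has_real_derivative flatexp 2 (\<rho>\<^sup>2 - dist2 (-J) z - \<kappa> * \<tau>) * (- \<kappa>)) (at \<tau> within {0..1})"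
      by (rule DERIV_chain2[OF DERIV_flat_0]) (auto intro!: derivative_eq_intros)
    then have 2: "((\<lambda>\<tau>. \<phi> \<tau> z) has_real_derivative - \<kappa> * \<psi> \<tau> z) (at \<tau> within {0..1})"
      unfolding \<phi>_def \<psi>_def by (auto intro!: derivative_eq_intros)
    show "((\<lambda>\<tau>. W \<tau> z * \<phi> \<tau> z) has_vector_derivative dW \<tau> z * \<phi> \<tau> z - W \<tau> z * (\<kappa> * \<psi> \<tau> z)) (at \<tau> within {0..1})"
      using DERIV_mult[OF 1 2] by (simp add: has_real_derivative_iff_has_vector_derivative[symmetric] algebra_simps)
  next
    fix \<tau> assume "\<tau> \<in> {0..1::real}"
    then show "(\<lambda>z. W \<tau> z * \<phi> \<tau> z) integrable_on cbox (a - (\<chi> i. h)) (a + (\<chi> i. h))"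
      using intQ[OF contz[OF contXe]] by (simp add: Q_def)
  next
    show "continuous_on ({0..1} \<times> cbox (a - (\<chi> i. h)) (a + (\<chi> i. h))) (\<lambda>(\<tau>, z). dW \<tau> z * \<phi> \<tau> z - W \<tau> z * (\<kappa> * \<psi> \<tau> z))"
      using contXf by (simp add: case_prod_unfold Q_def)
  qed (use \<sigma> in auto)
  \<comment> \<open>The Gronwall constant: the error term contributes \<open>L\<close> and the
    divergence of the transport field \<open>?n * \<beta>\<close>, each multiplied by at most
    \<open>?n\<close> directions of extent \<open>h\<close>.\<close>
  define M where "M = ?n * h * (L + ?n * \<beta>)"
  have E'_le: "E' \<sigma> \<le> M * E \<sigma>" if \<sigma>: "\<sigma> \<in> {0..1}" for \<sigma>
  proof -
    \<comment> \<open>The flux of the energy. It vanishes off the plaque, so its divergence in the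
      directions \<open>- J\<close> integrates to zero and may be added to the derivative of
      \<open>E\<close>.\<close>
    define \<Theta> where "\<Theta> k z = b k \<sigma> z * W \<sigma> z * \<phi> \<sigma> z" for k z
    have affine: "slide (s \<sigma>) z = slide (s \<sigma>) 0 + (\<chi> i. (if i \<in> J then s \<sigma> else 1) * z $ i)" for z
      by (auto simp: slide_def vec_eq_iff algebra_simps)
    have blin: "bounded_linear (\<lambda>z. \<chi> i. (if i \<in> J then s \<sigma> else 1) * z $ i)"
      by (intro linear_linear[THEN iffD2] linearI) (auto simp: vec_eq_iff algebra_simps)
    let ?\<Omega>' = "interior Q"
    have Cslide: "C_on 1 ?\<Omega>' (\<lambda>z. f (slide (s \<sigma>) z))" if "C_on 1 \<Omega> f" for f :: "real ^ 'n \<Rightarrow> real"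
    proof -
      have "C_on 1 ?\<Omega>' (\<lambda>z. f (slide (s \<sigma>) 0 + (\<chi> i. (if i \<in> J then s \<sigma> else 1) * z $ i)))"
      proof (rule C_on_affine_compose[OF blin open_interior _ open_\<Omega> that])
        fix z assume "z \<in> interior Q"
        then have "slide (s \<sigma>) z \<in> \<Omega>" using slide\<Omega>[OF \<sigma>] interior_subset by blast
        then show "slide (s \<sigma>) 0 + (\<chi> i. (if i \<in> J then s \<sigma> else 1) * z $ i) \<in> \<Omega>" by (simp only: affine[of z, symmetric])
      qed
      then show ?thesis by (simp only: affine[symmetric])
    qed
    have C\<Theta>: "C_on 1 ?\<Omega>' (\<Theta> k)" for k
      unfolding \<Theta>_def[abs_def] W_def b_def \<phi>_def
      by (intro C_on_mult C_on_const C_on_sum C_on_diff Cslide w(1) B_C1 C_on_compose_real[OF _ open_UNIV _ C_on_flat]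
          C_on_dist2 C_on_bounded_linear bounded_linear_vec_nth open_interior) auto
    \<comment> \<open>The strict inequality \<open>\<rho> < h\<close> keeps the plaque away from the
      boundary of the cube, as the extension of the flux by zero requires.\<close>
    have pl_int: "plaque r \<rho> \<subseteq> ?\<Omega>'"
    proof -
      have "plaque r \<rho> \<subseteq> box (a - (\<chi> i. h)) (a + (\<chi> i. h))"
      proof
        fix z assume z: "z \<in> plaque r \<rho>"
        have "r < h" using r\<rho> \<rho> by simp
        then have "\<bar>z $ i - a $ i\<bar> < h" for i
          using plaque_component[OF z, of i] r0 \<rho> by (auto split: if_splits)
        then show "z \<in> box (a - (\<chi> i. h)) (a + (\<chi> i. h))"
          by (simp add: mem_box_cart abs_less_iff) (smt (verit))
      qed
      then show ?thesis by (simp add: Q_def interior_cbox)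
    qed
    have plc: "compact (plaque r \<rho>)" using compact_plaque r0 rh \<rho> by simp
    have off: "\<Theta> k z = 0" if "z \<notin> plaque r \<rho>" for k z
      using supp[of \<sigma> z] that \<sigma> by (auto simp: \<Theta>_def)
    have CU: "C_on 1 UNIV (\<Theta> k)" for k
      by (rule C_on_zero_extension[OF open_interior C\<Theta> plc pl_int off])
    have div0: "integral Q (\<lambda>z. frechet_derivative (\<Theta> k) (at z) (axis k 1)) = 0" for k
    proof -
      have "continuous_on UNIV (\<lambda>z. frechet_derivative (\<Theta> k) (at z) (axis k 1))" using CU by simp
      moreover have "frechet_derivative (\<Theta> k) (at z) (axis k 1) = 0" if "z \<notin> plaque r \<rho>" for z
      proof -
        have "((\<lambda>x. 0) has_derivative frechet_derivative (\<Theta> k) (at z)) (at z)"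
          by (rule has_derivative_transform_within_open[of "\<Theta> k" _ _ _ "- plaque r \<rho>"])
             (use that off CU closed_plaque in \<open>auto simp: open_Compl frechet_derivative_works\<close>)
        then show ?thesis using has_derivative_unique[OF _ has_derivative_const, of 0 _ z] by fastforce
      qed
      ultimately have "integral Q (\<lambda>z. frechet_derivative (\<Theta> k) (at z) (axis k 1)) = integral\<^sup>L lborel (\<lambda>z. frechet_derivative (\<Theta> k) (at z) (axis k 1))"
        using integral_zero_outside_compact(2)[OF _ plc] plQ unfolding Q_def by blast
      also have "\<dots> = 0" by (rule integral_derivative_compact_support[OF CU plc off])
      finally show ?thesis .
    qed
    have divergence: "frechet_derivative (\<Theta> k) (at z) (axis k 1) =
        b k \<sigma> z * grad w (slide (s \<sigma>) z) $ k * \<phi> \<sigma> z + db k \<sigma> z * W \<sigma> z * \<phi> \<sigma> z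
        - W \<sigma> z * \<psi> \<sigma> z * (2 * b k \<sigma> z * (z $ k - a $ k))" if z: "z \<in> Q" and k: "k \<in> - J" for k z
    proof -
      let ?e = "axis k 1 :: real ^ 'n"
      \<comment> \<open>In a direction outside \<open>J\<close> sliding commutes with translation,
        so the partial derivatives of \<open>W\<close> in these directions are those of
        \<open>w\<close> at the slid point.\<close>
      have sl: "slide (s \<sigma>) (z + u *\<^sub>R ?e) = slide (s \<sigma>) z + u *\<^sub>R ?e" for u
        using k by (auto simp: slide_def vec_eq_iff axis_def)
      have comp: "(z + u *\<^sub>R ?e) $ j = z $ j" if "j \<in> J" for u j using that k by (auto simp: axis_def)
      have dJ: "dist2 J (z + u *\<^sub>R ?e) = dist2 J z" for u
        unfolding dist2_def by (intro sum.cong refl) (simp only: comp)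
      have dK: "dist2 (-J) (z + u *\<^sub>R ?e) = dist2 (-J) z + 2 * u * (z $ k - a $ k) + u\<^sup>2" for u
      proof -
        let ?R = "\<lambda>y. \<Sum>i\<in>- J - {k}. (y $ i - a $ i)\<^sup>2"
        have split: "dist2 (-J) y = (y $ k - a $ k)\<^sup>2 + ?R y" for y
          unfolding dist2_def using k by (simp add: sum.remove)
        have R: "?R (z + u *\<^sub>R ?e) = ?R z"
          by (intro sum.cong refl) (auto simp: axis_def)
        have "(z + u *\<^sub>R ?e) $ k = z $ k + u" by simp
        then have "dist2 (-J) (z + u *\<^sub>R ?e) = (z $ k + u - a $ k)\<^sup>2 + ?R z"
          unfolding split R by (simp only:)
        also have "(z $ k + u - a $ k)\<^sup>2 = (z $ k - a $ k)\<^sup>2 + 2 * u * (z $ k - a $ k) + u\<^sup>2"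
          by (simp add: power2_eq_square algebra_simps)
        finally show ?thesis unfolding split by (simp only: add_ac)
      qed
      have dif: "f differentiable (at (slide (s \<sigma>) z))" if "C_on 1 \<Omega> f" for f :: "real ^ 'n \<Rightarrow> real"
        using that slide\<Omega>[OF \<sigma> z] by simp
      have 1: "((\<lambda>u. W \<sigma> (z + u *\<^sub>R ?e)) has_real_derivative grad w (slide (s \<sigma>) z) $ k) (at 0)"
        unfolding W_def sl using DERIV_along_line[OF dif[OF w(1)], where v="?e"] by (simp add: inner_axis)
      have "((\<lambda>u. B k j (slide (s \<sigma>) z + u *\<^sub>R ?e)) has_real_derivative grad (B k j) (slide (s \<sigma>) z) $ k) (at 0)" for j
        using DERIV_along_line[OF dif[OF B_C1], where v="?e"] by (simp add: inner_axis)
      then have 2: "((\<lambda>u. b k \<sigma> (z + u *\<^sub>R ?e)) has_real_derivative db k \<sigma> z) (at 0)"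
      proof -
        have "b k \<sigma> (z + u *\<^sub>R ?e) = c1 * (\<Sum>j\<in>J. (z $ j - a $ j) * B k j (slide (s \<sigma>) z + u *\<^sub>R ?e))" for u
          unfolding b_def sl by (intro arg_cong[where f="times c1"] sum.cong refl) (simp only: comp)
        then show ?thesis unfolding db_def
          using \<open>\<And>j. ((\<lambda>u. B k j (slide (s \<sigma>) z + u *\<^sub>R ?e)) has_real_derivative grad (B k j) (slide (s \<sigma>) z) $ k) (at 0)\<close>
          by (simp only:) (intro DERIV_cmult DERIV_sum)
      qed
      have "((\<lambda>u. flatexp 0 (\<rho>\<^sup>2 - dist2 (-J) (z + u *\<^sub>R ?e) - \<kappa> * \<sigma>)) has_real_derivative
         flatexp 2 (\<rho>\<^sup>2 - dist2 (-J) (z + 0 *\<^sub>R ?e) - \<kappa> * \<sigma>) * (- (2 * (z $ k - a $ k)))) (at 0)"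
        by (rule DERIV_chain2[OF DERIV_flat_0]) (unfold dK, auto intro!: derivative_eq_intros)
      then have 3: "((\<lambda>u. \<phi> \<sigma> (z + u *\<^sub>R ?e)) has_real_derivative - (2 * (z $ k - a $ k)) * \<psi> \<sigma> z) (at 0)"
        unfolding \<phi>_def \<psi>_def dJ by (auto intro!: derivative_eq_intros)
      have "((\<lambda>u. \<Theta> k (z + u *\<^sub>R ?e)) has_real_derivative
         b k \<sigma> z * grad w (slide (s \<sigma>) z) $ k * \<phi> \<sigma> z + db k \<sigma> z * W \<sigma> z * \<phi> \<sigma> z
        - W \<sigma> z * \<psi> \<sigma> z * (2 * b k \<sigma> z * (z $ k - a $ k))) (at 0)"
        unfolding \<Theta>_def using DERIV_mult[OF DERIV_mult[OF 2 1] 3] by (simp add: algebra_simps)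
      moreover have "((\<lambda>u. \<Theta> k (z + u *\<^sub>R ?e)) has_real_derivative grad (\<Theta> k) z \<bullet> ?e) (at 0)"
        by (rule DERIV_along_line) (use CU[of k] in simp)
      ultimately have "grad (\<Theta> k) z \<bullet> ?e = b k \<sigma> z * grad w (slide (s \<sigma>) z) $ k * \<phi> \<sigma> z + db k \<sigma> z * W \<sigma> z * \<phi> \<sigma> z
        - W \<sigma> z * \<psi> \<sigma> z * (2 * b k \<sigma> z * (z $ k - a $ k))"
        using DERIV_unique by blast
      then show ?thesis by (simp add: grad_def inner_axis)
    qed
    let ?div = "\<lambda>z. \<Sum>k\<in>- J. frechet_derivative (\<Theta> k) (at z) (axis k 1)"
    have cont_div: "continuous_on Q ?div"
    proof (rule continuous_on_sum)
      fix k
      have "continuous_on UNIV (\<lambda>z. frechet_derivative (\<Theta> k) (at z) (axis k 1))" using CU[of k] by simp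
      then show "continuous_on Q (\<lambda>z. frechet_derivative (\<Theta> k) (at z) (axis k 1))" by (rule continuous_on_subset) simp
    qed
    have int_div: "integral Q ?div = 0"
    proof -
      have "integral Q ?div = (\<Sum>k\<in>- J. integral Q (\<lambda>z. frechet_derivative (\<Theta> k) (at z) (axis k 1)))"
      proof (rule integral_sum)
        fix k
        have "continuous_on UNIV (\<lambda>z. frechet_derivative (\<Theta> k) (at z) (axis k 1))" using CU[of k] by simp
        then show "(\<lambda>z. frechet_derivative (\<Theta> k) (at z) (axis k 1)) integrable_on Q"
          by (intro intQ) (rule continuous_on_subset, auto)
      qed auto
      then show ?thesis by (simp add: div0)
    qed
    \<comment> \<open>The first-order terms of \<open>dW\<close> are absorbed by the divergence.
      What the divergence adds at the edge of the cut-off is a multiple of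
      \<open>W * \<psi>\<close>, and the shrinking of the cut-off supplies \<open>- \<kappa>\<close>
      times this product to outweigh it.\<close>
    have pointwise: "dW \<sigma> z * \<phi> \<sigma> z - W \<sigma> z * (\<kappa> * \<psi> \<sigma> z) \<le> ?div z + M * (W \<sigma> z * \<phi> \<sigma> z)" if z: "z \<in> Q" for z
    proof (cases "z \<in> plaque r \<rho>")
      case False
      then have 0: "\<phi> \<sigma> z = 0" "\<psi> \<sigma> z = 0" using supp[of \<sigma> z] \<sigma> by auto
      then have "?div z = 0" by (simp add: divergence[OF z])
      then show ?thesis using 0 by simp
    next
      case True
      let ?y = "slide (s \<sigma>) z"
      have y: "?y \<in> Q" using slide\<Omega>[OF \<sigma> z] by simp
      have zJ: "\<bar>z $ j - a $ j\<bar> \<le> r" if "j \<in> J" for j using plaque_component[OF True, of j] that r0 \<rho> by simp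
      have zK: "\<bar>z $ k - a $ k\<bar> \<le> \<rho>" if "k \<in> - J" for k using plaque_component[OF True, of k] that r0 \<rho> by simp
      have Wz: "W \<sigma> z \<ge> 0" using W0[OF \<sigma> z] .
      have cardJ: "real (card I) \<le> ?n" for I :: "'n set" by (simp add: card_mono)
      have bk: "\<bar>b k \<sigma> z\<bar> \<le> ?n * (r * \<beta>)" for k
      proof -
        have "\<bar>b k \<sigma> z\<bar> \<le> (\<Sum>j\<in>J. \<bar>(z $ j - a $ j) * B k j ?y\<bar>)" unfolding b_def by (simp only: abs_mult[of c1] c1 mult_1 sum_abs)
        also have "\<dots> \<le> (\<Sum>j\<in>J. r * \<beta>)" unfolding abs_mult using zJ \<beta>(2)[OF y] r0 by (intro sum_mono mult_mono) auto
        also have "\<dots> \<le> ?n * (r * \<beta>)" using cardJ[of J] r0 \<beta>(1) by (simp add: mult_right_mono)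
        finally show ?thesis .
      qed
      have dbk: "\<bar>db k \<sigma> z\<bar> \<le> ?n * (h * \<beta>)" for k
      proof -
        have "\<bar>db k \<sigma> z\<bar> \<le> (\<Sum>j\<in>J. \<bar>(z $ j - a $ j) * grad (B k j) ?y $ k\<bar>)" unfolding db_def by (simp only: abs_mult[of c1] c1 mult_1 sum_abs)
        also have "\<dots> \<le> (\<Sum>j\<in>J. h * \<beta>)" unfolding abs_mult using zJ rh \<beta>(3)[OF y] h_pos by (intro sum_mono mult_mono) (auto intro: order_trans)
        also have "\<dots> \<le> ?n * (h * \<beta>)" using cardJ[of J] h_pos \<beta>(1) by (simp add: mult_right_mono)
        finally show ?thesis .
      qed
      have sum_db: "(\<Sum>k\<in>- J. - db k \<sigma> z) \<le> ?n * h * (?n * \<beta>)"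
      proof -
        have "(\<Sum>k\<in>- J. - db k \<sigma> z) \<le> (\<Sum>k\<in>- J. ?n * (h * \<beta>))" using dbk by (intro sum_mono) (auto simp: abs_le_iff)
        also have "\<dots> \<le> ?n * (?n * (h * \<beta>))" using cardJ[of "-J"] h_pos \<beta>(1) by (simp add: mult_right_mono)
        finally show ?thesis by (simp add: mult_ac)
      qed
      \<comment> \<open>Here the ratio of \<open>r\<close> and \<open>\<rho>\<close> is decided: at
        most \<open>?n\<close> directions,
        \<open>\<bar>b k \<sigma> z\<bar> \<le> ?n * (r * \<beta>)\<close> and
        \<open>\<bar>z $ k - a $ k\<bar> \<le> \<rho>\<close> give the bound
        \<open>2 * ?n\<^sup>2 * r * \<beta> * \<rho>\<close>, which is exactly
        \<open>\<kappa>\<close>.\<close>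
      have sum_b: "(\<Sum>k\<in>- J. 2 * b k \<sigma> z * (z $ k - a $ k)) \<le> \<kappa>"
      proof -
        have "(\<Sum>k\<in>- J. 2 * b k \<sigma> z * (z $ k - a $ k)) \<le> (\<Sum>k\<in>- J. 2 * (?n * (r * \<beta>)) * \<rho>)"
        proof (rule sum_mono)
          fix k assume k: "k \<in> - J"
          have "2 * b k \<sigma> z * (z $ k - a $ k) \<le> 2 * (\<bar>b k \<sigma> z\<bar> * \<bar>z $ k - a $ k\<bar>)" by (simp add: abs_mult[symmetric])
          also have "\<dots> \<le> 2 * ((?n * (r * \<beta>)) * \<rho>)" using bk[of k] zK[OF k] r0 \<beta>(1) by (intro mult_left_mono mult_mono) auto
          finally show "2 * b k \<sigma> z * (z $ k - a $ k) \<le> 2 * (?n * (r * \<beta>)) * \<rho>" by simp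
        qed
        also have "\<dots> \<le> ?n * (2 * (?n * (r * \<beta>)) * \<rho>)" using cardJ[of "-J"] r0 \<rho> \<beta>(1) by (simp add: mult_right_mono)
        also have "\<dots> = \<kappa>" unfolding \<kappa>_def r using n1 \<beta>(1) by (simp add: field_simps power2_eq_square)
        finally show ?thesis .
      qed
      have dWle: "dW \<sigma> z \<le> (\<Sum>k\<in>- J. b k \<sigma> z * grad w ?y $ k) + ?n * h * L * W \<sigma> z"
      proof -
        have "dW \<sigma> z = c1 * (\<Sum>j\<in>J. (z $ j - a $ j) * grad w ?y $ j)"
        proof -
          have "grad w ?y \<bullet> dz z = (\<Sum>j\<in>UNIV. if j \<in> J then (z $ j - a $ j) * grad w ?y $ j else 0)"
            unfolding inner_vec_def dz_def by (intro sum.cong) auto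
          also have "\<dots> = (\<Sum>j\<in>J. (z $ j - a $ j) * grad w ?y $ j)" by (subst sum.inter_filter[symmetric]) auto
          finally show ?thesis by (simp add: dW_def)
        qed
        moreover have "(\<Sum>k\<in>- J. b k \<sigma> z * grad w ?y $ k) = c1 * (\<Sum>j\<in>J. (z $ j - a $ j) * (\<Sum>k\<in>- J. B k j ?y * grad w ?y $ k))"
          unfolding b_def by (simp add: sum_distrib_left sum_distrib_right mult_ac) (rule sum.swap)
        ultimately have eqn: "dW \<sigma> z - (\<Sum>k\<in>- J. b k \<sigma> z * grad w ?y $ k)
          = (\<Sum>j\<in>J. c1 * (z $ j - a $ j) * (grad w ?y $ j - (\<Sum>k\<in>- J. B k j ?y * grad w ?y $ k)))"
          by (simp add: sum_distrib_left sum_subtractf[symmetric] algebra_simps)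
        have cxy: "c1 * x * y \<le> \<bar>x\<bar> * \<bar>y\<bar>" for x y :: real
          using abs_ge_self[of "c1 * x * y"] by (simp add: abs_mult c1)
        have "(\<Sum>j\<in>J. c1 * (z $ j - a $ j) * (grad w ?y $ j - (\<Sum>k\<in>- J. B k j ?y * grad w ?y $ k))) \<le> (\<Sum>j\<in>J. h * (L * W \<sigma> z))"
        proof (rule sum_mono)
          fix j assume j: "j \<in> J"
          have "c1 * (z $ j - a $ j) * (grad w ?y $ j - (\<Sum>k\<in>- J. B k j ?y * grad w ?y $ k))
            \<le> \<bar>z $ j - a $ j\<bar> * \<bar>grad w ?y $ j - (\<Sum>k\<in>- J. B k j ?y * grad w ?y $ k)\<bar>"
            by (rule cxy)
          also have "\<dots> \<le> h * (L * W \<sigma> z)" unfolding W_def using zJ[OF j] rh Lw[OF y j] h_pos by (intro mult_mono) auto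
          finally show "c1 * (z $ j - a $ j) * (grad w ?y $ j - (\<Sum>k\<in>- J. B k j ?y * grad w ?y $ k)) \<le> h * (L * W \<sigma> z)" .
        qed
        then have "dW \<sigma> z - (\<Sum>k\<in>- J. b k \<sigma> z * grad w ?y $ k) \<le> (\<Sum>j\<in>J. h * (L * W \<sigma> z))" by (simp only: eqn)
        also have "(\<Sum>j\<in>J. h * (L * W \<sigma> z)) \<le> ?n * h * L * W \<sigma> z" using cardJ[of J] h_pos Lw0 Wz by (simp add: mult.assoc mult_right_mono)
        finally show ?thesis by simp
      qed
      have "?div z = (\<Sum>k\<in>- J. b k \<sigma> z * grad w ?y $ k) * \<phi> \<sigma> z + (\<Sum>k\<in>- J. db k \<sigma> z) * (W \<sigma> z * \<phi> \<sigma> z)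
          - W \<sigma> z * \<psi> \<sigma> z * (\<Sum>k\<in>- J. 2 * b k \<sigma> z * (z $ k - a $ k))"
        by (simp add: divergence[OF z] sum.distrib sum_subtractf sum_distrib_left sum_distrib_right mult.assoc)
      moreover have "dW \<sigma> z * \<phi> \<sigma> z \<le> ((\<Sum>k\<in>- J. b k \<sigma> z * grad w ?y $ k) + ?n * h * L * W \<sigma> z) * \<phi> \<sigma> z"
        using dWle \<phi>0(1) by (rule mult_right_mono)
      moreover have "W \<sigma> z * \<psi> \<sigma> z * (\<Sum>k\<in>- J. 2 * b k \<sigma> z * (z $ k - a $ k)) \<le> W \<sigma> z * \<psi> \<sigma> z * \<kappa>"
        using sum_b Wz \<phi>0 by (intro mult_left_mono) auto
      moreover have "(\<Sum>k\<in>- J. - db k \<sigma> z) * (W \<sigma> z * \<phi> \<sigma> z) \<le> ?n * h * (?n * \<beta>) * (W \<sigma> z * \<phi> \<sigma> z)"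
        using sum_db Wz \<phi>0 by (intro mult_right_mono) auto
      ultimately show ?thesis by (simp add: M_def sum_negf algebra_simps)
    qed
    have cE: "continuous_on Q (\<lambda>z. W \<sigma> z * \<phi> \<sigma> z)" by (rule contz[OF contXe \<sigma>])
    have "E' \<sigma> \<le> integral Q (\<lambda>z. ?div z + M * (W \<sigma> z * \<phi> \<sigma> z))"
      unfolding E'_def
      by (intro integral_le intQ contz[OF contXf \<sigma>] continuous_intros cont_div cE pointwise)
    also have "\<dots> = integral Q ?div + M * integral Q (\<lambda>z. W \<sigma> z * \<phi> \<sigma> z)"
      by (subst Henstock_Kurzweil_Integration.integral_add) (auto intro!: intQ continuous_intros cont_div cE)
    finally show ?thesis by (simp add: int_div E_def)
  qed
  have E1: "E 1 \<le> exp M * E 0"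
  proof -
    \<comment> \<open>Gronwall's inequality: the product with the integrating factor
      decreases.\<close>
    let ?F = "\<lambda>\<sigma>. exp (- M * \<sigma>) * E \<sigma>"
    have "continuous_on {0..1} E"
      using derE by (meson continuous_on_eq_continuous_within has_vector_derivative_continuous)
    then have cF: "continuous_on {0..1} ?F" by (intro continuous_intros)
    have "?F 1 \<le> ?F 0"
    proof (rule DERIV_nonpos_imp_decreasing_open[of 0 1 ?F])
      fix \<sigma> :: real assume "0 < \<sigma>" "\<sigma> < 1"
      then have "at \<sigma> within {0..1} = at \<sigma>"
        by (intro at_within_interior) (simp add: interior_atLeastAtMost_real)
      then have dE: "(E has_real_derivative E' \<sigma>) (at \<sigma>)"
        using derE[of \<sigma>] \<open>0 < \<sigma>\<close> \<open>\<sigma> < 1\<close> unfolding has_real_derivative_iff_has_vector_derivative by simp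
      have "((\<lambda>\<sigma>. exp (- M * \<sigma>)) has_real_derivative exp (- M * \<sigma>) * (- M)) (at \<sigma>)"
        by (auto intro!: derivative_eq_intros)
      from DERIV_mult[OF this dE]
      have "(?F has_real_derivative exp (- M * \<sigma>) * (E' \<sigma> - M * E \<sigma>)) (at \<sigma>)"
        by (simp add: algebra_simps)
      moreover have "exp (- M * \<sigma>) * (E' \<sigma> - M * E \<sigma>) \<le> 0"
        using E'_le[of \<sigma>] \<open>0 < \<sigma>\<close> \<open>\<sigma> < 1\<close> by (intro mult_nonneg_nonpos) auto
      ultimately show "\<exists>y. (?F has_real_derivative y) (at \<sigma>) \<and> y \<le> 0" by blast
    qed (use cF in auto)
    then have "exp (- M) * E 1 \<le> E 0" by simp
    then have "exp M * (exp (- M) * E 1) \<le> exp M * E 0" by (intro mult_left_mono) auto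
    then show ?thesis by (simp add: mult.assoc[symmetric] exp_add[symmetric])
  qed
  have LQ: "E \<sigma> = (LINT z:Q|lborel. W \<sigma> z * \<phi> \<sigma> z)" "set_integrable lborel Q (\<lambda>z. W \<sigma> z * \<phi> \<sigma> z)" if \<sigma>: "\<sigma> \<in> {0..1}" for \<sigma>
  proof -
    show *: "set_integrable lborel Q (\<lambda>z. W \<sigma> z * \<phi> \<sigma> z)" unfolding set_integrable_def
      by (intro borel_integrable_compact Q_props contz[OF contXe \<sigma>])
    show "E \<sigma> = (LINT z:Q|lborel. W \<sigma> z * \<phi> \<sigma> z)" unfolding E_def by (rule set_borel_integral_eq_integral(2)[OF *, symmetric])
  qed
  have iW: "set_integrable lborel X (\<lambda>z. W \<sigma> z)" if "\<sigma> \<in> {0..1}" "compact X" "X \<subseteq> Q" for \<sigma> X unfolding set_integrable_def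
    by (intro borel_integrable_compact that continuous_on_subset[OF contz[OF contX(1)]])
  have E0: "E 0 \<le> (LINT z:plaque r \<rho>|lborel. W 0 z)"
    unfolding LQ(1)[of 0, simplified] set_lebesgue_integral_def
  proof (rule integral_mono)
    show "integrable lborel (\<lambda>z. indicator Q z *\<^sub>R (W 0 z * \<phi> 0 z))" using LQ(2)[of 0] by (simp add: set_integrable_def)
    show "integrable lborel (\<lambda>z. indicator (plaque r \<rho>) z *\<^sub>R W 0 z)"
      using iW[of 0 "plaque r \<rho>"] compact_plaque plQ r0 rh \<rho> by (simp add: set_integrable_def)
    fix z
    have "\<phi> 0 z \<le> 1" unfolding \<phi>_def using flatexp_0_bounds by (intro mult_le_one) auto
    then show "indicator Q z *\<^sub>R (W 0 z * \<phi> 0 z) \<le> indicator (plaque r \<rho>) z *\<^sub>R W 0 z"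
    proof (cases "z \<in> plaque r \<rho>")
      case True
      then show ?thesis using \<open>\<phi> 0 z \<le> 1\<close> W0[of 0 z] plQ by (auto simp: mult_left_le)
    next
      case False
      then have "\<phi> 0 z = 0" using supp[of 0 z] by blast
      then show ?thesis using False by simp
    qed
  qed
  \<comment> \<open>Lower bound of the final cut-off on the smaller plaque: there
    \<open>dist2 J\<close> is at most a quarter of \<open>r\<^sup>2\<close>, and the other argument
    keeps at least the fraction \<open>1 - 1 / 4 - 1 / 2\<close> of
    \<open>\<rho>\<^sup>2\<close>.\<close>
  let ?d = "flatexp 0 (3 * r\<^sup>2 / 4) * flatexp 0 (\<rho>\<^sup>2 / 4)"
  have d: "?d > 0" using r0 \<rho> by (intro mult_pos_pos flatexp_0_pos) auto
  let ?P' = "plaque (r / 2) (\<rho> / 2)"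
  have P'Q: "?P' \<subseteq> Q" "compact ?P'" using plaque_sub_Q[of "r/2" "\<rho>/2"] compact_plaque[of "r/2" "\<rho>/2"] r0 rh \<rho> by auto
  have "(LINT z:?P'|lborel. W 1 z) * ?d = (LINT z:?P'|lborel. W 1 z * ?d)" by (simp only: set_integral_mult_left)
  also have "\<dots> \<le> E 1"
    unfolding LQ(1)[of 1, simplified] set_lebesgue_integral_def
  proof (rule integral_mono)
    show "integrable lborel (\<lambda>z. indicator Q z *\<^sub>R (W 1 z * \<phi> 1 z))" using LQ(2)[of 1] by (simp add: set_integrable_def)
    have "integrable lborel (\<lambda>z. indicator ?P' z *\<^sub>R W 1 z * ?d)"
      using iW[of 1 ?P'] P'Q by (intro integrable_mult_left) (simp add: set_integrable_def)
    then show "integrable lborel (\<lambda>z. indicator ?P' z *\<^sub>R (W 1 z * ?d))" by (simp add: mult.assoc)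
    fix z
    show "indicator ?P' z *\<^sub>R (W 1 z * ?d) \<le> indicator Q z *\<^sub>R (W 1 z * \<phi> 1 z)"
    proof (cases "z \<in> ?P'")
      case True
      then have "dist2 J z \<le> r\<^sup>2 / 4" "dist2 (-J) z \<le> \<rho>\<^sup>2 / 4" by (auto simp: plaque_def power_divide)
      then have "flatexp 0 (3 * r\<^sup>2 / 4) \<le> flatexp 0 (r\<^sup>2 - dist2 J z)" "flatexp 0 (\<rho>\<^sup>2 / 4) \<le> flatexp 0 (\<rho>\<^sup>2 - dist2 (-J) z - \<kappa> * 1)"
        by (auto intro!: flatexp_0_mono simp: \<kappa>_def)
      then have "?d \<le> \<phi> 1 z" unfolding \<phi>_def using flatexp_nonneg by (intro mult_mono) auto
      then show ?thesis using True P'Q W0[of 1 z] by (auto intro!: mult_left_mono)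
    next
      case False
      then show ?thesis using W0[of 1 z] \<phi>0 by (auto simp: indicator_def)
    qed
  qed
  also have "\<dots> \<le> exp M * (LINT z:plaque r \<rho>|lborel. W 0 z)"
    using E0 by (intro order_trans[OF E1] mult_left_mono) auto
  finally have "(LINT z:?P'|lborel. W 1 z) \<le> exp M * (LINT z:plaque r \<rho>|lborel. W 0 z) / ?d"
    using d by (simp add: pos_le_divide_eq)
  then show ?thesis by (simp add: W_def s_def M_def)
qed

end

section \<open>The local estimate\<close>

lemma powr_add_le:
  fixes x y p :: real
  assumes "0 \<le> x" "0 \<le> y" "0 \<le> p"
  shows "(x + y) powr p \<le> 2 powr p * (x powr p + y powr p)"
proof -
  have "(x + y) powr p \<le> (2 * max x y) powr p" using assms by (intro powr_mono2) auto
  also have "\<dots> = 2 powr p * max x y powr p" using assms by (simp add: powr_mult)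
  also have "\<dots> \<le> 2 powr p * (x powr p + y powr p)" by (intro mult_left_mono) (auto simp: max_def)
  finally show ?thesis .
qed

text \<open>Together with \<open>bracket_powr_le\<close> this makes
  \<open>(1 + x\<^sup>2) powr (p / 2)\<close> a substitute for \<open>\<bar>x\<bar> powr p\<close>:
  comparable up to constants, and differentiable in \<open>x\<close> also at 0 and for
  \<open>p = 1\<close>.\<close>

lemma abs_powr_le_bracket:
  fixes x p :: real
  assumes "0 \<le> p" shows "\<bar>x\<bar> powr p \<le> (1 + x\<^sup>2) powr (p / 2)"
proof -
  have "\<bar>x\<bar> powr p = (x\<^sup>2) powr (p / 2)"
  proof (cases "x = 0")
    case False
    have "x\<^sup>2 = \<bar>x\<bar> powr 2" using False by (simp add: powr_numeral)
    then show ?thesis by (simp only: powr_powr) simp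
  qed simp
  also have "\<dots> \<le> (1 + x\<^sup>2) powr (p / 2)" using assms by (intro powr_mono2) auto
  finally show ?thesis .
qed

lemma bracket_powr_le:
  fixes x p :: real
  assumes "0 \<le> p" shows "(1 + x\<^sup>2) powr (p / 2) \<le> 2 powr p * (1 + \<bar>x\<bar> powr p)"
proof -
  have "(1 + x\<^sup>2) powr (p / 2) \<le> ((1 + \<bar>x\<bar>)\<^sup>2) powr (p / 2)"
    using assms by (intro powr_mono2) (auto simp: power2_eq_square algebra_simps)
  also have "\<dots> = (1 + \<bar>x\<bar>) powr p"
  proof -
    have "(1 + \<bar>x\<bar>)\<^sup>2 = (1 + \<bar>x\<bar>) powr 2" by (simp add: powr_numeral)
    then show ?thesis by (simp only: powr_powr) simp
  qed
  also have "\<dots> \<le> 2 powr p * (1 powr p + \<bar>x\<bar> powr p)" using assms by (intro powr_add_le) auto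
  finally show ?thesis by simp
qed

lemma C_on_powr: "C_on 1 {0<..} (\<lambda>x::real. x powr \<alpha>)"
  unfolding One_nat_def
proof (rule C_on_SucI[where f'="\<lambda>x v. v * (\<alpha> * x powr (\<alpha> - 1))"])
  fix x :: real assume "x \<in> {0<..}"
  then have "((\<lambda>x. x powr \<alpha>) has_real_derivative \<alpha> * x powr (\<alpha> - 1)) (at x)"
    by (auto intro!: derivative_eq_intros)
  then show "((\<lambda>x. x powr \<alpha>) has_derivative (\<lambda>v. v * (\<alpha> * x powr (\<alpha> - 1)))) (at x)"
    by (simp add: has_field_derivative_def mult_commute_abs)
qed (auto intro!: continuous_intros)

lemma grad_compose_powr:
  fixes u :: "real ^ 'n::finite \<Rightarrow> real"
  assumes u: "u differentiable (at z)" "u z > 0"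
  shows "grad (\<lambda>z. u z powr \<alpha>) z = (\<alpha> * u z powr (\<alpha> - 1)) *\<^sub>R grad u z"
proof -
  have "((\<lambda>x. x powr \<alpha>) has_real_derivative \<alpha> * u z powr (\<alpha> - 1)) (at (u z))"
    using u(2) by (auto intro!: derivative_eq_intros)
  then have "((\<lambda>x. x powr \<alpha>) has_derivative (\<lambda>v. v * (\<alpha> * u z powr (\<alpha> - 1)))) (at (u z))"
    by (simp add: has_field_derivative_def mult_commute_abs)
  from has_derivative_compose[OF u(1)[unfolded frechet_derivative_works] this]
  have "((\<lambda>z. u z powr \<alpha>) has_derivative (\<lambda>v. frechet_derivative u (at z) v * (\<alpha> * u z powr (\<alpha> - 1)))) (at z)" .
  from frechet_derivative_at[OF this] show ?thesis
    by (simp add: grad_def vec_eq_iff fun_eq_iff mult.commute)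
qed

lemma grad_one_plus_sum_squares:
  fixes u :: "'i \<Rightarrow> real ^ 'n::finite \<Rightarrow> real"
  assumes "\<And>i. i \<in> I \<Longrightarrow> u i differentiable (at z)"
  shows "grad (\<lambda>z. 1 + (\<Sum>i\<in>I. (u i z)\<^sup>2)) z = (\<Sum>i\<in>I. (2 * u i z) *\<^sub>R grad (u i) z)"
proof -
  have "((\<lambda>z. 1 + (\<Sum>i\<in>I. u i z * u i z)) has_derivative
    (\<lambda>v. 0 + (\<Sum>i\<in>I. u i z * frechet_derivative (u i) (at z) v + frechet_derivative (u i) (at z) v * u i z))) (at z)"
    using assms by (intro has_derivative_add has_derivative_sum has_derivative_mult has_derivative_const)
      (auto simp: frechet_derivative_works)
  from frechet_derivative_at[OF this] show ?thesis
    by (simp add: grad_def vec_eq_iff fun_eq_iff power2_eq_square sum_component algebra_simps)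
qed

lemma uniform_measure_continuous:
  fixes g :: "'a::euclidean_space \<Rightarrow> real"
  assumes P: "compact P" "emeasure lborel P \<noteq> 0" and g: "continuous_on P g" and g0: "\<And>z. z \<in> P \<Longrightarrow> g z \<ge> 0"
  shows "integrable (uniform_measure lborel P) (\<lambda>z. indicator P z *\<^sub>R g z)"
    and "(\<integral>z. indicator P z *\<^sub>R g z \<partial>uniform_measure lborel P) = (LINT z:P|lborel. g z) / measure lborel P"
    and "(\<integral>\<^sup>+z. ennreal (indicator P z *\<^sub>R g z) \<partial>uniform_measure lborel P) = ennreal ((LINT z:P|lborel. g z) / measure lborel P)"
proof -
  have Pb[measurable]: "P \<in> sets borel" using P(1) by (simp add: compact_imp_closed)
  have fin: "emeasure lborel P \<noteq> \<infinity>" using emeasure_compact_finite[OF P(1)] by simp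
  interpret U: prob_space "uniform_measure lborel P" by (rule prob_space_uniform_measure[OF P(2) fin])
  have "(\<lambda>z. indicator P z *\<^sub>R g z) \<in> borel_measurable borel"
    by (rule borel_measurable_continuous_on_indicator[OF Pb g])
  then have Um: "(\<lambda>z. indicator P z *\<^sub>R g z) \<in> borel_measurable (uniform_measure lborel P)"
    by (subst measurable_cong_sets[of _ borel _ borel]) auto
  note bm[measurable] = \<open>(\<lambda>z. indicator P z *\<^sub>R g z) \<in> borel_measurable borel\<close>
  obtain b where "\<And>z. z \<in> P \<Longrightarrow> \<bar>g z\<bar> \<le> b"
    using compact_imp_bounded[OF compact_continuous_image[OF g P(1)]] unfolding bounded_iff by auto
  then have b: "norm (indicator P z *\<^sub>R g z) \<le> max 0 b" for z by (cases "z \<in> P") (auto simp: le_max_iff_disj)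
  show i: "integrable (uniform_measure lborel P) (\<lambda>z. indicator P z *\<^sub>R g z)"
    using b by (intro U.integrable_const_bound[where B="max 0 b"] AE_I2 Um)
  have gl: "integrable lborel (\<lambda>z. indicator P z *\<^sub>R g z)" by (rule borel_integrable_compact[OF P(1) g])
  have m: "emeasure lborel P = ennreal (measure lborel P)" using fin by (simp add: emeasure_eq_ennreal_measure)
  then have mpos: "measure lborel P > 0" using P(2) by (simp add: zero_less_measure_iff)
  have L0: "(LINT z:P|lborel. g z) \<ge> 0" unfolding set_lebesgue_integral_def using g0 by (intro integral_nonneg_AE) (auto simp: indicator_def)
  have "(\<integral>\<^sup>+z. ennreal (indicator P z *\<^sub>R g z) \<partial>uniform_measure lborel P)
    = (\<integral>\<^sup>+z. ennreal (indicator P z *\<^sub>R g z) * indicator P z \<partial>lborel) / emeasure lborel P"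
    by (rule nn_integral_uniform_measure; measurable)
  also have "(\<integral>\<^sup>+z. ennreal (indicator P z *\<^sub>R g z) * indicator P z \<partial>lborel) = (\<integral>\<^sup>+z. ennreal (indicator P z *\<^sub>R g z) \<partial>lborel)"
    by (intro nn_integral_cong) (auto simp: indicator_def)
  also have "\<dots> = ennreal (LINT z:P|lborel. g z)" unfolding set_lebesgue_integral_def
    by (rule nn_integral_eq_integral[OF gl]) (use g0 in \<open>auto simp: indicator_def\<close>)
  finally show nn: "(\<integral>\<^sup>+z. ennreal (indicator P z *\<^sub>R g z) \<partial>uniform_measure lborel P) = ennreal ((LINT z:P|lborel. g z) / measure lborel P)"
    using L0 mpos by (simp add: m divide_ennreal)
  have "(\<integral>\<^sup>+z. ennreal (indicator P z *\<^sub>R g z) \<partial>uniform_measure lborel P) = ennreal (\<integral>z. indicator P z *\<^sub>R g z \<partial>uniform_measure lborel P)"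
    by (rule nn_integral_eq_integral[OF i]) (use g0 in \<open>auto simp: indicator_def\<close>)
  moreover have "(\<integral>z. indicator P z *\<^sub>R g z \<partial>uniform_measure lborel P) \<ge> 0" using g0 by (intro integral_nonneg_AE) (auto simp: indicator_def)
  ultimately show "(\<integral>z. indicator P z *\<^sub>R g z \<partial>uniform_measure lborel P) = (LINT z:P|lborel. g z) / measure lborel P"
    using nn L0 mpos by (simp add: ennreal_inj)
qed

section \<open>Energies of leafwise constant functions\<close>

context leaf_chart
begin

text \<open>Only the infinitesimal consequence in the \<open>J\<close> directions is recorded. Two
  derivatives are asked for because the relation is differentiated once to obtain the equation for
  the gradient.\<close>

definition leafwise_constant :: "(real ^ 'n \<Rightarrow> real) \<Rightarrow> bool" where
  "leafwise_constant f \<longleftrightarrow> C_on 2 \<Omega> f \<and>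
     (\<forall>z\<in>\<Omega>. \<forall>j\<in>J. grad f z $ j = (\<Sum>k\<in>- J. B k j z * grad f z $ k))"

text \<open>The relation is linear in the gradient, so every C^1 function of \<open>f\<close>
  satisfies it exactly. The factor 0 brings this into the form expected by
  \<open>transport_energy\<close>, with \<open>L = 0\<close>.\<close>

lemma transport_bracket:
  assumes f: "leafwise_constant f" and p: "p \<ge> 0"
  shows "C_on 1 \<Omega> (\<lambda>z. (1 + (f z)\<^sup>2) powr (p / 2))"
    and "z \<in> Q \<Longrightarrow> j \<in> J \<Longrightarrow> \<bar>grad (\<lambda>z. (1 + (f z)\<^sup>2) powr (p / 2)) z $ j -
      (\<Sum>k\<in>- J. B k j z * grad (\<lambda>z. (1 + (f z)\<^sup>2) powr (p / 2)) z $ k)\<bar> \<le> 0 * ((1 + (f z)\<^sup>2) powr (p / 2))"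
proof -
  have C1: "C_on 1 \<Omega> f" using f C_on_mono[of 2 \<Omega> f 1] by (simp add: leafwise_constant_def)
  have "C_on 1 \<Omega> (\<lambda>z. 1 + f z * f z)" by (intro C_on_add C_on_mult C_on_const C1 open_\<Omega>)
  then show "C_on 1 \<Omega> (\<lambda>z. (1 + (f z)\<^sup>2) powr (p / 2))"
    unfolding power2_eq_square
    by (intro C_on_compose_real[OF open_\<Omega> _ _ C_on_powr]) (auto simp: add_pos_nonneg)
  assume z: "z \<in> Q" and j: "j \<in> J"
  then have z\<Omega>: "z \<in> \<Omega>" using Q_props by auto
  have d: "f differentiable (at z)" using C1 z\<Omega> by simp
  \<comment> \<open>A sum over a single index, to fit
    \<open>grad_one_plus_sum_squares\<close>.\<close>
  define u where "u z = 1 + (\<Sum>i\<in>{()}. (f z)\<^sup>2)" for z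
  have u: "u = (\<lambda>z. 1 + (f z)\<^sup>2)" by (simp add: u_def fun_eq_iff)
  have "grad u z = (2 * f z) *\<^sub>R grad f z"
    using grad_one_plus_sum_squares[of "{()}" "\<lambda>_. f" z] d by (simp add: u_def[abs_def])
  moreover have "u differentiable (at z)" unfolding u by (intro derivative_intros d)
  ultimately have "grad (\<lambda>z. u z powr (p / 2)) z = (p / 2 * u z powr (p / 2 - 1) * (2 * f z)) *\<^sub>R grad f z"
    using grad_compose_powr[of u z "p / 2"] by (simp add: u add_pos_nonneg)
  moreover have "grad f z $ j = (\<Sum>k\<in>- J. B k j z * grad f z $ k)"
    using f z\<Omega> j by (simp add: leafwise_constant_def)
  ultimately have "grad (\<lambda>z. u z powr (p / 2)) z $ j - (\<Sum>k\<in>- J. B k j z * grad (\<lambda>z. u z powr (p / 2)) z $ k) = 0"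
    by (simp add: sum_distrib_left mult_ac)
  then show "\<bar>grad (\<lambda>z. (1 + (f z)\<^sup>2) powr (p / 2)) z $ j -
      (\<Sum>k\<in>- J. B k j z * grad (\<lambda>z. (1 + (f z)\<^sup>2) powr (p / 2)) z $ k)\<bar> \<le> 0 * ((1 + (f z)\<^sup>2) powr (p / 2))"
    by (simp add: u)
qed

text \<open>Differentiating the relation produces second derivatives of \<open>f\<close> with the
  same coefficients \<open>B k j\<close>, plus products of first derivatives of \<open>B\<close> and
  \<open>f\<close>. In the equation for the squared gradient the second derivatives cancel by their
  symmetry; the rest is quadratic in the gradient and thus at most a multiple of the unknown
  itself.\<close>

lemma transport_grad_bracket:
  assumes f: "leafwise_constant f" and p: "p \<ge> 0" and \<beta>: "\<And>k j z. z \<in> Q \<Longrightarrow> norm (grad (B k j) z) \<le> \<beta>"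
  shows "C_on 1 \<Omega> (\<lambda>z. (1 + (norm (grad f z))\<^sup>2) powr (p / 2))"
    and "z \<in> Q \<Longrightarrow> j \<in> J \<Longrightarrow> \<bar>grad (\<lambda>z. (1 + (norm (grad f z))\<^sup>2) powr (p / 2)) z $ j -
      (\<Sum>k\<in>- J. B k j z * grad (\<lambda>z. (1 + (norm (grad f z))\<^sup>2) powr (p / 2)) z $ k)\<bar>
      \<le> (p * (real CARD('n))\<^sup>2 * \<beta>) * ((1 + (norm (grad f z))\<^sup>2) powr (p / 2))"
proof -
  have C2: "C_on 2 \<Omega> f" using f by (simp add: leafwise_constant_def)
  have Cg: "C_on 1 \<Omega> (\<lambda>z. grad f z $ i)" for i
    using C_on_grad[of 1 \<Omega> f i] C2 by (simp add: numeral_2_eq_2)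
  define u where "u z = 1 + (\<Sum>i\<in>UNIV. (grad f z $ i)\<^sup>2)" for z
  have u: "u = (\<lambda>z. 1 + (norm (grad f z))\<^sup>2)"
    by (simp add: u_def fun_eq_iff norm_vec_def L2_set_def sum_nonneg)
  have u0: "u z > 0" for z by (simp add: u add_pos_nonneg)
  have Cu: "C_on 1 \<Omega> u" unfolding u_def[abs_def] power2_eq_square
    by (intro C_on_add C_on_sum C_on_mult C_on_const Cg open_\<Omega>)
  show "C_on 1 \<Omega> (\<lambda>z. (1 + (norm (grad f z))\<^sup>2) powr (p / 2))"
    using C_on_compose_real[OF open_\<Omega> _ _ C_on_powr Cu] u0 by (simp add: u)
  assume z: "z \<in> Q" and j: "j \<in> J"
  then have z\<Omega>: "z \<in> \<Omega>" using Q_props by auto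
  define v where "v i = grad f z $ i" for i
  define D where "D i k = grad (\<lambda>y. grad f y $ i) z $ k" for i k
  have sym: "D i k = D k i" for i k
    using symmetric_second_derivative[OF open_\<Omega> C2 z\<Omega>, of "axis i 1" "axis k 1"] by (simp add: D_def grad_def)
  have dg: "(\<lambda>y. grad f y $ i) differentiable (at z)" for i using Cg[of i] z\<Omega> by simp
  have gu: "grad u z $ k = (\<Sum>i\<in>UNIV. 2 * v i * D i k)" for k
    using grad_one_plus_sum_squares[of UNIV "\<lambda>i y. grad f y $ i" z] dg
    by (simp add: u_def[abs_def] sum_component v_def D_def)
  have dB: "B k j differentiable (at z)" for k using B_C1 z\<Omega> by simp
  \<comment> \<open>The relation holds on the open set \<open>\<Omega>\<close>, so both of its sides
    have the same derivative at \<open>z\<close> in direction \<open>i\<close>.\<close>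
  have DJ: "D j i = (\<Sum>k\<in>- J. grad (B k j) z $ i * v k + B k j z * D k i)" for i
  proof -
    have "((\<lambda>y. \<Sum>k\<in>- J. B k j y * grad f y $ k) has_derivative
      (\<lambda>w. \<Sum>k\<in>- J. B k j z * frechet_derivative (\<lambda>y. grad f y $ k) (at z) w + frechet_derivative (B k j) (at z) w * grad f z $ k)) (at z)"
      using dB dg by (intro has_derivative_sum has_derivative_mult) (auto simp: frechet_derivative_works)
    then have "((\<lambda>y. grad f y $ j) has_derivative
      (\<lambda>w. \<Sum>k\<in>- J. B k j z * frechet_derivative (\<lambda>y. grad f y $ k) (at z) w + frechet_derivative (B k j) (at z) w * grad f z $ k)) (at z)"
      by (rule has_derivative_transform_within_open[OF _ open_\<Omega> z\<Omega>]) (use f j in \<open>simp add: leafwise_constant_def\<close>)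
    from fun_cong[OF frechet_derivative_at[OF this], of "axis i 1"] show ?thesis
      by (simp add: D_def grad_def[of "\<lambda>y. grad f y $ _"] grad_def[of "B _ j"] v_def add.commute)
  qed
  \<comment> \<open>By \<open>DJ\<close> and the symmetry of \<open>D\<close>, the terms
    \<open>2 * v i * (B k j z * D k i)\<close> occur on both sides of the difference and
    cancel.\<close>
  have "grad u z $ j - (\<Sum>k\<in>- J. B k j z * grad u z $ k) = (\<Sum>i\<in>UNIV. \<Sum>k\<in>- J. 2 * v i * (grad (B k j) z $ i * v k))"
  proof -
    have "(\<Sum>k\<in>- J. B k j z * grad u z $ k) = (\<Sum>i\<in>UNIV. \<Sum>k\<in>- J. 2 * v i * (B k j z * D k i))"
      unfolding gu sum_distrib_left by (subst sum.swap) (simp add: sym mult_ac)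
    moreover have "grad u z $ j = (\<Sum>i\<in>UNIV. \<Sum>k\<in>- J. 2 * v i * (grad (B k j) z $ i * v k) + 2 * v i * (B k j z * D k i))"
      unfolding gu sym[of _ j] DJ by (simp add: sum_distrib_left distrib_left)
    ultimately show ?thesis by (simp add: sum.distrib)
  qed
  also have "\<bar>\<dots>\<bar> \<le> (\<Sum>i\<in>(UNIV::'n set). \<Sum>k\<in>- J. 2 * \<beta> * u z)"
  proof (rule order_trans[OF sum_abs], rule sum_mono, rule order_trans[OF sum_abs], rule sum_mono)
    fix i k
    have v1: "\<bar>v l\<bar> \<le> norm (grad f z)" for l unfolding v_def by (rule component_le_norm_cart)
    have b: "\<bar>grad (B k j) z $ i\<bar> \<le> \<beta>" using component_le_norm_cart \<beta>[OF z] order_trans by blast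
    then have \<beta>0: "\<beta> \<ge> 0" by linarith
    have "\<bar>2 * v i * (grad (B k j) z $ i * v k)\<bar> = 2 * (\<bar>v i\<bar> * (\<bar>grad (B k j) z $ i\<bar> * \<bar>v k\<bar>))" by (simp add: abs_mult)
    also have "\<dots> \<le> 2 * (norm (grad f z) * (\<beta> * norm (grad f z)))"
      using v1 b \<beta>0 by (intro mult_left_mono mult_mono) auto
    also have "\<dots> = 2 * \<beta> * (norm (grad f z))\<^sup>2" by (simp add: power2_eq_square)
    also have "\<dots> \<le> 2 * \<beta> * u z" using \<beta>0 by (intro mult_left_mono) (auto simp: u)
    finally show "\<bar>2 * v i * (grad (B k j) z $ i * v k)\<bar> \<le> 2 * \<beta> * u z" .
  qed
  also have "\<dots> \<le> 2 * (real CARD('n))\<^sup>2 * \<beta> * u z"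
  proof -
    have "\<beta> \<ge> 0" using norm_ge_zero \<beta>[OF z] order_trans by blast
    then have "real (card (- J)) * (2 * \<beta> * u z) \<le> real CARD('n) * (2 * \<beta> * u z)"
      using u0[of z] by (intro mult_right_mono) (auto simp: card_mono)
    then have "real CARD('n) * (real (card (- J)) * (2 * \<beta> * u z)) \<le> real CARD('n) * (real CARD('n) * (2 * \<beta> * u z))"
      by (intro mult_left_mono) auto
    then show ?thesis by (simp add: power2_eq_square mult_ac)
  qed
  finally have main: "\<bar>grad u z $ j - (\<Sum>k\<in>- J. B k j z * grad u z $ k)\<bar> \<le> 2 * (real CARD('n))\<^sup>2 * \<beta> * u z" .
  let ?c = "p / 2 * u z powr (p / 2 - 1)"
  have du: "u differentiable (at z)" using Cu z\<Omega> by simp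
  have gw: "grad (\<lambda>z. u z powr (p / 2)) z = ?c *\<^sub>R grad u z"
    by (rule grad_compose_powr[OF du u0])
  have "grad (\<lambda>z. u z powr (p / 2)) z $ j - (\<Sum>k\<in>- J. B k j z * grad (\<lambda>z. u z powr (p / 2)) z $ k)
    = ?c * (grad u z $ j - (\<Sum>k\<in>- J. B k j z * grad u z $ k))"
    unfolding gw by (simp add: sum_distrib_left right_diff_distrib mult_ac)
  then have "\<bar>grad (\<lambda>z. u z powr (p / 2)) z $ j - (\<Sum>k\<in>- J. B k j z * grad (\<lambda>z. u z powr (p / 2)) z $ k)\<bar>
    = \<bar>?c * (grad u z $ j - (\<Sum>k\<in>- J. B k j z * grad u z $ k))\<bar>" by (simp only:)
  also have "\<dots> = ?c * \<bar>grad u z $ j - (\<Sum>k\<in>- J. B k j z * grad u z $ k)\<bar>" using p by (simp add: abs_mult)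
  also have "\<dots> \<le> ?c * (2 * (real CARD('n))\<^sup>2 * \<beta> * u z)" using p by (intro mult_left_mono main) auto
  also have "\<dots> = (p * (real CARD('n))\<^sup>2 * \<beta>) * (u z powr (p / 2 - 1) * u z)" by simp
  also have "u z powr (p / 2 - 1) * u z = u z powr (p / 2)" using u0[of z] by (simp add: powr_diff)
  finally show "\<bar>grad (\<lambda>z. (1 + (norm (grad f z))\<^sup>2) powr (p / 2)) z $ j -
      (\<Sum>k\<in>- J. B k j z * grad (\<lambda>z. (1 + (norm (grad f z))\<^sup>2) powr (p / 2)) z $ k)\<bar>
      \<le> (p * (real CARD('n))\<^sup>2 * \<beta>) * ((1 + (norm (grad f z))\<^sup>2) powr (p / 2))"
    unfolding u .
qed

lemma open_plaque_interior: "open {z. dist2 J z < r\<^sup>2 \<and> dist2 (- J) z < \<rho>\<^sup>2}"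
proof -
  have "continuous_on UNIV (dist2 I)" for I
    using C_on_imp_continuous_on[OF C_on_dist2[OF open_UNIV, of 0]] .
  then show ?thesis by (intro open_Collect_conj open_Collect_less continuous_on_const)
qed

lemma center_in_plaque_interior: "r > 0 \<Longrightarrow> \<rho> > 0 \<Longrightarrow> a \<in> {z. dist2 J z < r\<^sup>2 \<and> dist2 (- J) z < \<rho>\<^sup>2}"
  by (simp add: dist2_def)

lemma plaque_emeasure_pos:
  assumes "r > 0" "\<rho> > 0" shows "emeasure lborel (plaque r \<rho>) \<noteq> 0"
proof
  assume 0: "emeasure lborel (plaque r \<rho>) = 0"
  let ?O = "{z. dist2 J z < r\<^sup>2 \<and> dist2 (- J) z < \<rho>\<^sup>2}"
  have "emeasure lborel ?O \<le> emeasure lborel (plaque r \<rho>)"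
    using closed_plaque by (intro emeasure_mono) (auto simp: plaque_def)
  then have "?O \<in> null_sets lborel" using 0 open_plaque_interior[of r \<rho>] by (auto simp: null_sets_def)
  then have "negligible ?O" by (simp add: negligible_iff_null_sets null_sets_completionI)
  then show False
    using open_not_negligible[OF open_plaque_interior] center_in_plaque_interior[OF assms] by blast
qed

lemma dist2_convex:
  assumes "0 \<le> u" "0 \<le> v" "u + v = 1"
  shows "dist2 I (u *\<^sub>R z + v *\<^sub>R \<zeta>) \<le> u * dist2 I z + v * dist2 I \<zeta>"
proof -
  have *: "(u * x + v * y)\<^sup>2 \<le> u * x\<^sup>2 + v * y\<^sup>2" for x y :: real
  proof -
    have v: "v = 1 - u" using assms by simp
    have "u * x\<^sup>2 + v * y\<^sup>2 - (u * x + v * y)\<^sup>2 = u * v * (x - y)\<^sup>2"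
      unfolding v by (simp add: power2_eq_square algebra_simps)
    moreover have "u * v * (x - y)\<^sup>2 \<ge> 0" using assms by simp
    ultimately show ?thesis by linarith
  qed
  have "dist2 I (u *\<^sub>R z + v *\<^sub>R \<zeta>) = (\<Sum>i\<in>I. (u * (z $ i - a $ i) + v * (\<zeta> $ i - a $ i))\<^sup>2)"
  proof -
    have "(u *\<^sub>R z + v *\<^sub>R \<zeta>) $ i - a $ i = u * (z $ i - a $ i) + v * (\<zeta> $ i - a $ i)" for i
    proof -
      have "a $ i = (u + v) * a $ i" using assms by simp
      then show ?thesis by (simp add: algebra_simps)
    qed
    then show ?thesis unfolding dist2_def by (simp only:)
  qed
  also have "\<dots> \<le> (\<Sum>i\<in>I. u * (z $ i - a $ i)\<^sup>2 + v * (\<zeta> $ i - a $ i)\<^sup>2)" by (intro sum_mono *)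
  finally show ?thesis by (simp add: dist2_def sum.distrib sum_distrib_left)
qed

lemma dist2_convex_le:
  assumes "0 \<le> u" "0 \<le> v" "u + v = 1" "dist2 I z \<le> c" "dist2 I \<zeta> \<le> c"
  shows "dist2 I (u *\<^sub>R z + v *\<^sub>R \<zeta>) \<le> c"
proof -
  have "u * dist2 I z + v * dist2 I \<zeta> \<le> u * c + v * c" using assms by (intro add_mono mult_left_mono) auto
  also have "\<dots> = c" using assms by (simp add: distrib_right[symmetric])
  finally show ?thesis using dist2_convex[OF assms(1-3), of I z \<zeta>] by linarith
qed

lemma convex_plaque: "convex (plaque r \<rho>)"
  by (rule convexI) (auto simp: plaque_def intro!: dist2_convex_le)

lemma mix_in_plaque:
  assumes z: "z \<in> plaque r \<rho>" and \<zeta>: "\<zeta> \<in> plaque r \<rho>" and t: "0 \<le> t" "t \<le> 1"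
  shows "mix (- J) t z \<zeta> \<in> plaque r \<rho>"
proof -
  have "dist2 J (mix (- J) t z \<zeta>) = dist2 J \<zeta>"
    unfolding dist2_def by (intro sum.cong) (auto simp: mix_def)
  moreover have "dist2 (- J) (mix (- J) t z \<zeta>) = dist2 (- J) ((1 - t) *\<^sub>R z + t *\<^sub>R \<zeta>)"
    unfolding dist2_def by (intro sum.cong) (auto simp: mix_def)
  moreover have "dist2 (- J) ((1 - t) *\<^sub>R z + t *\<^sub>R \<zeta>) \<le> \<rho>\<^sup>2"
    using z \<zeta> t by (intro dist2_convex_le) (auto simp: plaque_def)
  ultimately show ?thesis using \<zeta> by (simp add: plaque_def)
qed

lemma slide_affine: "slide s ((1 - t) *\<^sub>R z + t *\<^sub>R \<zeta>) = (1 - t) *\<^sub>R slide s z + t *\<^sub>R slide s \<zeta>"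
  by (auto simp: slide_def vec_eq_iff algebra_simps)

lemma continuous_on_slide: "continuous_on X (slide s)"
proof -
  have "continuous_on X (\<lambda>z. if i \<in> J then a $ i + s * (z $ i - a $ i) else z $ i)" for i
    by (cases "i \<in> J") (auto intro!: continuous_intros)
  then show ?thesis unfolding slide_def[abs_def] by (intro continuous_on_vec_lambda)
qed

end

lemma nn_set_integral_eq_set_integral:
  fixes g :: "'a::euclidean_space \<Rightarrow> real"
  assumes P: "compact P" and g: "continuous_on P g" and g0: "\<And>z. z \<in> P \<Longrightarrow> g z \<ge> 0"
  shows "(\<integral>\<^sup>+z\<in>P. ennreal (g z) \<partial>lborel) = ennreal (LINT z:P|lborel. g z)"
proof -
  have "(\<integral>\<^sup>+z\<in>P. ennreal (g z) \<partial>lborel) = (\<integral>\<^sup>+z. ennreal (indicator P z *\<^sub>R g z) \<partial>lborel)"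
    by (intro nn_integral_cong) (auto simp: indicator_def)
  also have "\<dots> = ennreal (LINT z:P|lborel. g z)" unfolding set_lebesgue_integral_def
    by (rule nn_integral_eq_integral[OF borel_integrable_compact[OF P g]]) (use g0 in \<open>auto simp: indicator_def\<close>)
  finally show ?thesis .
qed

lemma set_integral_nonneg_mono:
  fixes f g :: "'a::euclidean_space \<Rightarrow> real"
  assumes P: "compact P" "compact R" "P \<subseteq> R" and f: "continuous_on P f" and g: "continuous_on R g"
    and fg: "\<And>z. z \<in> P \<Longrightarrow> f z \<le> g z" and g0: "\<And>z. z \<in> R \<Longrightarrow> g z \<ge> 0"
  shows "(LINT z:P|lborel. f z) \<le> (LINT z:R|lborel. g z)"
  unfolding set_lebesgue_integral_def
  by (rule integral_mono[OF borel_integrable_compact[OF P(1) f] borel_integrable_compact[OF P(2) g]])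
     (use P(3) fg g0 in \<open>auto simp: indicator_def\<close>)

lemma set_integral_nonneg_continuous:
  fixes g :: "'a::euclidean_space \<Rightarrow> real"
  shows "(\<And>z. z \<in> R \<Longrightarrow> g z \<ge> 0) \<Longrightarrow> 0 \<le> (LINT z:R|lborel. g z)"
  unfolding set_lebesgue_integral_def by (intro integral_nonneg_AE) (auto simp: indicator_def)

lemma bracket_integral_bound:
  fixes f :: "'a::euclidean_space \<Rightarrow> real"
  assumes P: "compact P" "compact R" "P \<subseteq> R" and f: "continuous_on R f" and p: "p > 0"
  shows "(LINT z:P|lborel. (1 + (f z)\<^sup>2) powr (p / 2)) \<le> 2 powr p * (measure lborel R + (LINT z:R|lborel. \<bar>f z\<bar> powr p))"
proof -
  have c: "continuous_on R (\<lambda>z. \<bar>f z\<bar> powr p)" using f p by (intro continuous_on_powr' continuous_intros) auto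
  have "(LINT z:P|lborel. (1 + (f z)\<^sup>2) powr (p / 2)) \<le> (LINT z:R|lborel. 2 powr p * (1 + \<bar>f z\<bar> powr p))"
  proof (rule set_integral_nonneg_mono[OF P])
    show "continuous_on P (\<lambda>z. (1 + (f z)\<^sup>2) powr (p / 2))"
      by (intro continuous_on_powr continuous_intros continuous_on_subset[OF f P(3)])
         (metis add_pos_nonneg less_irrefl zero_le_power2 zero_less_one)
    show "continuous_on R (\<lambda>z. 2 powr p * (1 + \<bar>f z\<bar> powr p))" by (intro continuous_intros c)
  qed (use bracket_powr_le p in \<open>auto simp: less_imp_le\<close>)
  also have "\<dots> = 2 powr p * (LINT z:R|lborel. 1 + \<bar>f z\<bar> powr p)" by simp
  also have "(LINT z:R|lborel. 1 + \<bar>f z\<bar> powr p) = (LINT z:R|lborel. 1) + (LINT z:R|lborel. \<bar>f z\<bar> powr p)"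
  proof (rule set_integral_add)
    show "set_integrable lborel R (\<lambda>z. 1 :: real)" "set_integrable lborel R (\<lambda>z. \<bar>f z\<bar> powr p)"
      unfolding set_integrable_def by (rule borel_integrable_compact[OF P(2)], intro continuous_intros c)+
  qed
  also have "(LINT z:R|lborel. (1::real)) = measure lborel R" using P(2) by (simp add: set_lebesgue_integral_def compact_imp_closed)
  finally show ?thesis .
qed

context leaf_chart
begin

theorem local_estimate:
  assumes p: "1 \<le> p" "p \<le> q" and pq: "real (card (- J)) * (q / p - 1) < q"
  shows "\<exists>S. open S \<and> a \<in> S \<and> S \<subseteq> Q \<and> (\<forall>N. \<exists>C. \<forall>f. leafwise_constant f \<longrightarrow>
    (LINT z:Q|lborel. \<bar>f z\<bar> powr p) \<le> N \<longrightarrow> (LINT z:Q|lborel. norm (grad f z) powr p) \<le> N \<longrightarrow>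
    (\<integral>\<^sup>+z\<in>S. ennreal (\<bar>f z\<bar> powr q) \<partial>lborel) \<le> ennreal C)"
proof -
  have cB: "continuous_on \<Omega> (B k j)" "continuous_on \<Omega> (\<lambda>z. norm (grad (B k j) z))" for k j
    using C_on_imp_continuous_on[OF B_C1] continuous_on_grad[of 0 \<Omega> "B k j"] B_C1[of k j] by (auto intro!: continuous_intros)
  obtain \<beta>1 where \<beta>1: "\<beta>1 \<ge> 1" "\<And>k j z. z \<in> Q \<Longrightarrow> \<bar>B k j z\<bar> \<le> \<beta>1" using bounded_on_Q[of B, OF cB(1)] by metis
  obtain \<beta>2 where \<beta>2: "\<beta>2 \<ge> 1" "\<And>k j z. z \<in> Q \<Longrightarrow> \<bar>norm (grad (B k j) z)\<bar> \<le> \<beta>2"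
    using bounded_on_Q[of "\<lambda>k j z. norm (grad (B k j) z)", OF cB(2)] by metis
  define \<beta> where "\<beta> = max \<beta>1 \<beta>2"
  have \<beta>: "\<beta> \<ge> 1" "\<And>k j z. z \<in> Q \<Longrightarrow> \<bar>B k j z\<bar> \<le> \<beta>" "\<And>k j z. z \<in> Q \<Longrightarrow> norm (grad (B k j) z) \<le> \<beta>"
    using \<beta>1 \<beta>2 by (auto simp: \<beta>_def le_max_iff_disj)
  have \<beta>': "\<And>k j z. z \<in> Q \<Longrightarrow> \<bar>grad (B k j) z $ k\<bar> \<le> \<beta>"
    using \<beta>(3) component_le_norm_cart order_trans by blast
  let ?n = "real CARD('n)"
  define \<rho> where "\<rho> = h / 2"
  define r where "r = \<rho> / (4 * ?n\<^sup>2 * \<beta>)"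
  have \<rho>: "0 < \<rho>" "\<rho> < h" using h_pos by (auto simp: \<rho>_def)
  have X1: "4 * ?n\<^sup>2 * \<beta> \<ge> 1"
  proof -
    have n1: "?n \<ge> 1" by (simp add: Suc_leI)
    show ?thesis using n1 \<beta>(1) mult_mono[of 1 "4 * ?n\<^sup>2" 1 \<beta>] one_le_power[OF n1, of 2] by simp
  qed
  have r: "0 < r" "r \<le> \<rho>"
  proof -
    show "0 < r" unfolding r_def by (rule divide_pos_pos) (use \<rho> X1 in linarith)+
    define X where "X = 4 * ?n\<^sup>2 * \<beta>"
    have "\<rho> / X \<le> \<rho> / 1" by (rule divide_left_mono) (use \<rho> X1[folded X_def] in auto)
    then show "r \<le> \<rho>" by (simp add: r_def X_def)
  qed
  \<comment> \<open>Halving both radii preserves their ratio, so \<open>transport_energy\<close>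
    applies a second time, starting from the smaller plaque.\<close>
  have r2: "r / 2 = (\<rho> / 2) / (4 * ?n\<^sup>2 * \<beta>)" by (simp add: r_def)
  define P1 where "P1 = plaque r \<rho>"
  define P2 where "P2 = plaque (r / 2) (\<rho> / 2)"
  define P3 where "P3 = plaque (r / 2 / 2) (\<rho> / 2 / 2)"
  have sub: "P1 \<subseteq> Q" "P2 \<subseteq> Q" "P3 \<subseteq> Q" unfolding P1_def P2_def P3_def by (rule plaque_sub_Q; use r \<rho> in simp)+
  have comp: "compact P1" "compact P2" "compact P3" unfolding P1_def P2_def P3_def by (rule compact_plaque; use r \<rho> in simp)+
  define TE where "TE L r \<rho> = exp (?n * h * (L + ?n * \<beta>)) / (flatexp 0 (3 * r\<^sup>2 / 4) * flatexp 0 (\<rho>\<^sup>2 / 4))" for L r \<rho>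
  have TE0: "TE L r \<rho> \<ge> 0" for L r \<rho> unfolding TE_def by (intro divide_nonneg_nonneg mult_nonneg_nonneg flatexp_nonneg) auto
  have emP2: "emeasure lborel P2 \<noteq> 0" unfolding P2_def using r \<rho> by (intro plaque_emeasure_pos) auto
  have emP2': "emeasure lborel P2 \<noteq> \<infinity>" using emeasure_compact_finite[OF comp(2)] by simp
  define V where "V = measure lborel P2"
  have V: "V > 0" unfolding V_def using emP2 emP2' by (simp add: zero_less_measure_iff emeasure_eq_ennreal_measure)
  have P2b: "P2 \<in> sets borel" using comp(2) by (simp add: compact_imp_closed)
  interpret M: mixing_domain P2 "- J"
    by unfold_locales (use P2b emP2 emP2' convex_plaque mix_in_plaque in \<open>auto simp: P2_def\<close>)
  interpret U: prob_space M.U by (rule M.prob_space_U)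
  obtain R where R: "\<And>z \<zeta>. z \<in> Q \<Longrightarrow> \<zeta> \<in> Q \<Longrightarrow> norm (z - \<zeta>) \<le> R"
  proof -
    obtain b where "\<And>z. z \<in> Q \<Longrightarrow> norm z \<le> b" using compact_imp_bounded[OF Q_props(1)] bounded_iff by blast
    then have "norm (z - \<zeta>) \<le> b + b" if "z \<in> Q" "\<zeta> \<in> Q" for z \<zeta>
      using that norm_triangle_ineq4[of z \<zeta>] by (meson add_mono order_trans)
    then show ?thesis using that by blast
  qed
  have aQ: "a \<in> Q" using h_pos by (simp add: mem_Q)
  have R0: "R \<ge> 0" using R[OF aQ aQ] by simp
  obtain C3 where C3: "C3 \<ge> 0" "\<And>H G B. integrable M.U H \<Longrightarrow> H \<in> borel_measurable borel \<Longrightarrow> G \<in> borel_measurable borel \<Longrightarrow>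
    (\<forall>z. 0 \<le> G z \<and> G z \<le> B) \<Longrightarrow>
    (\<forall>z\<in>P2. \<forall>z'\<in>P2. (\<forall>k\<in>- J. z $ k = z' $ k) \<longrightarrow> G z = G z') \<Longrightarrow>
    (\<forall>z\<in>P2. \<forall>\<zeta>\<in>P2. ennreal \<bar>H z - H \<zeta>\<bar> \<le> ennreal R * (\<integral>\<^sup>+t. ennreal (G ((1 - t) *\<^sub>R z + t *\<^sub>R \<zeta>)) \<partial>unit_uniform)) \<Longrightarrow>
    (\<integral>\<^sup>+z. ennreal (\<bar>H z - (\<integral>\<zeta>. H \<zeta> \<partial>M.U)\<bar> powr q) \<partial>M.U) \<le> ennreal (C3 * (\<integral>z. G z powr p \<partial>M.U) powr (q / p))"
    using M.sobolev_poincare[OF p pq R0] by blast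
  define S where "S = {z. dist2 J z < (r / 2 / 2)\<^sup>2 \<and> dist2 (- J) z < (\<rho> / 2 / 2)\<^sup>2}"
  have S: "open S" "a \<in> S" "S \<subseteq> P3"
    unfolding S_def P3_def by (rule open_plaque_interior, rule center_in_plaque_interior, use r \<rho> in \<open>auto simp: plaque_def\<close>)
  have "\<exists>C. \<forall>f. leafwise_constant f \<longrightarrow>
    (LINT z:Q|lborel. \<bar>f z\<bar> powr p) \<le> N \<longrightarrow> (LINT z:Q|lborel. norm (grad f z) powr p) \<le> N \<longrightarrow>
    (\<integral>\<^sup>+z\<in>S. ennreal (\<bar>f z\<bar> powr q) \<partial>lborel) \<le> ennreal C" for N
  proof -
    define K where "K = 2 powr p * (measure lborel Q + N)"
    define M1 where "M1 = TE 0 r \<rho> * K"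
    define M2 where "M2 = TE (p * ?n\<^sup>2 * \<beta>) r \<rho> * K"
    define M3 where "M3 = 2 powr q * (C3 * (M2 / V) powr (q / p) + (M1 / V) powr q)"
    define C where "C = TE 0 (r / 2) (\<rho> / 2) * (2 powr q * (V + V * M3))"
    have "(\<integral>\<^sup>+z\<in>S. ennreal (\<bar>f z\<bar> powr q) \<partial>lborel) \<le> ennreal C"
      if f: "leafwise_constant f" and N1: "(LINT z:Q|lborel. \<bar>f z\<bar> powr p) \<le> N" and N2: "(LINT z:Q|lborel. norm (grad f z) powr p) \<le> N" for f
    proof -
      have C2f: "C_on 2 \<Omega> f" using f by (simp add: leafwise_constant_def)
      have C1f: "C_on 1 \<Omega> f" by (rule C_on_mono[OF C2f]) simp
      have cf: "continuous_on Q f" using C_on_imp_continuous_on[OF C1f] continuous_on_subset Q_props(3) by blast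
      have cg: "continuous_on Q (grad f)" using continuous_on_grad[of 0 \<Omega> f] C1f continuous_on_subset Q_props(3) by auto
      have cS: "continuous_on P2 (\<lambda>z. g (slide 0 z))" if "continuous_on Q g" for g :: "real ^ 'n \<Rightarrow> 'c::topological_space"
        by (rule continuous_on_compose2[OF that continuous_on_slide]) (use slide_in_Q[of _ 0] sub in auto)
      have SQ: "slide 0 z \<in> Q" if "z \<in> P2" for z using slide_in_Q[of z 0] that sub by auto
      have cbr: "continuous_on X (\<lambda>z. (1 + (g z)\<^sup>2) powr s)" if "continuous_on X g" for X :: "(real ^ 'n) set" and g :: "real ^ 'n \<Rightarrow> real" and s
        by (intro continuous_on_powr continuous_intros that) (metis add_pos_nonneg less_irrefl zero_le_power2 zero_less_one)
      have N0: "N \<ge> 0" using N1 set_integral_nonneg_continuous[of Q "\<lambda>z. \<bar>f z\<bar> powr p"] by simp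
      have K1: "(LINT z:P1|lborel. (1 + (f z)\<^sup>2) powr (p / 2)) \<le> K"
        unfolding K_def
        by (rule order_trans[OF bracket_integral_bound[OF comp(1) Q_props(1) sub(1) cf] mult_left_mono]) (use p N1 in auto)
      have K2: "(LINT z:P1|lborel. (1 + (norm (grad f z))\<^sup>2) powr (p / 2)) \<le> K"
        unfolding K_def
        by (rule order_trans[OF bracket_integral_bound[OF comp(1) Q_props(1) sub(1) continuous_on_norm[OF cg]] mult_left_mono]) (use p N2 in auto)
      have M1: "(LINT z:P2|lborel. (1 + (f (slide 0 z))\<^sup>2) powr (p / 2)) \<le> M1"
      proof -
        \<comment> \<open>Backward in time: \<open>c0 = 1\<close> and \<open>c1 = -1\<close> lead
          from the identity to the freezing.\<close>
        have "(LINT z:plaque (r / 2) (\<rho> / 2)|lborel. (1 + (f (slide (1 + -1) z))\<^sup>2) powr (p / 2)) \<le>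
          TE 0 r \<rho> * (LINT z:plaque r \<rho>|lborel. (1 + (f (slide 1 z))\<^sup>2) powr (p / 2))"
          unfolding TE_def
          by (rule transport_energy[OF _ \<beta>(1,2) \<beta>' \<rho> r_def transport_bracket(1)[OF f] _ _ transport_bracket(2)[OF f]]) (use p in auto)
        also have "\<dots> \<le> TE 0 r \<rho> * K" using K1 TE0 by (intro mult_left_mono) (auto simp: P1_def)
        finally show ?thesis by (simp add: M1_def P2_def)
      qed
      have M2: "(LINT z:P2|lborel. (1 + (norm (grad f (slide 0 z)))\<^sup>2) powr (p / 2)) \<le> M2"
      proof -
        have "(LINT z:plaque (r / 2) (\<rho> / 2)|lborel. (1 + (norm (grad f (slide (1 + -1) z)))\<^sup>2) powr (p / 2)) \<le>
          TE (p * ?n\<^sup>2 * \<beta>) r \<rho> * (LINT z:plaque r \<rho>|lborel. (1 + (norm (grad f (slide 1 z)))\<^sup>2) powr (p / 2))"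
          unfolding TE_def
          by (rule transport_energy[OF _ \<beta>(1,2) \<beta>' \<rho> r_def transport_grad_bracket(1)[OF f _ \<beta>(3)] _ _ transport_grad_bracket(2)[OF f _ \<beta>(3)]]) (use p \<beta>(1) in auto)
        also have "\<dots> \<le> TE (p * ?n\<^sup>2 * \<beta>) r \<rho> * K" using K2 TE0 by (intro mult_left_mono) (auto simp: P1_def)
        finally show ?thesis by (simp add: M2_def P2_def)
      qed
      define H where "H z = indicator P2 z *\<^sub>R f (slide 0 z)" for z
      define G where "G z = indicator P2 z *\<^sub>R norm (grad f (slide 0 z))" for z
      have Hb: "H \<in> borel_measurable borel" unfolding H_def[abs_def]
        by (rule borel_measurable_continuous_on_indicator[OF P2b cS[OF cf]])
      have Gb: "G \<in> borel_measurable borel" unfolding G_def[abs_def]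
        by (rule borel_measurable_continuous_on_indicator[OF P2b cS[OF continuous_on_norm[OF cg]]])
      obtain b1 where b1: "\<And>z. z \<in> Q \<Longrightarrow> \<bar>f z\<bar> \<le> b1"
        using compact_imp_bounded[OF compact_continuous_image[OF cf Q_props(1)]] unfolding bounded_iff by auto
      obtain b2 where b2: "\<And>z. z \<in> Q \<Longrightarrow> norm (grad f z) \<le> b2"
        using compact_imp_bounded[OF compact_continuous_image[OF cg Q_props(1)]] unfolding bounded_iff by auto
      have Hb1: "\<bar>H z\<bar> \<le> max 0 b1" for z using b1[OF SQ, of z] by (cases "z \<in> P2") (auto simp: H_def)
      have Hi: "integrable M.U H"
        by (rule U.integrable_const_bound[where B="max 0 b1"]) (use Hb1 Hb in \<open>auto simp: measurable_cong_sets[of M.U borel borel borel]\<close>)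
      have GB: "\<forall>z. 0 \<le> G z \<and> G z \<le> max 0 b2" using b2[OF SQ] by (auto simp: G_def indicator_def le_max_iff_disj)
      have inv: "\<forall>z\<in>P2. \<forall>z'\<in>P2. (\<forall>k\<in>- J. z $ k = z' $ k) \<longrightarrow> G z = G z'"
      proof (intro ballI impI)
        fix z z' assume "z \<in> P2" "z' \<in> P2" "\<forall>k\<in>- J. z $ k = z' $ k"
        moreover from this have "slide 0 z = slide 0 z'" by (auto simp: slide_def vec_eq_iff)
        ultimately show "G z = G z'" by (simp add: G_def)
      qed
      have seg: "\<forall>z\<in>P2. \<forall>\<zeta>\<in>P2. ennreal \<bar>H z - H \<zeta>\<bar> \<le> ennreal R * (\<integral>\<^sup>+t. ennreal (G ((1 - t) *\<^sub>R z + t *\<^sub>R \<zeta>)) \<partial>unit_uniform)"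
      proof (intro ballI)
        fix z \<zeta> assume z: "z \<in> P2" "\<zeta> \<in> P2"
        define G' where "G' y = indicator Q y *\<^sub>R norm (grad f y)" for y
        have G'b: "G' \<in> borel_measurable borel" unfolding G'_def[abs_def]
          by (rule borel_measurable_continuous_on_indicator[OF _ continuous_on_norm[OF cg]]) (use Q_props in \<open>auto simp: compact_imp_closed\<close>)
        have "ennreal \<bar>f (slide 0 z) - f (slide 0 \<zeta>)\<bar> \<le> ennreal R * (\<integral>\<^sup>+t. ennreal (G' ((1 - t) *\<^sub>R slide 0 z + t *\<^sub>R slide 0 \<zeta>)) \<partial>unit_uniform)"
          by (rule segment_gradient_bound[OF C1f Q_props(2,3) SQ[OF z(1)] SQ[OF z(2)] G'b _ R[OF SQ[OF z(1)] SQ[OF z(2)]]]) (simp add: G'_def)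
        also have "(\<integral>\<^sup>+t. ennreal (G' ((1 - t) *\<^sub>R slide 0 z + t *\<^sub>R slide 0 \<zeta>)) \<partial>unit_uniform) = (\<integral>\<^sup>+t. ennreal (G ((1 - t) *\<^sub>R z + t *\<^sub>R \<zeta>)) \<partial>unit_uniform)"
        proof (rule nn_integral_cong_AE, use AE_unit_uniform in eventually_elim)
          case (elim t)
          have "(1 - t) *\<^sub>R z + t *\<^sub>R \<zeta> \<in> P2" using convexD[OF M.D_convex z, of "1 - t" t] elim by simp
          then show ?case using SQ by (simp add: G'_def G_def slide_affine[symmetric])
        qed
        finally show "ennreal \<bar>H z - H \<zeta>\<bar> \<le> ennreal R * (\<integral>\<^sup>+t. ennreal (G ((1 - t) *\<^sub>R z + t *\<^sub>R \<zeta>)) \<partial>unit_uniform)"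
          using z by (simp add: H_def)
      qed
      define m where "m = (\<integral>\<zeta>. H \<zeta> \<partial>M.U)"
      have Gp: "(\<integral>z. G z powr p \<partial>M.U) \<le> M2 / V"
      proof -
        have c: "continuous_on P2 (\<lambda>z. norm (grad f (slide 0 z)) powr p)"
          using p by (intro continuous_on_powr' continuous_on_norm cS[OF cg] continuous_intros) auto
        have "(\<integral>z. G z powr p \<partial>M.U) = (\<integral>z. indicator P2 z *\<^sub>R (norm (grad f (slide 0 z)) powr p) \<partial>M.U)"
          using p by (intro Bochner_Integration.integral_cong) (auto simp: G_def indicator_def)
        also have "\<dots> = (LINT z:P2|lborel. norm (grad f (slide 0 z)) powr p) / V"
          unfolding V_def by (rule uniform_measure_continuous(2)[OF comp(2) emP2 c]) simp
        also have "(LINT z:P2|lborel. norm (grad f (slide 0 z)) powr p) \<le> (LINT z:P2|lborel. (1 + (norm (grad f (slide 0 z)))\<^sup>2) powr (p / 2))"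
          by (rule set_integral_nonneg_mono[OF comp(2,2) order_refl c cbr[OF continuous_on_norm[OF cS[OF cg]]]])
             (use abs_powr_le_bracket[of p "norm (grad f (slide 0 z))" for z] p in auto)
        also have "\<dots> \<le> M2" by (rule M2)
        finally show ?thesis using V by (simp add: divide_right_mono)
      qed
      have mM: "\<bar>m\<bar> \<le> M1 / V"
      proof -
        have c: "continuous_on P2 (\<lambda>z. \<bar>f (slide 0 z)\<bar>)" by (intro continuous_intros cS[OF cf])
        have "\<bar>m\<bar> \<le> (\<integral>z. \<bar>H z\<bar> \<partial>M.U)" unfolding m_def by (rule integral_abs_bound)
        also have "\<dots> = (\<integral>z. indicator P2 z *\<^sub>R \<bar>f (slide 0 z)\<bar> \<partial>M.U)"
          by (intro Bochner_Integration.integral_cong) (auto simp: H_def indicator_def)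
        also have "\<dots> = (LINT z:P2|lborel. \<bar>f (slide 0 z)\<bar>) / V"
          unfolding V_def by (rule uniform_measure_continuous(2)[OF comp(2) emP2 c]) simp
        also have "(LINT z:P2|lborel. \<bar>f (slide 0 z)\<bar>) \<le> (LINT z:P2|lborel. (1 + (f (slide 0 z))\<^sup>2) powr (p / 2))"
        proof (rule set_integral_nonneg_mono[OF comp(2,2) order_refl c cbr[OF cS[OF cf]]])
          fix z
          \<comment> \<open>The base \<open>1 + (f (slide 0 z))\<^sup>2\<close> is at least 1, so
            raising the exponent from 1/2 to \<open>p / 2\<close> increases the power; this takes
            the place of Hoelder's inequality.\<close>
          have "\<bar>f (slide 0 z)\<bar> \<le> (1 + (f (slide 0 z))\<^sup>2) powr (1 / 2)" using abs_powr_le_bracket[of 1 "f (slide 0 z)"] by simp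
          also have "\<dots> \<le> (1 + (f (slide 0 z))\<^sup>2) powr (p / 2)" using p by (intro powr_mono) auto
          finally show "\<bar>f (slide 0 z)\<bar> \<le> (1 + (f (slide 0 z))\<^sup>2) powr (p / 2)" .
        qed auto
        also have "\<dots> \<le> M1" by (rule M1)
        finally show ?thesis using V by (simp add: divide_right_mono)
      qed
      have q0: "q \<ge> 1" using p by simp
      have M1_0: "M1 \<ge> 0" using order_trans[OF set_integral_nonneg_continuous M1] by simp
      have M3_0: "M3 \<ge> 0" using C3(1) by (simp add: M3_def)
      have "(\<integral>\<^sup>+z. ennreal (\<bar>H z - m\<bar> powr q) \<partial>M.U) \<le> ennreal (C3 * (\<integral>z. G z powr p \<partial>M.U) powr (q / p))"
        unfolding m_def by (rule C3(2)[OF Hi Hb Gb GB inv seg])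
      also have "\<dots> \<le> ennreal (C3 * (M2 / V) powr (q / p))"
        using C3(1) Gp p by (intro ennreal_leI mult_left_mono powr_mono2) (auto intro!: integral_nonneg_AE)
      finally have sob: "(\<integral>\<^sup>+z. ennreal (\<bar>H z - m\<bar> powr q) \<partial>M.U) \<le> ennreal (C3 * (M2 / V) powr (q / p))" .
      have "(\<integral>\<^sup>+z. ennreal (\<bar>H z\<bar> powr q) \<partial>M.U) \<le> (\<integral>\<^sup>+z. ennreal (2 powr q) * (ennreal (\<bar>H z - m\<bar> powr q) + ennreal (\<bar>m\<bar> powr q)) \<partial>M.U)"
      proof (rule nn_integral_mono)
        fix z
        have "\<bar>H z\<bar> powr q \<le> (\<bar>H z - m\<bar> + \<bar>m\<bar>) powr q" using q0 by (intro powr_mono2) auto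
        also have "\<dots> \<le> 2 powr q * (\<bar>H z - m\<bar> powr q + \<bar>m\<bar> powr q)" using q0 by (intro powr_add_le) auto
        finally show "ennreal (\<bar>H z\<bar> powr q) \<le> ennreal (2 powr q) * (ennreal (\<bar>H z - m\<bar> powr q) + ennreal (\<bar>m\<bar> powr q))"
          by (simp add: ennreal_mult[symmetric] ennreal_plus[symmetric] ennreal_leI del: ennreal_plus)
      qed
      also have "\<dots> = ennreal (2 powr q) * ((\<integral>\<^sup>+z. ennreal (\<bar>H z - m\<bar> powr q) \<partial>M.U) + ennreal (\<bar>m\<bar> powr q))"
      proof -
        have [measurable]: "H \<in> borel_measurable M.U" using Hi by simp
        show ?thesis using U.emeasure_space_1 by (subst nn_integral_cmult, measurable, subst nn_integral_add) auto
      qed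
      also have "\<dots> \<le> ennreal (2 powr q) * (ennreal (C3 * (M2 / V) powr (q / p)) + ennreal ((M1 / V) powr q))"
        using mM q0 by (intro mult_left_mono add_mono sob ennreal_leI powr_mono2) auto
      also have "\<dots> = ennreal M3" using C3(1) by (simp add: M3_def ennreal_mult[symmetric] ennreal_plus[symmetric] del: ennreal_plus)
      finally have HM3: "(\<integral>\<^sup>+z. ennreal (\<bar>H z\<bar> powr q) \<partial>M.U) \<le> ennreal M3" .
      have c: "continuous_on P2 (\<lambda>z. \<bar>f (slide 0 z)\<bar> powr q)" using q0 by (intro continuous_on_powr' cS[OF cf] continuous_intros) auto
      have "ennreal ((LINT z:P2|lborel. \<bar>f (slide 0 z)\<bar> powr q) / V) = (\<integral>\<^sup>+z. ennreal (indicator P2 z *\<^sub>R \<bar>f (slide 0 z)\<bar> powr q) \<partial>M.U)"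
        unfolding V_def by (rule uniform_measure_continuous(3)[OF comp(2) emP2 c, symmetric]) simp
      also have "\<dots> = (\<integral>\<^sup>+z. ennreal (\<bar>H z\<bar> powr q) \<partial>M.U)"
        using q0 by (intro nn_integral_cong) (auto simp: H_def indicator_def)
      also have "\<dots> \<le> ennreal M3" by (rule HM3)
      finally have "(LINT z:P2|lborel. \<bar>f (slide 0 z)\<bar> powr q) / V \<le> M3" using M3_0 by simp
      then have Hq: "(LINT z:P2|lborel. \<bar>f (slide 0 z)\<bar> powr q) \<le> V * M3" using V by (simp add: pos_divide_le_eq mult.commute)
      have M4: "(LINT z:P2|lborel. (1 + (f (slide 0 z))\<^sup>2) powr (q / 2)) \<le> 2 powr q * (V + V * M3)"
        unfolding V_def
        by (rule order_trans[OF bracket_integral_bound[OF comp(2,2) order_refl cS[OF cf]] mult_left_mono]) (use q0 Hq V_def in auto)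
      \<comment> \<open>Forward in time on the halved plaques: \<open>c0 = 0\<close> and
        \<open>c1 = 1\<close> lead from the freezing back to \<open>f\<close> itself.\<close>
      have "(LINT z:plaque (r / 2 / 2) (\<rho> / 2 / 2)|lborel. (1 + (f (slide (0 + 1) z))\<^sup>2) powr (q / 2)) \<le>
          TE 0 (r / 2) (\<rho> / 2) * (LINT z:plaque (r / 2) (\<rho> / 2)|lborel. (1 + (f (slide 0 z))\<^sup>2) powr (q / 2))"
        unfolding TE_def
        by (rule transport_energy[OF _ \<beta>(1,2) \<beta>' _ _ r2 transport_bracket(1)[OF f] _ _ transport_bracket(2)[OF f]]) (use q0 \<rho> in auto)
      also have "\<dots> \<le> C" unfolding C_def using M4 TE0 by (intro mult_left_mono) (auto simp: P2_def)
      finally have fin: "(LINT z:P3|lborel. (1 + (f z)\<^sup>2) powr (q / 2)) \<le> C" by (simp add: P3_def)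
      have "(\<integral>\<^sup>+z\<in>S. ennreal (\<bar>f z\<bar> powr q) \<partial>lborel) \<le> (\<integral>\<^sup>+z\<in>P3. ennreal ((1 + (f z)\<^sup>2) powr (q / 2)) \<partial>lborel)"
        using S(3) abs_powr_le_bracket[of q] q0 by (intro nn_integral_mono) (auto simp: indicator_def intro!: ennreal_leI)
      also have "\<dots> = ennreal (LINT z:P3|lborel. (1 + (f z)\<^sup>2) powr (q / 2))"
        by (rule nn_set_integral_eq_set_integral[OF comp(3) cbr[OF continuous_on_subset[OF cf sub(3)]]]) simp
      also have "\<dots> \<le> ennreal C" using fin by (rule ennreal_leI)
      finally show ?thesis .
    qed
    then show ?thesis by blast
  qed
  note main = this
  show ?thesis
    by (rule exI[of _ S], intro conjI allI S(1,2) main) (use S(3) sub(3) in blast)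
qed

end

section \<open>Change of variables\<close>

text \<open>The library proves the change of variables formula for well-ordered index types only.\<close>

typedef 'a ordered_copy = "UNIV :: 'a set" by simp

lemma bij_Rep_ordered_copy: "bij Rep_ordered_copy"
proof (rule bijI)
  show "inj Rep_ordered_copy" by (simp add: inj_def Rep_ordered_copy_inject)
  show "surj Rep_ordered_copy" by (rule surjI[of _ Abs_ordered_copy]) (simp add: Abs_ordered_copy_inverse)
qed

instance ordered_copy :: (finite) finite
proof
  have "finite (range (Rep_ordered_copy :: 'a ordered_copy \<Rightarrow> 'a))" by simp
  then show "finite (UNIV :: 'a ordered_copy set)"
    using bij_is_inj[OF bij_Rep_ordered_copy] by (rule finite_imageD)
qed

definition ordered_copy_rank :: "'a::finite ordered_copy \<Rightarrow> nat" where
  "ordered_copy_rank = (SOME f. inj f)"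

lemma inj_ordered_copy_rank: "inj (ordered_copy_rank :: 'a::finite ordered_copy \<Rightarrow> nat)"
proof -
  obtain f :: "'a ordered_copy \<Rightarrow> nat" where "inj f"
    using finite_imp_inj_to_nat_seg[OF finite[of "UNIV :: 'a ordered_copy set"]] by auto
  then show ?thesis unfolding ordered_copy_rank_def by (rule someI[where P=inj])
qed

instantiation ordered_copy :: (finite) wellorder
begin

definition less_eq_ordered_copy :: "'a ordered_copy \<Rightarrow> 'a ordered_copy \<Rightarrow> bool" where
  "less_eq_ordered_copy x y \<longleftrightarrow> ordered_copy_rank x \<le> ordered_copy_rank y"

definition less_ordered_copy :: "'a ordered_copy \<Rightarrow> 'a ordered_copy \<Rightarrow> bool" where
  "less_ordered_copy x y \<longleftrightarrow> ordered_copy_rank x < ordered_copy_rank y"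

instance
proof
  fix x y :: "'a ordered_copy"
  show "x \<le> y \<Longrightarrow> y \<le> x \<Longrightarrow> x = y"
    using inj_ordered_copy_rank by (auto simp: less_eq_ordered_copy_def inj_def)
next
  fix P :: "'a ordered_copy \<Rightarrow> bool" and a :: "'a ordered_copy"
  assume "\<And>x. (\<And>y. y < x \<Longrightarrow> P y) \<Longrightarrow> P x"
  then show "P a" unfolding less_ordered_copy_def
    by (induction a rule: measure_induct_rule[where f=ordered_copy_rank]) blast
qed (auto simp: less_eq_ordered_copy_def less_ordered_copy_def)

end

section \<open>Lebesgue measure and determinants under renaming of coordinates\<close>

definition from_copy :: "real ^ 'n ordered_copy \<Rightarrow> real ^ 'n::finite" where
  "from_copy y = (\<chi> i. y $ Abs_ordered_copy i)"

definition to_copy :: "real ^ 'n::finite \<Rightarrow> real ^ 'n ordered_copy" where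
  "to_copy x = (\<chi> i. x $ Rep_ordered_copy i)"

lemma from_to_copy [simp]: "from_copy (to_copy x) = x" "to_copy (from_copy y) = y"
  by (simp_all add: from_copy_def to_copy_def vec_eq_iff Abs_ordered_copy_inverse Rep_ordered_copy_inverse)

lemma linear_copy: "bounded_linear from_copy" "bounded_linear to_copy"
  by (auto intro!: linear_linear[THEN iffD2] linearI simp: from_copy_def to_copy_def vec_eq_iff)

text \<open>Conjugation with the bijection matches the permutations of the two index types and
  preserves signs.\<close>

lemma det_reindex:
  fixes M :: "real ^ 'n::finite ^ 'n"
  shows "det (\<chi> i j. M $ Rep_ordered_copy i $ Rep_ordered_copy j) = det M"
proof -
  let ?r = "Rep_ordered_copy :: 'n ordered_copy \<Rightarrow> 'n"
  have r: "bij ?r" by (rule bij_Rep_ordered_copy)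
  have rU: "?r ` UNIV = UNIV" using r by (simp add: bij_def)
  have inj: "inj ?r" using r by (simp add: bij_def)
  let ?m = "map_permutation UNIV ?r"
  have bij: "bij_betw ?m {p. p permutes UNIV} {p. p permutes UNIV}"
  proof -
    have "?m = (\<lambda>p x. if x \<in> UNIV then ?r (p (inv_into UNIV ?r x)) else x)"
      by (auto simp: fun_eq_iff map_permutation_def restrict_id_def rU)
    then show ?thesis using bij_betw_permutations[OF r] by simp
  qed
  have "det M = (\<Sum>p | p permutes UNIV. of_int (sign (?m p)) * (\<Prod>i\<in>UNIV. M $ i $ ?m p i))"
    unfolding det_def by (rule sum.reindex_bij_betw[OF bij, symmetric])
  also have "\<dots> = (\<Sum>p | p permutes UNIV. of_int (sign p) * (\<Prod>i\<in>UNIV. M $ ?r i $ ?r (p i)))"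
  proof (rule sum.cong[OF refl])
    fix p :: "'n ordered_copy \<Rightarrow> 'n ordered_copy" assume "p \<in> {p. p permutes UNIV}"
    then have p: "p permutes UNIV" by simp
    have "sign (?m p) = sign p" by (rule sign_map_permutation[OF inj p]) simp
    moreover have "(\<Prod>i\<in>UNIV. M $ i $ ?m p i) = (\<Prod>i\<in>UNIV. M $ ?r i $ ?m p (?r i))"
      by (rule prod.reindex_bij_betw[OF r, symmetric])
    moreover have "?m p (?r i) = ?r (p i)" for i by (rule map_permutation_apply[OF inj]) simp
    ultimately show "of_int (sign (?m p)) * (\<Prod>i\<in>UNIV. M $ i $ ?m p i) = of_int (sign p) * (\<Prod>i\<in>UNIV. M $ ?r i $ ?r (p i))"
      by simp
  qed
  finally show ?thesis by (simp add: det_def)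
qed

lemma emeasure_lborel_box_cart:
  fixes l u :: "real ^ 'n::finite"
  assumes "\<And>i. l $ i \<le> u $ i"
  shows "emeasure lborel (box l u) = ennreal (\<Prod>i\<in>UNIV. u $ i - l $ i)"
proof -
  have B: "(Basis :: (real ^ 'n) set) = (\<lambda>i. axis i 1) ` UNIV" by (auto simp: Basis_vec_def)
  have inj: "inj (\<lambda>i::'n. axis i 1 :: real ^ 'n)" by (auto simp: inj_def axis_eq_axis)
  have "emeasure lborel (box l u) = ennreal (\<Prod>b\<in>Basis. (u - l) \<bullet> b)"
    using assms by (intro emeasure_lborel_box) (auto simp: B inner_axis)
  then show ?thesis unfolding B prod.reindex[OF inj] by (simp add: inner_axis)
qed

text \<open>Boxes correspond to boxes with the same side lengths, and Lebesgue measure is determined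
  by its values on boxes.\<close>

lemma distr_from_copy: "distr lborel borel from_copy = (lborel :: (real ^ 'n::finite) measure)"
proof (rule lborel_eqI[symmetric])
  have [measurable]: "from_copy \<in> borel_measurable borel"
    using linear_copy by (intro borel_measurable_continuous_onI linear_continuous_on)
  fix l u :: "real ^ 'n" assume le: "\<And>b. b \<in> Basis \<Longrightarrow> l \<bullet> b \<le> u \<bullet> b"
  have le': "l $ i \<le> u $ i" for i using le[of "axis i 1"] by (auto simp: inner_axis Basis_vec_def)
  have "from_copy -` box l u = box (to_copy l) (to_copy u)"
    by (auto simp: mem_box_cart from_copy_def to_copy_def) (metis Rep_ordered_copy_inverse Abs_ordered_copy_inverse UNIV_I)+
  then have "emeasure (distr lborel borel from_copy) (box l u) = emeasure lborel (box (to_copy l) (to_copy u))"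
    by (simp add: emeasure_distr)
  also have "\<dots> = ennreal (\<Prod>i\<in>UNIV. to_copy u $ i - to_copy l $ i)"
    by (rule emeasure_lborel_box_cart) (simp add: to_copy_def le')
  also have "(\<Prod>i\<in>UNIV. to_copy u $ i - to_copy l $ i) = (\<Prod>i\<in>UNIV. u $ i - l $ i)"
    unfolding to_copy_def vec_lambda_beta by (rule prod.reindex_bij_betw[OF bij_Rep_ordered_copy])
  also have "ennreal \<dots> = emeasure lborel (box l u)" by (rule emeasure_lborel_box_cart[symmetric]) (rule le')
  finally show "emeasure (distr lborel borel from_copy) (box l u) = (\<Prod>b\<in>Basis. (u - l) \<bullet> b)"
    using le by (simp add: emeasure_lborel_box)
qed simp

text \<open>For gauge integrals, one side has the value \<open>b\<close> if and only if the other
  has. Whichever extended integral is finite thus determines the other; if neither is finite, both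
  are infinite.\<close>

lemma nn_change_of_variables_wellorder:
  fixes f :: "real ^ 'k::{finite,wellorder} \<Rightarrow> real" and t :: "real ^ 'k::_ \<Rightarrow> real ^ 'k::_"
  assumes der: "\<And>x. x \<in> S \<Longrightarrow> (t has_derivative t' x) (at x within S)"
    "\<And>y. y \<in> T \<Longrightarrow> (s has_derivative s' y) (at y within T)"
    and f0: "\<And>y. y \<in> T \<Longrightarrow> 0 \<le> f y"
    and ts: "\<And>x. x \<in> S \<Longrightarrow> t x \<in> T \<and> s (t x) = x" "\<And>y. y \<in> T \<Longrightarrow> s y \<in> S \<and> t (s y) = y"
    and id: "\<And>y. y \<in> T \<Longrightarrow> s' y \<circ> t' (s y) = id"
    and meas: "(\<lambda>x. indicator S x * (\<bar>det (matrix (t' x))\<bar> * f (t x))) \<in> borel_measurable borel"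
      "(\<lambda>y. indicator T y * f y) \<in> borel_measurable borel"
  shows "(\<integral>\<^sup>+x\<in>S. ennreal (\<bar>det (matrix (t' x))\<bar> * f (t x)) \<partial>lborel) = (\<integral>\<^sup>+y\<in>T. ennreal (f y) \<partial>lborel)"
proof -
  have iff: "((\<lambda>x. \<bar>det (matrix (t' x))\<bar> * f (t x)) has_integral b) S \<longleftrightarrow> (f has_integral b) T" for b
    by (rule cov_invertible_nonneg_eq[OF der f0 ts id])
  have hi: "(F has_integral r) X" if "(\<integral>\<^sup>+x\<in>X. ennreal (F x) \<partial>lborel) = ennreal r" "r \<ge> 0" "\<And>x. x \<in> X \<Longrightarrow> F x \<ge> 0"
    "(\<lambda>x. indicator X x * F x) \<in> borel_measurable borel" for F :: "real ^ 'k::_ \<Rightarrow> real" and X r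
  proof -
    have "((\<lambda>x. indicator X x * F x) has_integral r) UNIV"
    proof (rule nn_integral_has_integral[OF that(4) _ _ that(2)])
      show "0 \<le> indicator X x * F x" for x using that(3) by (auto simp: indicator_def)
      have "(\<integral>\<^sup>+x. ennreal (indicator X x * F x) \<partial>lborel) = (\<integral>\<^sup>+x\<in>X. ennreal (F x) \<partial>lborel)"
        by (intro nn_integral_cong) (auto simp: indicator_def)
      then show "(\<integral>\<^sup>+x. ennreal (indicator X x * F x) \<partial>lborel) = ennreal r" using that(1) by simp
    qed
    also have "(\<lambda>x. indicator X x * F x) = (\<lambda>x. if x \<in> X then F x else 0)" by (auto simp: fun_eq_iff)
    finally show ?thesis by (simp add: has_integral_restrict_UNIV)
  qed
  have nn: "\<bar>det (matrix (t' x))\<bar> * f (t x) \<ge> 0" if "x \<in> S" for x using f0 ts(1)[OF that] by simp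
  let ?L = "\<integral>\<^sup>+x\<in>S. ennreal (\<bar>det (matrix (t' x))\<bar> * f (t x)) \<partial>lborel" and ?R = "\<integral>\<^sup>+y\<in>T. ennreal (f y) \<partial>lborel"
  consider r where "?L = ennreal r" "r \<ge> 0" | r where "?R = ennreal r" "r \<ge> 0" | "?L = \<infinity>" "?R = \<infinity>"
    by (cases ?L; cases ?R) auto
  then show ?thesis
  proof cases
    case 1
    then have "(f has_integral r) T" using hi[OF 1 nn meas(1)] iff by simp
    from nn_integral_has_integral_lebesgue'[OF f0 this] show ?thesis using 1 by simp
  next
    case 2
    then have "((\<lambda>x. \<bar>det (matrix (t' x))\<bar> * f (t x)) has_integral r) S" using hi[OF 2 f0 meas(2)] iff by simp
    from nn_integral_has_integral_lebesgue'[OF nn this] show ?thesis using 2 by simp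
  qed simp
qed

text \<open>Renaming the coordinates preserves Lebesgue measure, determinants and differentiability,
  so that hypotheses and conclusion transfer.\<close>

lemma nn_change_of_variables:
  fixes f :: "real ^ 'n::finite \<Rightarrow> real" and t :: "real ^ 'n \<Rightarrow> real ^ 'n"
  assumes der: "\<And>x. x \<in> S \<Longrightarrow> (t has_derivative t' x) (at x within S)"
    "\<And>y. y \<in> T \<Longrightarrow> (s has_derivative s' y) (at y within T)"
    and f0: "\<And>y. y \<in> T \<Longrightarrow> 0 \<le> f y"
    and ts: "\<And>x. x \<in> S \<Longrightarrow> t x \<in> T \<and> s (t x) = x" "\<And>y. y \<in> T \<Longrightarrow> s y \<in> S \<and> t (s y) = y"
    and id: "\<And>y. y \<in> T \<Longrightarrow> s' y \<circ> t' (s y) = id"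
    and meas: "(\<lambda>x. indicator S x * (\<bar>det (matrix (t' x))\<bar> * f (t x))) \<in> borel_measurable borel"
      "(\<lambda>y. indicator T y * f y) \<in> borel_measurable borel"
  shows "(\<integral>\<^sup>+x\<in>S. ennreal (\<bar>det (matrix (t' x))\<bar> * f (t x)) \<partial>lborel) = (\<integral>\<^sup>+y\<in>T. ennreal (f y) \<partial>lborel)"
proof -
  have fm[measurable]: "from_copy \<in> borel_measurable borel"
    using linear_copy by (intro borel_measurable_continuous_onI linear_continuous_on)
  have transfer: "(\<integral>\<^sup>+x\<in>X. ennreal (F x) \<partial>lborel) = (\<integral>\<^sup>+y\<in>to_copy ` X. ennreal (F (from_copy y)) \<partial>lborel)"
    if m: "(\<lambda>x. indicator X x * F x) \<in> borel_measurable borel" for F :: "real ^ 'n \<Rightarrow> real" and X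
  proof -
    have "(\<integral>\<^sup>+x\<in>X. ennreal (F x) \<partial>lborel) = (\<integral>\<^sup>+x. ennreal (indicator X x * F x) \<partial>distr lborel borel from_copy)"
      unfolding distr_from_copy by (intro nn_integral_cong) (auto simp: indicator_def)
    also have "\<dots> = (\<integral>\<^sup>+y. ennreal (indicator X (from_copy y) * F (from_copy y)) \<partial>lborel)"
      using m by (intro nn_integral_distr) auto
    also have "\<dots> = (\<integral>\<^sup>+y\<in>to_copy ` X. ennreal (F (from_copy y)) \<partial>lborel)"
    proof (intro nn_integral_cong)
      fix y :: "real ^ 'n ordered_copy"
      have "from_copy y \<in> X \<longleftrightarrow> y \<in> to_copy ` X" by (metis from_to_copy imageE imageI)
      then show "ennreal (indicator X (from_copy y) * F (from_copy y)) = ennreal (F (from_copy y)) * indicator (to_copy ` X) y"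
        by (auto simp: indicator_def)
    qed
    finally show ?thesis .
  qed
  have measc: "(\<lambda>y. indicator (to_copy ` X) y * F (from_copy y)) \<in> borel_measurable borel"
    if "(\<lambda>x. indicator X x * F x) \<in> borel_measurable borel" for F :: "real ^ 'n \<Rightarrow> real" and X
  proof -
    have "(\<lambda>y. indicator X (from_copy y) * F (from_copy y)) \<in> borel_measurable borel"
      using measurable_compose[OF fm that] by simp
    also have "(\<lambda>y. indicator X (from_copy y) * F (from_copy y)) = (\<lambda>y. indicator (to_copy ` X) y * F (from_copy y))"
    proof
      fix y :: "real ^ 'n ordered_copy"
      have "from_copy y \<in> X \<longleftrightarrow> y \<in> to_copy ` X" by (metis from_to_copy imageE imageI)
      then show "indicator X (from_copy y) * F (from_copy y) = indicator (to_copy ` X) y * F (from_copy y)"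
        by (auto simp: indicator_def)
    qed
    finally show ?thesis .
  qed
  have detc: "det (matrix (\<lambda>w. to_copy (L (from_copy w)))) = det (matrix L)" for L :: "real ^ 'n \<Rightarrow> real ^ 'n"
  proof -
    have "from_copy (axis j 1) = axis (Rep_ordered_copy j) (1::real)" for j :: "'n ordered_copy"
      by (auto simp: from_copy_def axis_def vec_eq_iff Abs_ordered_copy_inverse Rep_ordered_copy_inverse)
    then have "matrix (\<lambda>w. to_copy (L (from_copy w))) = (\<chi> i j. matrix L $ Rep_ordered_copy i $ Rep_ordered_copy j)"
      by (simp add: matrix_def to_copy_def)
    then show ?thesis by (simp add: det_reindex)
  qed
  have derc: "((\<lambda>w. to_copy (k (from_copy w))) has_derivative (\<lambda>w. to_copy (k' (from_copy w)))) (at y within to_copy ` X)"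
    if "(k has_derivative k') (at (from_copy y) within X)" for k k' :: "real ^ 'n \<Rightarrow> real ^ 'n" and X y
  proof -
    have im: "from_copy ` to_copy ` X = X" by (auto simp: image_image)
    have "(from_copy has_derivative from_copy) (at y within to_copy ` X)"
      by (rule bounded_linear_imp_has_derivative[OF linear_copy(1)])
    from has_derivative_in_compose[OF this, of k k'] that im
    have "((\<lambda>w. k (from_copy w)) has_derivative (\<lambda>w. k' (from_copy w))) (at y within to_copy ` X)" by simp
    then show ?thesis by (rule bounded_linear.has_derivative[OF linear_copy(2)])
  qed
  let ?t = "\<lambda>w. to_copy (t (from_copy w))" and ?s = "\<lambda>w. to_copy (s (from_copy w))"
  have "(\<integral>\<^sup>+x\<in>S. ennreal (\<bar>det (matrix (t' x))\<bar> * f (t x)) \<partial>lborel) =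
    (\<integral>\<^sup>+y\<in>to_copy ` S. ennreal (\<bar>det (matrix (\<lambda>w. to_copy (t' (from_copy y) (from_copy w))))\<bar> * f (from_copy (?t y))) \<partial>lborel)"
    by (subst transfer[OF meas(1)]) (simp add: detc)
  also have "\<dots> = (\<integral>\<^sup>+y\<in>to_copy ` T. ennreal (f (from_copy y)) \<partial>lborel)"
  proof (rule nn_change_of_variables_wellorder[where s="?s" and s'="\<lambda>y w. to_copy (s' (from_copy y) (from_copy w))"])
    fix y assume "y \<in> to_copy ` S"
    then have y: "from_copy y \<in> S" by auto
    show "(?t has_derivative (\<lambda>w. to_copy (t' (from_copy y) (from_copy w)))) (at y within to_copy ` S)"
      by (rule derc[OF der(1)[OF y]])
    show "?t y \<in> to_copy ` T \<and> ?s (?t y) = y" using ts(1)[OF y] by auto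
  next
    fix y assume "y \<in> to_copy ` T"
    then have y: "from_copy y \<in> T" by auto
    show "(?s has_derivative (\<lambda>w. to_copy (s' (from_copy y) (from_copy w)))) (at y within to_copy ` T)"
      by (rule derc[OF der(2)[OF y]])
    show "?s y \<in> to_copy ` S \<and> ?t (?s y) = y" using ts(2)[OF y] by auto
    show "0 \<le> f (from_copy y)" by (rule f0[OF y])
    show "(\<lambda>w. to_copy (s' (from_copy y) (from_copy w))) \<circ> (\<lambda>w. to_copy (t' (from_copy (?s y)) (from_copy w))) = id"
    proof
      fix w
      show "((\<lambda>w. to_copy (s' (from_copy y) (from_copy w))) \<circ> (\<lambda>w. to_copy (t' (from_copy (?s y)) (from_copy w)))) w = id w"
        using fun_cong[OF id[OF y], of "from_copy w"] by simp
    qed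
  next
    show "(\<lambda>x. indicator (to_copy ` S) x * (\<bar>det (matrix (\<lambda>w. to_copy (t' (from_copy x) (from_copy w))))\<bar> * f (from_copy (?t x)))) \<in> borel_measurable borel"
      using measc[OF meas(1)] by (simp add: detc)
    show "(\<lambda>y. indicator (to_copy ` T) y * f (from_copy y)) \<in> borel_measurable borel" by (rule measc[OF meas(2)])
  qed
  also have "\<dots> = (\<integral>\<^sup>+y\<in>T. ennreal (f y) \<partial>lborel)" by (rule transfer[OF meas(2), symmetric])
  finally show ?thesis .
qed

section \<open>The Riemannian volume\<close>

text \<open>All matrices on the segment from the identity to \<open>M\<close> have a positive
  quadratic form and are therefore invertible, so the determinant cannot change sign along
  it.\<close>

lemma det_pos_if_positive_definite:
  fixes M :: "real ^ 'n::finite ^ 'n"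
  assumes pos: "\<And>v. v \<noteq> 0 \<Longrightarrow> v \<bullet> (M *v v) > 0"
  shows "det M > 0"
proof (rule ccontr)
  assume neg: "\<not> det M > 0"
  let ?N = "\<lambda>t::real. (\<chi> i j. (1 - t) * (if i = j then 1 else 0) + t * M $ i $ j) :: real ^ 'n ^ 'n"
  have N: "?N t *v v = (1 - t) *\<^sub>R v + t *\<^sub>R (M *v v)" for t v
  proof -
    have "(\<Sum>j\<in>UNIV. ((1 - t) * (if i = j then 1 else 0) + t * M $ i $ j) * v $ j)
       = (\<Sum>j\<in>UNIV. (if i = j then (1 - t) * v $ j else 0) + t * (M $ i $ j * v $ j))" for i
      by (intro sum.cong) (auto simp: algebra_simps)
    then show ?thesis
      by (simp add: vec_eq_iff matrix_vector_mult_def sum.distrib sum_distrib_left)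
  qed
  have nz: "det (?N t) \<noteq> 0" if t: "0 \<le> t" "t \<le> 1" for t
  proof -
    have "?N t *v v \<noteq> 0" if "v \<noteq> 0" for v
    proof -
      have "v \<bullet> v > 0" "v \<bullet> (M *v v) > 0" using that pos by auto
      then have "(1 - t) * (v \<bullet> v) + t * (v \<bullet> (M *v v)) > 0"
        using t by (cases "t = 0") (auto intro!: add_nonneg_pos)
      then have "v \<bullet> (?N t *v v) > 0" by (simp add: N inner_add_right)
      then show ?thesis by force
    qed
    then have "inj (matrix_vector_mult (?N t))"
      by (metis (no_types, lifting) matrix_vector_mul_linear linear_injective_0)
    then show ?thesis
      using matrix_left_invertible_injective invertible_det_nz invertible_left_inverse by blast
  qed
  have "continuous_on {0..1} (\<lambda>t. det (?N t))"
    unfolding det_def by (intro continuous_intros)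
  moreover have "det (?N 0) = 1"
  proof -
    have "?N 0 = mat 1" by (simp add: mat_def vec_eq_iff)
    then show ?thesis by simp
  qed
  moreover have "det (?N 1) \<le> 0" using neg by (simp add: vec_nth_inverse)
  ultimately obtain t where "0 \<le> t" "t \<le> 1" "det (?N t) = 0"
    using IVT2'[of "\<lambda>t. det (?N t)" 1 0 0] by auto
  then show False using nz by blast
qed

lemma bilinear_expansion:
  fixes b :: "real ^ 'n::finite \<Rightarrow> real ^ 'n \<Rightarrow> real"
  assumes "bilinear b"
  shows "b v w = (\<Sum>i\<in>UNIV. \<Sum>j\<in>UNIV. v $ i * w $ j * b (axis i 1) (axis j 1))"
proof -
  have "b v w = b (\<Sum>i\<in>UNIV. v $ i *\<^sub>R axis i 1) (\<Sum>j\<in>UNIV. w $ j *\<^sub>R axis j 1)"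
    by (simp add: basis_expansion scalar_mult_eq_scaleR[symmetric])
  also have "\<dots> = (\<Sum>(i, j)\<in>UNIV \<times> UNIV. b (v $ i *\<^sub>R axis i 1) (w $ j *\<^sub>R axis j 1))"
    by (rule bilinear_sum[OF assms])
  also have "\<dots> = (\<Sum>i\<in>UNIV. \<Sum>j\<in>UNIV. b (v $ i *\<^sub>R axis i 1) (w $ j *\<^sub>R axis j 1))"
    by (rule sum.cartesian_product[symmetric])
  also have "\<dots> = (\<Sum>i\<in>UNIV. \<Sum>j\<in>UNIV. v $ i * w $ j * b (axis i 1) (axis j 1))"
    using assms by (intro sum.cong refl) (simp add: bilinear_lmul bilinear_rmul)
  finally show ?thesis .
qed

section \<open>Charts, volume densities and the change of charts\<close>

locale compact_riemannian =
  fixes A :: "('m::{t2_space, second_countable_topology}, 'n::finite) chart set"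
    and g :: "('m, 'n) metric"
  assumes atlas: "smooth_atlas A" and metric: "riemannian_metric A g" and compact_M: "compact (UNIV :: 'm set)"
begin

abbreviation dom :: "('m, 'n) chart \<Rightarrow> 'm set" where "dom \<equiv> fst"
abbreviation img :: "('m, 'n) chart \<Rightarrow> (real ^ 'n) set" where "img c \<equiv> snd c ` fst c"

lemma chart_facts:
  assumes "c \<in> A"
  shows "open (dom c)" "open (img c)" "continuous_on (dom c) (snd c)" "continuous_on (img c) (chart_inv c)"
    "\<And>x. x \<in> dom c \<Longrightarrow> chart_inv c (snd c x) = x" "\<And>y. y \<in> img c \<Longrightarrow> snd c (chart_inv c y) = y"
    "\<And>y. y \<in> img c \<Longrightarrow> chart_inv c y \<in> dom c"
proof -
  have "is_chart c" using atlas assms by (simp add: smooth_atlas_def)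
  then have o: "open (dom c)" "open (img c)" and h: "homeomorphism (dom c) (img c) (snd c) (chart_inv c)"
    by (auto simp: is_chart_def)
  show "open (dom c)" "open (img c)" by fact+
  show "continuous_on (dom c) (snd c)" "continuous_on (img c) (chart_inv c)"
    "\<And>x. x \<in> dom c \<Longrightarrow> chart_inv c (snd c x) = x" "\<And>y. y \<in> img c \<Longrightarrow> snd c (chart_inv c y) = y"
    "\<And>y. y \<in> img c \<Longrightarrow> chart_inv c y \<in> dom c"
    using h by (auto simp: homeomorphism_def)
qed

lemma charts_cover: "\<exists>c\<in>A. x \<in> dom c"
  using atlas by (auto simp: smooth_atlas_def)

lemma chart_image_eq: "c \<in> A \<Longrightarrow> B \<subseteq> dom c \<Longrightarrow> snd c ` B = img c \<inter> chart_inv c -` B"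
  using chart_facts[of c] by auto

lemma inj_on_chart: "c \<in> A \<Longrightarrow> inj_on (snd c) (dom c)"
  using chart_facts(5) by (metis inj_on_inverseI)

lemma open_chart_image: "c \<in> A \<Longrightarrow> open W \<Longrightarrow> W \<subseteq> dom c \<Longrightarrow> open (snd c ` W)"
  unfolding chart_image_eq
  by (rule continuous_open_preimage) (auto simp: chart_facts)

lemma open_chart_preimage: "c \<in> A \<Longrightarrow> open S \<Longrightarrow> open (dom c \<inter> snd c -` S)"
  by (rule continuous_open_preimage) (auto simp: chart_facts)

lemma borel_chart_image:
  assumes c: "c \<in> A" and B: "B \<in> sets borel" "B \<subseteq> dom c"
  shows "snd c ` B \<in> sets borel"
proof -
  have "chart_inv c \<in> measurable (restrict_space borel (img c)) borel"
    by (rule borel_measurable_continuous_on_restrict) (simp add: chart_facts c)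
  from measurable_sets[OF this B(1)]
  have "chart_inv c -` B \<inter> img c \<in> sets (restrict_space borel (img c))" by (simp add: space_restrict_space)
  then have "chart_inv c -` B \<inter> img c \<in> sets borel"
    using chart_facts(2)[OF c] by (subst (asm) sets_restrict_space_iff) auto
  then show ?thesis using chart_image_eq[OF c B(2)] by (simp add: Int_commute)
qed

text \<open>A total Borel function, along which measures can be pushed forward; the measures in
  question have density zero off the image of the chart.\<close>

definition ext_inv :: "('m, 'n) chart \<Rightarrow> real ^ 'n \<Rightarrow> 'm" where
  "ext_inv c y = (if y \<in> img c then chart_inv c y else undefined)"

lemma ext_inv_measurable: "c \<in> A \<Longrightarrow> ext_inv c \<in> borel_measurable borel"
  unfolding ext_inv_def[abs_def]
  by (rule borel_measurable_continuous_on_if) (auto simp: chart_facts)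

definition dens :: "('m, 'n) chart \<Rightarrow> real ^ 'n \<Rightarrow> real" where
  "dens c y = sqrt (det (gram g c (chart_inv c y)))"

lemma metric_facts:
  assumes "c \<in> A" "x \<in> dom c"
  shows "bilinear (g c x)" "g c x v w = g c x w v" "v \<noteq> 0 \<Longrightarrow> g c x v v > 0"
proof -
  have *: "bilinear (g c x) \<and> (\<forall>v w. g c x v w = g c x w v) \<and> (\<forall>v. v \<noteq> 0 \<longrightarrow> g c x v v > 0)"
    using metric assms unfolding riemannian_metric_def by blast
  show "bilinear (g c x)" "g c x v w = g c x w v" "v \<noteq> 0 \<Longrightarrow> g c x v v > 0" using * by blast+
qed

lemma metric_nonneg: "c \<in> A \<Longrightarrow> x \<in> dom c \<Longrightarrow> g c x v v \<ge> 0"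
  using metric_facts(3)[of c x v] bilinear_lzero[OF metric_facts(1)[of c x]] by (cases "v = 0") (auto simp: less_imp_le)

lemma metric_smooth: "c \<in> A \<Longrightarrow> C_on k (img c) (\<lambda>y. g c (chart_inv c y) v w)"
proof -
  assume c: "c \<in> A"
  then have "smooth_on (img c) (\<lambda>y. g c (chart_inv c y) v w)"
    using metric unfolding riemannian_metric_def by blast
  then show ?thesis using smooth_on_open[OF chart_facts(2)[OF c]] by blast
qed

lemma metric_continuous: "c \<in> A \<Longrightarrow> continuous_on (img c) (\<lambda>y. g c (chart_inv c y) v w)"
  using metric_smooth C_on_imp_continuous_on by blast

lemma gram_form: "c \<in> A \<Longrightarrow> x \<in> dom c \<Longrightarrow> v \<bullet> (gram g c x *v w) = g c x v w"
  by (subst bilinear_expansion[OF metric_facts(1)], assumption+)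
     (simp add: inner_vec_def matrix_vector_mult_def gram_def sum_distrib_left mult_ac)

lemma det_gram_pos: "c \<in> A \<Longrightarrow> x \<in> dom c \<Longrightarrow> det (gram g c x) > 0"
  by (rule det_pos_if_positive_definite) (simp add: gram_form metric_facts)

lemma dens_pos: "c \<in> A \<Longrightarrow> y \<in> img c \<Longrightarrow> dens c y > 0"
  unfolding dens_def using det_gram_pos chart_facts(7) by simp

lemma continuous_on_dens: "c \<in> A \<Longrightarrow> continuous_on (img c) (dens c)"
proof -
  assume c: "c \<in> A"
  have ct: "continuous_on (img c) (\<lambda>y. gram g c (chart_inv c y) $ i $ j)" for i j
    by (simp add: gram_def metric_continuous c)
  then show ?thesis unfolding dens_def[abs_def] det_def
    by (intro continuous_on_real_sqrt continuous_on_sum continuous_on_mult continuous_on_prod continuous_on_const ct)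
qed

lemma dens_indicator_measurable:
  assumes "c \<in> A" "S \<in> sets borel" "S \<subseteq> img c"
  shows "(\<lambda>y. indicator S y * dens c y) \<in> borel_measurable borel"
  using borel_measurable_continuous_on_indicator[OF assms(2) continuous_on_subset[OF continuous_on_dens[OF assms(1)] assms(3)]]
  by simp

lemma transition_facts:
  assumes c: "c \<in> A" "c' \<in> A"
  shows "open (snd c ` (dom c \<inter> dom c'))"
    "C_on k (snd c ` (dom c \<inter> dom c')) (transition c c')"
    "y \<in> snd c ` (dom c \<inter> dom c') \<Longrightarrow> transition c c' y \<in> snd c' ` (dom c \<inter> dom c')"
    "y \<in> snd c ` (dom c \<inter> dom c') \<Longrightarrow> transition c' c (transition c c' y) = y"
    "y \<in> snd c ` (dom c \<inter> dom c') \<Longrightarrow> chart_inv c' (transition c c' y) = chart_inv c y"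
proof -
  show o: "open (snd c ` (dom c \<inter> dom c'))" by (intro open_chart_image[OF c(1)] open_Int chart_facts(1) c) auto
  show "C_on k (snd c ` (dom c \<inter> dom c')) (transition c c')"
  proof -
    have "smooth_on (snd c ` (dom c \<inter> dom c')) (transition c c')"
      using atlas c unfolding smooth_atlas_def by blast
    then show ?thesis using smooth_on_open[OF o] by blast
  qed
  assume "y \<in> snd c ` (dom c \<inter> dom c')"
  then obtain x where x: "x \<in> dom c" "x \<in> dom c'" "y = snd c x" by auto
  then show "transition c c' y \<in> snd c' ` (dom c \<inter> dom c')" "transition c' c (transition c c' y) = y"
     "chart_inv c' (transition c c' y) = chart_inv c y"
    using chart_facts(5) c by (auto simp: transition_def)
qed

lemma transition_has_derivative:
  assumes c: "c \<in> A" "c' \<in> A" and y: "y \<in> snd c ` (dom c \<inter> dom c')"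
  shows "(transition c c' has_derivative frechet_derivative (transition c c') (at y)) (at y)"
  using transition_facts(2)[OF c, of 1] y by (auto simp: frechet_derivative_works)

lemma transition_derivative_inverse:
  assumes c: "c \<in> A" "c' \<in> A" and y: "y \<in> snd c ` (dom c \<inter> dom c')"
  shows "frechet_derivative (transition c' c) (at (transition c c' y)) \<circ> frechet_derivative (transition c c') (at y) = id"
proof -
  have "transition c c' y \<in> snd c' ` (dom c' \<inter> dom c)" using transition_facts(3)[OF c y] by (simp add: Int_commute)
  from has_derivative_compose[OF transition_has_derivative[OF c y] transition_has_derivative[OF c(2,1) this]]
  have "((\<lambda>y. transition c' c (transition c c' y)) has_derivative
    (\<lambda>v. frechet_derivative (transition c' c) (at (transition c c' y)) (frechet_derivative (transition c c') (at y) v))) (at y)" .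
  then have "((\<lambda>y. y) has_derivative
    (\<lambda>v. frechet_derivative (transition c' c) (at (transition c c' y)) (frechet_derivative (transition c c') (at y) v))) (at y)"
    by (rule has_derivative_transform_within_open[OF _ transition_facts(1)[OF c] y]) (rule transition_facts(4)[OF c])
  from has_derivative_unique[OF this has_derivative_ident] show ?thesis by (simp add: fun_eq_iff)
qed

lemma metric_change:
  "\<lbrakk>c \<in> A; c' \<in> A; x \<in> dom c; x \<in> dom c'\<rbrakk> \<Longrightarrow> g c x v w = g c' x (coord_change c c' x v) (coord_change c c' x w)"
  using metric unfolding riemannian_metric_def by blast

text \<open>Gram matrices change by congruence with the Jacobian matrix, so their determinants
  differ by the square of the Jacobian determinant.\<close>

lemma dens_change:
  assumes c: "c \<in> A" "c' \<in> A" and y: "y \<in> snd c ` (dom c \<inter> dom c')"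
  shows "dens c y = \<bar>det (matrix (frechet_derivative (transition c c') (at y)))\<bar> * dens c' (transition c c' y)"
proof -
  obtain x where x: "x \<in> dom c" "x \<in> dom c'" "y = snd c x" using y by auto
  have cx: "chart_inv c y = x" using x chart_facts(5)[OF c(1)] by simp
  let ?L = "frechet_derivative (transition c c') (at y)"
  let ?M = "matrix ?L"
  have lin: "linear ?L" using transition_has_derivative[OF c y] has_derivative_linear by blast
  have e: "?L (axis i 1) = column i ?M" for i by (simp add: matrix_def column_def vec_eq_iff)
  have "gram g c x $ i $ j = (transpose ?M ** gram g c' x ** ?M) $ i $ j" for i j
  proof -
    have "gram g c x $ i $ j = g c' x (?L (axis i 1)) (?L (axis j 1))"
      using metric_change[OF c x(1,2)] x(3) by (simp add: gram_def coord_change_def)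
    also have "\<dots> = column i ?M \<bullet> (gram g c' x *v column j ?M)"
      unfolding e by (rule gram_form[symmetric, OF c(2) x(2)])
    also have "\<dots> = (transpose ?M ** (gram g c' x ** ?M)) $ i $ j"
      by (simp add: matrix_matrix_mult_def transpose_def column_def inner_vec_def matrix_vector_mult_def)
    finally show ?thesis by (simp add: matrix_mul_assoc)
  qed
  then have "gram g c x = transpose ?M ** gram g c' x ** ?M" by (simp add: vec_eq_iff)
  then have "det (gram g c x) = (det ?M)\<^sup>2 * det (gram g c' x)"
    by (simp add: det_mul power2_eq_square)
  then show ?thesis
    unfolding dens_def transition_facts(5)[OF c y] cx by (simp add: real_sqrt_mult)
qed

text \<open>The volume of \<open>B\<close> as computed in the chart \<open>c\<close>; meaningful for
  Borel sets inside the domain of \<open>c\<close>.\<close>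

definition form :: "('m, 'n) chart \<Rightarrow> 'm set \<Rightarrow> ennreal" where
  "form c B = (\<integral>\<^sup>+ y. ennreal (dens c y) * indicator (snd c ` B) y \<partial>lborel)"

text \<open>Change of variables along the transition map, whose Jacobian factor is exactly the
  quotient of the two densities.\<close>

lemma form_change:
  assumes c: "c \<in> A" "c' \<in> A" and B: "B \<in> sets borel" "B \<subseteq> dom c \<inter> dom c'"
  shows "form c B = form c' B"
proof -
  let ?t = "transition c c'" and ?s = "transition c' c"
  have sub: "snd c ` B \<subseteq> snd c ` (dom c \<inter> dom c')" "snd c' ` B \<subseteq> snd c' ` (dom c' \<inter> dom c)" using B by auto
  have bor: "snd c ` B \<in> sets borel" "snd c' ` B \<in> sets borel" using borel_chart_image c B by auto
  have swap: "transition d d' x \<in> snd d' ` B \<and> transition d' d (transition d d' x) = x"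
    if d: "d \<in> A" "d' \<in> A" "B \<subseteq> dom d" "B \<subseteq> dom d'" and x: "x \<in> snd d ` B" for d d' x
  proof -
    obtain b where b: "b \<in> B" "x = snd d b" using x by auto
    have "chart_inv d x = b" using chart_facts(5)[OF d(1)] b d(3) by auto
    moreover have "chart_inv d' (snd d' b) = b" using chart_facts(5)[OF d(2)] b d(4) by auto
    ultimately show ?thesis using b by (simp add: transition_def)
  qed
  have ts: "?t x \<in> snd c' ` B \<and> ?s (?t x) = x" if "x \<in> snd c ` B" for x
    using swap[OF c _ _ that] B by simp
  have st: "?s y \<in> snd c ` B \<and> ?t (?s y) = y" if "y \<in> snd c' ` B" for y
    using swap[OF c(2,1) _ _ that] B by simp
  have eq: "dens c x = \<bar>det (matrix (frechet_derivative ?t (at x)))\<bar> * dens c' (?t x)" if "x \<in> snd c ` B" for x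
    using dens_change[OF c] that sub by auto
  have "(\<integral>\<^sup>+x\<in>snd c ` B. ennreal (\<bar>det (matrix (frechet_derivative ?t (at x)))\<bar> * dens c' (?t x)) \<partial>lborel)
    = (\<integral>\<^sup>+y\<in>snd c' ` B. ennreal (dens c' y) \<partial>lborel)"
  proof (rule nn_change_of_variables[where s="?s" and s'="\<lambda>y. frechet_derivative ?s (at y)", OF _ _ _ ts st])
    show "(?t has_derivative frechet_derivative ?t (at x)) (at x within snd c ` B)" if "x \<in> snd c ` B" for x
      using transition_has_derivative[OF c] that sub by (blast intro: has_derivative_at_withinI)
    show "(?s has_derivative frechet_derivative ?s (at y)) (at y within snd c' ` B)" if "y \<in> snd c' ` B" for y
      using transition_has_derivative[OF c(2,1)] that sub by (blast intro: has_derivative_at_withinI)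
    show "0 \<le> dens c' y" if "y \<in> snd c' ` B" for y
      using dens_pos[OF c(2), of y] that B(2) by (force simp: less_imp_le)
    show "frechet_derivative ?s (at y) \<circ> frechet_derivative ?t (at (?s y)) = id" if "y \<in> snd c' ` B" for y
      using transition_derivative_inverse[OF c, of "?s y"] st[OF that] sub by auto
    show "(\<lambda>y. indicator (snd c' ` B) y * dens c' y) \<in> borel_measurable borel"
      using B by (intro dens_indicator_measurable c bor) auto
    have "(\<lambda>y. indicator (snd c ` B) y * dens c y) \<in> borel_measurable borel"
      using B by (intro dens_indicator_measurable c bor) auto
    also have "(\<lambda>y. indicator (snd c ` B) y * dens c y) = (\<lambda>x. indicator (snd c ` B) x * (\<bar>det (matrix (frechet_derivative ?t (at x)))\<bar> * dens c' (?t x)))"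
      using eq by (auto simp: fun_eq_iff indicator_def)
    finally show "(\<lambda>x. indicator (snd c ` B) x * (\<bar>det (matrix (frechet_derivative ?t (at x)))\<bar> * dens c' (?t x))) \<in> borel_measurable borel" .
  qed
  moreover have "(\<integral>\<^sup>+x\<in>snd c ` B. ennreal (\<bar>det (matrix (frechet_derivative ?t (at x)))\<bar> * dens c' (?t x)) \<partial>lborel) = form c B"
    unfolding form_def using eq by (intro nn_integral_cong) (auto simp: indicator_def)
  ultimately show ?thesis by (simp add: form_def)
qed

lemma finite_chart_cover:
  obtains k :: nat and cs :: "nat \<Rightarrow> ('m, 'n) chart" where "\<forall>i<k. cs i \<in> A" "(\<Union>i<k. dom (cs i)) = UNIV"
proof -
  obtain C where C: "C \<subseteq> A" "finite C" "UNIV \<subseteq> (\<Union>c\<in>C. dom c)"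
    by (rule compactE_image[OF compact_M, of A dom]) (use charts_cover chart_facts(1) in auto)
  obtain cs :: "nat \<Rightarrow> ('m, 'n) chart" where "bij_betw cs {..<card C} C"
    using ex_bij_betw_nat_finite[OF C(2)] by (auto simp: atLeast0LessThan)
  then have im: "cs ` {..<card C} = C" by (simp add: bij_betw_def)
  have "(\<Union>i<card C. dom (cs i)) = (\<Union>c\<in>cs ` {..<card C}. dom c)" by simp
  then have "(\<Union>i<card C. dom (cs i)) = (\<Union>c\<in>C. dom c)" by (simp only: im)
  then have "(\<Union>i<card C. dom (cs i)) = UNIV" using C(3) by (simp add: top.extremum_unique)
  moreover have "\<forall>i<card C. cs i \<in> A" using im C(1) by blast
  ultimately show ?thesis by (intro that[of "card C" cs])
qed

section \<open>Existence and uniqueness of the volume measure\<close>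

definition is_volume :: "'m measure \<Rightarrow> bool" where
  "is_volume \<mu> \<longleftrightarrow> sets \<mu> = sets borel \<and> (\<forall>c\<in>A. \<forall>B\<in>sets borel. B \<subseteq> dom c \<longrightarrow> emeasure \<mu> B = form c B)"

text \<open>Unique existence is what gives a meaning to the definite description in
  \<open>riemannian_volume\<close>. Additivity over disjoint pieces, each inside one chart, forces
  the value \<open>\<Phi>\<close>; by \<open>form_change\<close> this value is right in every other
  chart as well.\<close>

lemma ex1_volume: "\<exists>!\<mu>. is_volume \<mu>"
proof -
  obtain k :: nat and cs :: "nat \<Rightarrow> ('m, 'n) chart" where cs': "\<forall>i<k. cs i \<in> A" and cs'': "(\<Union>i<k. dom (cs i)) = UNIV"
    by (rule finite_chart_cover)
  have cs: "\<And>i. i < k \<Longrightarrow> cs i \<in> A" "(\<Union>i<k. dom (cs i)) = UNIV" using cs' cs'' by simp_all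
  define V where "V i = dom (cs i) - (\<Union>j<i. dom (cs j))" for i
  have Vsub: "V i \<subseteq> dom (cs i)" for i by (auto simp: V_def)
  have Vb: "V i \<in> sets borel" if "i < k" for i
  proof -
    have "open (dom (cs j))" if "j < k" for j using cs(1)[OF that] chart_facts(1) by blast
    then show ?thesis unfolding V_def using that by (intro sets.Diff borel_open open_UN) auto
  qed
  have Vdisj: "disjoint_family_on V {..<k}"
    unfolding disjoint_family_on_def V_def by (auto simp: neq_iff)
  have Vcov: "(\<Union>i<k. V i) = UNIV"
  proof -
    have "\<exists>i<k. x \<in> V i" for x
    proof -
      obtain i where i: "i < k" "x \<in> dom (cs i)" using cs(2) by blast
      define l where "l = (LEAST i. x \<in> dom (cs i))"
      have l: "x \<in> dom (cs l)" unfolding l_def by (rule LeastI[of _ i]) (rule i(2))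
      have "l \<le> i" unfolding l_def by (rule Least_le) (rule i(2))
      moreover have "x \<notin> dom (cs j)" if "j < l" for j using not_less_Least[of j "\<lambda>i. x \<in> dom (cs i)"] that by (simp add: l_def)
      then have "x \<in> V l" using l by (simp add: V_def)
      ultimately show ?thesis using i(1) by (meson le_less_trans)
    qed
    then show ?thesis by auto
  qed
  define \<Phi> where "\<Phi> B = (\<Sum>i<k. form (cs i) (B \<inter> V i))" for B
  have additive: "(\<Sum>i<k. form c (B \<inter> V i)) = form c B" if c: "c \<in> A" and B: "B \<in> sets borel" "B \<subseteq> dom c" for c B
  proof -
    have ib: "snd c ` (B \<inter> V i) \<in> sets borel" if "i < k" for i
      using B Vb[OF that] by (intro borel_chart_image c) auto
    have m: "(\<lambda>y. ennreal (dens c y) * indicator (snd c ` (B \<inter> V i)) y) \<in> borel_measurable lborel" if "i < k" for i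
    proof -
      have "(\<lambda>y. indicator (snd c ` (B \<inter> V i)) y * dens c y) \<in> borel_measurable borel"
        using B by (intro dens_indicator_measurable c ib that) auto
      then have "(\<lambda>y. ennreal (indicator (snd c ` (B \<inter> V i)) y * dens c y)) \<in> borel_measurable lborel" by simp
      also have "(\<lambda>y. ennreal (indicator (snd c ` (B \<inter> V i)) y * dens c y)) = (\<lambda>y. ennreal (dens c y) * indicator (snd c ` (B \<inter> V i)) y)"
        by (auto simp: indicator_def)
      finally show ?thesis .
    qed
    have "(\<Sum>i<k. form c (B \<inter> V i)) = (\<integral>\<^sup>+y. (\<Sum>i<k. ennreal (dens c y) * indicator (snd c ` (B \<inter> V i)) y) \<partial>lborel)"
      unfolding form_def using m by (intro nn_integral_sum[symmetric]) auto
    also have "\<dots> = form c B"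
      unfolding form_def
    proof (intro nn_integral_cong)
      fix y
      have "(\<Sum>i<k. indicator (snd c ` (B \<inter> V i)) y) = (indicator (\<Union>i<k. snd c ` (B \<inter> V i)) y :: ennreal)"
      proof (rule indicator_UN_disjoint[symmetric])
        show "disjoint_family_on (\<lambda>i. snd c ` (B \<inter> V i)) {..<k}"
          unfolding disjoint_family_on_def
        proof (intro ballI impI)
          fix i j assume ij: "i \<in> {..<k}" "j \<in> {..<k}" "i \<noteq> j"
          have "snd c ` (B \<inter> V i) \<inter> snd c ` (B \<inter> V j) = snd c ` ((B \<inter> V i) \<inter> (B \<inter> V j))"
            by (rule inj_on_image_Int[OF inj_on_chart[OF c], symmetric]) (use B in auto)
          also have "(B \<inter> V i) \<inter> (B \<inter> V j) = {}" using Vdisj ij by (auto simp: disjoint_family_on_def)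
          finally show "snd c ` (B \<inter> V i) \<inter> snd c ` (B \<inter> V j) = {}" by simp
        qed
      qed simp
      also have "(\<Union>i<k. snd c ` (B \<inter> V i)) = snd c ` (B \<inter> (\<Union>i<k. V i))" by blast
      also have "B \<inter> (\<Union>i<k. V i) = B" using Vcov by simp
      finally show "(\<Sum>i<k. ennreal (dens c y) * indicator (snd c ` (B \<inter> V i)) y) = ennreal (dens c y) * indicator (snd c ` B) y"
        by (simp add: sum_distrib_left[symmetric])
    qed
    finally show ?thesis .
  qed
  have \<Phi>_form: "\<Phi> B = form c B" if c: "c \<in> A" and B: "B \<in> sets borel" "B \<subseteq> dom c" for c B
  proof -
    have "\<Phi> B = (\<Sum>i<k. form c (B \<inter> V i))" unfolding \<Phi>_def
      by (intro sum.cong refl form_change cs c) (use B Vb Vsub in auto)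
    then show ?thesis using additive[OF c B] by simp
  qed
  have uniq: "emeasure \<mu> B = \<Phi> B" if \<mu>: "is_volume \<mu>" and B: "B \<in> sets borel" for \<mu> B
  proof -
    have s: "sets \<mu> = sets borel" using \<mu> by (simp add: is_volume_def)
    have "emeasure \<mu> B = emeasure \<mu> (\<Union>i<k. B \<inter> V i)" using Vcov by (metis Int_UN_distrib inf_top_right)
    also have "\<dots> = (\<Sum>i<k. emeasure \<mu> (B \<inter> V i))"
    proof (rule sum_emeasure[symmetric])
      show "disjoint_family_on (\<lambda>i. B \<inter> V i) {..<k}" using Vdisj unfolding disjoint_family_on_def by blast
    qed (use B Vb s in auto)
    also have "\<dots> = \<Phi> B" unfolding \<Phi>_def
    proof (intro sum.cong refl)
      fix i assume "i \<in> {..<k}"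
      then show "emeasure \<mu> (B \<inter> V i) = form (cs i) (B \<inter> V i)"
        using \<mu> cs(1)[of i] B Vb[of i] Vsub[of i] unfolding is_volume_def by (simp add: le_infI2 sets.Int)
    qed
    finally show ?thesis .
  qed
  \<comment> \<open>Existence: the disjoint union of the chart images, modelled as a product with a
    counting measure, carries the density \<open>d\<close>. The push-forward along the inverse
    charts is a measure by construction, which settles countable additivity.\<close>
  let ?N = "count_space {..<k} \<Otimes>\<^sub>M (lborel :: (real ^ 'n) measure)"
  define d where "d = (\<lambda>(i, y). ennreal (indicator (snd (cs i) ` V i) y * dens (cs i) y))"
  define e where "e = (\<lambda>(i, y). ext_inv (cs i) y)"
  have d_m: "d \<in> borel_measurable ?N" unfolding d_def
  proof (rule measurable_pair_measure_countable1)
    fix i assume "i \<in> {..<k}"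
    then have i: "i < k" by simp
    have m: "(\<lambda>y. indicator (snd (cs i) ` V i) y * dens (cs i) y) \<in> borel_measurable borel"
      by (rule dens_indicator_measurable[OF cs(1)[OF i] borel_chart_image[OF cs(1)[OF i] Vb[OF i] Vsub] image_mono[OF Vsub]])
    show "(\<lambda>y. case (i, y) of (i, y) \<Rightarrow> ennreal (indicator (snd (cs i) ` V i) y * dens (cs i) y)) \<in> borel_measurable lborel"
      by (simp add: measurable_compose[OF m measurable_ennreal])
  qed simp
  have e_m: "e \<in> measurable ?N borel" unfolding e_def
    by (rule measurable_pair_measure_countable1) (use cs ext_inv_measurable in auto)
  define \<mu> where "\<mu> = distr (density ?N d) borel e"
  have em: "emeasure \<mu> B = \<Phi> B" if B: "B \<in> sets borel" for B
  proof -
    have e_m': "e \<in> measurable (density ?N d) borel" using e_m by simp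
    have "emeasure \<mu> B = emeasure (density ?N d) (e -` B \<inter> space ?N)"
      unfolding \<mu>_def by (subst emeasure_distr[OF e_m' B]) simp
    also have "\<dots> = (\<integral>\<^sup>+z. d z * indicator (e -` B \<inter> space ?N) z \<partial>?N)"
      by (rule emeasure_density[OF d_m measurable_sets[OF e_m B]])
    also have "\<dots> = (\<integral>\<^sup>+i. (\<integral>\<^sup>+y. d (i, y) * indicator (e -` B \<inter> space ?N) (i, y) \<partial>lborel) \<partial>count_space {..<k})"
      by (rule lborel.nn_integral_fst[symmetric]) (use d_m measurable_sets[OF e_m B] in measurable)
    also have "\<dots> = (\<Sum>i<k. \<integral>\<^sup>+y. d (i, y) * indicator (e -` B \<inter> space ?N) (i, y) \<partial>lborel)"
      by (rule nn_integral_count_space_finite) simp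
    also have "\<dots> = \<Phi> B" unfolding \<Phi>_def form_def
    proof (intro sum.cong refl nn_integral_cong)
      fix i y assume "i \<in> {..<k}"
      then have i: "i < k" "cs i \<in> A" using cs by auto
      have "y \<in> snd (cs i) ` (B \<inter> V i) \<longleftrightarrow> y \<in> snd (cs i) ` V i \<and> ext_inv (cs i) y \<in> B"
        using chart_facts(5)[OF i(2)] Vsub[of i] by (auto simp: ext_inv_def)
      then show "d (i, y) * indicator (e -` B \<inter> space ?N) (i, y) = ennreal (dens (cs i) y) * indicator (snd (cs i) ` (B \<inter> V i)) y"
        using i by (auto simp: d_def e_def space_pair_measure indicator_def)
    qed
    finally show ?thesis .
  qed
  have "is_volume \<mu>" unfolding is_volume_def using em \<Phi>_form by (simp add: \<mu>_def)
  moreover have "\<nu> = \<mu>" if "is_volume \<nu>" for \<nu>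
    by (rule measure_eqI) (use that uniq em calculation in \<open>auto simp: is_volume_def\<close>)
  ultimately show ?thesis by blast
qed

abbreviation vol :: "'m measure" where "vol \<equiv> riemannian_volume A g"

lemma is_volume_vol: "is_volume vol"
proof -
  have "vol = (THE \<mu>. is_volume \<mu>)"
    unfolding riemannian_volume_def is_volume_def form_def dens_def ..
  then show ?thesis using theI'[OF ex1_volume] by simp
qed

lemma sets_vol [simp, measurable_cong]: "sets vol = sets borel"
  using is_volume_vol by (simp add: is_volume_def)

lemma space_vol [simp]: "space vol = UNIV"
  using sets_eq_imp_space_eq[OF sets_vol] by simp

lemma emeasure_vol: "c \<in> A \<Longrightarrow> B \<in> sets borel \<Longrightarrow> B \<subseteq> dom c \<Longrightarrow> emeasure vol B = form c B"
  using is_volume_vol by (simp add: is_volume_def)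

text \<open>The volume restricted to \<open>X\<close> is the push-forward of the chart density under
  the inverse chart. This is verified on Borel sets and then holds for all nonnegative
  integrands.\<close>

lemma nn_integral_vol:
  assumes c: "c \<in> A" and X: "X \<in> sets borel" "X \<subseteq> dom c" and u: "u \<in> borel_measurable borel"
  shows "(\<integral>\<^sup>+x\<in>X. u x \<partial>vol) = (\<integral>\<^sup>+y\<in>snd c ` X. u (chart_inv c y) * ennreal (dens c y) \<partial>lborel)"
proof -
  have bX: "snd c ` X \<in> sets borel" by (rule borel_chart_image[OF c X])
  let ?d = "\<lambda>y. ennreal (indicator (snd c ` X) y * dens c y)"
  have m: "(\<lambda>y. indicator (snd c ` X) y * dens c y) \<in> borel_measurable borel"
    by (rule dens_indicator_measurable[OF c bX]) (use X in auto)
  have d[measurable]: "?d \<in> borel_measurable lborel"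
    by (simp add: measurable_compose[OF m measurable_ennreal])
  note [measurable] = ext_inv_measurable[OF c] u X(1)
  have e: "ext_inv c \<in> measurable (density lborel ?d) borel" by simp
  have "density vol (indicator X) = distr (density lborel ?d) borel (ext_inv c)"
  proof (rule measure_eqI)
    fix B assume "B \<in> sets (density vol (indicator X))"
    then have B[measurable]: "B \<in> sets borel" by simp
    have "emeasure (density vol (indicator X)) B = (\<integral>\<^sup>+x. indicator X x * indicator B x \<partial>vol)"
      by (rule emeasure_density) auto
    also have "\<dots> = (\<integral>\<^sup>+x. indicator (B \<inter> X) x \<partial>vol)"
      by (intro nn_integral_cong) (auto simp: indicator_def)
    also have "\<dots> = emeasure vol (B \<inter> X)" by (rule nn_integral_indicator) (use B X in auto)
    also have "\<dots> = form c (B \<inter> X)" using B X by (intro emeasure_vol c) auto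
    also have "\<dots> = (\<integral>\<^sup>+y. ?d y * indicator (ext_inv c -` B) y \<partial>lborel)"
      unfolding form_def
    proof (intro nn_integral_cong)
      fix y
      have "y \<in> snd c ` (B \<inter> X) \<longleftrightarrow> y \<in> snd c ` X \<and> ext_inv c y \<in> B"
        using chart_facts(5)[OF c] X(2) by (auto simp: ext_inv_def)
      then show "ennreal (dens c y) * indicator (snd c ` (B \<inter> X)) y = ?d y * indicator (ext_inv c -` B) y"
        by (auto simp: indicator_def)
    qed
    also have "\<dots> = emeasure (density lborel ?d) (ext_inv c -` B)"
      using measurable_sets[OF ext_inv_measurable[OF c] B] by (intro emeasure_density[symmetric] d) simp
    also have "\<dots> = emeasure (distr (density lborel ?d) borel (ext_inv c)) B"
      by (subst emeasure_distr[OF e B]) simp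
    finally show "emeasure (density vol (indicator X)) B = emeasure (distr (density lborel ?d) borel (ext_inv c)) B" .
  qed simp
  then have "(\<integral>\<^sup>+x. u x \<partial>density vol (indicator X)) = (\<integral>\<^sup>+x. u x \<partial>distr (density lborel ?d) borel (ext_inv c))" by simp
  moreover have "(\<integral>\<^sup>+x. u x \<partial>density vol (indicator X)) = (\<integral>\<^sup>+x\<in>X. u x \<partial>vol)"
    by (subst nn_integral_density) (auto simp: mult.commute)
  moreover have "(\<integral>\<^sup>+x. u x \<partial>distr (density lborel ?d) borel (ext_inv c)) = (\<integral>\<^sup>+y. ?d y * u (ext_inv c y) \<partial>lborel)"
    by (subst nn_integral_distr[OF e], use u in simp, subst nn_integral_density) auto
  moreover have "(\<integral>\<^sup>+y. ?d y * u (ext_inv c y) \<partial>lborel) = (\<integral>\<^sup>+y\<in>snd c ` X. u (chart_inv c y) * ennreal (dens c y) \<partial>lborel)"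
    using X(2) by (intro nn_integral_cong) (auto simp: indicator_def ext_inv_def mult.commute)
  ultimately show ?thesis by simp
qed

lemma dens_bounds:
  assumes c: "c \<in> A" and Q: "compact Q" "Q \<subseteq> img c"
  obtains \<delta> \<Delta> where "0 < \<delta>" "0 < \<Delta>" "\<And>y. y \<in> Q \<Longrightarrow> \<delta> \<le> dens c y" "\<And>y. y \<in> Q \<Longrightarrow> dens c y \<le> \<Delta>"
proof (cases "Q = {}")
  case False
  have cont: "continuous_on Q (dens c)" by (rule continuous_on_subset[OF continuous_on_dens[OF c] Q(2)])
  obtain y1 where y1: "y1 \<in> Q" "\<And>y. y \<in> Q \<Longrightarrow> dens c y1 \<le> dens c y" using continuous_attains_inf[OF Q(1) False cont] by blast
  obtain y2 where y2: "y2 \<in> Q" "\<And>y. y \<in> Q \<Longrightarrow> dens c y \<le> dens c y2" using continuous_attains_sup[OF Q(1) False cont] by blast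
  show ?thesis by (rule that[of "dens c y1" "dens c y2"]) (use y1 y2 dens_pos[OF c] Q in auto)
qed (use that[of 1 1] in auto)

lemma chart_neighbourhood:
  assumes c: "c \<in> A" and x: "x \<in> dom c" and W: "open W" "snd c x \<in> W" "W \<subseteq> img c"
  obtains h where "h > 0" "cbox (snd c x - (\<chi> i. h)) (snd c x + (\<chi> i. h)) \<subseteq> W"
proof -
  obtain e where e: "e > 0" "cball (snd c x) e \<subseteq> W" using W open_contains_cball by blast
  define h where "h = e / real CARD('n)"
  have h: "h > 0" using e by (simp add: h_def)
  have "cbox (snd c x - (\<chi> i. h)) (snd c x + (\<chi> i. h)) \<subseteq> cball (snd c x) e"
  proof
    fix z assume z: "z \<in> cbox (snd c x - (\<chi> i. h)) (snd c x + (\<chi> i. h))"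
    have "norm (z - snd c x) \<le> (\<Sum>i\<in>UNIV. \<bar>(z - snd c x) $ i\<bar>)" by (rule norm_le_l1_cart)
    also have "\<dots> \<le> (\<Sum>i\<in>(UNIV::'n set). h)"
      using z by (intro sum_mono) (auto simp: mem_box_cart abs_le_iff algebra_simps)
    also have "\<dots> = e" by (simp add: h_def)
    finally show "z \<in> cball (snd c x) e" by (simp add: dist_norm norm_minus_commute)
  qed
  then show ?thesis using that h e by blast
qed

lemma emeasure_vol_cube_finite:
  assumes c: "c \<in> A" and Q: "compact Q" "Q \<subseteq> img c"
  shows "emeasure vol (dom c \<inter> snd c -` Q) < \<infinity>"
proof -
  let ?X = "dom c \<inter> snd c -` Q"
  have im: "snd c ` ?X = Q" using Q by auto
  obtain \<delta> \<Delta> where \<Delta>: "0 < \<Delta>" "\<And>y. y \<in> Q \<Longrightarrow> dens c y \<le> \<Delta>" using dens_bounds[OF c Q] by metis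
  have Xb: "?X \<in> sets borel"
  proof -
    have "snd c \<in> measurable (restrict_space borel (dom c)) borel"
      by (rule borel_measurable_continuous_on_restrict) (simp add: chart_facts c)
    from measurable_sets[OF this, of Q] have "snd c -` Q \<inter> dom c \<in> sets (restrict_space borel (dom c))"
      using Q(1) by (simp add: space_restrict_space compact_imp_closed)
    then show ?thesis using chart_facts(1)[OF c] by (subst (asm) sets_restrict_space_iff) (auto simp: Int_commute)
  qed
  have "emeasure vol ?X = form c ?X" by (rule emeasure_vol[OF c Xb]) auto
  also have "\<dots> \<le> (\<integral>\<^sup>+y. ennreal \<Delta> * indicator Q y \<partial>lborel)"
    unfolding form_def im using \<Delta> by (intro nn_integral_mono) (auto simp: indicator_def intro!: ennreal_leI)
  also have "\<dots> = ennreal \<Delta> * emeasure lborel Q"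
    using Q(1) by (intro nn_integral_cmult_indicator) (simp add: compact_imp_closed)
  also have "\<dots> < \<infinity>" using emeasure_compact_finite[OF Q(1)] by (simp add: ennreal_mult_less_top)
  finally show ?thesis .
qed

text \<open>Every point has a neighbourhood of finite volume, inside a compact cube of some chart,
  and finitely many of them cover the manifold.\<close>

lemma finite_measure_vol: "finite_measure vol"
proof
  have "\<exists>O'. open O' \<and> x \<in> O' \<and> emeasure vol O' < \<infinity>" for x
  proof -
    obtain c where c: "c \<in> A" "x \<in> dom c" using charts_cover by blast
    obtain h where h: "h > 0" "cbox (snd c x - (\<chi> i. h)) (snd c x + (\<chi> i. h)) \<subseteq> img c"
      using chart_neighbourhood[OF c, of "img c"] chart_facts(2)[OF c(1)] c by auto
    let ?Q = "cbox (snd c x - (\<chi> i. h)) (snd c x + (\<chi> i. h))"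
    let ?O = "dom c \<inter> snd c -` box (snd c x - (\<chi> i. h)) (snd c x + (\<chi> i. h))"
    have X: "emeasure vol (dom c \<inter> snd c -` ?Q) < \<infinity>" by (rule emeasure_vol_cube_finite[OF c(1) _ h(2)]) simp
    have Xb: "dom c \<inter> snd c -` ?Q \<in> sets borel"
    proof -
      have "snd c \<in> measurable (restrict_space borel (dom c)) borel"
        by (rule borel_measurable_continuous_on_restrict) (simp add: chart_facts c)
      from measurable_sets[OF this, of ?Q] have "snd c -` ?Q \<inter> dom c \<in> sets (restrict_space borel (dom c))"
        by (simp add: space_restrict_space)
      then show ?thesis using chart_facts(1)[OF c(1)] by (subst (asm) sets_restrict_space_iff) (auto simp: Int_commute)
    qed
    have "emeasure vol ?O \<le> emeasure vol (dom c \<inter> snd c -` ?Q)"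
      using Xb box_subset_cbox by (intro emeasure_mono) auto
    then have "emeasure vol ?O < \<infinity>" using X by (rule le_less_trans)
    moreover have "open ?O" by (rule open_chart_preimage[OF c(1) open_box])
    moreover have "x \<in> ?O" using c h by (simp add: mem_box_cart)
    ultimately show ?thesis by blast
  qed
  then obtain N where N: "\<And>x. open (N x)" "\<And>x. x \<in> N x" "\<And>x. emeasure vol (N x) < \<infinity>" by metis
  obtain F where F: "F \<subseteq> UNIV" "finite F" "UNIV \<subseteq> (\<Union>x\<in>F. N x)"
    by (rule compactE_image[OF compact_M, of UNIV N]) (use N in auto)
  have "emeasure vol UNIV \<le> emeasure vol (\<Union>x\<in>F. N x)" using F N by (intro emeasure_mono) auto
  also have "\<dots> \<le> (\<Sum>x\<in>F. emeasure vol (N x))" using F N by (intro emeasure_subadditive_finite) auto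
  also have "\<dots> < \<infinity>" using N F(2) by (simp add: less_top)
  finally show "emeasure vol (space vol) \<noteq> \<infinity>" by simp
qed

end

section \<open>Weak gradients\<close>

lemma set_integrable_mult_continuous:
  fixes u \<phi> :: "'a::euclidean_space \<Rightarrow> real"
  assumes K: "compact K" and u: "set_integrable lborel K u" and \<phi>: "continuous_on UNIV \<phi>"
  shows "set_integrable lborel K (\<lambda>y. u y * \<phi> y)"
proof -
  obtain b where b: "\<And>y. y \<in> K \<Longrightarrow> \<bar>\<phi> y\<bar> \<le> b"
    using compact_imp_bounded[OF compact_continuous_image[OF continuous_on_subset[OF \<phi>] K]] unfolding bounded_iff by auto
  have i: "integrable lborel (\<lambda>y. indicator K y *\<^sub>R u y)" using u by (simp add: set_integrable_def)
  have [measurable]: "\<phi> \<in> borel_measurable borel" using \<phi> by (rule borel_measurable_continuous_onI)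
  have m: "(\<lambda>y. (indicator K y *\<^sub>R u y) * \<phi> y) \<in> borel_measurable lborel"
    by (rule borel_measurable_times[OF borel_measurable_integrable[OF i]]) simp
  have "integrable lborel (\<lambda>y. (indicator K y *\<^sub>R u y) * \<phi> y)"
  proof (rule Bochner_Integration.integrable_bound[OF integrable_mult_right[OF integrable_abs[OF i], of b] m])
    show "AE y in lborel. norm ((indicator K y *\<^sub>R u y) * \<phi> y) \<le> norm (b * \<bar>indicator K y *\<^sub>R u y\<bar>)"
    proof (rule AE_I2)
      fix y
      show "norm ((indicator K y *\<^sub>R u y) * \<phi> y) \<le> norm (b * \<bar>indicator K y *\<^sub>R u y\<bar>)"
      proof (cases "y \<in> K")
        case True
        then have "\<bar>u y\<bar> * \<bar>\<phi> y\<bar> \<le> \<bar>u y\<bar> * \<bar>b\<bar>" using b[OF True] by (intro mult_left_mono) auto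
        then show ?thesis using True by (simp add: abs_mult mult.commute)
      qed simp
    qed
  qed
  then show ?thesis by (simp add: set_integrable_def mult.assoc)
qed

lemma AE_eq_if_test_integrals_eq:
  fixes h1 h2 :: "real ^ 'n::finite \<Rightarrow> real"
  assumes O: "open \<Omega>" and i: "\<And>K. compact K \<Longrightarrow> K \<subseteq> \<Omega> \<Longrightarrow> set_integrable lborel K h1"
    "\<And>K. compact K \<Longrightarrow> K \<subseteq> \<Omega> \<Longrightarrow> set_integrable lborel K h2"
    and test: "\<And>\<eta> K. smooth_on UNIV \<eta> \<Longrightarrow> compact K \<Longrightarrow> K \<subseteq> \<Omega> \<Longrightarrow> (\<And>y. y \<notin> K \<Longrightarrow> \<eta> y = 0) \<Longrightarrow>
      (LINT y:K|lborel. h1 y * \<eta> y) = (LINT y:K|lborel. h2 y * \<eta> y)"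
  shows "AE y in lborel. y \<in> \<Omega> \<longrightarrow> h1 y = h2 y"
proof -
  have "AE y in lborel. y \<in> \<Omega> \<longrightarrow> h1 y - h2 y = 0"
  proof (rule fundamental_lemma_of_calculus_of_variations[OF O])
    show "set_integrable lborel K (\<lambda>y. h1 y - h2 y)" if "compact K" "K \<subseteq> \<Omega>" for K
      by (rule set_integral_diff(1)[OF i(1)[OF that] i(2)[OF that]])
    fix \<eta> :: "real ^ 'n \<Rightarrow> real" and K assume h: "smooth_on UNIV \<eta>" "compact K" "K \<subseteq> \<Omega>" "\<And>y. y \<notin> K \<Longrightarrow> \<eta> y = 0"
    have c: "continuous_on UNIV \<eta>" using h(1) C_on_imp_continuous_on by (metis open_UNIV smooth_on_open)
    have "(LINT y:K|lborel. (h1 y - h2 y) * \<eta> y) = (LINT y:K|lborel. h1 y * \<eta> y - h2 y * \<eta> y)" by (simp add: left_diff_distrib)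
    also have "\<dots> = (LINT y:K|lborel. h1 y * \<eta> y) - (LINT y:K|lborel. h2 y * \<eta> y)"
      by (intro set_integral_diff(2) set_integrable_mult_continuous h c i)
    finally show "(LINT y:K|lborel. (h1 y - h2 y) * \<eta> y) = 0" using test[OF h] by simp
  qed
  then show ?thesis by eventually_elim auto
qed

context compact_riemannian
begin

lemma linear_coord_change:
  assumes "c \<in> A" "c' \<in> A" "x \<in> dom c" "x \<in> dom c'"
  shows "linear (coord_change c c' x)"
  unfolding coord_change_def
  using transition_has_derivative[of c c' "snd c x"] assms has_derivative_linear by blast

lemma metric_Cauchy_Schwarz:
  assumes "c \<in> A" "x \<in> dom c"
  shows "(g c x v w)\<^sup>2 \<le> g c x v v * g c x w w"
proof (cases "w = 0")
  case True
  then show ?thesis using bilinear_rzero[OF metric_facts(1)[OF assms]] by simp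
next
  case False
  note b = metric_facts(1)[OF assms]
  have ww: "g c x w w > 0" using metric_facts(3)[OF assms False] .
  define t where "t = g c x v w / g c x w w"
  have sym: "g c x w v = g c x v w" by (rule metric_facts(2)[OF assms])
  have "0 \<le> g c x (v - t *\<^sub>R w) (v - t *\<^sub>R w)" by (rule metric_nonneg[OF assms])
  also have "\<dots> = g c x v v - 2 * t * g c x v w + t * t * g c x w w"
    by (simp add: bilinear_lsub[OF b] bilinear_rsub[OF b] bilinear_lmul[OF b] bilinear_rmul[OF b] sym algebra_simps)
  also have "t * t * g c x w w = t * g c x v w" using ww by (simp add: t_def)
  finally have "t * g c x v w \<le> g c x v v" by simp
  then have "t * g c x v w * g c x w w \<le> g c x v v * g c x w w" using ww by (intro mult_right_mono) auto
  then show ?thesis using ww by (simp add: t_def power2_eq_square)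
qed

lemma field_norm_chart:
  assumes X: "measurable_vector_field A X" and c: "c \<in> A" "x \<in> dom c"
  shows "field_norm A g X x = sqrt (g c x (X c x) (X c x))"
proof -
  define c0 where "c0 = (SOME c. c \<in> A \<and> x \<in> dom c)"
  have c0: "c0 \<in> A \<and> x \<in> dom c0" unfolding c0_def by (rule someI[of _ c]) (use c in simp)
  have "X c x = coord_change c0 c x (X c0 x)" using X c c0 unfolding measurable_vector_field_def by blast
  then have "g c0 x (X c0 x) (X c0 x) = g c x (X c x) (X c x)" using metric_change[of c0 c x] c c0 by simp
  then show ?thesis by (simp add: field_norm_def Let_def c0_def[symmetric])
qed

lemma field_norm_nonneg: "field_norm A g X x \<ge> 0"
proof -
  define c0 where "c0 = (SOME c. c \<in> A \<and> x \<in> dom c)"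
  have c0: "c0 \<in> A \<and> x \<in> dom c0" unfolding c0_def by (rule someI_ex) (use charts_cover[of x] in blast)
  then show ?thesis using metric_nonneg[of c0 x] by (simp add: field_norm_def Let_def c0_def[symmetric])
qed

lemma continuous_on_metric_dom:
  assumes c: "c \<in> A" shows "continuous_on (dom c) (\<lambda>x. g c x v w)"
proof -
  have "continuous_on (dom c) (\<lambda>x. g c (chart_inv c (snd c x)) v w)"
    by (rule continuous_on_compose2[OF metric_continuous[OF c] chart_facts(3)[OF c]]) simp
  then show ?thesis by (rule continuous_on_cong[THEN iffD1, rotated 2]) (auto simp: chart_facts(5)[OF c])
qed

text \<open>The chart chosen in \<open>field_norm\<close> need not depend measurably on the point.
  On each chart of a finite cover, however, the norm is given by one formula in coordinates.\<close>

lemma field_norm_measurable [measurable]: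
  assumes X: "measurable_vector_field A X"
  shows "field_norm A g X \<in> borel_measurable borel"
proof -
  obtain k :: nat and cs :: "nat \<Rightarrow> ('m, 'n) chart" where cs: "\<forall>i<k. cs i \<in> A" and cov: "(\<Union>i<k. dom (cs i)) = UNIV"
    by (rule finite_chart_cover)
  show ?thesis
  proof (rule measurable_piecewise_restrict[of "(\<lambda>i. dom (cs i)) ` {..<k}"])
    show "space borel \<subseteq> \<Union> ((\<lambda>i. dom (cs i)) ` {..<k})" using cov by simp
    fix D assume "D \<in> (\<lambda>i. dom (cs i)) ` {..<k}"
    then obtain i where i: "i < k" "D = dom (cs i)" by blast
    then obtain c where c: "c \<in> A" "D = dom c" using cs by blast
    show "D \<inter> space borel \<in> sets borel" using chart_facts(1)[OF c(1)] c(2) by simp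
    have [measurable]: "X c \<in> borel_measurable (restrict_space borel (dom c))"
      using X c unfolding measurable_vector_field_def by blast
    have [measurable]: "(\<lambda>x. g c x v w) \<in> borel_measurable (restrict_space borel (dom c))" for v w
      by (rule borel_measurable_continuous_on_restrict[OF continuous_on_metric_dom[OF c(1)]])
    have [measurable]: "(\<lambda>x. X c x $ i) \<in> borel_measurable (restrict_space borel (dom c))" for i
    proof -
      have "(\<lambda>v::real ^ 'n. v $ i) \<in> borel_measurable borel"
        by (intro borel_measurable_continuous_onI linear_continuous_on bounded_linear_vec_nth)
      from measurable_compose[OF _ this] show ?thesis by measurable
    qed
    have "(\<lambda>x. sqrt (\<Sum>i\<in>UNIV. \<Sum>j\<in>UNIV. X c x $ i * X c x $ j * g c x (axis i 1) (axis j 1))) \<in> borel_measurable (restrict_space borel (dom c))"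
      by measurable
    then have "field_norm A g X \<in> borel_measurable (restrict_space borel (dom c))"
    proof (rule measurable_cong[THEN iffD1, rotated])
      fix x assume "x \<in> space (restrict_space borel (dom c))"
      then have x: "x \<in> dom c" by (simp add: space_restrict_space)
      show "sqrt (\<Sum>i\<in>UNIV. \<Sum>j\<in>UNIV. X c x $ i * X c x $ j * g c x (axis i 1) (axis j 1)) = field_norm A g X x"
        unfolding field_norm_chart[OF X c(1) x] by (subst bilinear_expansion[OF metric_facts(1)[OF c(1) x]]) simp
    qed
    then show "field_norm A g X \<in> borel_measurable (restrict_space borel D)" by (simp add: c)
  qed simp
qed

text \<open>In a chart the volume has a density with respect to Lebesgue measure, so Lebesgue null
  sets of the image yield null sets of the volume.\<close>

lemma AE_vol_if_AE_chart:
  assumes c: "c \<in> A" and ae: "AE y in lborel. y \<in> img c \<longrightarrow> P (chart_inv c y)"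
  shows "AE x in vol. x \<in> dom c \<longrightarrow> P x"
proof -
  obtain N where N: "{y \<in> space lborel. \<not> (y \<in> img c \<longrightarrow> P (chart_inv c y))} \<subseteq> N" "emeasure lborel N = 0" "N \<in> sets lborel"
    using AE_E[OF ae] by blast
  let ?Z = "dom c \<inter> snd c -` N"
  have Zb: "?Z \<in> sets borel"
  proof -
    have "snd c \<in> measurable (restrict_space borel (dom c)) borel"
      by (rule borel_measurable_continuous_on_restrict) (simp add: chart_facts c)
    from measurable_sets[OF this, of N] have "snd c -` N \<inter> dom c \<in> sets (restrict_space borel (dom c))"
      using N(3) by (simp add: space_restrict_space)
    then show ?thesis using chart_facts(1)[OF c] by (subst (asm) sets_restrict_space_iff) (auto simp: Int_commute)
  qed
  have "emeasure vol ?Z = form c ?Z" by (rule emeasure_vol[OF c Zb]) simp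
  also have "\<dots> = (\<integral>\<^sup>+y. 0 \<partial>(lborel :: (real ^ 'n) measure))" unfolding form_def
  proof (rule nn_integral_cong_AE)
    have "AE y in lborel. y \<notin> N" using N by (intro AE_not_in) auto
    then show "AE y in lborel. ennreal (dens c y) * indicator (snd c ` ?Z) y = 0"
      by eventually_elim (auto simp: indicator_def)
  qed
  finally have "?Z \<in> null_sets vol" using Zb by auto
  then have "AE x in vol. x \<notin> ?Z" by (rule AE_not_in)
  then show ?thesis
  proof eventually_elim
    case (elim x)
    show ?case
    proof
      assume x: "x \<in> dom c"
      then have "snd c x \<notin> N" using elim by auto
      then have "P (chart_inv c (snd c x))" using N(1) x by auto
      then show "P x" using chart_facts(5)[OF c x] by simp
    qed
  qed
qed

lemma weak_gradient_facts:
  assumes "weak_gradient A g u X"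
  shows "measurable_vector_field A X"
    "\<And>c w K. c \<in> A \<Longrightarrow> compact K \<Longrightarrow> K \<subseteq> img c \<Longrightarrow> set_integrable lborel K (\<lambda>y. u (chart_inv c y))"
    "\<And>c w K. c \<in> A \<Longrightarrow> compact K \<Longrightarrow> K \<subseteq> img c \<Longrightarrow> set_integrable lborel K (\<lambda>y. g c (chart_inv c y) (X c (chart_inv c y)) w)"
    "\<And>c w K \<eta>. c \<in> A \<Longrightarrow> smooth_on UNIV \<eta> \<Longrightarrow> compact K \<Longrightarrow> K \<subseteq> img c \<Longrightarrow> (\<And>y. y \<notin> K \<Longrightarrow> \<eta> y = 0) \<Longrightarrow>
      (LINT y:K|lborel. u (chart_inv c y) * frechet_derivative \<eta> (at y) w) =
      - (LINT y:K|lborel. g c (chart_inv c y) (X c (chart_inv c y)) w * \<eta> y)"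
  using assms unfolding weak_gradient_def by blast+

lemma weak_gradient_linear:
  assumes u: "weak_gradient A g u X" and v: "weak_gradient A g v Y"
  shows "weak_gradient A g (\<lambda>x. \<alpha> * u x + \<beta> * v x) (\<lambda>c x. \<alpha> *\<^sub>R X c x + \<beta> *\<^sub>R Y c x)"
  unfolding weak_gradient_def
proof (intro conjI ballI allI impI)
  have mX: "measurable_vector_field A X" and mY: "measurable_vector_field A Y"
    using weak_gradient_facts u v by blast+
  show "measurable_vector_field A (\<lambda>c x. \<alpha> *\<^sub>R X c x + \<beta> *\<^sub>R Y c x)"
    unfolding measurable_vector_field_def
  proof (intro conjI ballI)
    fix c assume c: "c \<in> A"
    have [measurable]: "X c \<in> borel_measurable (restrict_space borel (dom c))" "Y c \<in> borel_measurable (restrict_space borel (dom c))"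
      using mX mY c unfolding measurable_vector_field_def by blast+
    show "(\<lambda>x. \<alpha> *\<^sub>R X c x + \<beta> *\<^sub>R Y c x) \<in> borel_measurable (restrict_space borel (dom c))" by measurable
    fix c' x assume c': "c' \<in> A" and x: "x \<in> dom c \<inter> dom c'"
    have "linear (coord_change c c' x)" using linear_coord_change c c' x by auto
    moreover have "X c' x = coord_change c c' x (X c x)" "Y c' x = coord_change c c' x (Y c x)"
      using mX mY c c' x unfolding measurable_vector_field_def by blast+
    ultimately show "\<alpha> *\<^sub>R X c' x + \<beta> *\<^sub>R Y c' x = coord_change c c' x (\<alpha> *\<^sub>R X c x + \<beta> *\<^sub>R Y c x)"
      by (simp add: linear_add linear_cmul)
  qed
next
  fix c w K assume c: "c \<in> A" and K: "compact K \<and> K \<subseteq> img c"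
  let ?u = "\<lambda>y. u (chart_inv c y)" and ?v = "\<lambda>y. v (chart_inv c y)"
  let ?X = "\<lambda>y. g c (chart_inv c y) (X c (chart_inv c y)) w" and ?Y = "\<lambda>y. g c (chart_inv c y) (Y c (chart_inv c y)) w"
  show "set_integrable lborel K (\<lambda>y. \<alpha> * ?u y + \<beta> * ?v y)"
    using weak_gradient_facts(2)[OF u c] weak_gradient_facts(2)[OF v c] K by (intro set_integral_add set_integrable_mult_right) auto
  have "set_integrable lborel K (\<lambda>y. \<alpha> * ?X y + \<beta> * ?Y y)"
    using weak_gradient_facts(3)[OF u c] weak_gradient_facts(3)[OF v c] K by (intro set_integral_add set_integrable_mult_right) auto
  moreover have lin: "g c (chart_inv c y) (\<alpha> *\<^sub>R X c (chart_inv c y) + \<beta> *\<^sub>R Y c (chart_inv c y)) w = \<alpha> * ?X y + \<beta> * ?Y y" if "y \<in> img c" for y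
    using metric_facts(1)[OF c chart_facts(7)[OF c that]] by (simp add: bilinear_ladd bilinear_lmul)
  ultimately show "set_integrable lborel K (\<lambda>y. g c (chart_inv c y) (\<alpha> *\<^sub>R X c (chart_inv c y) + \<beta> *\<^sub>R Y c (chart_inv c y)) w)"
    using K by (subst set_integrable_cong[OF refl refl lin]) auto
next
  fix c w and \<eta> :: "real ^ 'n \<Rightarrow> real" and K assume c: "c \<in> A" and h: "smooth_on UNIV \<eta> \<and> compact K \<and> K \<subseteq> img c \<and> (\<forall>y. y \<notin> K \<longrightarrow> \<eta> y = 0)"
  let ?u = "\<lambda>y. u (chart_inv c y)" and ?v = "\<lambda>y. v (chart_inv c y)"
  let ?X = "\<lambda>y. g c (chart_inv c y) (X c (chart_inv c y)) w" and ?Y = "\<lambda>y. g c (chart_inv c y) (Y c (chart_inv c y)) w"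
  let ?D = "\<lambda>y. frechet_derivative \<eta> (at y) w"
  have sm: "C_on 1 UNIV \<eta>" using h by (simp only: smooth_on_open[OF open_UNIV])
  have cD: "continuous_on UNIV ?D" using sm by simp
  have c\<eta>: "continuous_on UNIV \<eta>" using C_on_imp_continuous_on[OF sm] .
  have lin: "g c (chart_inv c y) (\<alpha> *\<^sub>R X c (chart_inv c y) + \<beta> *\<^sub>R Y c (chart_inv c y)) w = \<alpha> * ?X y + \<beta> * ?Y y" if "y \<in> img c" for y
    using metric_facts(1)[OF c chart_facts(7)[OF c that]] by (simp add: bilinear_ladd bilinear_lmul)
  have comb: "(LINT y:K|lborel. (\<alpha> * f1 y + \<beta> * f2 y) * \<phi> y) = \<alpha> * (LINT y:K|lborel. f1 y * \<phi> y) + \<beta> * (LINT y:K|lborel. f2 y * \<phi> y)"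
    if "set_integrable lborel K f1" "set_integrable lborel K f2" "continuous_on UNIV \<phi>" for f1 f2 \<phi> :: "real ^ 'n \<Rightarrow> real"
  proof -
    have "(LINT y:K|lborel. (\<alpha> * f1 y + \<beta> * f2 y) * \<phi> y) = (LINT y:K|lborel. \<alpha> * (f1 y * \<phi> y) + \<beta> * (f2 y * \<phi> y))"
      by (simp add: algebra_simps)
    also have "\<dots> = (LINT y:K|lborel. \<alpha> * (f1 y * \<phi> y)) + (LINT y:K|lborel. \<beta> * (f2 y * \<phi> y))"
      using h that by (intro set_integral_add set_integrable_mult_right set_integrable_mult_continuous) auto
    finally show ?thesis by simp
  qed
  have "(LINT y:K|lborel. (\<alpha> * ?u y + \<beta> * ?v y) * ?D y) = \<alpha> * (LINT y:K|lborel. ?u y * ?D y) + \<beta> * (LINT y:K|lborel. ?v y * ?D y)"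
    using h by (intro comb weak_gradient_facts(2)[OF u c] weak_gradient_facts(2)[OF v c] cD) auto
  also have "\<dots> = - (\<alpha> * (LINT y:K|lborel. ?X y * \<eta> y) + \<beta> * (LINT y:K|lborel. ?Y y * \<eta> y))"
    using weak_gradient_facts(4)[OF u c, of \<eta> K w] weak_gradient_facts(4)[OF v c, of \<eta> K w] h by simp
  also have "\<dots> = - (LINT y:K|lborel. (\<alpha> * ?X y + \<beta> * ?Y y) * \<eta> y)"
    using h by (subst comb) (auto intro!: weak_gradient_facts(3)[OF u c] weak_gradient_facts(3)[OF v c] c\<eta>)
  also have "(LINT y:K|lborel. (\<alpha> * ?X y + \<beta> * ?Y y) * \<eta> y) = (LINT y:K|lborel. g c (chart_inv c y) (\<alpha> *\<^sub>R X c (chart_inv c y) + \<beta> *\<^sub>R Y c (chart_inv c y)) w * \<eta> y)"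
    unfolding set_lebesgue_integral_def using h lin
    by (intro Bochner_Integration.integral_cong refl) (auto simp: indicator_def)
  finally show "(LINT y:K|lborel. (\<alpha> * ?u y + \<beta> * ?v y) * ?D y) =
    - (LINT y:K|lborel. g c (chart_inv c y) (\<alpha> *\<^sub>R X c (chart_inv c y) + \<beta> *\<^sub>R Y c (chart_inv c y)) w * \<eta> y)" .
qed

lemma weak_gradient_diff:
  assumes "weak_gradient A g u X" "weak_gradient A g v Y"
  shows "weak_gradient A g (\<lambda>x. u x - v x) (\<lambda>c x. X c x - Y c x)"
  using weak_gradient_linear[OF assms, of 1 "-1"] by simp

lemma weak_gradient_scale:
  assumes "weak_gradient A g u X"
  shows "weak_gradient A g (\<lambda>x. \<alpha> * u x) (\<lambda>c x. \<alpha> *\<^sub>R X c x)"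
  using weak_gradient_linear[OF assms assms, of \<alpha> 0] by simp

text \<open>The pairings of \<open>X\<close> and \<open>Y\<close> with the coordinate fields are
  weak derivatives of the same function, hence agree almost everywhere; definiteness of the metric
  then identifies the fields. This makes the choice in \<open>sobolev_norm\<close> harmless.\<close>

lemma weak_gradient_unique:
  assumes X: "weak_gradient A g u X" and Y: "weak_gradient A g u Y"
  shows "AE x in vol. field_norm A g X x = field_norm A g Y x"
proof -
  have chart: "AE x in vol. x \<in> dom c \<longrightarrow> field_norm A g X x = field_norm A g Y x" if c: "c \<in> A" for c
  proof (rule AE_vol_if_AE_chart[OF c])
    have "AE y in lborel. \<forall>i\<in>UNIV. y \<in> img c \<longrightarrow> g c (chart_inv c y) (X c (chart_inv c y)) (axis i 1) = g c (chart_inv c y) (Y c (chart_inv c y)) (axis i 1)"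
    proof (rule AE_finite_allI)
      fix i
      show "AE y in lborel. y \<in> img c \<longrightarrow> g c (chart_inv c y) (X c (chart_inv c y)) (axis i 1) = g c (chart_inv c y) (Y c (chart_inv c y)) (axis i 1)"
      proof (rule AE_eq_if_test_integrals_eq[OF chart_facts(2)[OF c] weak_gradient_facts(3)[OF X c] weak_gradient_facts(3)[OF Y c]])
        fix \<eta> :: "real ^ 'n \<Rightarrow> real" and K assume h: "smooth_on UNIV \<eta>" "compact K" "K \<subseteq> img c" "\<And>y. y \<notin> K \<Longrightarrow> \<eta> y = 0"
        show "(LINT y:K|lborel. g c (chart_inv c y) (X c (chart_inv c y)) (axis i 1) * \<eta> y) = (LINT y:K|lborel. g c (chart_inv c y) (Y c (chart_inv c y)) (axis i 1) * \<eta> y)"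
          using weak_gradient_facts(4)[OF X c h, of "axis i 1"] weak_gradient_facts(4)[OF Y c h, of "axis i 1"] by simp
      qed
    qed simp
    then show "AE y in lborel. y \<in> img c \<longrightarrow> field_norm A g X (chart_inv c y) = field_norm A g Y (chart_inv c y)"
    proof eventually_elim
      case (elim y)
      show ?case
      proof
        assume y: "y \<in> img c"
        let ?x = "chart_inv c y"
        have x: "?x \<in> dom c" by (rule chart_facts(7)[OF c y])
        note b = metric_facts(1)[OF c x]
        let ?d = "X c ?x - Y c ?x"
        have "g c ?x ?d (axis i 1) = 0" for i using elim y by (simp add: bilinear_lsub[OF b])
        then have "g c ?x ?d ?d = 0" unfolding bilinear_expansion[OF b, of ?d ?d]
        proof -
          assume z: "\<And>i. g c ?x ?d (axis i 1) = 0"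
          have "(\<Sum>i\<in>UNIV. \<Sum>j\<in>UNIV. ?d $ i * ?d $ j * g c ?x (axis i 1) (axis j 1)) = (\<Sum>j\<in>UNIV. ?d $ j * g c ?x ?d (axis j 1))"
          proof -
            have "g c ?x ?d (axis j 1) = (\<Sum>i\<in>UNIV. ?d $ i * g c ?x (axis i 1) (axis j 1))" for j
            proof -
              have "g c ?x ?d (axis j 1) = (\<Sum>i\<in>UNIV. \<Sum>l\<in>UNIV. ?d $ i * axis j 1 $ l * g c ?x (axis i 1) (axis l 1))"
                by (rule bilinear_expansion[OF b])
              also have "\<dots> = (\<Sum>i\<in>UNIV. \<Sum>l\<in>UNIV. if l = j then ?d $ i * g c ?x (axis i 1) (axis l 1) else 0)"
                by (intro sum.cong) (auto simp: axis_def)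
              finally show ?thesis by simp
            qed
            then show ?thesis by (subst sum.swap) (simp add: sum_distrib_left mult_ac)
          qed
          then show "(\<Sum>i\<in>UNIV. \<Sum>j\<in>UNIV. ?d $ i * ?d $ j * g c ?x (axis i 1) (axis j 1)) = 0" using z by simp
        qed
        then have "?d = 0" using metric_facts(3)[OF c x, of ?d] by fastforce
        then show "field_norm A g X ?x = field_norm A g Y ?x"
          by (simp add: field_norm_chart[OF weak_gradient_facts(1)[OF X] c x] field_norm_chart[OF weak_gradient_facts(1)[OF Y] c x])
      qed
    qed
  qed
  obtain k :: nat and cs :: "nat \<Rightarrow> ('m, 'n) chart" where cs: "\<forall>i<k. cs i \<in> A" and cov: "(\<Union>i<k. dom (cs i)) = UNIV"
    by (rule finite_chart_cover)
  have "AE x in vol. \<forall>i\<in>{..<k}. x \<in> dom (cs i) \<longrightarrow> field_norm A g X x = field_norm A g Y x"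
    by (rule AE_finite_allI) (use cs chart in auto)
  then show ?thesis by eventually_elim (use cov in blast)
qed

lemma smooth_function_C_on: "smooth_function A u \<Longrightarrow> c \<in> A \<Longrightarrow> C_on k (img c) (\<lambda>y. u (chart_inv c y))"
proof -
  assume u: "smooth_function A u" and c: "c \<in> A"
  have "smooth_on (img c) (u \<circ> chart_inv c)" using u c unfolding smooth_function_def by blast
  from this[unfolded smooth_on_open[OF chart_facts(2)[OF c]]] show ?thesis unfolding o_def by blast
qed

text \<open>By parts, the classical partial derivatives are weak derivatives too. Hence whatever
  weak gradient a smooth function comes with can be used for estimates of its classical
  derivatives.\<close>

lemma weak_gradient_smooth:
  assumes u: "smooth_function A u" and X: "weak_gradient A g u X" and c: "c \<in> A"
  shows "AE y in lborel. y \<in> img c \<longrightarrow> (\<forall>i. g c (chart_inv c y) (X c (chart_inv c y)) (axis i 1) = grad (\<lambda>y. u (chart_inv c y)) y $ i)"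
proof -
  let ?f = "\<lambda>y. u (chart_inv c y)"
  have C1: "C_on 1 (img c) ?f" by (rule smooth_function_C_on[OF u c])
  have "AE y in lborel. \<forall>i\<in>UNIV. y \<in> img c \<longrightarrow> g c (chart_inv c y) (X c (chart_inv c y)) (axis i 1) = grad ?f y $ i"
  proof (rule AE_finite_allI)
    fix i
    show "AE y in lborel. y \<in> img c \<longrightarrow> g c (chart_inv c y) (X c (chart_inv c y)) (axis i 1) = grad ?f y $ i"
    proof (rule AE_eq_if_test_integrals_eq[OF chart_facts(2)[OF c] weak_gradient_facts(3)[OF X c]])
      show "set_integrable lborel K (\<lambda>y. grad ?f y $ i)" if "compact K" "K \<subseteq> img c" for K
      proof -
        have "continuous_on (img c) (\<lambda>y. grad ?f y $ i)" using C1 by (simp add: grad_def)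
        then show ?thesis unfolding set_integrable_def
          using that by (intro borel_integrable_compact) (auto intro: continuous_on_subset)
      qed
      fix \<eta> :: "real ^ 'n \<Rightarrow> real" and K assume h: "smooth_on UNIV \<eta>" "compact K" "K \<subseteq> img c" "\<And>y. y \<notin> K \<Longrightarrow> \<eta> y = 0"
      have "C_on 1 UNIV \<eta>" using h(1) by (simp only: smooth_on_open[OF open_UNIV])
      then have "C_on 1 (img c) \<eta>" by (rule C_on_subset) simp
      from integration_by_parts[OF chart_facts(2)[OF c] C1 this h(2,3,4), of "axis i 1"]
      show "(LINT y:K|lborel. g c (chart_inv c y) (X c (chart_inv c y)) (axis i 1) * \<eta> y) = (LINT y:K|lborel. grad ?f y $ i * \<eta> y)"
        using weak_gradient_facts(4)[OF X c h, of "axis i 1"] by (simp add: grad_def)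
    qed
  qed simp
  then show ?thesis by eventually_elim auto
qed

section \<open>The Sobolev seminorm\<close>

lemma sobolev_spaceE:
  assumes "u \<in> sobolev_space A g p"
  obtains X where "weak_gradient A g u X" "u \<in> borel_measurable borel" "integrable vol (\<lambda>x. \<bar>u x\<bar> powr p)"
    "integrable vol (\<lambda>x. field_norm A g X x powr p)"
proof -
  have m: "borel_measurable vol = (borel_measurable borel :: ('m \<Rightarrow> real) set)" by (rule measurable_cong_sets) simp_all
  show ?thesis
    using assms that by (auto simp: sobolev_space_def Lp_space_def m abs_of_nonneg[OF field_norm_nonneg])
qed

lemma sobolev_spaceI:
  assumes "weak_gradient A g u X" "u \<in> borel_measurable borel" "integrable vol (\<lambda>x. \<bar>u x\<bar> powr p)"
    "integrable vol (\<lambda>x. field_norm A g X x powr p)"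
  shows "u \<in> sobolev_space A g p"
proof -
  have m: "borel_measurable vol = (borel_measurable borel :: ('m \<Rightarrow> real) set)" by (rule measurable_cong_sets) simp_all
  show ?thesis
    using assms field_norm_measurable[OF weak_gradient_facts(1)[OF assms(1)]]
    by (auto simp: sobolev_space_def Lp_space_def m abs_of_nonneg[OF field_norm_nonneg] intro!: exI[of _ X])
qed

text \<open>By \<open>weak_gradient_unique\<close> the seminorm may be computed with whatever weak
  gradient is at hand, in place of the chosen one.\<close>

lemma sobolev_norm_eq:
  assumes "weak_gradient A g u X"
  shows "sobolev_norm A g p u = ((\<integral>x. \<bar>u x\<bar> powr p \<partial>vol) + (\<integral>x. field_norm A g X x powr p \<partial>vol)) powr (1 / p)"
proof -
  let ?Y = "SOME X. weak_gradient A g u X"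
  have Y: "weak_gradient A g u ?Y" by (rule someI[of _ X]) (rule assms)
  have [measurable]: "field_norm A g X \<in> borel_measurable borel" "field_norm A g ?Y \<in> borel_measurable borel"
    using field_norm_measurable weak_gradient_facts(1) assms Y by blast+
  have "(\<integral>x. field_norm A g ?Y x powr p \<partial>vol) = (\<integral>x. field_norm A g X x powr p \<partial>vol)"
  proof (rule integral_cong_AE)
    show "AE x in vol. field_norm A g ?Y x powr p = field_norm A g X x powr p"
      using weak_gradient_unique[OF Y assms] by eventually_elim simp
  qed measurable
  then show ?thesis by (simp add: sobolev_norm_def)
qed

text \<open>The parallelogram identity yields the factor 2 at once; a sharp triangle inequality
  would gain nothing, since the bound serves for boundedness and convergence.\<close>

lemma field_norm_diff_le:
  assumes X: "measurable_vector_field A X" and Y: "measurable_vector_field A Y" and Z: "measurable_vector_field A (\<lambda>c x. X c x - Y c x)"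
  shows "field_norm A g (\<lambda>c x. X c x - Y c x) x \<le> 2 * (field_norm A g X x + field_norm A g Y x)"
proof -
  obtain c where c: "c \<in> A" "x \<in> dom c" using charts_cover by blast
  note b = metric_facts(1)[OF c]
  let ?v = "X c x" and ?w = "Y c x"
  have vv: "g c x ?v ?v \<ge> 0" "g c x ?w ?w \<ge> 0" "g c x (?v + ?w) (?v + ?w) \<ge> 0" using metric_nonneg[OF c] by auto
  have "g c x (?v - ?w) (?v - ?w) + g c x (?v + ?w) (?v + ?w) = 2 * g c x ?v ?v + 2 * g c x ?w ?w"
    by (simp add: bilinear_lsub[OF b] bilinear_rsub[OF b] bilinear_ladd[OF b] bilinear_radd[OF b])
  then have "g c x (?v - ?w) (?v - ?w) \<le> 2 * g c x ?v ?v + 2 * g c x ?w ?w" using vv by linarith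
  also have "\<dots> \<le> (2 * (sqrt (g c x ?v ?v) + sqrt (g c x ?w ?w)))\<^sup>2"
    using vv by (simp add: power2_eq_square algebra_simps)
  finally have "sqrt (g c x (?v - ?w) (?v - ?w)) \<le> 2 * (sqrt (g c x ?v ?v) + sqrt (g c x ?w ?w))"
    using vv by (intro real_le_lsqrt) auto
  then show ?thesis by (simp add: field_norm_chart[OF X c] field_norm_chart[OF Y c] field_norm_chart[OF Z c])
qed

lemma field_norm_scale:
  assumes X: "measurable_vector_field A X" and Z: "measurable_vector_field A (\<lambda>c x. \<alpha> *\<^sub>R X c x)"
  shows "field_norm A g (\<lambda>c x. \<alpha> *\<^sub>R X c x) x = \<bar>\<alpha>\<bar> * field_norm A g X x"
proof -
  obtain c where c: "c \<in> A" "x \<in> dom c" using charts_cover by blast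
  note b = metric_facts(1)[OF c]
  show ?thesis
    by (simp add: field_norm_chart[OF X c] field_norm_chart[OF Z c] bilinear_lmul[OF b] bilinear_rmul[OF b]
        real_sqrt_mult mult.assoc[symmetric] power2_eq_square[symmetric])
qed

text \<open>A triangle inequality up to the constant 8, which arises as
  \<open>4 * 2 powr (1 / p) \<le> 8\<close>. It takes the place of Minkowski's inequality and is
  enough for limits and for bounded sets.\<close>

lemma sobolev_diff:
  assumes p: "p \<ge> 1" and u: "u \<in> sobolev_space A g p" and v: "v \<in> sobolev_space A g p"
  shows "(\<lambda>x. u x - v x) \<in> sobolev_space A g p"
    and "sobolev_norm A g p (\<lambda>x. u x - v x) \<le> 8 * (sobolev_norm A g p u + sobolev_norm A g p v)"
proof -
  obtain X where X: "weak_gradient A g u X" and um[measurable]: "u \<in> borel_measurable borel" and ui: "integrable vol (\<lambda>x. \<bar>u x\<bar> powr p)"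
    and Xi: "integrable vol (\<lambda>x. field_norm A g X x powr p)" using sobolev_spaceE[OF u] .
  obtain Y where Y: "weak_gradient A g v Y" and vm[measurable]: "v \<in> borel_measurable borel" and vi: "integrable vol (\<lambda>x. \<bar>v x\<bar> powr p)"
    and Yi: "integrable vol (\<lambda>x. field_norm A g Y x powr p)" using sobolev_spaceE[OF v] .
  let ?Z = "\<lambda>c x. X c x - Y c x"
  have Z: "weak_gradient A g (\<lambda>x. u x - v x) ?Z" by (rule weak_gradient_diff[OF X Y])
  note mX = weak_gradient_facts(1)[OF X] and mY = weak_gradient_facts(1)[OF Y] and mZ = weak_gradient_facts(1)[OF Z]
  note [measurable] = field_norm_measurable[OF mX] field_norm_measurable[OF mY] field_norm_measurable[OF mZ]
  have b1: "\<bar>u x - v x\<bar> powr p \<le> 4 powr p * (\<bar>u x\<bar> powr p + \<bar>v x\<bar> powr p)" for x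
  proof -
    have "\<bar>u x - v x\<bar> powr p \<le> (\<bar>u x\<bar> + \<bar>v x\<bar>) powr p" using p by (intro powr_mono2) auto
    also have "\<dots> \<le> 2 powr p * (\<bar>u x\<bar> powr p + \<bar>v x\<bar> powr p)" using p by (intro powr_add_le) auto
    also have "\<dots> \<le> 4 powr p * (\<bar>u x\<bar> powr p + \<bar>v x\<bar> powr p)" using p by (intro mult_right_mono powr_mono2) auto
    finally show ?thesis .
  qed
  have b2: "field_norm A g ?Z x powr p \<le> 4 powr p * (field_norm A g X x powr p + field_norm A g Y x powr p)" for x
  proof -
    have "field_norm A g ?Z x powr p \<le> (2 * (field_norm A g X x + field_norm A g Y x)) powr p"
      using p field_norm_diff_le[OF mX mY mZ] field_norm_nonneg by (intro powr_mono2) auto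
    also have "\<dots> = 2 powr p * (field_norm A g X x + field_norm A g Y x) powr p"
      by (subst powr_mult) (simp_all add: field_norm_nonneg)
    also have "\<dots> \<le> 2 powr p * (2 powr p * (field_norm A g X x powr p + field_norm A g Y x powr p))"
      using p field_norm_nonneg by (intro mult_left_mono powr_add_le) auto
    also have "\<dots> = 4 powr p * (field_norm A g X x powr p + field_norm A g Y x powr p)"
      by (simp add: mult.assoc[symmetric] powr_mult[symmetric])
    finally show ?thesis .
  qed
  have i1: "integrable vol (\<lambda>x. \<bar>u x - v x\<bar> powr p)"
    by (rule Bochner_Integration.integrable_bound[of _ "\<lambda>x. 4 powr p * (\<bar>u x\<bar> powr p + \<bar>v x\<bar> powr p)"])
       (use ui vi b1 in \<open>auto intro!: AE_I2\<close>)
  have i2: "integrable vol (\<lambda>x. field_norm A g ?Z x powr p)"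
    by (rule Bochner_Integration.integrable_bound[of _ "\<lambda>x. 4 powr p * (field_norm A g X x powr p + field_norm A g Y x powr p)"])
       (use Xi Yi b2 in \<open>auto intro!: AE_I2\<close>)
  show "(\<lambda>x. u x - v x) \<in> sobolev_space A g p"
    by (rule sobolev_spaceI[OF Z _ i1 i2]) measurable
  let ?U = "(\<integral>x. \<bar>u x\<bar> powr p \<partial>vol) + (\<integral>x. field_norm A g X x powr p \<partial>vol)"
  let ?V = "(\<integral>x. \<bar>v x\<bar> powr p \<partial>vol) + (\<integral>x. field_norm A g Y x powr p \<partial>vol)"
  have U0: "?U \<ge> 0" "?V \<ge> 0" by (auto intro!: add_nonneg_nonneg integral_nonneg_AE)
  have "(\<integral>x. \<bar>u x - v x\<bar> powr p \<partial>vol) \<le> (\<integral>x. 4 powr p * (\<bar>u x\<bar> powr p + \<bar>v x\<bar> powr p) \<partial>vol)"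
    by (rule integral_mono[OF i1]) (use ui vi b1 in auto)
  moreover have "(\<integral>x. field_norm A g ?Z x powr p \<partial>vol) \<le> (\<integral>x. 4 powr p * (field_norm A g X x powr p + field_norm A g Y x powr p) \<partial>vol)"
    by (rule integral_mono[OF i2]) (use Xi Yi b2 in auto)
  ultimately have "(\<integral>x. \<bar>u x - v x\<bar> powr p \<partial>vol) + (\<integral>x. field_norm A g ?Z x powr p \<partial>vol) \<le> 4 powr p * (?U + ?V)"
    using ui vi Xi Yi by (simp add: algebra_simps)
  then have "sobolev_norm A g p (\<lambda>x. u x - v x) \<le> (4 powr p * (?U + ?V)) powr (1 / p)"
    unfolding sobolev_norm_eq[OF Z] using p by (intro powr_mono2) (auto intro!: add_nonneg_nonneg integral_nonneg_AE)
  also have "\<dots> = 4 * (?U + ?V) powr (1 / p)" using p U0 by (subst powr_mult) (auto simp: powr_powr)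
  also have "(?U + ?V) powr (1 / p) \<le> 2 powr (1 / p) * (?U powr (1 / p) + ?V powr (1 / p))" using p U0 by (intro powr_add_le) auto
  also have "\<dots> \<le> 2 powr 1 * (?U powr (1 / p) + ?V powr (1 / p))" using p by (intro mult_right_mono powr_mono) auto
  finally show "sobolev_norm A g p (\<lambda>x. u x - v x) \<le> 8 * (sobolev_norm A g p u + sobolev_norm A g p v)"
    unfolding sobolev_norm_eq[OF X] sobolev_norm_eq[OF Y] by simp
qed

lemma sobolev_scale:
  assumes p: "p \<ge> 1" and u: "u \<in> sobolev_space A g p"
  shows "(\<lambda>x. \<alpha> * u x) \<in> sobolev_space A g p"
    and "sobolev_norm A g p (\<lambda>x. \<alpha> * u x) = \<bar>\<alpha>\<bar> * sobolev_norm A g p u"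
proof -
  obtain X where X: "weak_gradient A g u X" and um[measurable]: "u \<in> borel_measurable borel" and ui: "integrable vol (\<lambda>x. \<bar>u x\<bar> powr p)"
    and Xi: "integrable vol (\<lambda>x. field_norm A g X x powr p)" using sobolev_spaceE[OF u] .
  let ?Z = "\<lambda>c x. \<alpha> *\<^sub>R X c x"
  have Z: "weak_gradient A g (\<lambda>x. \<alpha> * u x) ?Z" by (rule weak_gradient_scale[OF X])
  note mX = weak_gradient_facts(1)[OF X] and mZ = weak_gradient_facts(1)[OF Z]
  have e1: "\<bar>\<alpha> * u x\<bar> powr p = \<bar>\<alpha>\<bar> powr p * \<bar>u x\<bar> powr p" for x by (simp add: abs_mult powr_mult)
  have e2: "field_norm A g ?Z x powr p = \<bar>\<alpha>\<bar> powr p * field_norm A g X x powr p" for x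
    using field_norm_nonneg by (simp add: field_norm_scale[OF mX mZ] powr_mult)
  show "(\<lambda>x. \<alpha> * u x) \<in> sobolev_space A g p"
    by (rule sobolev_spaceI[OF Z]) (use ui Xi in \<open>auto simp only: e1 e2 intro!: integrable_mult_right\<close>, measurable)
  have "sobolev_norm A g p (\<lambda>x. \<alpha> * u x) = (\<bar>\<alpha>\<bar> powr p * ((\<integral>x. \<bar>u x\<bar> powr p \<partial>vol) + (\<integral>x. field_norm A g X x powr p \<partial>vol))) powr (1 / p)"
    unfolding sobolev_norm_eq[OF Z] e1 e2 by (simp add: distrib_left)
  also have "\<dots> = \<bar>\<alpha>\<bar> * sobolev_norm A g p u"
    unfolding sobolev_norm_eq[OF X] using p
    by (subst powr_mult) (auto simp: powr_powr intro!: add_nonneg_nonneg integral_nonneg_AE)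
  finally show "sobolev_norm A g p (\<lambda>x. \<alpha> * u x) = \<bar>\<alpha>\<bar> * sobolev_norm A g p u" .
qed

end

section \<open>Basic functions in charts\<close>

context compact_riemannian
begin

lemma borel_chart_preimage:
  assumes c: "c \<in> A" and Q: "Q \<in> sets borel"
  shows "dom c \<inter> snd c -` Q \<in> sets borel"
proof -
  have "snd c \<in> measurable (restrict_space borel (dom c)) borel"
    by (rule borel_measurable_continuous_on_restrict) (simp add: chart_facts c)
  from measurable_sets[OF this Q] have "snd c -` Q \<inter> dom c \<in> sets (restrict_space borel (dom c))"
    by (simp add: space_restrict_space)
  then show ?thesis using chart_facts(1)[OF c] by (subst (asm) sets_restrict_space_iff) (auto simp: Int_commute)
qed

lemma chart_pullback_measurable:
  assumes c: "c \<in> A" and Q[measurable]: "Q \<in> sets borel" and QI: "Q \<subseteq> img c" and u[measurable]: "u \<in> borel_measurable borel"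
  shows "(\<lambda>y. u (chart_inv c y) * indicator Q y) \<in> (borel_measurable borel :: (real ^ 'n \<Rightarrow> ennreal) set)"
proof -
  note [measurable] = ext_inv_measurable[OF c]
  have "(\<lambda>y. u (ext_inv c y) * indicator Q y) \<in> borel_measurable borel" by measurable
  also have "(\<lambda>y. u (ext_inv c y) * indicator Q y) = (\<lambda>y. u (chart_inv c y) * indicator Q y)"
    using QI by (auto simp: fun_eq_iff ext_inv_def indicator_def)
  finally show ?thesis .
qed

text \<open>On compact subsets of a chart image the density lies between two positive constants, so
  integrals in the chart and on the manifold are comparable; \<open>vol_le_lborel\<close> is the
  converse bound.\<close>

lemma lborel_le_vol:
  assumes c: "c \<in> A" and Q: "compact Q" "Q \<subseteq> img c"
  obtains \<Gamma> where "\<Gamma> \<ge> 0" "\<forall>u. u \<in> borel_measurable borel \<longrightarrow> (\<integral>\<^sup>+y\<in>Q. u (chart_inv c y) \<partial>lborel) \<le> ennreal \<Gamma> * (\<integral>\<^sup>+x. u x \<partial>vol)"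
proof -
  obtain \<delta> \<Delta> where \<delta>: "0 < \<delta>" "\<And>y. y \<in> Q \<Longrightarrow> \<delta> \<le> dens c y" using dens_bounds[OF c Q] by metis
  have Qb: "Q \<in> sets borel" using Q(1) by (simp add: compact_imp_closed)
  let ?X = "dom c \<inter> snd c -` Q"
  have im: "snd c ` ?X = Q" using Q by auto
  have Xb: "?X \<in> sets borel" by (rule borel_chart_preimage[OF c Qb])
  have "(\<integral>\<^sup>+y\<in>Q. u (chart_inv c y) \<partial>lborel) \<le> ennreal (1 / \<delta>) * (\<integral>\<^sup>+x. u x \<partial>vol)" if u[measurable]: "u \<in> borel_measurable borel" for u
  proof -
    have m: "(\<lambda>y. u (chart_inv c y) * indicator Q y) \<in> borel_measurable borel" by (rule chart_pullback_measurable[OF c Qb Q(2) u])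
    have "ennreal \<delta> * (\<integral>\<^sup>+y\<in>Q. u (chart_inv c y) \<partial>lborel) = (\<integral>\<^sup>+y. ennreal \<delta> * (u (chart_inv c y) * indicator Q y) \<partial>lborel)"
      using m by (intro nn_integral_cmult[symmetric]) simp
    also have "\<dots> \<le> (\<integral>\<^sup>+y\<in>Q. u (chart_inv c y) * ennreal (dens c y) \<partial>lborel)"
    proof (rule nn_integral_mono)
      fix y
      show "ennreal \<delta> * (u (chart_inv c y) * indicator Q y) \<le> u (chart_inv c y) * ennreal (dens c y) * indicator Q y"
      proof (cases "y \<in> Q")
        case True
        then have "u (chart_inv c y) * ennreal \<delta> \<le> u (chart_inv c y) * ennreal (dens c y)" using \<delta>(2) by (intro mult_left_mono ennreal_leI) auto
        then show ?thesis using True by (simp add: mult.commute)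
      qed simp
    qed
    also have "\<dots> = (\<integral>\<^sup>+x\<in>?X. u x \<partial>vol)" using nn_integral_vol[OF c Xb _ u] im by simp
    also have "\<dots> \<le> (\<integral>\<^sup>+x. u x \<partial>vol)" by (intro nn_integral_mono) (auto simp: indicator_def)
    finally have "ennreal \<delta> * (\<integral>\<^sup>+y\<in>Q. u (chart_inv c y) \<partial>lborel) \<le> (\<integral>\<^sup>+x. u x \<partial>vol)" .
    then have "ennreal (1 / \<delta>) * (ennreal \<delta> * (\<integral>\<^sup>+y\<in>Q. u (chart_inv c y) \<partial>lborel)) \<le> ennreal (1 / \<delta>) * (\<integral>\<^sup>+x. u x \<partial>vol)"
      by (rule mult_left_mono) simp
    then show ?thesis using \<delta>(1) by (simp add: mult.assoc[symmetric] ennreal_mult[symmetric])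
  qed
  then show ?thesis using \<delta>(1) by (intro that[of "1 / \<delta>"]) auto
qed

lemma vol_le_lborel:
  assumes c: "c \<in> A" and Q: "compact Q" "Q \<subseteq> img c"
  obtains \<Delta> where "\<Delta> \<ge> 0" "\<forall>u S. u \<in> borel_measurable borel \<longrightarrow> S \<in> sets borel \<longrightarrow> S \<subseteq> Q \<longrightarrow>
    (\<integral>\<^sup>+x\<in>dom c \<inter> snd c -` S. u x \<partial>vol) \<le> ennreal \<Delta> * (\<integral>\<^sup>+y\<in>S. u (chart_inv c y) \<partial>lborel)"
proof -
  obtain \<delta> \<Delta> where \<Delta>: "0 < \<Delta>" "\<And>y. y \<in> Q \<Longrightarrow> dens c y \<le> \<Delta>" using dens_bounds[OF c Q] by metis
  have "(\<integral>\<^sup>+x\<in>dom c \<inter> snd c -` S. u x \<partial>vol) \<le> ennreal \<Delta> * (\<integral>\<^sup>+y\<in>S. u (chart_inv c y) \<partial>lborel)"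
    if u[measurable]: "u \<in> borel_measurable borel" and S: "S \<in> sets borel" "S \<subseteq> Q" for u S
  proof -
    let ?X = "dom c \<inter> snd c -` S"
    have im: "snd c ` ?X = S" using Q S by auto
    have Xb: "?X \<in> sets borel" by (rule borel_chart_preimage[OF c S(1)])
    have m: "(\<lambda>y. u (chart_inv c y) * indicator S y) \<in> borel_measurable borel" using S Q by (intro chart_pullback_measurable[OF c S(1) _ u]) auto
    have "(\<integral>\<^sup>+x\<in>?X. u x \<partial>vol) = (\<integral>\<^sup>+y\<in>S. u (chart_inv c y) * ennreal (dens c y) \<partial>lborel)"
      using nn_integral_vol[OF c Xb _ u] im by simp
    also have "\<dots> \<le> (\<integral>\<^sup>+y. ennreal \<Delta> * (u (chart_inv c y) * indicator S y) \<partial>lborel)"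
    proof (rule nn_integral_mono)
      fix y
      show "u (chart_inv c y) * ennreal (dens c y) * indicator S y \<le> ennreal \<Delta> * (u (chart_inv c y) * indicator S y)"
      proof (cases "y \<in> S")
        case True
        then have "u (chart_inv c y) * ennreal (dens c y) \<le> u (chart_inv c y) * ennreal \<Delta>" using \<Delta>(2) S by (intro mult_left_mono ennreal_leI) auto
        then show ?thesis using True by (simp add: mult.commute)
      qed simp
    qed
    also have "\<dots> = ennreal \<Delta> * (\<integral>\<^sup>+y\<in>S. u (chart_inv c y) \<partial>lborel)"
      using m by (intro nn_integral_cmult) simp
    finally show ?thesis .
  qed
  then show ?thesis using \<Delta>(1) by (intro that[of \<Delta>]) auto
qed

text \<open>The partial derivatives are the pairings of the weak gradient with the coordinate
  fields. Cauchy-Schwarz bounds the sum of their squares by the squared norm of the field times the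
  trace \<open>?t\<close> of the Gram matrix, and \<open>G\<^sup>2\<close> bounds that trace on
  \<open>Q\<close>.\<close>

lemma grad_le_field_norm:
  assumes c: "c \<in> A" and Q: "compact Q" "Q \<subseteq> img c"
  obtains G where "G \<ge> 0" "\<forall>u X. smooth_function A u \<longrightarrow> weak_gradient A g u X \<longrightarrow>
    (AE y in lborel. y \<in> Q \<longrightarrow> norm (grad (\<lambda>y. u (chart_inv c y)) y) \<le> G * field_norm A g X (chart_inv c y))"
proof -
  let ?t = "\<lambda>y. \<Sum>i\<in>UNIV. g c (chart_inv c y) (axis i 1) (axis i 1)"
  have "continuous_on Q ?t" by (intro continuous_on_sum continuous_on_subset[OF metric_continuous[OF c] Q(2)])
  then obtain b where b: "\<And>y. y \<in> Q \<Longrightarrow> \<bar>?t y\<bar> \<le> b"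
    using compact_imp_bounded[OF compact_continuous_image[of Q ?t, OF _ Q(1)]] unfolding bounded_iff real_norm_def by blast
  define G where "G = sqrt (max 0 b)"
  have G: "G \<ge> 0" "\<And>y. y \<in> Q \<Longrightarrow> ?t y \<le> G\<^sup>2" using b by (auto simp: G_def le_max_iff_disj) (metis abs_le_D1)
  show ?thesis
  proof (rule that[OF G(1)], intro allI impI)
    fix u X assume u: "smooth_function A u" and X: "weak_gradient A g u X"
    let ?f = "\<lambda>y. u (chart_inv c y)"
    show "AE y in lborel. y \<in> Q \<longrightarrow> norm (grad ?f y) \<le> G * field_norm A g X (chart_inv c y)"
      using weak_gradient_smooth[OF u X c]
    proof eventually_elim
      case (elim y)
      show ?case
      proof
        assume y: "y \<in> Q"
        let ?x = "chart_inv c y"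
        have yI: "y \<in> img c" using y Q by auto
        have x: "?x \<in> dom c" by (rule chart_facts(7)[OF c yI])
        let ?v = "X c ?x"
        have gv: "g c ?x ?v ?v \<ge> 0" by (rule metric_nonneg[OF c x])
        have "(norm (grad ?f y))\<^sup>2 = (\<Sum>i\<in>UNIV. (grad ?f y $ i)\<^sup>2)" by (simp add: norm_vec_def L2_set_def sum_nonneg)
        also have "\<dots> = (\<Sum>i\<in>UNIV. (g c ?x ?v (axis i 1))\<^sup>2)" using elim yI by simp
        also have "\<dots> \<le> (\<Sum>i\<in>UNIV. g c ?x ?v ?v * g c ?x (axis i 1) (axis i 1))" by (intro sum_mono metric_Cauchy_Schwarz[OF c x])
        also have "\<dots> = g c ?x ?v ?v * ?t y" by (simp add: sum_distrib_left)
        also have "\<dots> \<le> g c ?x ?v ?v * G\<^sup>2" by (intro mult_left_mono G(2)[OF y] gv)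
        also have "\<dots> = (G * field_norm A g X ?x)\<^sup>2"
          using gv by (simp add: field_norm_chart[OF weak_gradient_facts(1)[OF X] c x] power_mult_distrib)
        finally show "norm (grad ?f y) \<le> G * field_norm A g X ?x"
          by (rule power2_le_imp_le) (simp add: G(1) field_norm_nonneg)
      qed
    qed
  qed
qed

lemma chart_integral_bound:
  assumes c: "c \<in> A" and Q: "compact Q" "Q \<subseteq> img c" and p: "p \<ge> 1"
  obtains \<Gamma> where "\<Gamma> \<ge> 0" "\<forall>u X. smooth_function A u \<longrightarrow> weak_gradient A g u X \<longrightarrow> u \<in> borel_measurable borel \<longrightarrow>
    (\<integral>\<^sup>+y\<in>Q. ennreal (\<bar>u (chart_inv c y)\<bar> powr p) \<partial>lborel) \<le> ennreal \<Gamma> * (\<integral>\<^sup>+x. ennreal (\<bar>u x\<bar> powr p) \<partial>vol) \<and>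
    (\<integral>\<^sup>+y\<in>Q. ennreal (norm (grad (\<lambda>y. u (chart_inv c y)) y) powr p) \<partial>lborel) \<le> ennreal \<Gamma> * (\<integral>\<^sup>+x. ennreal (field_norm A g X x powr p) \<partial>vol)"
proof -
  obtain \<Gamma> where \<Gamma>0: "\<Gamma> \<ge> 0" "\<forall>u. u \<in> borel_measurable borel \<longrightarrow> (\<integral>\<^sup>+y\<in>Q. u (chart_inv c y) \<partial>lborel) \<le> ennreal \<Gamma> * (\<integral>\<^sup>+x. u x \<partial>vol)"
    by (rule lborel_le_vol[OF c Q])
  note \<Gamma> = \<Gamma>0(1) \<Gamma>0(2)[rule_format]
  obtain G where G0: "G \<ge> 0" "\<forall>u X. smooth_function A u \<longrightarrow> weak_gradient A g u X \<longrightarrow>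
    (AE y in lborel. y \<in> Q \<longrightarrow> norm (grad (\<lambda>y. u (chart_inv c y)) y) \<le> G * field_norm A g X (chart_inv c y))"
    by (rule grad_le_field_norm[OF c Q])
  note G = G0(1) G0(2)[rule_format]
  have Qb: "Q \<in> sets borel" using Q(1) by (simp add: compact_imp_closed)
  let ?\<Gamma> = "max \<Gamma> (G powr p * \<Gamma>)"
  show ?thesis
  proof (rule that[of ?\<Gamma>], use \<Gamma>(1) in simp, intro conjI allI impI)
    fix u X assume u: "smooth_function A u" and X: "weak_gradient A g u X" and um[measurable]: "u \<in> borel_measurable borel"
    note [measurable] = field_norm_measurable[OF weak_gradient_facts(1)[OF X]]
    have "(\<integral>\<^sup>+y\<in>Q. ennreal (\<bar>u (chart_inv c y)\<bar> powr p) \<partial>lborel) \<le> ennreal \<Gamma> * (\<integral>\<^sup>+x. ennreal (\<bar>u x\<bar> powr p) \<partial>vol)"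
      by (rule \<Gamma>(2)[of "\<lambda>x. ennreal (\<bar>u x\<bar> powr p)"]) measurable
    also have "\<dots> \<le> ennreal ?\<Gamma> * (\<integral>\<^sup>+x. ennreal (\<bar>u x\<bar> powr p) \<partial>vol)" by (intro mult_right_mono ennreal_leI) auto
    finally show "(\<integral>\<^sup>+y\<in>Q. ennreal (\<bar>u (chart_inv c y)\<bar> powr p) \<partial>lborel) \<le> ennreal ?\<Gamma> * (\<integral>\<^sup>+x. ennreal (\<bar>u x\<bar> powr p) \<partial>vol)" .
    have fm: "(\<lambda>x. ennreal (field_norm A g X x powr p)) \<in> borel_measurable borel" by measurable
    have "(\<integral>\<^sup>+y\<in>Q. ennreal (norm (grad (\<lambda>y. u (chart_inv c y)) y) powr p) \<partial>lborel)
      \<le> (\<integral>\<^sup>+y. ennreal (G powr p) * (ennreal (field_norm A g X (chart_inv c y) powr p) * indicator Q y) \<partial>lborel)"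
    proof (rule nn_integral_mono_AE, use G(2)[OF u X] in eventually_elim)
      fix y assume h: "y \<in> Q \<longrightarrow> norm (grad (\<lambda>y. u (chart_inv c y)) y) \<le> G * field_norm A g X (chart_inv c y)"
      show "ennreal (norm (grad (\<lambda>y. u (chart_inv c y)) y) powr p) * indicator Q y \<le> ennreal (G powr p) * (ennreal (field_norm A g X (chart_inv c y) powr p) * indicator Q y)"
      proof (cases "y \<in> Q")
        case True
        then have "norm (grad (\<lambda>y. u (chart_inv c y)) y) powr p \<le> (G * field_norm A g X (chart_inv c y)) powr p"
          using h p by (intro powr_mono2) auto
        also have "\<dots> = G powr p * field_norm A g X (chart_inv c y) powr p" using G(1) field_norm_nonneg by (simp add: powr_mult)
        finally show ?thesis using True by (simp add: ennreal_mult[symmetric] ennreal_leI)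
      qed simp
    qed
    also have "\<dots> = ennreal (G powr p) * (\<integral>\<^sup>+y\<in>Q. ennreal (field_norm A g X (chart_inv c y) powr p) \<partial>lborel)"
      using chart_pullback_measurable[OF c Qb Q(2) fm] by (intro nn_integral_cmult) simp
    also have "\<dots> \<le> ennreal (G powr p) * (ennreal \<Gamma> * (\<integral>\<^sup>+x. ennreal (field_norm A g X x powr p) \<partial>vol))"
      by (intro mult_left_mono \<Gamma>(2)[OF fm]) simp
    also have "\<dots> = ennreal (G powr p * \<Gamma>) * (\<integral>\<^sup>+x. ennreal (field_norm A g X x powr p) \<partial>vol)"
      using \<Gamma>(1) by (simp add: ennreal_mult mult.assoc)
    also have "\<dots> \<le> ennreal ?\<Gamma> * (\<integral>\<^sup>+x. ennreal (field_norm A g X x powr p) \<partial>vol)" by (intro mult_right_mono ennreal_leI) auto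
    finally show "(\<integral>\<^sup>+y\<in>Q. ennreal (norm (grad (\<lambda>y. u (chart_inv c y)) y) powr p) \<partial>lborel) \<le> ennreal ?\<Gamma> * (\<integral>\<^sup>+x. ennreal (field_norm A g X x powr p) \<partial>vol)" .
  qed
qed

end

section \<open>Frames tangent to the leaves\<close>

locale foliated = compact_riemannian A g
  for A :: "('m::{t2_space, second_countable_topology}, 'n::finite) chart set" and g :: "('m, 'n) metric" +
  fixes F :: "'m set set" and S :: "'m set \<Rightarrow> ('m, 'n) submanifold_structure"
  assumes partition: "partition_on UNIV F" and immersed: "\<And>L. L \<in> F \<Longrightarrow> immersed_submanifold A (S L) L"
    and extend: "vectors_extend A F S"
begin

abbreviation leaf :: "'m \<Rightarrow> 'm set" where "leaf \<equiv> leaf_through F"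

lemma leaf_facts: "leaf x \<in> F" "x \<in> leaf x"
proof -
  have "\<exists>!L. L \<in> F \<and> x \<in> L" using partition unfolding partition_on_def disjoint_def by blast
  from theI'[OF this] show "leaf x \<in> F" "x \<in> leaf x" by (auto simp: leaf_through_def)
qed

lemma min_leaf_dim_le: "min_leaf_dim F S \<le> leaf_dim (S (leaf x))"
  unfolding min_leaf_dim_def
proof (rule Min_le)
  have "range (\<lambda>x. leaf_dim (S (leaf x))) \<subseteq> {..CARD('n)}"
    by (auto simp: leaf_dim_def dim_subset_UNIV_cart)
  then show "finite (range (\<lambda>x. leaf_dim (S (leaf x))))" by (rule finite_subset) simp
qed simp

text \<open>Along a line in the model space the function is constant, so its derivative along the image of the line vanishes.\<close>

lemma basic_derivative_zero:
  assumes v: "v \<in> smooth_basic_functions A F" and c: "c \<in> A" "x \<in> dom c" and w: "w \<in> leaf_tangent (S (leaf x)) c x"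
  shows "grad (\<lambda>y. v (chart_inv c y)) (snd c x) \<bullet> w = 0"
proof -
  obtain V P where SVP: "S (leaf x) = (V, P)" by fastforce
  obtain f' v0 D \<sigma> u where w': "w = f' v0" "(D, \<sigma>) \<in> P" "u \<in> D" "\<sigma> u = x" "v0 \<in> V" and
    der: "(snd c \<circ> \<sigma> has_derivative f') (at u within D)"
    using w unfolding leaf_tangent_def SVP by auto
  have im: "immersed_submanifold A (V, P) (leaf x)" using immersed[OF leaf_facts(1)] SVP by metis
  have V: "subspace V" using im by (simp add: immersed_submanifold_def)
  have D: "openin (top_of_set V) D" "continuous_on D \<sigma>" using im w'(2) by (auto simp: immersed_submanifold_def)
  have \<sigma>L: "\<sigma> y \<in> leaf x" if "y \<in> D" for y
  proof -
    have "(\<Union>(D, \<sigma>)\<in>P. \<sigma> ` D) = leaf x" using im by (simp add: immersed_submanifold_def)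
    then show ?thesis using w'(2) that by blast
  qed
  have "openin (top_of_set D) (D \<inter> \<sigma> -` dom c)"
    by (rule continuous_openin_preimage_gen[OF D(2) chart_facts(1)[OF c(1)]])
  then have "openin (top_of_set V) (D \<inter> \<sigma> -` dom c)" using D(1) openin_trans by blast
  then obtain T where T: "open T" "D \<inter> \<sigma> -` dom c = V \<inter> T" by (auto simp: openin_open)
  \<comment> \<open>The times at which the line through \<open>u\<close> in direction
    \<open>v0\<close> stays in the parameter domain and over the chart: an open set, because
    \<open>D\<close> is relatively open in the linear space \<open>V\<close> and \<open>v0\<close>
    lies in \<open>V\<close>.\<close>
  define I where "I = (\<lambda>t::real. u + t *\<^sub>R v0) -` T"
  have uT: "u \<in> V" "u \<in> T" using T(2) w' c(2) by auto
  have I: "open I" "0 \<in> I"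
    unfolding I_def using uT by (auto intro!: open_vimage T(1) continuous_intros)
  have ID: "u + t *\<^sub>R v0 \<in> D" "\<sigma> (u + t *\<^sub>R v0) \<in> dom c" if "t \<in> I" for t
  proof -
    have "u + t *\<^sub>R v0 \<in> V \<inter> T" using that uT w'(5) V by (auto simp: I_def intro!: subspace_add subspace_scale)
    then show "u + t *\<^sub>R v0 \<in> D" "\<sigma> (u + t *\<^sub>R v0) \<in> dom c" using T(2) by auto
  qed
  let ?f = "\<lambda>y. v (chart_inv c y)" and ?\<gamma> = "\<lambda>t::real. u + t *\<^sub>R v0"
  have "C_on (Suc 0) (img c) ?f" using v c by (intro smooth_function_C_on) (auto simp: smooth_basic_functions_def)
  then have df: "(?f has_derivative (\<lambda>w. grad ?f (snd c x) \<bullet> w)) (at (snd c x))"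
    by (rule has_derivative_grad) (use c in auto)
  have d1: "(?\<gamma> has_derivative (\<lambda>h. h *\<^sub>R v0)) (at 0 within I)" by (auto intro!: derivative_eq_intros)
  have "(snd c \<circ> \<sigma> has_derivative f') (at (?\<gamma> 0) within ?\<gamma> ` I)"
    using has_derivative_subset[OF der, of "?\<gamma> ` I"] ID by auto
  from has_derivative_in_compose[OF d1 this]
  have "((\<lambda>t. (snd c \<circ> \<sigma>) (?\<gamma> t)) has_derivative (\<lambda>h. f' (h *\<^sub>R v0))) (at 0 within I)" .
  then have d2: "((\<lambda>t. (snd c \<circ> \<sigma>) (?\<gamma> t)) has_derivative (\<lambda>h. f' (h *\<^sub>R v0))) (at 0)"
    by (simp add: at_within_open[OF I(2,1)])
  have df': "(?f has_derivative (\<lambda>w. grad ?f (snd c x) \<bullet> w)) (at ((snd c \<circ> \<sigma>) (?\<gamma> 0)))" using df w'(4) by simp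
  have d3: "((\<lambda>t. ?f ((snd c \<circ> \<sigma>) (?\<gamma> t))) has_derivative (\<lambda>h. grad ?f (snd c x) \<bullet> f' (h *\<^sub>R v0))) (at 0)"
    by (rule has_derivative_compose[where g="?f" and f="\<lambda>t. (snd c \<circ> \<sigma>) (?\<gamma> t)" and f'="\<lambda>h. f' (h *\<^sub>R v0)" and g'="\<lambda>w. grad ?f (snd c x) \<bullet> w", OF d2 df'])
  have const: "?f ((snd c \<circ> \<sigma>) (?\<gamma> t)) = v x" if "t \<in> I" for t
  proof -
    have "?f ((snd c \<circ> \<sigma>) (?\<gamma> t)) = v (\<sigma> (?\<gamma> t))" using chart_facts(5)[OF c(1) ID(2)[OF that]] by simp
    also have "\<dots> = v x" using v \<sigma>L[OF ID(1)[OF that]] leaf_facts[of x] unfolding smooth_basic_functions_def by blast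
    finally show ?thesis .
  qed
  have "((\<lambda>t. v x) has_derivative (\<lambda>h. grad ?f (snd c x) \<bullet> f' (h *\<^sub>R v0))) (at 0)"
    by (rule has_derivative_transform_within_open[OF d3 I(1,2) const])
  from has_derivative_unique[OF this has_derivative_const] have "grad ?f (snd c x) \<bullet> f' (1 *\<^sub>R v0) = 0" by metis
  then show ?thesis using w'(1) by simp
qed

text \<open>The derivative of an immersion maps a basis of the model space to independent tangent
  vectors. Where the leaf has larger dimension only \<open>min_leaf_dim F S\<close> of them are
  kept, so that the number of eliminated derivatives is the same at all points.\<close>

lemma independent_tangent_vectors:
  assumes c: "c \<in> A" "x \<in> dom c"
  obtains I where "independent I" "I \<subseteq> leaf_tangent (S (leaf x)) c x" "card I = min_leaf_dim F S" "finite I"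
proof -
  obtain V P where SVP: "S (leaf x) = (V, P)" by fastforce
  have im: "immersed_submanifold A (V, P) (leaf x)" using immersed[OF leaf_facts(1)] SVP by metis
  have V: "subspace V" using im by (simp add: immersed_submanifold_def)
  have "(\<Union>(D, \<sigma>)\<in>P. \<sigma> ` D) = leaf x" using im by (simp add: immersed_submanifold_def)
  then have "x \<in> (\<Union>z\<in>P. snd z ` fst z)" using leaf_facts(2)[of x] by (simp add: case_prod_unfold)
  then obtain z u where "z \<in> P" "u \<in> fst z" "snd z u = x" by blast
  then obtain D \<sigma> where D: "(D, \<sigma>) \<in> P" "u \<in> D" "\<sigma> u = x" by (metis prod.collapse)
  have "\<exists>f'. (snd c \<circ> \<sigma> has_derivative f') (at u within D) \<and> inj_on f' V"
    using im D c unfolding immersed_submanifold_def by fastforce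
  then obtain f' where f': "(snd c \<circ> \<sigma> has_derivative f') (at u within D)" "inj_on f' V" by blast
  have lin: "linear f'" using f'(1) has_derivative_linear by blast
  obtain b where b: "b \<subseteq> V" "independent b" "V \<subseteq> span b" "card b = dim V" using basis_exists by blast
  have fb: "finite b" using b(2) independent_imp_finite by blast
  have "min_leaf_dim F S \<le> card b" using min_leaf_dim_le[of x] b(4) SVP by (simp add: leaf_dim_def)
  then obtain b' where b': "b' \<subseteq> b" "card b' = min_leaf_dim F S" using obtain_subset_with_card_n by metis
  have spanb': "span b' \<subseteq> V" using b(1) b'(1) V by (intro span_minimal) auto
  have ind: "independent b'" using b(2) b'(1) independent_mono by blast
  have inj: "inj_on f' (span b')" using f'(2) spanb' inj_on_subset by blast
  have "independent (f' ` b')" by (rule linear_independent_injective_image[OF lin ind inj])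
  moreover have "f' ` b' \<subseteq> leaf_tangent (S (leaf x)) c x"
  proof
    fix w assume "w \<in> f' ` b'"
    then obtain v0 where "v0 \<in> V" "w = f' v0" using b'(1) b(1) by blast
    then have "w = f' v0 \<and> (D, \<sigma>) \<in> snd (S (leaf x)) \<and> u \<in> D \<and> \<sigma> u = x \<and> v0 \<in> fst (S (leaf x)) \<and>
      (snd c \<circ> \<sigma> has_derivative f') (at u within D)" using D f'(1) by (simp add: SVP)
    then show "w \<in> leaf_tangent (S (leaf x)) c x" unfolding leaf_tangent_def by blast
  qed
  moreover have "card (f' ` b') = min_leaf_dim F S"
    using inj b'(2) by (metis card_image inj_on_subset span_superset)
  moreover have "finite (f' ` b')" using fb b'(1) finite_subset by blast
  ultimately show ?thesis by (rule that)
qed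

text \<open>Steinitz exchange: \<open>I\<close> is completed to a basis by coordinate axes.
  \<open>J\<close> consists of the indices whose axes were not added, and \<open>\<tau>\<close>
  assigns the vectors of \<open>I\<close> to them, so that the matrix of the new basis has one
  column for each coordinate index.\<close>

lemma complement_by_axes:
  fixes I :: "(real ^ 'n) set"
  assumes I: "independent I" "finite I"
  obtains J :: "'n set" and \<tau> where "card J = card I" "\<tau> ` J = I"
    "det (\<chi> i j. (if j \<in> J then \<tau> j else axis j 1) $ i) \<noteq> 0"
proof -
  let ?ax = "\<lambda>i::'n. axis i 1 :: real ^ 'n"
  obtain B where B: "I \<subseteq> B" "B \<subseteq> I \<union> range ?ax" "independent B" "I \<union> range ?ax \<subseteq> span B"
    using maximal_independent_subset_extend[of I "I \<union> range ?ax"] I(1) by auto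
  have "Basis = range ?ax" by (auto simp: Basis_vec_def)
  then have spB: "span B = UNIV" using B(4) span_Basis span_mono[of "range ?ax" "span B"] by (auto simp: span_span)
  have fB: "finite B" using B(3) independent_imp_finite by blast
  have cB: "card B = CARD('n)" using dim_eq_card[of B UNIV] B(3) spB by (simp add: dim_UNIV)
  define K where "K = {k. ?ax k \<in> B - I}"
  have inj: "inj ?ax" by (auto simp: inj_def axis_eq_axis)
  have BK: "B - I = ?ax ` K" using B(2) by (auto simp: K_def)
  have "card K = card (B - I)" unfolding BK by (simp add: card_image inj_on_subset[OF inj])
  also have "\<dots> = CARD('n) - card I" using B(1) I(2) cB by (simp add: card_Diff_subset)
  finally have "card (- K) = card I"
    using card_mono[OF fB B(1)] cB by (simp add: Compl_eq_Diff_UNIV card_Diff_subset)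
  then obtain \<tau> where \<tau>: "bij_betw \<tau> (- K) I" using I(2) finite_same_card_bij[of "-K" I] by auto
  let ?N = "\<chi> i j. (if j \<in> - K then \<tau> j else axis j 1) $ i :: real ^ 'n ^ 'n"
  have col: "column j ?N = (if j \<in> - K then \<tau> j else ?ax j)" for j
    by (simp add: column_def vec_eq_iff)
  have "columns ?N = B"
  proof -
    have "columns ?N = \<tau> ` (- K) \<union> ?ax ` K" unfolding columns_def col by auto
    also have "\<dots> = B" using \<tau> BK B(1) by (auto simp: bij_betw_def)
    finally show ?thesis .
  qed
  then have "invertible ?N"
    using spB by (simp add: invertible_right_inverse matrix_right_invertible_span_columns span_vec_eq)
  then have "det ?N \<noteq> 0" by (simp add: invertible_det_nz)
  then show ?thesis using that[of "- K" \<tau>] \<tau> \<open>card (- K) = card I\<close> by (simp add: bij_betw_def)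
qed

lemma C_on_det:
  fixes M :: "real ^ 'n \<Rightarrow> real ^ 'n ^ 'n"
  assumes "open \<Omega>" "\<And>i j. C_on k \<Omega> (\<lambda>y. M y $ i $ j)"
  shows "C_on k \<Omega> (\<lambda>y. det (M y))"
  unfolding det_def by (intro C_on_sum C_on_mult C_on_const C_on_prod assms)

text \<open>Near a point the leaves contain the span of a frame \<open>X j\<close>, \<open>j \<in> J\<close>, that together with the axes outside \<open>J\<close> is a frame
  of the whole space; Cramer's rule expresses the remaining partial derivatives of a basic function.\<close>

lemma leaf_frame:
  assumes c: "c \<in> A" "x \<in> dom c"
  obtains \<Omega> J B where "open \<Omega>" "snd c x \<in> \<Omega>" "\<Omega> \<subseteq> img c" "card (J :: 'n set) = min_leaf_dim F S"
    "\<forall>k j. C_on 1 \<Omega> (B k j)"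
    "\<forall>v y j. v \<in> smooth_basic_functions A F \<longrightarrow> y \<in> \<Omega> \<longrightarrow> j \<in> J \<longrightarrow>
      grad (\<lambda>y. v (chart_inv c y)) y $ j = (\<Sum>k\<in>- J. B k j y * grad (\<lambda>y. v (chart_inv c y)) y $ k)"
proof -
  obtain I where I: "independent I" "I \<subseteq> leaf_tangent (S (leaf x)) c x" "card I = min_leaf_dim F S" "finite I"
    by (rule independent_tangent_vectors[OF c])
  obtain J :: "'n set" and \<tau> where J: "card J = card I" "\<tau> ` J = I"
    "det (\<chi> i j. (if j \<in> J then \<tau> j else axis j 1) $ i :: real ^ 'n ^ 'n) \<noteq> 0"
    by (rule complement_by_axes[OF I(1,4)])
  have "\<exists>W X. open W \<and> x \<in> W \<and> W \<subseteq> dom c \<and> smooth_on (snd c ` W) (X \<circ> chart_inv c) \<and> X x = \<tau> j \<and>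
          (\<forall>y\<in>W. X y \<in> leaf_tangent (S (leaf y)) c y)" if "j \<in> J" for j
    using extend c I(2) J(2) that unfolding vectors_extend_def by blast
  then obtain W X where WX: "\<And>j. j \<in> J \<Longrightarrow> open (W j) \<and> x \<in> W j \<and> W j \<subseteq> dom c \<and> smooth_on (snd c ` W j) (X j \<circ> chart_inv c) \<and> X j x = \<tau> j \<and>
          (\<forall>y\<in>W j. X j y \<in> leaf_tangent (S (leaf y)) c y)" by metis
  define W0 where "W0 = dom c \<inter> (\<Inter>j\<in>J. W j)"
  have W0: "open W0" "x \<in> W0" "W0 \<subseteq> dom c" unfolding W0_def using WX c chart_facts(1)[OF c(1)] by (auto intro!: open_Int open_INT)
  define \<Omega>0 where "\<Omega>0 = snd c ` W0"
  have \<Omega>0: "open \<Omega>0" unfolding \<Omega>0_def by (rule open_chart_image[OF c(1) W0(1,3)])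
  \<comment> \<open>At \<open>snd c x\<close> this is the invertible matrix from
    \<open>complement_by_axes\<close>. Nearby, the columns with index in \<open>J\<close> are the
    extended fields, tangent to the leaf through the respective point.\<close>
  define N where "N y = (\<chi> i j. (if j \<in> J then X j (chart_inv c y) else axis j 1) $ i :: real ^ 'n ^ 'n)" for y
  have CN: "C_on 1 \<Omega>0 (\<lambda>y. N y $ i $ j)" for i j
  proof (cases "j \<in> J")
    case True
    have sub: "\<Omega>0 \<subseteq> snd c ` W j" using True by (auto simp: \<Omega>0_def W0_def)
    have "open (snd c ` W j)" using WX[OF True] by (intro open_chart_image[OF c(1)]) auto
    then have "C_on 1 (snd c ` W j) (X j \<circ> chart_inv c)" using WX[OF True] smooth_on_open by blast
    then have "C_on 1 \<Omega>0 (X j \<circ> chart_inv c)" using sub by (rule C_on_subset)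
    then have "C_on 1 \<Omega>0 (\<lambda>y. (X j \<circ> chart_inv c) y $ i)" by (rule C_on_bounded_linear_compose[OF bounded_linear_vec_nth \<Omega>0])
    then show ?thesis using True by (simp add: N_def o_def)
  next
    case False
    then show ?thesis using C_on_const[OF \<Omega>0, of 1 "axis j (1::real) $ i"] by (simp add: N_def)
  qed
  have Cdet: "C_on 1 \<Omega>0 (\<lambda>y. det (N y))" by (rule C_on_det[OF \<Omega>0 CN])
  \<comment> \<open>Invertibility is an open condition. Leaves through nearby points may have a
    different dimension from that of the leaf through \<open>x\<close>, but their tangent spaces
    contain the span of the fields.\<close>
  define \<Omega> where "\<Omega> = \<Omega>0 \<inter> (\<lambda>y. det (N y)) -` (- {0})"
  have \<Omega>: "open \<Omega>" "\<Omega> \<subseteq> \<Omega>0"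
    unfolding \<Omega>_def by (rule continuous_open_preimage[OF C_on_imp_continuous_on[OF Cdet] \<Omega>0]) auto
  have x\<Omega>: "snd c x \<in> \<Omega>"
  proof -
    have "N (snd c x) = (\<chi> i j. (if j \<in> J then \<tau> j else axis j 1) $ i)"
      using WX chart_facts(5)[OF c] by (auto simp: N_def vec_eq_iff)
    then show ?thesis using J(3) W0(2) by (auto simp: \<Omega>_def \<Omega>0_def)
  qed
  \<comment> \<open>The coordinates of the \<open>j\<close>-th axis with respect to the frame. Being
    quotients of determinants they inherit the regularity of the fields, and they do not depend on
    the function to be differentiated.\<close>
  define B where "B k j y = det (\<chi> a b. if b = k then axis j 1 $ a else N y $ a $ b) / det (N y)" for k j y
  have CB: "C_on 1 \<Omega> (B k j)" for k j
  proof -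
    have "C_on 1 \<Omega>0 (\<lambda>y. (\<chi> a b. if b = k then axis j 1 $ a else N y $ a $ b) $ i $ l)" for i l
      using CN[of i l] C_on_const[OF \<Omega>0, of 1 "axis j (1::real) $ i"] by (cases "l = k") auto
    from C_on_det[OF \<Omega>0 this] have "C_on 1 \<Omega> (\<lambda>y. det (\<chi> a b. if b = k then axis j 1 $ a else N y $ a $ b))"
      using \<Omega>(2) by (rule C_on_subset)
    moreover have "C_on 1 \<Omega> (\<lambda>y. inverse (det (N y)))"
      by (rule C_on_inverse[OF \<Omega>(1) _ C_on_subset[OF Cdet \<Omega>(2)]]) (auto simp: \<Omega>_def)
    ultimately show ?thesis unfolding B_def divide_inverse by (rule C_on_mult[OF \<Omega>(1)])
  qed
  have eq: "grad (\<lambda>y. v (chart_inv c y)) y $ j = (\<Sum>k\<in>- J. B k j y * grad (\<lambda>y. v (chart_inv c y)) y $ k)"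
    if v: "v \<in> smooth_basic_functions A F" and y: "y \<in> \<Omega>" for v y j
  proof -
    let ?G = "grad (\<lambda>y. v (chart_inv c y)) y"
    obtain x' where x': "x' \<in> W0" "y = snd c x'" using y \<Omega>(2) by (auto simp: \<Omega>0_def)
    have cx': "chart_inv c y = x'" using x' W0(3) chart_facts(5)[OF c(1)] by auto
    have colJ: "?G \<bullet> column k (N y) = 0" if k: "k \<in> J" for k
    proof -
      have "column k (N y) = X k x'" using k by (simp add: column_def N_def cx' vec_eq_iff)
      moreover have "X k x' \<in> leaf_tangent (S (leaf x')) c x'" using WX[OF k] x'(1) k by (auto simp: W0_def)
      ultimately show ?thesis using basic_derivative_zero[OF v c(1), of x' "X k x'"] x' W0(3) by auto
    qed
    have colK: "?G \<bullet> column k (N y) = ?G $ k" if k: "k \<in> - J" for k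
    proof -
      have "column k (N y) = axis k 1" using k by (simp add: column_def N_def vec_eq_iff)
      then show ?thesis by (simp add: inner_axis)
    qed
    have "det (N y) \<noteq> 0" using y by (auto simp: \<Omega>_def)
    then have "N y *v (\<chi> k. B k j y) = axis j 1" by (subst cramer) (auto simp: B_def)
    \<comment> \<open>The expansion of the \<open>j\<close>-th axis in the frame is paired with the
      gradient: the fields give 0, and the axes outside \<open>J\<close> give partial
      derivatives.\<close>
    then have "?G $ j = ?G \<bullet> (N y *v (\<chi> k. B k j y))" by (simp add: inner_axis)
    also have "N y *v (\<chi> k. B k j y) = (\<Sum>k\<in>UNIV. B k j y *s column k (N y))"
      by (simp add: matrix_mult_sum)
    also have "?G \<bullet> \<dots> = (\<Sum>k\<in>UNIV. B k j y * (?G \<bullet> column k (N y)))"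
      by (simp add: inner_sum_right scalar_mult_eq_scaleR)
    also have "\<dots> = (\<Sum>k\<in>UNIV. if k \<in> - J then B k j y * ?G $ k else 0)"
      using colJ colK by (intro sum.cong) auto
    also have "\<dots> = (\<Sum>k\<in>- J. B k j y * ?G $ k)" by (subst sum.inter_filter[symmetric]) (auto intro: sum.cong)
    finally show ?thesis .
  qed
  show ?thesis
  proof (rule that[OF \<Omega>(1) x\<Omega>])
    show "\<Omega> \<subseteq> img c" using \<Omega>(2) W0(3) by (auto simp: \<Omega>0_def)
    show "card J = min_leaf_dim F S" using J(1) I(3) by simp
    show "\<forall>k j. C_on 1 \<Omega> (B k j)" using CB by blast
    show "\<forall>v y j. v \<in> smooth_basic_functions A F \<longrightarrow> y \<in> \<Omega> \<longrightarrow> j \<in> J \<longrightarrow>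
      grad (\<lambda>y. v (chart_inv c y)) y $ j = (\<Sum>k\<in>- J. B k j y * grad (\<lambda>y. v (chart_inv c y)) y $ k)"
      using eq by blast
  qed
qed

lemma basic_local_estimate:
  fixes x :: 'm
  assumes p: "1 \<le> p" "p \<le> q" and pq: "real (CARD('n) - min_leaf_dim F S) * (q / p - 1) < q"
  shows "\<exists>N C. open N \<and> x \<in> N \<and> (\<forall>v X. v \<in> smooth_basic_functions A F \<longrightarrow> weak_gradient A g v X \<longrightarrow> v \<in> borel_measurable borel \<longrightarrow>
    (\<integral>\<^sup>+x. ennreal (\<bar>v x\<bar> powr p) \<partial>vol) \<le> 1 \<longrightarrow> (\<integral>\<^sup>+x. ennreal (field_norm A g X x powr p) \<partial>vol) \<le> 1 \<longrightarrow>
    (\<integral>\<^sup>+x\<in>N. ennreal (\<bar>v x\<bar> powr q) \<partial>vol) \<le> ennreal C)"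
proof -
  obtain c where c: "c \<in> A" "x \<in> dom c" using charts_cover by blast
  obtain \<Omega> J B where \<Omega>: "open \<Omega>" "snd c x \<in> \<Omega>" "\<Omega> \<subseteq> img c" and J: "card (J :: 'n set) = min_leaf_dim F S"
    and B0: "\<forall>k j. C_on 1 \<Omega> (B k j)" and eq0: "\<forall>v y j. v \<in> smooth_basic_functions A F \<longrightarrow> y \<in> \<Omega> \<longrightarrow> j \<in> J \<longrightarrow>
      grad (\<lambda>y. v (chart_inv c y)) y $ j = (\<Sum>k\<in>- J. B k j y * grad (\<lambda>y. v (chart_inv c y)) y $ k)"
    by (rule leaf_frame[OF c])
  note B = B0[rule_format] and eq = eq0[rule_format]
  obtain h where h: "h > 0" "cbox (snd c x - (\<chi> i. h)) (snd c x + (\<chi> i. h)) \<subseteq> \<Omega>"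
    by (rule chart_neighbourhood[OF c \<Omega>])
  interpret L: leaf_chart \<Omega> "snd c x" h J B
    by unfold_locales (use \<Omega> h B in auto)
  have cJ: "card (- J) = CARD('n) - min_leaf_dim F S" using J by (simp add: Compl_eq_Diff_UNIV card_Diff_subset)
  obtain S' where S': "open S'" "snd c x \<in> S'" "S' \<subseteq> L.Q" and est: "\<And>N. \<exists>C. \<forall>f. L.leafwise_constant f \<longrightarrow>
    (LINT z:L.Q|lborel. \<bar>f z\<bar> powr p) \<le> N \<longrightarrow> (LINT z:L.Q|lborel. norm (grad f z) powr p) \<le> N \<longrightarrow>
    (\<integral>\<^sup>+z\<in>S'. ennreal (\<bar>f z\<bar> powr q) \<partial>lborel) \<le> ennreal C"
    using L.local_estimate[OF p] pq cJ by auto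
  have QI: "L.Q \<subseteq> img c" using L.Q_props(3) \<Omega>(3) by auto
  obtain \<Gamma> where \<Gamma>0: "\<Gamma> \<ge> 0" "\<forall>u X. smooth_function A u \<longrightarrow> weak_gradient A g u X \<longrightarrow> u \<in> borel_measurable borel \<longrightarrow>
    (\<integral>\<^sup>+y\<in>L.Q. ennreal (\<bar>u (chart_inv c y)\<bar> powr p) \<partial>lborel) \<le> ennreal \<Gamma> * (\<integral>\<^sup>+x. ennreal (\<bar>u x\<bar> powr p) \<partial>vol) \<and>
    (\<integral>\<^sup>+y\<in>L.Q. ennreal (norm (grad (\<lambda>y. u (chart_inv c y)) y) powr p) \<partial>lborel) \<le> ennreal \<Gamma> * (\<integral>\<^sup>+x. ennreal (field_norm A g X x powr p) \<partial>vol)"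
    by (rule chart_integral_bound[OF c(1) L.Q_props(1) QI p(1)])
  note \<Gamma> = \<Gamma>0(1) \<Gamma>0(2)[rule_format]
  obtain \<Delta> where \<Delta>0: "\<Delta> \<ge> 0" "\<forall>u S. u \<in> borel_measurable borel \<longrightarrow> S \<in> sets borel \<longrightarrow> S \<subseteq> L.Q \<longrightarrow>
    (\<integral>\<^sup>+x\<in>dom c \<inter> snd c -` S. u x \<partial>vol) \<le> ennreal \<Delta> * (\<integral>\<^sup>+y\<in>S. u (chart_inv c y) \<partial>lborel)"
    by (rule vol_le_lborel[OF c(1) L.Q_props(1) QI])
  note \<Delta> = \<Delta>0(1) \<Delta>0(2)[rule_format]
  \<comment> \<open>Energies at most 1 on the manifold become energies at most
    \<open>\<Gamma>\<close> on the cube, so the local estimate is used with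
    \<open>N = \<Gamma>\<close>.\<close>
  obtain C where C: "\<And>f. L.leafwise_constant f \<Longrightarrow>
    (LINT z:L.Q|lborel. \<bar>f z\<bar> powr p) \<le> \<Gamma> \<Longrightarrow> (LINT z:L.Q|lborel. norm (grad f z) powr p) \<le> \<Gamma> \<Longrightarrow>
    (\<integral>\<^sup>+z\<in>S'. ennreal (\<bar>f z\<bar> powr q) \<partial>lborel) \<le> ennreal C" using est[of \<Gamma>] by blast
  let ?N = "dom c \<inter> snd c -` S'"
  have "open ?N" by (rule open_chart_preimage[OF c(1) S'(1)])
  moreover have "x \<in> ?N" using c S' by auto
  moreover have "\<forall>v X. v \<in> smooth_basic_functions A F \<longrightarrow> weak_gradient A g v X \<longrightarrow> v \<in> borel_measurable borel \<longrightarrow>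
    (\<integral>\<^sup>+x. ennreal (\<bar>v x\<bar> powr p) \<partial>vol) \<le> 1 \<longrightarrow> (\<integral>\<^sup>+x. ennreal (field_norm A g X x powr p) \<partial>vol) \<le> 1 \<longrightarrow>
    (\<integral>\<^sup>+x\<in>?N. ennreal (\<bar>v x\<bar> powr q) \<partial>vol) \<le> ennreal (\<Delta> * C)"
  proof (intro allI impI)
    fix v X
    assume v: "v \<in> smooth_basic_functions A F" and X: "weak_gradient A g v X" and vm[measurable]: "v \<in> borel_measurable borel"
      and 1: "(\<integral>\<^sup>+x. ennreal (\<bar>v x\<bar> powr p) \<partial>vol) \<le> 1" "(\<integral>\<^sup>+x. ennreal (field_norm A g X x powr p) \<partial>vol) \<le> 1"
    let ?f = "\<lambda>y. v (chart_inv c y)"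
    have sv: "smooth_function A v" using v by (simp add: smooth_basic_functions_def)
    have C2: "C_on 2 \<Omega> ?f" by (rule C_on_subset[OF smooth_function_C_on[OF sv c(1)] \<Omega>(3)])
    have lc: "L.leafwise_constant ?f" unfolding L.leafwise_constant_def using C2 eq[OF v] by simp
    have C1: "C_on (Suc 0) \<Omega> ?f" by (rule C_on_mono[OF C2]) simp
    have cf: "continuous_on L.Q ?f" by (rule continuous_on_subset[OF C_on_imp_continuous_on[OF C1] L.Q_props(3)])
    have cg: "continuous_on L.Q (grad ?f)" by (rule continuous_on_subset[OF continuous_on_grad[OF C1] L.Q_props(3)])
    have G1: "ennreal (LINT z:L.Q|lborel. \<bar>?f z\<bar> powr p) \<le> ennreal \<Gamma>"
    proof -
      have "ennreal (LINT z:L.Q|lborel. \<bar>?f z\<bar> powr p) = (\<integral>\<^sup>+z\<in>L.Q. ennreal (\<bar>?f z\<bar> powr p) \<partial>lborel)"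
        using p by (intro nn_set_integral_eq_set_integral[symmetric] L.Q_props continuous_on_powr' continuous_intros cf) auto
      also have "\<dots> \<le> ennreal \<Gamma> * (\<integral>\<^sup>+x. ennreal (\<bar>v x\<bar> powr p) \<partial>vol)" using \<Gamma>(2)[OF sv X vm] by blast
      also have "\<dots> \<le> ennreal \<Gamma> * 1" by (intro mult_left_mono 1) simp
      finally show ?thesis by simp
    qed
    have G2: "ennreal (LINT z:L.Q|lborel. norm (grad ?f z) powr p) \<le> ennreal \<Gamma>"
    proof -
      have "ennreal (LINT z:L.Q|lborel. norm (grad ?f z) powr p) = (\<integral>\<^sup>+z\<in>L.Q. ennreal (norm (grad ?f z) powr p) \<partial>lborel)"
        using p by (intro nn_set_integral_eq_set_integral[symmetric] L.Q_props continuous_on_powr' continuous_on_norm continuous_intros cg) auto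
      also have "\<dots> \<le> ennreal \<Gamma> * (\<integral>\<^sup>+x. ennreal (field_norm A g X x powr p) \<partial>vol)" using \<Gamma>(2)[OF sv X vm] by blast
      also have "\<dots> \<le> ennreal \<Gamma> * 1" by (intro mult_left_mono 1) simp
      finally show ?thesis by simp
    qed
    have "(\<integral>\<^sup>+x\<in>?N. ennreal (\<bar>v x\<bar> powr q) \<partial>vol) \<le> ennreal \<Delta> * (\<integral>\<^sup>+y\<in>S'. ennreal (\<bar>?f y\<bar> powr q) \<partial>lborel)"
      by (rule \<Delta>(2)[of "\<lambda>x. ennreal (\<bar>v x\<bar> powr q)"]) (use S' in measurable)
    also have "\<dots> \<le> ennreal \<Delta> * ennreal C"
      using G1 G2 \<Gamma>(1) by (intro mult_left_mono C lc) (auto simp: ennreal_le_iff)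
    finally show "(\<integral>\<^sup>+x\<in>?N. ennreal (\<bar>v x\<bar> powr q) \<partial>vol) \<le> ennreal (\<Delta> * C)" using \<Delta>(1) by (simp add: ennreal_mult')
  qed
  ultimately show ?thesis by (intro exI[of _ ?N] exI[of _ "\<Delta> * C"] conjI)
qed

text \<open>The neighbourhoods in \<open>basic_local_estimate\<close> do not depend on the function,
  so finitely many of them cover the compact manifold, and the absolute values of their constants
  add up.\<close>

lemma basic_estimate:
  assumes p: "1 \<le> p" "p \<le> q" and pq: "real (CARD('n) - min_leaf_dim F S) * (q / p - 1) < q"
  obtains C where "C \<ge> 0" "\<forall>v X. v \<in> smooth_basic_functions A F \<longrightarrow> weak_gradient A g v X \<longrightarrow> v \<in> borel_measurable borel \<longrightarrow>
    (\<integral>\<^sup>+x. ennreal (\<bar>v x\<bar> powr p) \<partial>vol) \<le> 1 \<longrightarrow> (\<integral>\<^sup>+x. ennreal (field_norm A g X x powr p) \<partial>vol) \<le> 1 \<longrightarrow>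
    (\<integral>\<^sup>+x. ennreal (\<bar>v x\<bar> powr q) \<partial>vol) \<le> ennreal C"
proof -
  define P where "P N C \<longleftrightarrow> (\<forall>v X. v \<in> smooth_basic_functions A F \<longrightarrow> weak_gradient A g v X \<longrightarrow> v \<in> borel_measurable borel \<longrightarrow>
    (\<integral>\<^sup>+x. ennreal (\<bar>v x\<bar> powr p) \<partial>vol) \<le> 1 \<longrightarrow> (\<integral>\<^sup>+x. ennreal (field_norm A g X x powr p) \<partial>vol) \<le> 1 \<longrightarrow>
    (\<integral>\<^sup>+y\<in>N. ennreal (\<bar>v y\<bar> powr q) \<partial>vol) \<le> ennreal C)" for N C
  have "\<forall>x. \<exists>N C. open N \<and> x \<in> N \<and> P N C" unfolding P_def by (intro allI basic_local_estimate[OF assms])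
  then obtain N C where NC: "\<And>x. open (N x) \<and> x \<in> N x \<and> P (N x) (C x)" by metis
  then have N: "\<And>x. open (N x)" "\<And>x. x \<in> N x" and "\<And>x. P (N x) (C x)" by blast+
  note C = this(3)[unfolded P_def, rule_format]
  obtain I where I: "finite I" "UNIV \<subseteq> (\<Union>x\<in>I. N x)"
    by (rule compactE_image[OF compact_M, of UNIV N]) (use N in auto)
  show ?thesis
  proof (rule that[of "\<Sum>x\<in>I. \<bar>C x\<bar>"], use sum_nonneg[of I "\<lambda>x. \<bar>C x\<bar>"] in simp, intro allI impI)
    fix v X assume h: "v \<in> smooth_basic_functions A F" "weak_gradient A g v X" "v \<in> borel_measurable borel"
      "(\<integral>\<^sup>+x. ennreal (\<bar>v x\<bar> powr p) \<partial>vol) \<le> 1" "(\<integral>\<^sup>+x. ennreal (field_norm A g X x powr p) \<partial>vol) \<le> 1"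
    note [measurable] = h(3)
    have [measurable]: "N x \<in> sets borel" for x using N(1) by simp
    have "(\<integral>\<^sup>+x. ennreal (\<bar>v x\<bar> powr q) \<partial>vol) \<le> (\<integral>\<^sup>+y. (\<Sum>x\<in>I. ennreal (\<bar>v y\<bar> powr q) * indicator (N x) y) \<partial>vol)"
    proof (rule nn_integral_mono)
      fix y
      obtain x where x: "x \<in> I" "y \<in> N x" using I(2) by blast
      have "ennreal (\<bar>v y\<bar> powr q) = ennreal (\<bar>v y\<bar> powr q) * indicator (N x) y" using x by simp
      also have "\<dots> \<le> (\<Sum>x\<in>I. ennreal (\<bar>v y\<bar> powr q) * indicator (N x) y)" by (rule member_le_sum[OF x(1) _ I(1)]) simp
      finally show "ennreal (\<bar>v y\<bar> powr q) \<le> (\<Sum>x\<in>I. ennreal (\<bar>v y\<bar> powr q) * indicator (N x) y)" .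
    qed
    also have "\<dots> = (\<Sum>x\<in>I. \<integral>\<^sup>+y\<in>N x. ennreal (\<bar>v y\<bar> powr q) \<partial>vol)" by (rule nn_integral_sum) measurable
    also have "\<dots> \<le> (\<Sum>x\<in>I. ennreal \<bar>C x\<bar>)"
      by (intro sum_mono order_trans[OF C[OF h]] ennreal_leI) simp
    also have "\<dots> = ennreal (\<Sum>x\<in>I. \<bar>C x\<bar>)" by (rule sum_ennreal) simp
    finally show "(\<integral>\<^sup>+x. ennreal (\<bar>v x\<bar> powr q) \<partial>vol) \<le> ennreal (\<Sum>x\<in>I. \<bar>C x\<bar>)" .
  qed
qed

end

section \<open>Compactness\<close>

text \<open>Cantor's diagonal procedure; convergence of each single sequence survives further
  thinning and is not affected by finitely many initial terms.\<close>

lemma countable_convergent_subsequence: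
  fixes a :: "'i \<Rightarrow> nat \<Rightarrow> real"
  assumes S: "countable S" and b: "\<And>i. i \<in> S \<Longrightarrow> bounded (range (a i))"
  obtains r where "strict_mono r" "\<forall>i\<in>S. convergent (\<lambda>k. a i (r k))"
proof (cases "S = {}")
  case False
  define P where "P n s \<longleftrightarrow> convergent (\<lambda>k. a (from_nat_into S n) (s k))" for n and s :: "nat \<Rightarrow> nat"
  interpret subseqs P
  proof
    fix n and s :: "nat \<Rightarrow> nat"
    have "bounded (range (a (from_nat_into S n)))" by (rule b[OF from_nat_into[OF False]])
    then have "bounded (range (a (from_nat_into S n) \<circ> s))" by (rule bounded_subset) auto
    from bounded_imp_convergent_subsequence[OF this] obtain l r where "strict_mono r" "((a (from_nat_into S n) \<circ> s) \<circ> r) \<longlonglongrightarrow> l" by blast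
    then show "\<exists>r'. strict_mono r' \<and> P n (s \<circ> r')" by (auto simp: P_def convergent_def o_def)
  qed
  show ?thesis
  proof (rule that[OF subseq_diagseq], rule ballI)
    fix i assume "i \<in> S"
    then obtain n where n: "i = from_nat_into S n" using from_nat_into_surj[OF S] by metis
    have "P n (diagseq \<circ> (+) (Suc n))"
    proof (rule diagseq_holds)
      fix r s :: "nat \<Rightarrow> nat" and n assume "strict_mono r" "P n s"
      then obtain l where "(\<lambda>k. a (from_nat_into S n) (s k)) \<longlonglongrightarrow> l" by (auto simp: P_def convergent_def)
      from LIMSEQ_subseq_LIMSEQ[OF this \<open>strict_mono r\<close>] show "P n (s \<circ> r)" by (auto simp: P_def convergent_def o_def)
    qed
    then obtain l where "(\<lambda>k. a i (diagseq (k + Suc n))) \<longlonglongrightarrow> l" by (auto simp: P_def convergent_def n add.commute)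
    from LIMSEQ_offset[OF this] show "convergent (\<lambda>k. a i (diagseq k))" by (auto simp: convergent_def)
  qed
qed (auto intro: that[OF strict_mono_id])

text \<open>Fatou's lemma. The bound is asked for late indices only, which permits its use on tails
  of Cauchy sequences.\<close>

lemma nn_integral_powr_le_if_AE_limit:
  fixes u :: "'a \<Rightarrow> real" and f :: "nat \<Rightarrow> 'a \<Rightarrow> real"
  assumes [measurable]: "\<And>j. f j \<in> borel_measurable M" "u \<in> borel_measurable M"
    and lim: "AE x in M. (\<lambda>j. f j x) \<longlonglongrightarrow> u x" and q: "q > 0"
    and b: "\<And>j. j \<ge> J \<Longrightarrow> (\<integral>\<^sup>+x. ennreal (\<bar>f j x\<bar> powr q) \<partial>M) \<le> D"
  shows "(\<integral>\<^sup>+x. ennreal (\<bar>u x\<bar> powr q) \<partial>M) \<le> D"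
proof -
  have "(\<integral>\<^sup>+x. ennreal (\<bar>u x\<bar> powr q) \<partial>M) = (\<integral>\<^sup>+x. liminf (\<lambda>j. ennreal (\<bar>f j x\<bar> powr q)) \<partial>M)"
  proof (rule nn_integral_cong_AE, use lim in eventually_elim)
    fix x assume "(\<lambda>j. f j x) \<longlonglongrightarrow> u x"
    then have "(\<lambda>j. ennreal (\<bar>f j x\<bar> powr q)) \<longlonglongrightarrow> ennreal (\<bar>u x\<bar> powr q)"
      using q by (intro tendsto_ennrealI tendsto_powr2 tendsto_rabs tendsto_const) auto
    then show "ennreal (\<bar>u x\<bar> powr q) = liminf (\<lambda>j. ennreal (\<bar>f j x\<bar> powr q))"
      by (intro lim_imp_Liminf[symmetric]) auto
  qed
  also have "\<dots> \<le> liminf (\<lambda>j. \<integral>\<^sup>+x. ennreal (\<bar>f j x\<bar> powr q) \<partial>M)" by (rule nn_integral_liminf) measurable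
  also have "\<dots> \<le> liminf (\<lambda>j::nat. D)"
    by (rule Liminf_mono) (use b in \<open>auto simp: eventually_sequentially\<close>)
  also have "\<dots> = D" by (simp add: Liminf_const)
  finally show ?thesis .
qed

text \<open>Split at the height \<open>T\<close>: below it the linear term dominates, above it the
  power with exponent \<open>q'\<close>, whose coefficient is small for large \<open>T\<close> if
  \<open>q < q'\<close>.\<close>

lemma powr_interpolation:
  fixes w :: real
  assumes "1 \<le> q" "q \<le> q'" "T > 0"
  shows "\<bar>w\<bar> powr q \<le> T powr (q - 1) * \<bar>w\<bar> + T powr (q - q') * \<bar>w\<bar> powr q'"
proof (cases "\<bar>w\<bar> \<le> T")
  case True
  have "\<bar>w\<bar> powr q = \<bar>w\<bar> powr (q - 1) * \<bar>w\<bar>" by (cases "w = 0") (simp_all add: powr_diff)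
  also have "\<dots> \<le> T powr (q - 1) * \<bar>w\<bar>" using True assms by (intro mult_right_mono powr_mono2) auto
  finally show ?thesis by (simp add: add_increasing2)
next
  case False
  then have w: "w \<noteq> 0" using assms by auto
  have "\<bar>w\<bar> powr q = \<bar>w\<bar> powr (q - q') * \<bar>w\<bar> powr q'" using w by (simp add: powr_diff)
  also have "\<dots> \<le> T powr (q - q') * \<bar>w\<bar> powr q'" using False assms by (intro mult_right_mono powr_mono2') auto
  finally show ?thesis by (simp add: add_increasing)
qed

text \<open>Smallness in L^1 and boundedness in the larger exponent interpolate to a Cauchy property
  in the exponent \<open>q\<close>. The limit is taken along a subsequence that converges almost
  everywhere, and the estimate passes to it by Fatou's lemma.\<close>

lemma L1_Cauchy_imp_Lq_convergent:
  fixes w :: "nat \<Rightarrow> 'a \<Rightarrow> real"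
  assumes i: "\<And>k. integrable M (w k)"
    and c: "\<And>\<epsilon>. \<epsilon> > 0 \<Longrightarrow> \<exists>K. \<forall>k\<ge>K. \<forall>l\<ge>K. (\<integral>\<^sup>+x. ennreal \<bar>w k x - w l x\<bar> \<partial>M) \<le> ennreal \<epsilon>"
    and b: "\<And>k l. (\<integral>\<^sup>+x. ennreal (\<bar>w k x - w l x\<bar> powr q') \<partial>M) \<le> ennreal D" and q: "1 \<le> q" "q < q'"
  obtains u where "u \<in> borel_measurable M"
    "\<forall>\<epsilon>>0. \<exists>K. \<forall>k\<ge>K. (\<integral>\<^sup>+x. ennreal (\<bar>w k x - u x\<bar> powr q) \<partial>M) \<le> ennreal \<epsilon>"
proof -
  have wm[measurable]: "w k \<in> borel_measurable M" for k using i by simp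
  have c': "\<exists>N. \<forall>i\<ge>N. \<forall>j\<ge>N. (LINT x|M. norm (w i x - w j x)) < e" if e: "e > 0" for e
  proof -
    obtain K where K: "\<forall>k\<ge>K. \<forall>l\<ge>K. (\<integral>\<^sup>+x. ennreal \<bar>w k x - w l x\<bar> \<partial>M) \<le> ennreal (e / 2)" using c[of "e / 2"] e by auto
    have "(LINT x|M. norm (w k x - w l x)) < e" if "k \<ge> K" "l \<ge> K" for k l
    proof -
      have "ennreal (LINT x|M. norm (w k x - w l x)) = (\<integral>\<^sup>+x. ennreal \<bar>w k x - w l x\<bar> \<partial>M)"
        unfolding real_norm_def by (rule nn_integral_eq_integral[symmetric]) (use i in auto)
      also have "\<dots> \<le> ennreal (e / 2)" using K that by blast
      finally show ?thesis using e by (simp add: ennreal_le_iff)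
    qed
    then show ?thesis by blast
  qed
  obtain r where r: "strict_mono r" "AE x in M. Cauchy (\<lambda>i. w (r i) x)"
    by (rule cauchy_L1_AE_cauchy_subseq[of M w, OF i c'])
  define u where "u x = lim (\<lambda>i. w (r i) x)" for x
  have um[measurable]: "u \<in> borel_measurable M" unfolding u_def[abs_def] by (rule borel_measurable_lim_metric) simp
  have lim: "AE x in M. (\<lambda>i. w (r i) x) \<longlonglongrightarrow> u x" using r(2)
    by eventually_elim (simp add: u_def Cauchy_convergent_iff convergent_LIMSEQ_iff)
  have "\<exists>K. \<forall>k\<ge>K. (\<integral>\<^sup>+x. ennreal (\<bar>w k x - u x\<bar> powr q) \<partial>M) \<le> ennreal \<epsilon>" if \<epsilon>: "\<epsilon> > 0" for \<epsilon>
  proof -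
    \<comment> \<open>\<open>t\<close> is so small that the term with exponent \<open>q'\<close> is
      at most \<open>\<epsilon> / 2\<close>, and \<open>T\<close> is the height with
      \<open>T powr (q - q') = t\<close>. The absolute value and the summand 1 keep the denominator
      positive for every \<open>D\<close>.\<close>
    define t where "t = \<epsilon> / (2 * (\<bar>D\<bar> + 1))"
    define T where "T = t powr (1 / (q - q'))"
    have t: "t > 0" using \<epsilon> by (auto simp: t_def intro!: divide_pos_pos mult_pos_pos)
    have T: "T > 0" "T powr (q - q') = t" using t q by (auto simp: T_def powr_powr)
    have tD: "t * \<bar>D\<bar> \<le> \<epsilon> / 2"
    proof -
      have "t * \<bar>D\<bar> \<le> t * (\<bar>D\<bar> + 1)" using t by (intro mult_left_mono) auto
      also have "\<dots> = \<epsilon> / 2" unfolding t_def by (simp add: divide_simps)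
      finally show ?thesis .
    qed
    obtain K where K: "\<forall>k\<ge>K. \<forall>l\<ge>K. (\<integral>\<^sup>+x. ennreal \<bar>w k x - w l x\<bar> \<partial>M) \<le> ennreal (\<epsilon> / (2 * T powr (q - 1)))"
      using c[of "\<epsilon> / (2 * T powr (q - 1))"] \<epsilon> T by auto
    have est: "(\<integral>\<^sup>+x. ennreal (\<bar>w k x - w l x\<bar> powr q) \<partial>M) \<le> ennreal \<epsilon>" if kl: "k \<ge> K" "l \<ge> K" for k l
    proof -
      have "(\<integral>\<^sup>+x. ennreal (\<bar>w k x - w l x\<bar> powr q) \<partial>M) \<le>
        (\<integral>\<^sup>+x. ennreal (T powr (q - 1)) * ennreal \<bar>w k x - w l x\<bar> + ennreal t * ennreal (\<bar>w k x - w l x\<bar> powr q') \<partial>M)"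
        using powr_interpolation[of q q' T] q T t
        by (intro nn_integral_mono) (simp add: ennreal_mult[symmetric] ennreal_plus[symmetric] del: ennreal_plus)
      also have "\<dots> = ennreal (T powr (q - 1)) * (\<integral>\<^sup>+x. ennreal \<bar>w k x - w l x\<bar> \<partial>M) + ennreal t * (\<integral>\<^sup>+x. ennreal (\<bar>w k x - w l x\<bar> powr q') \<partial>M)"
        by (simp add: nn_integral_add nn_integral_cmult)
      also have "\<dots> \<le> ennreal (T powr (q - 1)) * ennreal (\<epsilon> / (2 * T powr (q - 1))) + ennreal t * ennreal \<bar>D\<bar>"
        using K kl by (intro add_mono mult_left_mono order_trans[OF b] ennreal_leI) auto
      also have "\<dots> = ennreal (\<epsilon> / 2 + t * \<bar>D\<bar>)"
        using T t \<epsilon> by (simp add: ennreal_mult[symmetric] ennreal_plus[symmetric] del: ennreal_plus)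
      also have "\<dots> \<le> ennreal \<epsilon>" using tD by (intro ennreal_leI) simp
      finally show ?thesis .
    qed
    have "(\<integral>\<^sup>+x. ennreal (\<bar>w k x - u x\<bar> powr q) \<partial>M) \<le> ennreal \<epsilon>" if k: "k \<ge> K" for k
    proof (rule nn_integral_powr_le_if_AE_limit[where f="\<lambda>j x. w k x - w (r j) x" and J=K])
      show "AE x in M. (\<lambda>j. w k x - w (r j) x) \<longlonglongrightarrow> w k x - u x"
        using lim by eventually_elim (intro tendsto_intros)
      show "(\<integral>\<^sup>+x. ennreal (\<bar>w k x - w (r j) x\<bar> powr q) \<partial>M) \<le> ennreal \<epsilon>" if "j \<ge> K" for j
        using est[OF k] that seq_suble[OF r(1), of j] by simp
    qed (use q in auto)
    then show ?thesis by blast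
  qed
  then show ?thesis by (intro that[OF um] allI impI)
qed

section \<open>Rellich's theorem in L^1 on the manifold\<close>

context compact_riemannian
begin

lemma smooth_function_linear:
  assumes u: "smooth_function A u" and v: "smooth_function A v"
  shows "smooth_function A (\<lambda>x. \<alpha> * u x + \<beta> * v x)"
  unfolding smooth_function_def
proof
  fix c assume c: "c \<in> A"
  have "C_on k (img c) (\<lambda>y. \<alpha> * u (chart_inv c y) + \<beta> * v (chart_inv c y))" for k
    by (intro C_on_add C_on_mult C_on_const smooth_function_C_on[OF _ c] u v chart_facts(2)[OF c])
  then show "smooth_on (img c) ((\<lambda>x. \<alpha> * u x + \<beta> * v x) \<circ> chart_inv c)"
    unfolding smooth_on_open[OF chart_facts(2)[OF c]] o_def by blast
qed

lemma smooth_function_diff: "smooth_function A u \<Longrightarrow> smooth_function A v \<Longrightarrow> smooth_function A (\<lambda>x. u x - v x)"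
  using smooth_function_linear[of u v 1 "-1"] by simp

lemma set_integrable_grid_cell:
  assumes u: "smooth_function A u" and c: "c \<in> A" and Q: "compact Q" "Q \<subseteq> img c"
  shows "set_integrable lborel (grid_cell Q N \<iota>) (\<lambda>y. u (chart_inv c y))"
proof (rule set_integrable_subset)
  show "set_integrable lborel Q (\<lambda>y. u (chart_inv c y))" unfolding set_integrable_def
    by (rule borel_integrable_compact[OF Q(1) continuous_on_subset[OF C_on_imp_continuous_on[OF smooth_function_C_on[OF u c, of 0]] Q(2)]])
  show "grid_cell Q N \<iota> \<in> sets lborel" using Q(1) by (simp add: borel_grid_cell compact_imp_closed)
  show "grid_cell Q N \<iota> \<subseteq> Q" by (auto simp: grid_cell_def)
qed

lemma grid_cell_integral_le:
  assumes u: "smooth_function A u" and c: "c \<in> A" and Q: "compact Q" "Q \<subseteq> img c"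
  shows "ennreal \<bar>LINT y:grid_cell Q N \<iota>|lborel. u (chart_inv c y)\<bar> \<le> (\<integral>\<^sup>+y\<in>Q. ennreal \<bar>u (chart_inv c y)\<bar> \<partial>lborel)"
proof -
  have "ennreal \<bar>LINT y:grid_cell Q N \<iota>|lborel. u (chart_inv c y)\<bar> \<le>
    (\<integral>\<^sup>+y. ennreal (norm (indicator (grid_cell Q N \<iota>) y *\<^sub>R u (chart_inv c y))) \<partial>lborel)"
    unfolding set_lebesgue_integral_def real_norm_def[symmetric]
    by (rule integral_norm_bound_ennreal) (use set_integrable_grid_cell[OF assms] in \<open>simp add: set_integrable_def\<close>)
  also have "\<dots> \<le> (\<integral>\<^sup>+y\<in>Q. ennreal \<bar>u (chart_inv c y)\<bar> \<partial>lborel)"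
    by (rule nn_integral_mono) (auto simp: indicator_def grid_cell_def)
  finally show ?thesis .
qed

text \<open>The Poincare inequality on cells, carried over to the manifold. What matters is that
  \<open>K\<close> does not depend on \<open>N\<close>, so that refining the grid makes the gradient
  term small.\<close>

lemma patch_estimate:
  assumes c: "c \<in> A" and Q: "compact Q" "convex Q" "Q \<subseteq> img c"
  obtains K where "K \<ge> 0" "\<forall>w Z N. smooth_function A w \<longrightarrow> weak_gradient A g w Z \<longrightarrow> w \<in> borel_measurable borel \<longrightarrow> N > 0 \<longrightarrow>
    (\<integral>\<^sup>+x\<in>dom c \<inter> snd c -` Q. ennreal \<bar>w x\<bar> \<partial>vol) \<le>
    ennreal K * (ennreal (1 / real N) * (\<integral>\<^sup>+x. ennreal (field_norm A g Z x) \<partial>vol) +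
      (\<Sum>\<iota>\<in>grid_index Q N. ennreal \<bar>LINT y:grid_cell Q N \<iota>|lborel. w (chart_inv c y)\<bar>))"
proof -
  obtain \<Gamma> where \<Gamma>0: "\<Gamma> \<ge> 0" "\<forall>u X. smooth_function A u \<longrightarrow> weak_gradient A g u X \<longrightarrow> u \<in> borel_measurable borel \<longrightarrow>
    (\<integral>\<^sup>+y\<in>Q. ennreal (\<bar>u (chart_inv c y)\<bar> powr 1) \<partial>lborel) \<le> ennreal \<Gamma> * (\<integral>\<^sup>+x. ennreal (\<bar>u x\<bar> powr 1) \<partial>vol) \<and>
    (\<integral>\<^sup>+y\<in>Q. ennreal (norm (grad (\<lambda>y. u (chart_inv c y)) y) powr 1) \<partial>lborel) \<le> ennreal \<Gamma> * (\<integral>\<^sup>+x. ennreal (field_norm A g X x powr 1) \<partial>vol)"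
    by (rule chart_integral_bound[OF c Q(1,3) order_refl])
  obtain \<Delta> where \<Delta>0: "\<Delta> \<ge> 0" "\<forall>u S. u \<in> borel_measurable borel \<longrightarrow> S \<in> sets borel \<longrightarrow> S \<subseteq> Q \<longrightarrow>
    (\<integral>\<^sup>+x\<in>dom c \<inter> snd c -` S. u x \<partial>vol) \<le> ennreal \<Delta> * (\<integral>\<^sup>+y\<in>S. u (chart_inv c y) \<partial>lborel)"
    by (rule vol_le_lborel[OF c Q(1,3)])
  define n where "n = real CARD('n) * 2 ^ CARD('n)"
  \<comment> \<open>The maximum with 1 lets one constant serve for both summands.\<close>
  define H where "H = max 1 (n * \<Gamma>)"
  have n: "n \<ge> 0" and H: "H \<ge> 1" "n * \<Gamma> \<le> H" by (auto simp: n_def H_def)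
  show ?thesis
  proof (rule that[of "\<Delta> * H"], use \<Delta>0 H in simp, intro allI impI)
    fix w Z and N :: nat
    assume w: "smooth_function A w" and Z: "weak_gradient A g w Z" and wm[measurable]: "w \<in> borel_measurable borel" and N: "N > 0"
    let ?f = "\<lambda>y. w (chart_inv c y)"
    let ?s = "\<Sum>\<iota>\<in>grid_index Q N. ennreal \<bar>LINT y:grid_cell Q N \<iota>|lborel. ?f y\<bar>"
    let ?G = "\<integral>\<^sup>+x. ennreal (field_norm A g Z x) \<partial>vol"
    have "(\<integral>\<^sup>+y\<in>Q. ennreal (norm (grad ?f y) powr 1) \<partial>lborel) \<le> ennreal \<Gamma> * (\<integral>\<^sup>+x. ennreal (field_norm A g Z x powr 1) \<partial>vol)"
      using \<Gamma>0(2)[rule_format, OF w Z wm] by blast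
    then have G: "(\<integral>\<^sup>+y\<in>Q. ennreal (norm (grad ?f y)) \<partial>lborel) \<le> ennreal \<Gamma> * ?G" using field_norm_nonneg by simp
    have D: "(\<integral>\<^sup>+x\<in>dom c \<inter> snd c -` Q. ennreal \<bar>w x\<bar> \<partial>vol) \<le> ennreal \<Delta> * (\<integral>\<^sup>+y\<in>Q. ennreal \<bar>?f y\<bar> \<partial>lborel)"
      by (rule \<Delta>0(2)[rule_format, of "\<lambda>x. ennreal \<bar>w x\<bar>" Q]) (use Q in \<open>auto simp: compact_imp_closed\<close>)
    have "(\<integral>\<^sup>+y\<in>Q. ennreal \<bar>?f y\<bar> \<partial>lborel) \<le> ennreal (real CARD('n) / real N * 2 ^ CARD('n)) * (\<integral>\<^sup>+y\<in>Q. ennreal (norm (grad ?f y)) \<partial>lborel) + ?s"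
      by (rule grid_poincare[OF smooth_function_C_on[OF w c] Q N])
    also have "\<dots> \<le> ennreal (real CARD('n) / real N * 2 ^ CARD('n)) * (ennreal \<Gamma> * ?G) + ?s"
      by (intro add_mono mult_left_mono G) auto
    also have "ennreal (real CARD('n) / real N * 2 ^ CARD('n)) * (ennreal \<Gamma> * ?G) = ennreal (n * \<Gamma>) * (ennreal (1 / real N) * ?G)"
      using \<Gamma>0(1) n by (simp add: mult.assoc[symmetric] ennreal_mult[symmetric] n_def)
    also have "ennreal (n * \<Gamma>) * (ennreal (1 / real N) * ?G) + ?s \<le> ennreal H * (ennreal (1 / real N) * ?G) + ennreal H * ?s"
    proof (intro add_mono mult_right_mono ennreal_leI H)
      have "1 * ?s \<le> ennreal H * ?s" using H(1) by (intro mult_right_mono) (auto simp: ennreal_ge_1)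
      then show "?s \<le> ennreal H * ?s" by simp
    qed simp
    also have "\<dots> = ennreal H * (ennreal (1 / real N) * ?G + ?s)" by (simp add: distrib_left)
    finally have "ennreal \<Delta> * (\<integral>\<^sup>+y\<in>Q. ennreal \<bar>?f y\<bar> \<partial>lborel) \<le> ennreal \<Delta> * (ennreal H * (ennreal (1 / real N) * ?G + ?s))"
      by (rule mult_left_mono) simp
    also have "\<dots> = ennreal (\<Delta> * H) * (ennreal (1 / real N) * ?G + ?s)"
      using \<Delta>0(1) H(1) by (simp only: ennreal_mult mult.assoc)
    finally show "(\<integral>\<^sup>+x\<in>dom c \<inter> snd c -` Q. ennreal \<bar>w x\<bar> \<partial>vol) \<le> ennreal (\<Delta> * H) * (ennreal (1 / real N) * ?G + ?s)"
      using D by (rule order_trans[rotated])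
  qed
qed

lemma cube_cover:
  obtains I :: "'m set" and c Q where "finite I" "\<forall>x. c x \<in> A \<and> compact (Q x) \<and> convex (Q x) \<and> Q x \<subseteq> img (c x)"
    "(\<Union>x\<in>I. dom (c x) \<inter> snd (c x) -` Q x) = UNIV"
proof -
  have "\<forall>x. \<exists>z. fst z \<in> A \<and> x \<in> dom (fst z) \<and> snd z > 0 \<and> cbox (snd (fst z) x - (\<chi> i. snd z)) (snd (fst z) x + (\<chi> i. snd z)) \<subseteq> img (fst z)"
  proof
    fix x
    obtain c where c: "c \<in> A" "x \<in> dom c" using charts_cover by blast
    have x: "snd c x \<in> img c" using c by blast
    obtain h where h: "h > 0" "cbox (snd c x - (\<chi> i. h)) (snd c x + (\<chi> i. h)) \<subseteq> img c"
      by (rule chart_neighbourhood[OF c chart_facts(2)[OF c(1)] x order_refl])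
    show "\<exists>z. fst z \<in> A \<and> x \<in> dom (fst z) \<and> snd z > 0 \<and> cbox (snd (fst z) x - (\<chi> i. snd z)) (snd (fst z) x + (\<chi> i. snd z)) \<subseteq> img (fst z)"
      by (rule exI[of _ "(c, h)"]) (simp add: c h)
  qed
  from choice[OF this] obtain z where z: "\<forall>x. fst (z x) \<in> A \<and> x \<in> dom (fst (z x)) \<and> snd (z x) > 0 \<and>
    cbox (snd (fst (z x)) x - (\<chi> i. snd (z x))) (snd (fst (z x)) x + (\<chi> i. snd (z x))) \<subseteq> img (fst (z x))" ..
  define c where "c x = fst (z x)" for x
  define h where "h x = snd (z x)" for x
  define Q where "Q x = cbox (snd (c x) x - (\<chi> i. h x)) (snd (c x) x + (\<chi> i. h x))" for x
  \<comment> \<open>The closed cubes \<open>Q x\<close> supply compactness and convexity, the open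
    ones in \<open>P x\<close> the finite subcover.\<close>
  define P where "P x = dom (c x) \<inter> snd (c x) -` box (snd (c x) x - (\<chi> i. h x)) (snd (c x) x + (\<chi> i. h x))" for x
  have c: "c x \<in> A" "x \<in> dom (c x)" "h x > 0" "Q x \<subseteq> img (c x)" for x using z by (auto simp: c_def h_def Q_def)
  have P: "open (P x)" "x \<in> P x" for x
  proof -
    show "open (P x)" unfolding P_def by (rule open_chart_preimage[OF c(1) open_box])
    show "x \<in> P x" using c(2,3) by (simp add: P_def mem_box_cart)
  qed
  obtain I where I: "I \<subseteq> UNIV" "finite I" "UNIV \<subseteq> (\<Union>x\<in>I. P x)"
    by (rule compactE_image[OF compact_M, of UNIV P]) (use P in auto)
  have PQ: "P x \<subseteq> dom (c x) \<inter> snd (c x) -` Q x" for x unfolding P_def Q_def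
    by (intro Int_mono vimage_mono box_subset_cbox order_refl)
  have "(\<Union>x\<in>I. P x) \<subseteq> (\<Union>x\<in>I. dom (c x) \<inter> snd (c x) -` Q x)" by (intro UN_mono PQ order_refl)
  then have "(\<Union>x\<in>I. dom (c x) \<inter> snd (c x) -` Q x) = UNIV" using I(3) by (simp only: top.extremum_unique[symmetric] order_trans)
  moreover have "\<forall>x. c x \<in> A \<and> compact (Q x) \<and> convex (Q x) \<and> Q x \<subseteq> img (c x)" using c by (auto simp: Q_def)
  ultimately show ?thesis using I(2) by (intro that[of I c Q])
qed

text \<open>The integrals over all cells of all grids on finitely many cubes form a countable family
  of bounded sequences, and a diagonal subsequence makes all of them converge. For a given
  \<open>\<epsilon>\<close> a fine grid controls the gradients, and for that grid only finitely many
  integrals remain to be compared.\<close>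

lemma rellich_L1:
  fixes v :: "nat \<Rightarrow> 'm \<Rightarrow> real"
  assumes v: "\<And>k. smooth_function A (v k)" "\<And>k. weak_gradient A g (v k) (X k)" "\<And>k. v k \<in> borel_measurable borel"
    and B: "B \<ge> 0" "\<And>k. (\<integral>\<^sup>+x. ennreal \<bar>v k x\<bar> \<partial>vol) \<le> ennreal B" "\<And>k. (\<integral>\<^sup>+x. ennreal (field_norm A g (X k) x) \<partial>vol) \<le> ennreal B"
  obtains r :: "nat \<Rightarrow> nat" where "strict_mono r"
    "\<forall>\<epsilon>>0. \<exists>K. \<forall>k\<ge>K. \<forall>l\<ge>K. (\<integral>\<^sup>+x. ennreal \<bar>v (r k) x - v (r l) x\<bar> \<partial>vol) \<le> ennreal \<epsilon>"
proof -
  obtain I :: "'m set" and c Q where I: "finite I" and cQ: "\<forall>x. c x \<in> A \<and> compact (Q x) \<and> convex (Q x) \<and> Q x \<subseteq> img (c x)"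
    and cov: "(\<Union>x\<in>I. dom (c x) \<inter> snd (c x) -` Q x) = UNIV" by (rule cube_cover)
  have c: "c x \<in> A" "compact (Q x)" "convex (Q x)" "Q x \<subseteq> img (c x)" for x using cQ by blast+
  have Qb: "Q x \<in> sets borel" for x using c(2) by (simp add: compact_imp_closed)
  define a where "a z k = (LINT y:grid_cell (Q (fst z)) (fst (snd z)) (snd (snd z))|lborel. v k (chart_inv (c (fst z)) y))" for z :: "'m \<times> nat \<times> ('n \<Rightarrow> int)" and k
  define S where "S = (SIGMA x:I. SIGMA N:UNIV. grid_index (Q x) N)"
  have S: "countable S" unfolding S_def
    by (intro countable_SIGMA[OF countable_finite[OF I] countable_SIGMA[OF countableI_type countable_finite]]
        finite_grid_index compact_imp_bounded c)
  have ab: "bounded (range (a z))" for z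
  proof -
    obtain \<Gamma> where \<Gamma>: "\<Gamma> \<ge> 0" "\<forall>u. u \<in> borel_measurable borel \<longrightarrow> (\<integral>\<^sup>+y\<in>Q (fst z). u (chart_inv (c (fst z)) y) \<partial>lborel) \<le> ennreal \<Gamma> * (\<integral>\<^sup>+x. u x \<partial>vol)"
      by (rule lborel_le_vol[OF c(1,2,4)])
    have "norm (a z k) \<le> \<Gamma> * B" for k
    proof -
      have [measurable]: "v k \<in> borel_measurable borel" by (rule v)
      have "ennreal \<bar>a z k\<bar> \<le> (\<integral>\<^sup>+y\<in>Q (fst z). ennreal \<bar>v k (chart_inv (c (fst z)) y)\<bar> \<partial>lborel)"
        unfolding a_def by (rule grid_cell_integral_le[OF v(1) c(1,2,4)])
      also have "\<dots> \<le> ennreal \<Gamma> * (\<integral>\<^sup>+x. ennreal \<bar>v k x\<bar> \<partial>vol)" by (rule \<Gamma>(2)[rule_format]) measurable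
      also have "\<dots> \<le> ennreal \<Gamma> * ennreal B" by (intro mult_left_mono B) simp
      also have "\<dots> = ennreal (\<Gamma> * B)" using \<Gamma>(1) B(1) by (simp add: ennreal_mult)
      finally show ?thesis using \<Gamma>(1) B(1) by (simp add: ennreal_le_iff)
    qed
    then show ?thesis unfolding bounded_iff by blast
  qed
  obtain r where r: "strict_mono r" "\<forall>z\<in>S. convergent (\<lambda>k. a z (r k))"
    by (rule countable_convergent_subsequence[OF S ab])
  define PE where "PE K x \<longleftrightarrow> K \<ge> 0 \<and> (\<forall>w Z N. smooth_function A w \<longrightarrow> weak_gradient A g w Z \<longrightarrow> w \<in> borel_measurable borel \<longrightarrow> N > 0 \<longrightarrow>
    (\<integral>\<^sup>+y\<in>dom (c x) \<inter> snd (c x) -` Q x. ennreal \<bar>w y\<bar> \<partial>vol) \<le>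
    ennreal K * (ennreal (1 / real N) * (\<integral>\<^sup>+x. ennreal (field_norm A g Z x) \<partial>vol) +
      (\<Sum>\<iota>\<in>grid_index (Q x) N. ennreal \<bar>LINT y:grid_cell (Q x) N \<iota>|lborel. w (chart_inv (c x) y)\<bar>)))" for K x
  have "\<forall>x. \<exists>K. PE K x"
  proof
    fix x show "\<exists>K. PE K x" unfolding PE_def by (rule patch_estimate[OF c(1,2,3,4)[of x]]) (rule exI, rule conjI, assumption+)
  qed
  from choice[OF this] obtain \<kappa> where \<kappa>: "\<forall>x. PE (\<kappa> x) x" ..
  have \<kappa>0: "\<kappa> x \<ge> 0" for x using \<kappa> by (simp add: PE_def)
  have "\<exists>K. \<forall>k\<ge>K. \<forall>l\<ge>K. (\<integral>\<^sup>+x. ennreal \<bar>v (r k) x - v (r l) x\<bar> \<partial>vol) \<le> ennreal \<epsilon>" if \<epsilon>: "\<epsilon> > 0" for \<epsilon>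
  proof -
    \<comment> \<open>\<open>s\<close> and \<open>m\<close> bound the factors of the two error
      terms, summed over the patches; the summands 1 keep them positive. \<open>N\<close> makes the
      gradient term at most \<open>\<epsilon> / 2\<close>, where \<open>4 * B\<close> bounds the
      gradient of a difference, and \<open>\<delta>\<close> does the same for the cell
      integrals.\<close>
    define s where "s = (\<Sum>x\<in>I. \<kappa> x) + 1"
    have s: "s > 0" unfolding s_def by (intro add_nonneg_pos sum_nonneg \<kappa>0) simp
    obtain N :: nat where N: "N > 0" "s * (4 * B) / \<epsilon> * 2 < real N"
      using reals_Archimedean2[of "max 0 (s * (4 * B) / \<epsilon> * 2)"] by (auto simp: less_max_iff_disj)
    have sN: "s * (4 * B) / real N \<le> \<epsilon> / 2" using N \<epsilon> by (simp add: field_simps)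
    define m where "m = (\<Sum>x\<in>I. \<kappa> x * real (card (grid_index (Q x) N))) + 1"
    have m: "m > 0" unfolding m_def by (intro add_nonneg_pos sum_nonneg mult_nonneg_nonneg \<kappa>0) auto
    define \<delta> where "\<delta> = \<epsilon> / (4 * m)"
    have \<delta>: "\<delta> > 0" "m * (2 * \<delta>) = \<epsilon> / 2" using \<epsilon> m by (auto simp: \<delta>_def)
    define T where "T = (\<lambda>(x, \<iota>). (x, N, \<iota>)) ` (SIGMA x:I. grid_index (Q x) N)"
    have T: "finite T" "T \<subseteq> S" unfolding T_def S_def
      by (intro finite_imageI finite_SigmaI I finite_grid_index compact_imp_bounded c) auto
    have "\<forall>z\<in>T. \<forall>\<^sub>F k in sequentially. \<bar>a z (r k) - lim (\<lambda>k. a z (r k))\<bar> < \<delta>"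
    proof
      fix z assume "z \<in> T"
      then have "(\<lambda>k. a z (r k)) \<longlonglongrightarrow> lim (\<lambda>k. a z (r k))" using T(2) r(2) convergent_LIMSEQ_iff by blast
      then show "\<forall>\<^sub>F k in sequentially. \<bar>a z (r k) - lim (\<lambda>k. a z (r k))\<bar> < \<delta>" using \<delta>(1) by (auto simp: tendsto_iff dist_real_def)
    qed
    then have "\<forall>\<^sub>F k in sequentially. \<forall>z\<in>T. \<bar>a z (r k) - lim (\<lambda>k. a z (r k))\<bar> < \<delta>" using T(1) by (simp add: eventually_ball_finite_distrib)
    then obtain K where K: "\<And>k z. k \<ge> K \<Longrightarrow> z \<in> T \<Longrightarrow> \<bar>a z (r k) - lim (\<lambda>k. a z (r k))\<bar> < \<delta>"
      unfolding eventually_sequentially by blast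
    have "(\<integral>\<^sup>+x. ennreal \<bar>v (r k) x - v (r l) x\<bar> \<partial>vol) \<le> ennreal \<epsilon>" if kl: "k \<ge> K" "l \<ge> K" for k l
    proof -
      let ?w = "\<lambda>x. v (r k) x - v (r l) x" and ?Z = "\<lambda>c x. X (r k) c x - X (r l) c x"
      have Z: "weak_gradient A g ?w ?Z" by (rule weak_gradient_diff[OF v(2) v(2)])
      have w: "smooth_function A ?w" by (rule smooth_function_diff[OF v(1) v(1)])
      have [measurable]: "v k \<in> borel_measurable borel" "field_norm A g (X k) \<in> borel_measurable borel" for k
        using v(3) field_norm_measurable[OF weak_gradient_facts(1)[OF v(2)]] by auto
      have wm[measurable]: "?w \<in> borel_measurable borel" by measurable
      have "(\<integral>\<^sup>+x. ennreal (field_norm A g ?Z x) \<partial>vol) \<le> (\<integral>\<^sup>+x. ennreal 2 * (ennreal (field_norm A g (X (r k)) x) + ennreal (field_norm A g (X (r l)) x)) \<partial>vol)"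
      proof (rule nn_integral_mono)
        fix x
        have "ennreal (field_norm A g ?Z x) \<le> ennreal (2 * (field_norm A g (X (r k)) x + field_norm A g (X (r l)) x))"
          by (intro ennreal_leI field_norm_diff_le weak_gradient_facts(1)[OF v(2)] weak_gradient_facts(1)[OF Z])
        then show "ennreal (field_norm A g ?Z x) \<le> ennreal 2 * (ennreal (field_norm A g (X (r k)) x) + ennreal (field_norm A g (X (r l)) x))"
          using field_norm_nonneg by (simp add: ennreal_mult ennreal_plus)
      qed
      also have "\<dots> = ennreal 2 * ((\<integral>\<^sup>+x. ennreal (field_norm A g (X (r k)) x) \<partial>vol) + (\<integral>\<^sup>+x. ennreal (field_norm A g (X (r l)) x) \<partial>vol))"
        by (subst nn_integral_cmult, measurable) (simp add: nn_integral_add)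
      also have "\<dots> \<le> ennreal 2 * (ennreal B + ennreal B)" by (intro mult_left_mono add_mono B) simp
      also have "\<dots> = ennreal (4 * B)"
        by (subst ennreal_plus[symmetric, OF B(1) B(1)], subst ennreal_mult[symmetric]) (use B(1) in auto)
      finally have fZ: "(\<integral>\<^sup>+x. ennreal (field_norm A g ?Z x) \<partial>vol) \<le> ennreal (4 * B)" .
      have [measurable]: "dom (c x) \<inter> snd (c x) -` Q x \<in> sets borel" for x by (rule borel_chart_preimage[OF c(1) Qb])
      have part: "(\<integral>\<^sup>+y\<in>dom (c x) \<inter> snd (c x) -` Q x. ennreal \<bar>?w y\<bar> \<partial>vol) \<le>
        ennreal (\<kappa> x * (4 * B / real N) + \<kappa> x * real (card (grid_index (Q x) N)) * (2 * \<delta>))" if x: "x \<in> I" for x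
      proof -
        have "(\<integral>\<^sup>+y\<in>dom (c x) \<inter> snd (c x) -` Q x. ennreal \<bar>?w y\<bar> \<partial>vol) \<le>
          ennreal (\<kappa> x) * (ennreal (1 / real N) * (\<integral>\<^sup>+x. ennreal (field_norm A g ?Z x) \<partial>vol) +
          (\<Sum>\<iota>\<in>grid_index (Q x) N. ennreal \<bar>LINT y:grid_cell (Q x) N \<iota>|lborel. ?w (chart_inv (c x) y)\<bar>))"
          using \<kappa>[rule_format, of x, unfolded PE_def, THEN conjunct2, rule_format, OF w Z wm N(1)] .
        also have "\<dots> \<le> ennreal (\<kappa> x) * (ennreal (1 / real N) * ennreal (4 * B) + (\<Sum>\<iota>\<in>grid_index (Q x) N. ennreal (2 * \<delta>)))"
        proof (intro mult_left_mono add_mono fZ sum_mono ennreal_leI)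
          fix \<iota> assume "\<iota> \<in> grid_index (Q x) N"
          then have zT: "(x, N, \<iota>) \<in> T" using x by (auto simp: T_def)
          have "(LINT y:grid_cell (Q x) N \<iota>|lborel. ?w (chart_inv (c x) y)) = a (x, N, \<iota>) (r k) - a (x, N, \<iota>) (r l)"
            unfolding a_def fst_conv snd_conv by (intro set_integral_diff set_integrable_grid_cell v(1) c)
          then show "\<bar>LINT y:grid_cell (Q x) N \<iota>|lborel. ?w (chart_inv (c x) y)\<bar> \<le> 2 * \<delta>"
            using K[OF kl(1) zT] K[OF kl(2) zT] by linarith
        qed auto
        also have "\<dots> = ennreal (\<kappa> x * (4 * B / real N) + \<kappa> x * real (card (grid_index (Q x) N)) * (2 * \<delta>))"
        proof -
          have "(\<Sum>\<iota>\<in>grid_index (Q x) N. ennreal (2 * \<delta>)) = ennreal (real (card (grid_index (Q x) N)) * (2 * \<delta>))"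
            using \<delta>(1) by (subst sum_ennreal) auto
          moreover have "ennreal (1 / real N) * ennreal (4 * B) = ennreal (4 * B / real N)"
            using B(1) by (simp add: ennreal_mult[symmetric])
          ultimately show ?thesis using \<kappa>0[of x] \<delta>(1) B(1)
            by (simp add: ennreal_mult[symmetric] ennreal_plus[symmetric] algebra_simps del: ennreal_plus)
        qed
        finally show ?thesis .
      qed
      have "(\<integral>\<^sup>+x. ennreal \<bar>?w x\<bar> \<partial>vol) \<le> (\<integral>\<^sup>+y. (\<Sum>x\<in>I. ennreal \<bar>?w y\<bar> * indicator (dom (c x) \<inter> snd (c x) -` Q x) y) \<partial>vol)"
      proof (rule nn_integral_mono)
        fix y
        obtain x where x: "x \<in> I" "y \<in> dom (c x) \<inter> snd (c x) -` Q x" using cov by blast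
        have "ennreal \<bar>?w y\<bar> = ennreal \<bar>?w y\<bar> * indicator (dom (c x) \<inter> snd (c x) -` Q x) y" using x(2) by (simp only: indicator_simps mult_1_right)
        also have "\<dots> \<le> (\<Sum>x\<in>I. ennreal \<bar>?w y\<bar> * indicator (dom (c x) \<inter> snd (c x) -` Q x) y)" by (rule member_le_sum[OF x(1) _ I]) simp
        finally show "ennreal \<bar>?w y\<bar> \<le> (\<Sum>x\<in>I. ennreal \<bar>?w y\<bar> * indicator (dom (c x) \<inter> snd (c x) -` Q x) y)" .
      qed
      also have "\<dots> = (\<Sum>x\<in>I. \<integral>\<^sup>+y\<in>dom (c x) \<inter> snd (c x) -` Q x. ennreal \<bar>?w y\<bar> \<partial>vol)" by (rule nn_integral_sum) measurable
      also have "\<dots> \<le> (\<Sum>x\<in>I. ennreal (\<kappa> x * (4 * B / real N) + \<kappa> x * real (card (grid_index (Q x) N)) * (2 * \<delta>)))"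
        by (rule sum_mono) (rule part)
      also have "\<dots> = ennreal (\<Sum>x\<in>I. \<kappa> x * (4 * B / real N) + \<kappa> x * real (card (grid_index (Q x) N)) * (2 * \<delta>))"
        using \<kappa>0 \<delta>(1) B(1) by (intro sum_ennreal) auto
      also have "(\<Sum>x\<in>I. \<kappa> x * (4 * B / real N) + \<kappa> x * real (card (grid_index (Q x) N)) * (2 * \<delta>)) = (s - 1) * (4 * B / real N) + (m - 1) * (2 * \<delta>)"
        by (simp add: s_def m_def sum.distrib sum_distrib_right sum_divide_distrib)
      also have "\<dots> \<le> s * (4 * B / real N) + m * (2 * \<delta>)"
        using B(1) \<delta>(1) by (intro add_mono mult_right_mono) auto
      also have "\<dots> \<le> \<epsilon>" using sN \<delta>(2) by simp
      finally show ?thesis by (simp add: ennreal_leI)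
    qed
    then show ?thesis by blast
  qed
  then show ?thesis by (intro that[OF r(1)] allI impI)
qed

end

section \<open>Passage to the closure of the smooth basic functions\<close>

context compact_riemannian
begin

lemma sobolev_norm_bound:
  assumes p: "p \<ge> 1" and X: "weak_gradient A g u X" and i: "integrable vol (\<lambda>x. \<bar>u x\<bar> powr p)" "integrable vol (\<lambda>x. field_norm A g X x powr p)"
    and R: "sobolev_norm A g p u \<le> R"
  shows "(\<integral>\<^sup>+x. ennreal (\<bar>u x\<bar> powr p) \<partial>vol) \<le> ennreal (R powr p)"
    "(\<integral>\<^sup>+x. ennreal (field_norm A g X x powr p) \<partial>vol) \<le> ennreal (R powr p)"
proof -
  let ?a = "\<integral>x. \<bar>u x\<bar> powr p \<partial>vol" and ?b = "\<integral>x. field_norm A g X x powr p \<partial>vol"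
  have ab: "?a \<ge> 0" "?b \<ge> 0" by simp_all
  have "?a + ?b = ((?a + ?b) powr (1 / p)) powr p" using p ab by (simp add: powr_powr)
  also have "\<dots> \<le> R powr p" using R p sobolev_norm_eq[OF X, of p] by (intro powr_mono2) auto
  finally have "?a \<le> R powr p" "?b \<le> R powr p" using ab by linarith+
  then show "(\<integral>\<^sup>+x. ennreal (\<bar>u x\<bar> powr p) \<partial>vol) \<le> ennreal (R powr p)"
    "(\<integral>\<^sup>+x. ennreal (field_norm A g X x powr p) \<partial>vol) \<le> ennreal (R powr p)"
    using i by (simp_all add: nn_integral_eq_integral ennreal_leI)
qed

lemma Lp_space_bound:
  assumes u: "u \<in> borel_measurable borel" and q: "q > 0" and D: "D \<ge> 0" "(\<integral>\<^sup>+x. ennreal (\<bar>u x\<bar> powr q) \<partial>vol) \<le> ennreal D"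
  shows "u \<in> Lp_space vol q" "(\<integral>x. \<bar>u x\<bar> powr q \<partial>vol) \<le> D" "Lp_norm vol q u \<le> D powr (1 / q)"
proof -
  note [measurable] = u
  have i: "integrable vol (\<lambda>x. \<bar>u x\<bar> powr q)"
    by (rule integrableI_nonneg) (use D in \<open>auto simp: le_less_trans[OF _ ennreal_less_top]\<close>)
  then show "u \<in> Lp_space vol q" by (simp add: Lp_space_def)
  have "ennreal (\<integral>x. \<bar>u x\<bar> powr q \<partial>vol) \<le> ennreal D" using D(2) nn_integral_eq_integral[OF i] by simp
  then show 1: "(\<integral>x. \<bar>u x\<bar> powr q \<partial>vol) \<le> D" using D(1) by (simp add: ennreal_le_iff)
  show "Lp_norm vol q u \<le> D powr (1 / q)" unfolding Lp_norm_def using 1 q by (intro powr_mono2) auto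
qed

text \<open>Finite volume and the pointwise bound
  \<open>\<bar>u x\<bar> powr s \<le> 1 + \<bar>u x\<bar> powr q\<close> take the place of Hoelder's
  inequality.\<close>

lemma nn_integral_powr_mono:
  assumes u[measurable]: "u \<in> borel_measurable borel" and s: "0 \<le> s" "s \<le> q"
    and C: "C \<ge> 0" "(\<integral>\<^sup>+x. ennreal (\<bar>u x\<bar> powr q) \<partial>vol) \<le> ennreal C"
  shows "(\<integral>\<^sup>+x. ennreal (\<bar>u x\<bar> powr s) \<partial>vol) \<le> ennreal (measure vol UNIV + C)"
proof -
  interpret finite_measure vol by (rule finite_measure_vol)
  have "(\<integral>\<^sup>+x. ennreal (\<bar>u x\<bar> powr s) \<partial>vol) \<le> (\<integral>\<^sup>+x. 1 + ennreal (\<bar>u x\<bar> powr q) \<partial>vol)"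
  proof (rule nn_integral_mono)
    fix x
    have "\<bar>u x\<bar> powr s \<le> 1 + \<bar>u x\<bar> powr q"
    proof (cases "\<bar>u x\<bar> \<le> 1")
      case True
      then have "\<bar>u x\<bar> powr s \<le> 1" using s powr_mono2[of s "\<bar>u x\<bar>" 1] by simp
      then show ?thesis by (simp add: add_increasing2)
    next
      case False
      then have "\<bar>u x\<bar> powr s \<le> \<bar>u x\<bar> powr q" using s by (intro powr_mono) auto
      then show ?thesis by simp
    qed
    then have "ennreal (\<bar>u x\<bar> powr s) \<le> ennreal (1 + \<bar>u x\<bar> powr q)" by (rule ennreal_leI)
    then show "ennreal (\<bar>u x\<bar> powr s) \<le> 1 + ennreal (\<bar>u x\<bar> powr q)" by (simp add: ennreal_plus)
  qed
  also have "\<dots> = emeasure vol UNIV + (\<integral>\<^sup>+x. ennreal (\<bar>u x\<bar> powr q) \<partial>vol)" by (simp add: nn_integral_add)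
  also have "\<dots> \<le> ennreal (measure vol UNIV) + ennreal C" using C(2) by (intro add_mono) (simp_all add: emeasure_eq_measure)
  finally show ?thesis using C(1) by (simp add: ennreal_plus)
qed

end

context foliated
begin

lemma smooth_basic_linear:
  assumes "u \<in> smooth_basic_functions A F" "v \<in> smooth_basic_functions A F"
  shows "(\<lambda>x. \<alpha> * u x + \<beta> * v x) \<in> smooth_basic_functions A F"
proof -
  have "smooth_function A (\<lambda>x. \<alpha> * u x + \<beta> * v x)" using assms by (intro smooth_function_linear) (auto simp: smooth_basic_functions_def)
  moreover have "\<alpha> * u x + \<beta> * v x = \<alpha> * u y + \<beta> * v y" if h: "L \<in> F" "x \<in> L" "y \<in> L" for L x y
  proof -
    have "u x = u y" "v x = v y" using assms h unfolding smooth_basic_functions_def by blast+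
    then show ?thesis by (simp only:)
  qed
  ultimately show ?thesis unfolding smooth_basic_functions_def by blast
qed

definition smooth_basic_sobolev :: "real \<Rightarrow> ('m \<Rightarrow> real) set" where
  "smooth_basic_sobolev p = smooth_basic_functions A F \<inter> sobolev_space A g p"

lemma smooth_basic_sobolev_diff:
  assumes "p \<ge> 1" "u \<in> smooth_basic_sobolev p" "v \<in> smooth_basic_sobolev p"
  shows "(\<lambda>x. u x - v x) \<in> smooth_basic_sobolev p"
  using assms sobolev_diff(1)[of p u v] smooth_basic_linear[of u v 1 "-1"] by (simp add: smooth_basic_sobolev_def)

lemma smooth_basic_sobolev_scale:
  assumes "p \<ge> 1" "u \<in> smooth_basic_sobolev p"
  shows "(\<lambda>x. \<alpha> * u x) \<in> smooth_basic_sobolev p"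
  using assms sobolev_scale(1)[of p u \<alpha>] smooth_basic_linear[of u u \<alpha> 0] by (simp add: smooth_basic_sobolev_def)

lemma basic_sobolevD:
  assumes "u \<in> basic_sobolev_space A g F p"
  shows "u \<in> sobolev_space A g p" "\<epsilon> > 0 \<Longrightarrow> \<exists>v. v \<in> smooth_basic_sobolev p \<and> sobolev_norm A g p (\<lambda>x. u x - v x) < \<epsilon>"
  using assms unfolding basic_sobolev_space_def smooth_basic_sobolev_def by blast+

lemma basic_sobolev_diff:
  assumes p: "p \<ge> 1" and u: "u \<in> basic_sobolev_space A g F p" and v: "v \<in> smooth_basic_sobolev p"
  shows "(\<lambda>x. u x - v x) \<in> basic_sobolev_space A g F p"
proof -
  have "(\<lambda>x. u x - v x) \<in> sobolev_space A g p"
    using v by (intro sobolev_diff(1)[OF p basic_sobolevD(1)[OF u]]) (simp add: smooth_basic_sobolev_def)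
  moreover have "\<exists>w \<in> smooth_basic_functions A F \<inter> sobolev_space A g p. sobolev_norm A g p (\<lambda>x. (u x - v x) - w x) < \<epsilon>" if "\<epsilon> > 0" for \<epsilon>
  proof -
    obtain w where w: "w \<in> smooth_basic_sobolev p" "sobolev_norm A g p (\<lambda>x. u x - w x) < \<epsilon>" using basic_sobolevD(2)[OF u \<open>\<epsilon> > 0\<close>] by blast
    have "(\<lambda>x. w x - v x) \<in> smooth_basic_sobolev p" by (rule smooth_basic_sobolev_diff[OF p w(1) v])
    moreover have "(\<lambda>x. (u x - v x) - (w x - v x)) = (\<lambda>x. u x - w x)" by auto
    ultimately show ?thesis using w(2) unfolding smooth_basic_sobolev_def by (intro bexI[of _ "\<lambda>x. w x - v x"]) auto
  qed
  ultimately show ?thesis unfolding basic_sobolev_space_def by blast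
qed

text \<open>Stated for smooth basic functions, where the relation between partial derivatives is
  available; \<open>basic_sobolev_bound\<close> extends it to the closure.\<close>

definition unit_ball_bound :: "real \<Rightarrow> real \<Rightarrow> real \<Rightarrow> bool" where
  "unit_ball_bound p s C \<longleftrightarrow> C \<ge> 0 \<and> (\<forall>v\<in>smooth_basic_sobolev p. sobolev_norm A g p v \<le> 1 \<longrightarrow>
     (\<integral>\<^sup>+x. ennreal (\<bar>v x\<bar> powr s) \<partial>vol) \<le> ennreal C)"

lemma ex_unit_ball_bound:
  assumes "1 \<le> p" "p \<le> q" "real (CARD('n) - min_leaf_dim F S) * (q / p - 1) < q"
  shows "\<exists>C. unit_ball_bound p q C"
proof -
  obtain C where C: "C \<ge> 0" "\<forall>v X. v \<in> smooth_basic_functions A F \<longrightarrow> weak_gradient A g v X \<longrightarrow> v \<in> borel_measurable borel \<longrightarrow>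
    (\<integral>\<^sup>+x. ennreal (\<bar>v x\<bar> powr p) \<partial>vol) \<le> 1 \<longrightarrow> (\<integral>\<^sup>+x. ennreal (field_norm A g X x powr p) \<partial>vol) \<le> 1 \<longrightarrow>
    (\<integral>\<^sup>+x. ennreal (\<bar>v x\<bar> powr q) \<partial>vol) \<le> ennreal C" by (rule basic_estimate[OF assms])
  have "(\<integral>\<^sup>+x. ennreal (\<bar>v x\<bar> powr q) \<partial>vol) \<le> ennreal C" if v: "v \<in> smooth_basic_sobolev p" and 1: "sobolev_norm A g p v \<le> 1" for v
  proof -
    have v': "v \<in> smooth_basic_functions A F" "v \<in> sobolev_space A g p" using v by (auto simp: smooth_basic_sobolev_def)
    obtain X where X: "weak_gradient A g v X" "v \<in> borel_measurable borel" "integrable vol (\<lambda>x. \<bar>v x\<bar> powr p)"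
      "integrable vol (\<lambda>x. field_norm A g X x powr p)" by (rule sobolev_spaceE[OF v'(2)])
    show ?thesis using C(2)[rule_format, OF v'(1) X(1,2)] sobolev_norm_bound[OF assms(1) X(1,3,4) 1] by simp
  qed
  then show ?thesis using C(1) unfolding unit_ball_bound_def by blast
qed

text \<open>Homogeneity: division by \<open>R\<close>, rather than by the seminorm itself, also
  covers functions of seminorm 0.\<close>

lemma smooth_bound:
  assumes p: "p \<ge> 1" and C: "unit_ball_bound p s C" and v: "v \<in> smooth_basic_sobolev p" and R: "R > 0" "sobolev_norm A g p v \<le> R"
  shows "(\<integral>\<^sup>+x. ennreal (\<bar>v x\<bar> powr s) \<partial>vol) \<le> ennreal (C * R powr s)"
proof -
  let ?w = "\<lambda>x. 1 / R * v x"
  have vs: "v \<in> sobolev_space A g p" using v by (simp add: smooth_basic_sobolev_def)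
  have [measurable]: "v \<in> borel_measurable borel" by (rule sobolev_spaceE[OF vs])
  have w: "?w \<in> smooth_basic_sobolev p" by (rule smooth_basic_sobolev_scale[OF p v])
  have "sobolev_norm A g p ?w \<le> 1" unfolding sobolev_scale(2)[OF p vs] using R by simp
  then have le: "(\<integral>\<^sup>+x. ennreal (\<bar>?w x\<bar> powr s) \<partial>vol) \<le> ennreal C" using C w unfolding unit_ball_bound_def by blast
  have "\<bar>v x\<bar> powr s = R powr s * \<bar>?w x\<bar> powr s" for x
    using R by (subst powr_mult[symmetric]) (auto simp: abs_mult)
  then have "(\<integral>\<^sup>+x. ennreal (\<bar>v x\<bar> powr s) \<partial>vol) = (\<integral>\<^sup>+x. ennreal (R powr s) * ennreal (\<bar>?w x\<bar> powr s) \<partial>vol)"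
    by (simp add: ennreal_mult)
  also have "\<dots> = ennreal (R powr s) * (\<integral>\<^sup>+x. ennreal (\<bar>?w x\<bar> powr s) \<partial>vol)" by (rule nn_integral_cmult) measurable
  also have "\<dots> \<le> ennreal (R powr s) * ennreal C" by (intro mult_left_mono le) simp
  also have "\<dots> = ennreal (C * R powr s)" using C by (simp add: unit_ball_bound_def ennreal_mult mult.commute)
  finally show ?thesis .
qed

text \<open>Since \<open>v = u - (u - v)\<close>, the weak triangle inequality for differences
  applies.\<close>

lemma approximant_norm_le:
  assumes p: "p \<ge> 1" and u: "u \<in> sobolev_space A g p" and v: "v \<in> smooth_basic_sobolev p"
  shows "sobolev_norm A g p v \<le> 8 * (sobolev_norm A g p u + sobolev_norm A g p (\<lambda>x. u x - v x))"
proof -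
  have "(\<lambda>x. u x - v x) \<in> sobolev_space A g p" using v by (intro sobolev_diff(1)[OF p u]) (simp add: smooth_basic_sobolev_def)
  from sobolev_diff(2)[OF p u this] show ?thesis by simp
qed

text \<open>A sequence of smooth basic functions approximating \<open>u\<close> converges almost
  everywhere along a subsequence, so the bound survives in the limit. Approximants at distance at
  most \<open>R\<close> have norm at most \<open>8 * (R + R) = 16 * R\<close> by the weak triangle
  inequality, which explains the constant.\<close>

lemma basic_sobolev_bound:
  assumes p: "p \<ge> 1" and s: "s > 0" and C: "unit_ball_bound p s C" and u: "u \<in> basic_sobolev_space A g F p"
    and R: "R > 0" "sobolev_norm A g p u \<le> R"
  shows "(\<integral>\<^sup>+x. ennreal (\<bar>u x\<bar> powr s) \<partial>vol) \<le> ennreal (C * (16 * R) powr s)"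
proof -
  note us = basic_sobolevD(1)[OF u]
  have [measurable]: "u \<in> borel_measurable borel" by (rule sobolev_spaceE[OF us])
  have "\<forall>j. \<exists>v. v \<in> smooth_basic_sobolev p \<and> sobolev_norm A g p (\<lambda>x. u x - v x) < R / real (Suc j)"
    using R by (intro allI basic_sobolevD(2)[OF u]) simp
  from choice[OF this] obtain v where v0: "\<forall>j. v j \<in> smooth_basic_sobolev p \<and> sobolev_norm A g p (\<lambda>x. u x - v j x) < R / real (Suc j)" ..
  then have v: "\<And>j. v j \<in> smooth_basic_sobolev p" "\<And>j. sobolev_norm A g p (\<lambda>x. u x - v j x) < R / real (Suc j)" by blast+
  have vs: "v j \<in> sobolev_space A g p" for j using v(1) by (simp add: smooth_basic_sobolev_def)
  have [measurable]: "v j \<in> borel_measurable borel" for j by (rule sobolev_spaceE[OF vs])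
  have vR: "sobolev_norm A g p (v j) \<le> 16 * R" for j
  proof -
    have "R / real (Suc j) \<le> R" using R by (simp add: divide_simps)
    then have "sobolev_norm A g p (\<lambda>x. u x - v j x) \<le> R" using v(2)[of j] by (meson less_imp_le order_trans)
    then have "8 * (sobolev_norm A g p u + sobolev_norm A g p (\<lambda>x. u x - v j x)) \<le> 8 * (R + R)"
      using R(2) by (intro mult_left_mono add_mono) auto
    then show ?thesis using approximant_norm_le[OF p us v(1)[of j]] by simp
  qed
  have d: "integrable vol (\<lambda>x. \<bar>u x - v j x\<bar> powr p)" "(\<integral>x. \<bar>u x - v j x\<bar> powr p \<partial>vol) \<le> (R / real (Suc j)) powr p" for j
  proof -
    obtain X where X: "weak_gradient A g (\<lambda>x. u x - v j x) X" "(\<lambda>x. u x - v j x) \<in> borel_measurable borel" and i: "integrable vol (\<lambda>x. \<bar>u x - v j x\<bar> powr p)"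
      "integrable vol (\<lambda>x. field_norm A g X x powr p)" by (rule sobolev_spaceE[OF sobolev_diff(1)[OF p us vs]])
    show "integrable vol (\<lambda>x. \<bar>u x - v j x\<bar> powr p)" by (rule i)
    show "(\<integral>x. \<bar>u x - v j x\<bar> powr p \<partial>vol) \<le> (R / real (Suc j)) powr p"
      using sobolev_norm_bound(1)[OF p X(1) i less_imp_le[OF v(2)]] nn_integral_eq_integral[OF i(1)] by (simp add: ennreal_le_iff)
  qed
  have "(\<lambda>j. \<integral>x. norm (\<bar>u x - v j x\<bar> powr p) \<partial>vol) \<longlonglongrightarrow> 0"
  proof (rule tendsto_sandwich[OF _ _ tendsto_const])
    show "\<forall>\<^sub>F j in sequentially. (\<integral>x. norm (\<bar>u x - v j x\<bar> powr p) \<partial>vol) \<le> (R / real (Suc j)) powr p" using d(2) by simp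
    have "(\<lambda>j. R / real (Suc j)) \<longlonglongrightarrow> 0" using LIMSEQ_Suc[OF lim_const_over_n[of R]] .
    from tendsto_powr2[OF this tendsto_const[of p]] show "(\<lambda>j. (R / real (Suc j)) powr p) \<longlonglongrightarrow> 0" using p R by simp
  qed simp
  from tendsto_L1_AE_subseq[of vol "\<lambda>j x. \<bar>u x - v j x\<bar> powr p", OF d(1) this]
  obtain r where r: "strict_mono r" "AE x in vol. (\<lambda>j. \<bar>u x - v (r j) x\<bar> powr p) \<longlonglongrightarrow> 0" by blast
  have "AE x in vol. (\<lambda>j. v (r j) x) \<longlonglongrightarrow> u x" using r(2)
  proof eventually_elim
    fix x assume "(\<lambda>j. \<bar>u x - v (r j) x\<bar> powr p) \<longlonglongrightarrow> 0"
    from tendsto_powr2[OF this tendsto_const[of "1 / p"]] have "(\<lambda>j. \<bar>u x - v (r j) x\<bar>) \<longlonglongrightarrow> 0" using p by (simp add: powr_powr)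
    then have "(\<lambda>j. u x - v (r j) x) \<longlonglongrightarrow> 0" by (rule tendsto_rabs_zero_cancel)
    from tendsto_diff[OF tendsto_const[of "u x"] this] show "(\<lambda>j. v (r j) x) \<longlonglongrightarrow> u x" by simp
  qed
  then show ?thesis
    by (rule nn_integral_powr_le_if_AE_limit[where J=0, rotated 2])
      (use s R in \<open>auto intro!: smooth_bound[OF p C v(1)] vR\<close>)
qed

text \<open>Each \<open>s k\<close> is replaced by a smooth basic function \<open>v k\<close> at
  distance below \<open>1 / real (Suc k)\<close>. Rellich's theorem and the bound in the larger
  exponent \<open>q'\<close> apply to the \<open>v k\<close>, and \<open>basic_sobolev_bound\<close>
  controls the error of the replacement in L^q.\<close>

lemma compact_embedding:
  assumes p: "p \<ge> 1" and q: "1 \<le> q" "q < q'" and C': "unit_ball_bound p q' C'"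
  shows "compactly_embedded (basic_sobolev_space A g F p) (sobolev_norm A g p) (Lp_space vol q) (Lp_norm vol q)"
proof -
  let ?X = "basic_sobolev_space A g F p" and ?N = "sobolev_norm A g p"
  have q0: "q > 0" using q by simp
  define C where "C = measure vol UNIV + C'"
  have C'0: "C' \<ge> 0" using C' by (simp add: unit_ball_bound_def)
  then have C0: "C \<ge> 0" by (simp add: C_def)
  have m: "u \<in> borel_measurable borel" if "u \<in> sobolev_space A g p" for u by (rule sobolev_spaceE[OF that])
  \<comment> \<open>Finite volume passes the bound from \<open>q'\<close> down to
    \<open>q\<close>.\<close>
  have C: "unit_ball_bound p q C" unfolding unit_ball_bound_def
  proof (intro conjI ballI impI C0)
    fix v assume v: "v \<in> smooth_basic_sobolev p" "?N v \<le> 1"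
    have "(\<integral>\<^sup>+x. ennreal (\<bar>v x\<bar> powr q') \<partial>vol) \<le> ennreal C'" using C' v unfolding unit_ball_bound_def by blast
    then show "(\<integral>\<^sup>+x. ennreal (\<bar>v x\<bar> powr q) \<partial>vol) \<le> ennreal C"
      unfolding C_def using v q C'0 by (intro nn_integral_powr_mono m) (auto simp: smooth_basic_sobolev_def)
  qed
  have bd: "u \<in> Lp_space vol q" "Lp_norm vol q u \<le> C powr (1 / q) * 16 * R" if u: "u \<in> ?X" and R: "R > 0" "?N u \<le> R" for u R
  proof -
    note b = basic_sobolev_bound[OF p q0 C u R]
    have um: "u \<in> borel_measurable borel" by (rule m[OF basic_sobolevD(1)[OF u]])
    have D: "C * (16 * R) powr q \<ge> 0" using C0 by simp
    show "u \<in> Lp_space vol q" by (rule Lp_space_bound(1)[OF um q0 D b])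
    have "(C * (16 * R) powr q) powr (1 / q) = C powr (1 / q) * 16 * R"
      using C0 R q0 by (simp add: powr_mult powr_powr)
    then show "Lp_norm vol q u \<le> C powr (1 / q) * 16 * R" using Lp_space_bound(3)[OF um q0 D b] by simp
  qed
  have bounded: "Lp_norm vol q u \<le> C powr (1 / q) * 16 * ?N u" if u: "u \<in> ?X" for u
  proof (cases "?N u > 0")
    case False
    have N0: "?N u = 0" using False by (simp add: sobolev_norm_def order_less_le)
    define c where "c = C powr (1 / q) * 16"
    have c: "c \<ge> 0" by (simp add: c_def)
    \<comment> \<open>The estimate \<open>bd\<close> is available for positive \<open>R\<close>
      only. For a function of seminorm 0 it holds with arbitrarily small \<open>R\<close>, which
      forces the L^q norm to vanish.\<close>
    have "Lp_norm vol q u \<le> 0"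
    proof (rule ccontr)
      assume L: "\<not> Lp_norm vol q u \<le> 0"
      define R where "R = Lp_norm vol q u / (2 * (c + 1))"
      have R: "R > 0" using L c by (simp add: R_def)
      have "Lp_norm vol q u \<le> c * R" using bd(2)[OF u R] N0 R by (simp add: c_def)
      also have "c * R \<le> (c + 1) * R" using R by simp
      also have "\<dots> = Lp_norm vol q u / 2" using c by (simp add: R_def field_simps)
      finally show False using L by simp
    qed
    then show ?thesis using N0 by simp
  qed (use bd(2)[OF u] in simp)
  have inc: "?X \<subseteq> Lp_space vol q"
  proof
    fix u assume "u \<in> ?X"
    then show "u \<in> Lp_space vol q" by (rule bd(1)[of u "max 1 (?N u)"]) auto
  qed
  have "\<exists>r u. strict_mono r \<and> u \<in> Lp_space vol q \<and> (\<lambda>k. Lp_norm vol q (\<lambda>x. s (r k) x - u x)) \<longlonglongrightarrow> 0"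
    if s: "\<And>k. s k \<in> ?X" and B: "\<And>k. ?N (s k) \<le> B" for s :: "nat \<Rightarrow> 'm \<Rightarrow> real" and B
  proof -
    note ss = basic_sobolevD(1)[OF s]
    have [measurable]: "s k \<in> borel_measurable borel" for k by (rule m[OF ss])
    have "\<forall>k. \<exists>v. v \<in> smooth_basic_sobolev p \<and> ?N (\<lambda>x. s k x - v x) < 1 / real (Suc k)"
      by (intro allI basic_sobolevD(2)[OF s]) simp
    from choice[OF this] obtain v where "\<forall>k. v k \<in> smooth_basic_sobolev p \<and> ?N (\<lambda>x. s k x - v k x) < 1 / real (Suc k)" ..
    then have v: "\<And>k. v k \<in> smooth_basic_sobolev p" "\<And>k. ?N (\<lambda>x. s k x - v k x) < 1 / real (Suc k)" by blast+
    have vs: "v k \<in> sobolev_space A g p" and vb: "v k \<in> smooth_basic_functions A F" for k using v(1) by (auto simp: smooth_basic_sobolev_def)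
    have vm[measurable]: "v k \<in> borel_measurable borel" for k by (rule m[OF vs])
    \<comment> \<open>By the weak triangle inequality, approximants at distance at most 1 from
      functions of norm at most \<open>\<bar>B\<bar>\<close>.\<close>
    define R where "R = 8 * (\<bar>B\<bar> + 1)"
    have R: "R > 0" by (simp add: R_def)
    have vR: "?N (v k) \<le> R" for k
    proof -
      have "1 / real (Suc k) \<le> 1" by simp
      then have "?N (\<lambda>x. s k x - v k x) \<le> 1" using v(2)[of k] by (meson less_imp_le order_trans)
      moreover have "?N (s k) \<le> \<bar>B\<bar>" using B[of k] by (rule order_trans) simp
      ultimately have "8 * (?N (s k) + ?N (\<lambda>x. s k x - v k x)) \<le> R" unfolding R_def by (intro mult_left_mono add_mono) auto
      then show ?thesis using approximant_norm_le[OF p ss v(1), of k k] by (rule order_trans[rotated])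
    qed
    have "\<forall>k. \<exists>X. weak_gradient A g (v k) X \<and> integrable vol (\<lambda>x. \<bar>v k x\<bar> powr p) \<and> integrable vol (\<lambda>x. field_norm A g X x powr p)"
    proof
      fix k show "\<exists>X. weak_gradient A g (v k) X \<and> integrable vol (\<lambda>x. \<bar>v k x\<bar> powr p) \<and> integrable vol (\<lambda>x. field_norm A g X x powr p)"
        by (rule sobolev_spaceE[OF vs[of k]]) blast
    qed
    from choice[OF this] obtain X where "\<forall>k. weak_gradient A g (v k) (X k) \<and> integrable vol (\<lambda>x. \<bar>v k x\<bar> powr p) \<and> integrable vol (\<lambda>x. field_norm A g (X k) x powr p)" ..
    then have X: "\<And>k. weak_gradient A g (v k) (X k)" "\<And>k. integrable vol (\<lambda>x. \<bar>v k x\<bar> powr p)" "\<And>k. integrable vol (\<lambda>x. field_norm A g (X k) x powr p)" by blast+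
    note Rb = sobolev_norm_bound[OF p X vR]
    \<comment> \<open>Rellich's theorem works with exponent 1; since the volume is finite, the
      bounds of order \<open>p\<close> imply bounds of order 1.\<close>
    define B1 where "B1 = measure vol UNIV + R powr p"
    have B1: "B1 \<ge> 0" by (simp add: B1_def)
    have L1: "(\<integral>\<^sup>+x. ennreal \<bar>v k x\<bar> \<partial>vol) \<le> ennreal B1" for k
      using nn_integral_powr_mono[OF vm _ p powr_ge_zero Rb(1), of k] unfolding B1_def by simp
    have G1: "(\<integral>\<^sup>+x. ennreal (field_norm A g (X k) x) \<partial>vol) \<le> ennreal B1" for k
    proof -
      have "field_norm A g (X k) \<in> borel_measurable borel" by (rule field_norm_measurable[OF weak_gradient_facts(1)[OF X(1)]])
      from nn_integral_powr_mono[OF this zero_le_one p powr_ge_zero] Rb(2)[of k]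
      have "(\<integral>\<^sup>+x. ennreal (\<bar>field_norm A g (X k) x\<bar> powr 1) \<partial>vol) \<le> ennreal B1"
        unfolding B1_def by (simp only: abs_of_nonneg[OF field_norm_nonneg])
      then show ?thesis by (simp add: field_norm_nonneg)
    qed
    obtain r :: "nat \<Rightarrow> nat" where r: "strict_mono r"
      "\<forall>\<epsilon>>0. \<exists>K. \<forall>k\<ge>K. \<forall>l\<ge>K. (\<integral>\<^sup>+x. ennreal \<bar>v (r k) x - v (r l) x\<bar> \<partial>vol) \<le> ennreal \<epsilon>"
      by (rule rellich_L1[of v X B1]) (use vb X(1) vm B1 L1 G1 in \<open>simp_all add: smooth_basic_functions_def\<close>)
    have iv: "integrable vol (v k)" for k
      by (rule integrableI_bounded) (use le_less_trans[OF L1[of k] ennreal_less_top] in simp_all)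
    have vv: "(\<integral>\<^sup>+x. ennreal (\<bar>v (r k) x - v (r l) x\<bar> powr q') \<partial>vol) \<le> ennreal (C' * (16 * R) powr q')" for k l
    proof (rule smooth_bound[OF p C' smooth_basic_sobolev_diff[OF p v(1) v(1)]])
      show "?N (\<lambda>x. v (r k) x - v (r l) x) \<le> 16 * R"
      proof -
        have "8 * (?N (v (r k)) + ?N (v (r l))) \<le> 8 * (R + R)" by (intro mult_left_mono add_mono vR) simp
        with sobolev_diff(2)[OF p vs vs] show ?thesis by (rule order_trans[THEN order_trans]) simp
      qed
    qed (use R in simp)
    obtain u where u: "u \<in> borel_measurable vol"
      "\<forall>\<epsilon>>0. \<exists>K. \<forall>k\<ge>K. (\<integral>\<^sup>+x. ennreal (\<bar>v (r k) x - u x\<bar> powr q) \<partial>vol) \<le> ennreal \<epsilon>"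
      by (rule L1_Cauchy_imp_Lq_convergent[of vol "\<lambda>k. v (r k)", OF iv r(2)[rule_format] vv q])
    have um[measurable]: "u \<in> borel_measurable borel" using u(1) unfolding measurable_cong_sets[OF sets_vol refl] .
    \<comment> \<open>The error of the replacement: \<open>basic_sobolev_bound\<close> for the
      difference of \<open>s (r k)\<close> and \<open>v (r k)\<close>, whose norm is below
      \<open>1 / real (Suc (r k))\<close>.\<close>
    define t where "t k = C * (16 * (1 / real (Suc (r k)))) powr q" for k
    have t0: "t k \<ge> 0" for k using C0 by (simp add: t_def)
    have t: "t \<longlonglongrightarrow> 0"
    proof -
      have "(\<lambda>k. 1 / real (Suc (r k))) \<longlonglongrightarrow> 0"
        using LIMSEQ_subseq_LIMSEQ[OF LIMSEQ_Suc[OF lim_const_over_n[of "1::real"]] r(1)] by (simp add: o_def)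
      from tendsto_mult_right_zero[OF this, of 16] have "(\<lambda>k. 16 * (1 / real (Suc (r k)))) \<longlonglongrightarrow> 0" .
      from tendsto_powr2[OF this tendsto_const[of q]] have "(\<lambda>k. (16 * (1 / real (Suc (r k)))) powr q) \<longlonglongrightarrow> 0" using q0 by simp
      from tendsto_mult_right_zero[OF this, of C] show ?thesis unfolding t_def[abs_def] .
    qed
    have est: "(\<integral>\<^sup>+x. ennreal (\<bar>s (r k) x - u x\<bar> powr q) \<partial>vol) \<le> ennreal (2 powr q * (t k + \<epsilon>))"
      if \<epsilon>: "\<epsilon> > 0" "(\<integral>\<^sup>+x. ennreal (\<bar>v (r k) x - u x\<bar> powr q) \<partial>vol) \<le> ennreal \<epsilon>" for k \<epsilon>
    proof -
      have sv: "(\<integral>\<^sup>+x. ennreal (\<bar>s (r k) x - v (r k) x\<bar> powr q) \<partial>vol) \<le> ennreal (t k)" unfolding t_def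
        by (rule basic_sobolev_bound[OF p q0 C basic_sobolev_diff[OF p s v(1)]]) (use v(2)[of "r k"] in auto)
      have "(\<integral>\<^sup>+x. ennreal (\<bar>s (r k) x - u x\<bar> powr q) \<partial>vol) \<le>
        (\<integral>\<^sup>+x. ennreal (2 powr q) * (ennreal (\<bar>s (r k) x - v (r k) x\<bar> powr q) + ennreal (\<bar>v (r k) x - u x\<bar> powr q)) \<partial>vol)"
      proof (rule nn_integral_mono)
        fix x
        have "\<bar>s (r k) x - u x\<bar> powr q \<le> (\<bar>s (r k) x - v (r k) x\<bar> + \<bar>v (r k) x - u x\<bar>) powr q" using q0 by (intro powr_mono2) auto
        also have "\<dots> \<le> 2 powr q * (\<bar>s (r k) x - v (r k) x\<bar> powr q + \<bar>v (r k) x - u x\<bar> powr q)" using q0 by (intro powr_add_le) auto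
        finally show "ennreal (\<bar>s (r k) x - u x\<bar> powr q) \<le>
          ennreal (2 powr q) * (ennreal (\<bar>s (r k) x - v (r k) x\<bar> powr q) + ennreal (\<bar>v (r k) x - u x\<bar> powr q))"
          by (simp add: ennreal_mult[symmetric] ennreal_plus[symmetric] ennreal_leI del: ennreal_plus)
      qed
      also have "\<dots> = ennreal (2 powr q) * ((\<integral>\<^sup>+x. ennreal (\<bar>s (r k) x - v (r k) x\<bar> powr q) \<partial>vol) + (\<integral>\<^sup>+x. ennreal (\<bar>v (r k) x - u x\<bar> powr q) \<partial>vol))"
        by (subst nn_integral_cmult, measurable) (simp add: nn_integral_add)
      also have "\<dots> \<le> ennreal (2 powr q) * (ennreal (t k) + ennreal \<epsilon>)" by (intro mult_left_mono add_mono sv \<epsilon>) simp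
      also have "\<dots> = ennreal (2 powr q * (t k + \<epsilon>))"
        using t0[of k] \<epsilon>(1) by (simp add: ennreal_mult[symmetric] ennreal_plus[symmetric] del: ennreal_plus)
      finally show ?thesis .
    qed
    have "(\<lambda>k. \<integral>x. \<bar>s (r k) x - u x\<bar> powr q \<partial>vol) \<longlonglongrightarrow> 0"
    proof (rule LIMSEQ_I)
      fix e :: real assume e: "e > 0"
      define \<epsilon> where "\<epsilon> = e / (4 * 2 powr q)"
      have \<epsilon>: "\<epsilon> > 0" "2 powr q * (\<epsilon> + \<epsilon>) < e" using e by (auto simp: \<epsilon>_def)
      obtain K where K: "\<forall>k\<ge>K. (\<integral>\<^sup>+x. ennreal (\<bar>v (r k) x - u x\<bar> powr q) \<partial>vol) \<le> ennreal \<epsilon>" using u(2) \<epsilon>(1) by blast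
      obtain K' where K': "\<forall>k\<ge>K'. norm (t k - 0) < \<epsilon>" using LIMSEQ_D[OF t \<epsilon>(1)] by blast
      have "norm ((\<integral>x. \<bar>s (r k) x - u x\<bar> powr q \<partial>vol) - 0) < e" if k: "k \<ge> max K K'" for k
      proof -
        have "(\<integral>\<^sup>+x. ennreal (\<bar>s (r k) x - u x\<bar> powr q) \<partial>vol) \<le> ennreal (2 powr q * (t k + \<epsilon>))" using K k by (intro est \<epsilon>) auto
        then have "(\<integral>x. \<bar>s (r k) x - u x\<bar> powr q \<partial>vol) \<le> 2 powr q * (t k + \<epsilon>)"
          using t0[of k] \<epsilon>(1) by (intro Lp_space_bound(2)[OF _ q0]) simp_all
        also have "\<dots> \<le> 2 powr q * (\<epsilon> + \<epsilon>)" using K'[rule_format, of k] k by (intro mult_left_mono) auto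
        finally show ?thesis using \<epsilon>(2) by simp
      qed
      then show "\<exists>K. \<forall>k\<ge>K. norm ((\<integral>x. \<bar>s (r k) x - u x\<bar> powr q \<partial>vol) - 0) < e" by blast
    qed
    from tendsto_powr2[OF this tendsto_const[of "1 / q"]] have lim: "(\<lambda>k. Lp_norm vol q (\<lambda>x. s (r k) x - u x)) \<longlonglongrightarrow> 0"
      unfolding Lp_norm_def using q0 by simp
    \<comment> \<open>A single index suffices: \<open>u\<close> differs from \<open>s (r K)\<close>,
      a member of L^q, by a function whose L^q norm is finite.\<close>
    have "u \<in> Lp_space vol q"
    proof -
      obtain K where K: "(\<integral>\<^sup>+x. ennreal (\<bar>v (r K) x - u x\<bar> powr q) \<partial>vol) \<le> ennreal 1" using u(2)[rule_format, OF zero_less_one] by blast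
      have iq: "integrable vol (\<lambda>x. \<bar>s (r K) x - u x\<bar> powr q)" "integrable vol (\<lambda>x. \<bar>s (r K) x\<bar> powr q)"
      proof -
        have "(\<lambda>x. s (r K) x - u x) \<in> Lp_space vol q"
          by (rule Lp_space_bound(1)[OF _ q0 _ est[OF zero_less_one K]]) (use t0[of K] in simp_all)
        moreover have "s (r K) \<in> Lp_space vol q" using inc s by blast
        ultimately show "integrable vol (\<lambda>x. \<bar>s (r K) x - u x\<bar> powr q)" "integrable vol (\<lambda>x. \<bar>s (r K) x\<bar> powr q)"
          unfolding Lp_space_def by blast+
      qed
      have "integrable vol (\<lambda>x. \<bar>u x\<bar> powr q)"
      proof (rule Bochner_Integration.integrable_bound[OF integrable_mult_right[OF Bochner_Integration.integrable_add[OF iq], of "2 powr q"]])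
        show "AE x in vol. norm (\<bar>u x\<bar> powr q) \<le> norm (2 powr q * (\<bar>s (r K) x - u x\<bar> powr q + \<bar>s (r K) x\<bar> powr q))"
        proof (rule AE_I2)
          fix x
          have "\<bar>u x\<bar> powr q \<le> (\<bar>s (r K) x - u x\<bar> + \<bar>s (r K) x\<bar>) powr q" using q0 by (intro powr_mono2) auto
          also have "\<dots> \<le> 2 powr q * (\<bar>s (r K) x - u x\<bar> powr q + \<bar>s (r K) x\<bar> powr q)" using q0 by (intro powr_add_le) auto
          finally show "norm (\<bar>u x\<bar> powr q) \<le> norm (2 powr q * (\<bar>s (r K) x - u x\<bar> powr q + \<bar>s (r K) x\<bar> powr q))" by simp
        qed
      qed measurable
      then show ?thesis using u(1) by (simp add: Lp_space_def)
    qed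
    then show ?thesis using r(1) lim by blast
  qed
  then show ?thesis unfolding compactly_embedded_def using inc bounded by blast
qed

end

text \<open>The third condition places \<open>p0\<close> below the critical exponent of dimension
  \<open>n - 1\<close>, if there is one. The excess \<open>p / (m * n)\<close> over
  \<open>n * p / m\<close> is small enough for this: as
  \<open>p0 / p = (n\<^sup>2 + 1) / (m * n)\<close>, the condition reduces to
  \<open>n * (p - 1) + p + 1 > 0\<close>, which covers the case \<open>p \<ge> n - 1\<close> as
  well.\<close>

lemma supercritical_exponent:
  fixes n p :: real
  assumes p: "1 \<le> p" "p < n"
  obtains p0 where "p0 > n * p / (n - p)" "p \<le> p0" "(n - 1) * (p0 / p - 1) < p0"
proof -
  define m where "m = n - p"
  define p0 where "p0 = n * p / m + p / (m * n)"
  have m: "m > 0" "n > 0" "p > 0" using p by (auto simp: m_def)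
  have gt: "p0 > n * p / m" unfolding p0_def using m by simp
  have "p * m \<le> n * p" using m by (simp add: m_def algebra_simps)
  then have "p \<le> n * p / m" using m by (simp add: pos_le_divide_eq)
  then have p0: "p \<le> p0" using gt by simp
  have e: "p0 / p = (n\<^sup>2 + 1) / (m * n)"
    unfolding p0_def using m by (simp add: add_divide_distrib power2_eq_square)
  have "(n + 1) * 1 \<le> (n + 1) * p" using p by (intro mult_left_mono) auto
  then have "0 < (n - 1) * (m * n) - (n\<^sup>2 + 1) * (n - 1 - p)" by (simp add: m_def algebra_simps power2_eq_square)
  then have "(p0 / p) * (n - 1 - p) < n - 1"
    unfolding e using m by (simp add: pos_divide_less_eq)
  then have "(n - 1) * (p0 / p - 1) < (p0 / p) * p" by (simp only: algebra_simps)
  also have "\<dots> = p0" using m by simp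
  finally show ?thesis using gt p0 by (intro that[of p0]) (auto simp: m_def)
qed

theorem theorem6p1:
  fixes A :: "('m::{t2_space, second_countable_topology}, 'n::finite) chart set"
    and g :: "('m, 'n) metric"
    and F :: "'m set set"
    and S :: "'m set \<Rightarrow> ('m, 'n) submanifold_structure"
  assumes "smooth_atlas A"
    and "riemannian_metric A g"
    and "compact (UNIV :: 'm set)"
    and "connected (UNIV :: 'm set)"
    and "singular_riemannian_foliation A g F S"
    and "\<forall>L\<in>F. closed L"
    and "min_leaf_dim F S \<ge> 1"
  shows
    "(\<forall>p::real. 1 \<le> p \<and> p < real CARD('n) \<longrightarrow>
        (\<exists>p0::real. p0 > real CARD('n) * p / (real CARD('n) - p) \<and>
          (\<forall>q::real. 1 \<le> q \<and> q < p0 \<longrightarrow>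
             compactly_embedded (basic_sobolev_space A g F p) (sobolev_norm A g p)
               (Lp_space (riemannian_volume A g) q) (Lp_norm (riemannian_volume A g) q)))) \<and>
     (\<forall>p::real. 1 \<le> p \<and> p \<ge> real CARD('n) - real (min_leaf_dim F S) \<longrightarrow>
        (\<forall>q::real. 1 \<le> q \<longrightarrow>
           compactly_embedded (basic_sobolev_space A g F p) (sobolev_norm A g p)
             (Lp_space (riemannian_volume A g) q) (Lp_norm (riemannian_volume A g) q)))"
proof -
  interpret foliated A g F S
    using assms(1-3,5) by unfold_locales (auto simp: singular_riemannian_foliation_def)
  let ?n = "real CARD('n)" and ?k = "real (CARD('n) - min_leaf_dim F S)"
  \<comment> \<open>Any point will do to see that some leaf dimension, and with it the minimum, is
    at most \<open>CARD('n)\<close>; this keeps the subtraction in \<open>?k\<close> from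
    truncating.\<close>
  have d: "min_leaf_dim F S \<le> CARD('n)"
    using min_leaf_dim_le[of undefined] dim_subset_UNIV_cart[of "fst (S (leaf undefined))"] unfolding leaf_dim_def by linarith
  have k: "?k = ?n - real (min_leaf_dim F S)" "?k \<ge> 0" "?k \<le> ?n - 1" using d assms(7) by linarith+
  have embed: "compactly_embedded (basic_sobolev_space A g F p) (sobolev_norm A g p) (Lp_space vol q) (Lp_norm vol q)"
    if p: "1 \<le> p" "p \<le> q'" and q: "1 \<le> q" "q < q'" and c: "?k * (q' / p - 1) < q'" for p q q'
  proof -
    obtain C where "unit_ball_bound p q' C" using ex_unit_ball_bound[OF p c] by blast
    then show ?thesis by (rule compact_embedding[OF p(1) q])
  qed
  have "\<exists>p0. p0 > ?n * p / (?n - p) \<and> (\<forall>q. 1 \<le> q \<and> q < p0 \<longrightarrow>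
    compactly_embedded (basic_sobolev_space A g F p) (sobolev_norm A g p) (Lp_space vol q) (Lp_norm vol q))"
    if p: "1 \<le> p" "p < ?n" for p
  proof -
    obtain p0 where gt: "p0 > ?n * p / (?n - p)" and p0: "p \<le> p0" and "(?n - 1) * (p0 / p - 1) < p0"
      by (rule supercritical_exponent[OF p])
    \<comment> \<open>Leaves of positive dimension give \<open>?k \<le> ?n - 1\<close>, and since
      \<open>p0 \<ge> p\<close> the condition on the exponent is monotone in the dimension.\<close>
    moreover have "?k * (p0 / p - 1) \<le> (?n - 1) * (p0 / p - 1)" using p0 p k by (intro mult_right_mono) auto
    ultimately have "?k * (p0 / p - 1) < p0" by simp
    then show ?thesis using gt embed[OF p(1) p0] by blast
  qed
  moreover have "compactly_embedded (basic_sobolev_space A g F p) (sobolev_norm A g p) (Lp_space vol q) (Lp_norm vol q)"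
    if p: "1 \<le> p" "p \<ge> ?n - real (min_leaf_dim F S)" and q: "1 \<le> q" for p q
  proof (rule embed[OF p(1) _ q])
    \<comment> \<open>Here \<open>?k \<le> p\<close>, so the condition holds for every exponent that
      is at least \<open>p\<close>; beyond that, \<open>q'\<close> only has to exceed
      \<open>q\<close>.\<close>
    define q' where "q' = max q p + 1"
    show "p \<le> max q p + 1" "q < max q p + 1" by auto
    have "?k * (q' / p - 1) \<le> p * (q' / p - 1)" using p k by (intro mult_right_mono) (auto simp: q'_def)
    also have "\<dots> = q' - p" using p by (simp add: field_simps)
    also have "\<dots> < q'" using p by simp
    finally show "?k * ((max q p + 1) / p - 1) < max q p + 1" unfolding q'_def .
  qed
  ultimately show ?thesis by blast
qed

end
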